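(* The convolution product for VV algebra modules is associative: for $\alpha,\beta,\gamma\in{}^\theta\mathbb{N}I$ and modules $L$, $M$, $N$ over $\mathfrak{W}_\alpha$, $\mathfrak{W}_\beta$, $\mathfrak{W}_\gamma$ respectively, there is a canonical isomorphism of modules $(M\circ L)\circ N\cong M\circ(L\circ N)$.
   Context: Setup. $k$ is a field with $\mathrm{char}(k)\neq 2$; modules are left modules. Fix $p,q\in k^\times$ such that $p$ is not a power of $q$ and vice versa, $p\neq\pm1$, and $\lambda\in k^\times$. Put $I=\{p^{2n}\lambda^{\pm1}\mid n\in\mathbb{Z}\}$ and assume $\pm1,\pm p,\pm q\notin I$. Let $\Gamma$ be the quiver with vertex set $I$ and an arrow $p^2i\to i$ for each $i\in I$; $|i\to j|$ is the number of arrows from $i$ to $j$. Put $I^+=\{p^{2n}\lambda\mid n\in\mathbb{Z}\}$, so that $I$ is the disjoint union of $I^+$ and $\{i^{-1}\mid i\in I^+\}$. Put $Q_{i,j}(x,y)=(-1)^{|i\to j|}(x-y)^{|i\to j|+|j\to i|}$ if $i\ne j$, and $Q_{i,i}=0$. KLR algebras. $\mathbb{N}I$ is the set of finitely supported formal sums $\tilde\nu=\sum_{i\in I}\tilde\nu_i i$, $\tilde\nu_i\in\mathbb{Z}_{\ge0}$, with $|\tilde\nu|=\sum_i\tilde\nu_i$; $\mathbb{N}I^+$ is the subset supported on $I^+$. For $|\tilde\nu|=m$ let $I^{\tilde\nu}=\{\mathbf{i}=(i_1,\dots,i_m)\in I^m\mid\sum_k i_k=\tilde\nu\}$ (formal sum).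 $\mathbf{R}_{\tilde\nu}$ is the $k$-algebra generated by $x_1,\dots,x_m$, $\sigma_1,\dots,\sigma_{m-1}$, $e(\mathbf{i})$ ($\mathbf{i}\in I^{\tilde\nu}$) with relations: (1) $e(\mathbf{i})e(\mathbf{j})=\delta_{\mathbf{i}\mathbf{j}}e(\mathbf{i})$, $\sum_{\mathbf i}e(\mathbf{i})=1$, $\sigma_ke(\mathbf{i})=e(s_k\mathbf{i})\sigma_k$, $x_le(\mathbf{i})=e(\mathbf{i})x_l$; (2) $x_rx_s=x_sx_r$; (3) $\sigma_k^2e(\mathbf{i})=Q_{i_k,i_{k+1}}(x_{k+1},x_k)e(\mathbf{i})$, $\sigma_j\sigma_k=\sigma_k\sigma_j$ for $j\ne k\pm1$, and $(\sigma_{k+1}\sigma_k\sigma_{k+1}-\sigma_k\sigma_{k+1}\sigma_k)e(\mathbf{i})$ equals $\frac{Q_{i_k,i_{k+1}}(x_{k+1},x_k)-Q_{i_k,i_{k+1}}(x_{k+1},x_{k+2})}{x_k-x_{k+2}}e(\mathbf{i})$ if $i_k=i_{k+2}$ and $0$ otherwise; (4) $(\sigma_kx_l-x_{s_k(l)}\sigma_k)e(\mathbf{i})$ equals $-e(\mathbf{i})$ if $l=k$, $i_k=i_{k+1}$; $e(\mathbf{i})$ if $l=k+1$, $i_k=i_{k+1}$; and $0$ otherwise. $\mathbf{R}_0=k$. VV algebras. ${}^\theta\mathbb{N}I=\{\nu=\sum_{i\in I}\nu_ii\in\mathbb{N}I\mid\nu_i=\nu_{i^{-1}}\ \forall i\}$;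 $|\nu|=\sum_i\nu_i$ is even. For $|\nu|=2m$ let ${}^\theta I^\nu=\{\mathbf{i}\in I^m\mid\sum_ki_k+\sum_ki_k^{-1}=\nu\}$ (formal sum). $\mathfrak{W}_\nu$ is the $k$-algebra generated by $x_1,\dots,x_m,\sigma_1,\dots,\sigma_{m-1},\pi$ and $e(\mathbf{i})$ ($\mathbf{i}\in{}^\theta I^\nu$) with relations (1)–(4) (for $\mathbf{i},\mathbf{j}\in{}^\theta I^\nu$) and (since $q^{\pm1}\notin I$) $\pi e(i_1,i_2,\dots,i_m)=e(i_1^{-1},i_2,\dots,i_m)\pi$, $\pi x_1=-x_1\pi$, $\pi x_l=x_l\pi$ ($l>1$), $\pi\sigma_k=\sigma_k\pi$ ($k\ne1$), $\pi^2=1$, $(\sigma_1\pi)^2=(\pi\sigma_1)^2$. $\mathfrak{W}_0=k$. Convolution. For $\alpha\in{}^\theta\mathbb{N}I$ put $\alpha^+=\sum_{i\in I^+}\alpha_ii\in\mathbb{N}I^+$ and $\mathbf{e}=\sum_{\mathbf{i}\in I^{\alpha^+}}e(\mathbf{i})\in\mathfrak{W}_\alpha$; one has $\mathbf{e}\mathfrak{W}_\alpha\mathbf{e}\cong\mathbf{R}_{\alpha^+}$ naturally. For a $\mathfrak{W}_\alpha$-module $M$ put $\mathrm{Res}(M)=\mathbf{e}M$, an $\mathbf{R}_{\alpha^+}$-module. For a $\mathfrak{W}_\beta$-module $M$ and $\mathfrak{W}_\gamma$-module $N$, $|\beta|=2m$, $|\gamma|=2n$, $$M\circ N:=\mathfrak{W}_{\beta+\gamma}e(\beta^+\gamma^+)\otimes_{\mathbf{R}_{\beta^+}\otimes\mathbf{R}_{\gamma^+}}(\mathrm{Res}(M)\otimes\mathrm{Res}(N)),\quad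 e(\beta^+\gamma^+)=\sum_{\mathbf{i}\in I^{\beta^+},\mathbf{j}\in I^{\gamma^+}}e(\mathbf{i}\mathbf{j}),$$ where $\mathbf{R}_{\beta^+}\otimes\mathbf{R}_{\gamma^+}$ acts on the right via $e(\mathbf{i})\otimes e(\mathbf{j})\mapsto e(\mathbf{i}\mathbf{j})$, with $x_k,\sigma_k$ of the first factor mapping to $x_k,\sigma_k$ and of the second factor to $x_{m+k},\sigma_{m+k}$. *)

theory Defs
  imports
    "HOL-Library.Poly_Mapping"
    "HOL-Library.Multiset"
    "HOL-Computational_Algebra.Computational_Algebra"
    "HOL-Algebra.Algebra"
begin

section \<open>Algebras given by generators and relations\<close>

datatype 'g fword = FWord (letters: "'g list")

instantiation fword :: (type) monoid_add
begin
definition "0 = FWord []"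
definition "u + v = FWord (letters u @ letters v)"
instance by standard (simp_all add: zero_fword_def plus_fword_def)
end

text \<open>The monoid algebra of the free monoid on \<open>'g\<close>, i.e. the free associative algebra;
  the class \<open>ring_1\<close> provides its multiplication.\<close>

type_synonym ('g, 'k) fralg = "'g fword \<Rightarrow>\<^sub>0 'k"

definition fscal :: "'k \<Rightarrow> ('g, 'k::field) fralg" where
  "fscal c = Poly_Mapping.single 0 c"

definition fvar :: "'g \<Rightarrow> ('g, 'k::field) fralg" where
  "fvar g = Poly_Mapping.single (FWord [g]) 1"

definition fsubst :: "('g \<Rightarrow> ('h, 'k::field) fralg) \<Rightarrow> ('g, 'k) fralg \<Rightarrow> ('h, 'k) fralg" where
  "fsubst \<phi> f =
     (\<Sum>w\<in>Poly_Mapping.keys f. fscal (Poly_Mapping.lookup f w) * prod_list (map \<phi> (letters w)))"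

definition free_alg :: "'g set \<Rightarrow> ('g, 'k::field) fralg ring" where
  "free_alg G = \<lparr>carrier = {f. \<forall>w\<in>Poly_Mapping.keys f. set (letters w) \<subseteq> G},
     monoid.mult = (*), monoid.one = 1, ring.zero = 0, ring.add = (+)\<rparr>"

definition presented :: "'g set \<Rightarrow> ('g, 'k::field) fralg set \<Rightarrow> ('g, 'k) fralg set ring" where
  "presented G Rs = free_alg G Quot (Idl\<^bsub>free_alg G\<^esub> Rs)"

definition pclass ::
  "'g set \<Rightarrow> ('g, 'k::field) fralg set \<Rightarrow> ('g, 'k) fralg \<Rightarrow> ('g, 'k) fralg set" where
  "pclass G Rs f = (Idl\<^bsub>free_alg G\<^esub> Rs) +>\<^bsub>free_alg G\<^esub> f"


section \<open>Modules and tensor products over noncommutative rings\<close>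

text \<open>The library locale \<^locale>\<open>module\<close> requires a commutative ring of scalars.  We use its record
  type, whose ring multiplication and unit are irrelevant for modules.\<close>

locale left_module = R?: ring R + M?: abelian_group M
  for R :: "('r, 'x) ring_scheme" (structure) and M :: "('r, 'm, 'y) module_scheme" (structure) +
  assumes smult_closed: "\<lbrakk>a \<in> carrier R; x \<in> carrier M\<rbrakk> \<Longrightarrow> a \<odot>\<^bsub>M\<^esub> x \<in> carrier M"
    and smult_l_distr: "\<lbrakk>a \<in> carrier R; b \<in> carrier R; x \<in> carrier M\<rbrakk> \<Longrightarrow>
      (a \<oplus>\<^bsub>R\<^esub> b) \<odot>\<^bsub>M\<^esub> x = a \<odot>\<^bsub>M\<^esub> x \<oplus>\<^bsub>M\<^esub> b \<odot>\<^bsub>M\<^esub> x"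
    and smult_r_distr: "\<lbrakk>a \<in> carrier R; x \<in> carrier M; y \<in> carrier M\<rbrakk> \<Longrightarrow>
      a \<odot>\<^bsub>M\<^esub> (x \<oplus>\<^bsub>M\<^esub> y) = a \<odot>\<^bsub>M\<^esub> x \<oplus>\<^bsub>M\<^esub> a \<odot>\<^bsub>M\<^esub> y"
    and smult_assoc: "\<lbrakk>a \<in> carrier R; b \<in> carrier R; x \<in> carrier M\<rbrakk> \<Longrightarrow>
      (a \<otimes>\<^bsub>R\<^esub> b) \<odot>\<^bsub>M\<^esub> x = a \<odot>\<^bsub>M\<^esub> (b \<odot>\<^bsub>M\<^esub> x)"
    and smult_one: "x \<in> carrier M \<Longrightarrow> \<one>\<^bsub>R\<^esub> \<odot>\<^bsub>M\<^esub> x = x"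

definition module_isomorphism ::
  "('r, 'x) ring_scheme \<Rightarrow> ('r, 'm, 'y) module_scheme \<Rightarrow> ('r, 'n, 'z) module_scheme
    \<Rightarrow> ('m \<Rightarrow> 'n) \<Rightarrow> bool" where
  "module_isomorphism R M N \<phi> \<longleftrightarrow>
     left_module R M \<and> left_module R N \<and>
     bij_betw \<phi> (carrier M) (carrier N) \<and>
     (\<forall>x\<in>carrier M. \<forall>y\<in>carrier M. \<phi> (x \<oplus>\<^bsub>M\<^esub> y) = \<phi> x \<oplus>\<^bsub>N\<^esub> \<phi> y) \<and>
     (\<forall>a\<in>carrier R. \<forall>x\<in>carrier M. \<phi> (a \<odot>\<^bsub>M\<^esub> x) = a \<odot>\<^bsub>N\<^esub> \<phi> x)"

definition regular_module :: "('r, 'x) ring_scheme \<Rightarrow> ('r, 'r) module" where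
  "regular_module R = \<lparr>carrier = carrier R, monoid.mult = monoid.mult R, monoid.one = monoid.one R,
     ring.zero = ring.zero R, ring.add = ring.add R, smult = monoid.mult R\<rparr>"

text \<open>Turns a multiplicatively written abelian group into a module record.\<close>

definition module_of_group :: "'m monoid \<Rightarrow> ('r \<Rightarrow> 'm \<Rightarrow> 'm) \<Rightarrow> ('r, 'm) module" where
  "module_of_group G act = \<lparr>carrier = carrier G, monoid.mult = undefined, monoid.one = undefined,
     ring.zero = monoid.one G, ring.add = monoid.mult G, smult = act\<rparr>"

text \<open>The tensor product of a right module \<open>A\<close> and a left module \<open>B\<close> over a ring with carrier
  \<open>C\<close>, acting by \<open>ra\<close> and \<open>la\<close>: the free abelian group on \<open>A \<times> B\<close> modulo the balancing relations.\<close>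

definition tensor_rels :: "'r set \<Rightarrow> ('a, 'x) ring_scheme \<Rightarrow> ('a \<Rightarrow> 'r \<Rightarrow> 'a)
    \<Rightarrow> ('b, 'y) ring_scheme \<Rightarrow> ('r \<Rightarrow> 'b \<Rightarrow> 'b) \<Rightarrow> ('a \<times> 'b \<Rightarrow>\<^sub>0 int) set" where
  "tensor_rels C A ra B la =
     {frag_of (a \<oplus>\<^bsub>A\<^esub> a', b) - frag_of (a, b) - frag_of (a', b) | a a' b.
        a \<in> carrier A \<and> a' \<in> carrier A \<and> b \<in> carrier B} \<union>
     {frag_of (a, b \<oplus>\<^bsub>B\<^esub> b') - frag_of (a, b) - frag_of (a, b') | a b b'.
        a \<in> carrier A \<and> b \<in> carrier B \<and> b' \<in> carrier B} \<union>
     {frag_of (ra a c, b) - frag_of (a, la c b) | a b c.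
        a \<in> carrier A \<and> b \<in> carrier B \<and> c \<in> C}"

definition tensor_class :: "'r set \<Rightarrow> ('a, 'x) ring_scheme \<Rightarrow> ('a \<Rightarrow> 'r \<Rightarrow> 'a)
    \<Rightarrow> ('b, 'y) ring_scheme \<Rightarrow> ('r \<Rightarrow> 'b \<Rightarrow> 'b) \<Rightarrow> ('a \<times> 'b \<Rightarrow>\<^sub>0 int) \<Rightarrow> ('a \<times> 'b \<Rightarrow>\<^sub>0 int) set" where
  "tensor_class C A ra B la f =
     (let F = free_Abelian_group (carrier A \<times> carrier B)
      in generate F (tensor_rels C A ra B la) #>\<^bsub>F\<^esub> f)"

definition tensor_group :: "'r set \<Rightarrow> ('a, 'x) ring_scheme \<Rightarrow> ('a \<Rightarrow> 'r \<Rightarrow> 'a)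
    \<Rightarrow> ('b, 'y) ring_scheme \<Rightarrow> ('r \<Rightarrow> 'b \<Rightarrow> 'b) \<Rightarrow> ('a \<times> 'b \<Rightarrow>\<^sub>0 int) set monoid" where
  "tensor_group C A ra B la =
     (let F = free_Abelian_group (carrier A \<times> carrier B)
      in F Mod generate F (tensor_rels C A ra B la))"

text \<open>Maps out of quotients are written as unions over all representatives, as in
  \<^const>\<open>rcoset_mult\<close>; if the map is well defined, this is a union of equal sets.\<close>

text \<open>For algebras \<open>R\<close>, \<open>S\<close> over the field \<open>'k\<close> with structure maps \<open>sR\<close>, \<open>sS\<close> and modules \<open>A\<close> over
  \<open>R\<close> and \<open>B\<close> over \<open>S\<close>, the tensor product of \<open>A\<close> and \<open>B\<close> over \<open>'k\<close>, with the action
  $(r \otimes s)(a \otimes b) = ra \otimes sb$ of the tensor product of \<open>R\<close> and \<open>S\<close>.  The latter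
  is the case where \<open>A\<close> and \<open>B\<close> are the regular modules; there, the action is the multiplication.\<close>

definition outer_tensor :: "('k \<Rightarrow> 'r) \<Rightarrow> ('k \<Rightarrow> 's) \<Rightarrow> ('r, 'a) module \<Rightarrow> ('s, 'b) module
    \<Rightarrow> (('r \<times> 's \<Rightarrow>\<^sub>0 int) set, ('a \<times> 'b \<Rightarrow>\<^sub>0 int) set) module" where
  "outer_tensor sR sS A B =
     (let ra = (\<lambda>a c. sR c \<odot>\<^bsub>A\<^esub> a); la = (\<lambda>c b. sS c \<odot>\<^bsub>B\<^esub> b)
      in module_of_group (tensor_group UNIV A ra B la)
           (\<lambda>t z. \<Union>f\<in>t. \<Union>g\<in>z. tensor_class UNIV A ra B la
              (frag_extend (\<lambda>(r, s). frag_extend (\<lambda>(a, b). frag_of (r \<odot>\<^bsub>A\<^esub> a, s \<odot>\<^bsub>B\<^esub> b)) g) f)))"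


section \<open>The quiver and the polynomials \<open>Q\<close>\<close>

definition VI :: "'k::field \<Rightarrow> 'k \<Rightarrow> 'k set" where
  "VI p lam = {p powi (2 * n) * lam | n. True} \<union> {p powi (2 * n) * inverse lam | n. True}"

definition VI_plus :: "'k::field \<Rightarrow> 'k \<Rightarrow> 'k set" where
  "VI_plus p lam = {p powi (2 * n) * lam | n. True}"

definition arrows :: "'k::field \<Rightarrow> 'k \<Rightarrow> 'k \<Rightarrow> nat" where
  "arrows p i j = (if i = p\<^sup>2 * j then 1 else 0)"

definition Qpoly :: "'k::field \<Rightarrow> 'k \<Rightarrow> 'k \<Rightarrow> 'a::ring_1 \<Rightarrow> 'a \<Rightarrow> 'a" where
  "Qpoly p i j u v =
     (if i = j then 0 else (-1) ^ arrows p i j * (u - v) ^ (arrows p i j + arrows p j i))"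

text \<open>The polynomial $(Q_{i,j}(u,a) - Q_{i,j}(u,b)) / (a - b)$, see the lemma below.\<close>

definition Qquot :: "'k::field \<Rightarrow> 'k \<Rightarrow> 'k \<Rightarrow> 'a::ring_1 \<Rightarrow> 'a \<Rightarrow> 'a \<Rightarrow> 'a" where
  "Qquot p i j u a b =
     (if i = j then 0
      else let d = arrows p i j + arrows p j i
           in - ((-1) ^ arrows p i j * (\<Sum>s<d. (u - a) ^ s * (u - b) ^ (d - 1 - s))))"

lemma Qquot_eq:
  fixes u a b :: "'a::comm_ring_1"
  shows "(a - b) * Qquot p i j u a b = Qpoly p i j u a - Qpoly p i j u b"
  by (auto simp: Qquot_def Qpoly_def arrows_def algebra_simps power2_eq_square numeral_2_eq_2)


section \<open>KLR and VV algebras\<close>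

text \<open>Elements of $\mathbb{N}I$ are multisets, tuples are lists.  Generators are numbered from 1 as
  usual, whence \<open>entry\<close>.\<close>

definition entry :: "'k list \<Rightarrow> nat \<Rightarrow> 'k" where
  "entry i k = i ! (k - 1)"

definition swap_entries :: "nat \<Rightarrow> 'k list \<Rightarrow> 'k list" where
  "swap_entries k i = i[k - 1 := entry i (k + 1), k := entry i k]"

definition adj_swap :: "nat \<Rightarrow> nat \<Rightarrow> nat" where
  "adj_swap k l = (if l = k then k + 1 else if l = k + 1 then k else l)"

definition invert_first :: "'k::field list \<Rightarrow> 'k list" where
  "invert_first i = inverse (hd i) # tl i"

datatype 'k gen = GX nat | GS nat | GP | GE "'k list"

type_synonym 'k falg = "('k gen, 'k) fralg"

abbreviation xx :: "nat \<Rightarrow> 'k::field falg" where "xx l \<equiv> fvar (GX l)"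
abbreviation ss :: "nat \<Rightarrow> 'k::field falg" where "ss k \<equiv> fvar (GS k)"
abbreviation pp :: "'k::field falg" where "pp \<equiv> fvar GP"
abbreviation ee :: "'k list \<Rightarrow> 'k::field falg" where "ee i \<equiv> fvar (GE i)"

definition klr_gens :: "nat \<Rightarrow> 'k list set \<Rightarrow> 'k gen set" where
  "klr_gens m A = GX ` {1..m} \<union> GS ` {1..<m} \<union> GE ` A"

definition klr_rels :: "'k::field \<Rightarrow> nat \<Rightarrow> 'k list set \<Rightarrow> 'k falg set" where
  "klr_rels p m A =
     {ee i * ee j - (if i = j then ee i else 0) | i j. i \<in> A \<and> j \<in> A} \<union>
     {(\<Sum>i\<in>A. ee i) - 1} \<union>
     {ss k * ee i - ee (swap_entries k i) * ss k | k i. k \<in> {1..<m} \<and> i \<in> A} \<union>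
     {xx l * ee i - ee i * xx l | l i. l \<in> {1..m} \<and> i \<in> A} \<union>
     {xx r * xx s - xx s * xx r | r s. r \<in> {1..m} \<and> s \<in> {1..m}} \<union>
     {ss k * ss k * ee i - Qpoly p (entry i k) (entry i (k + 1)) (xx (k + 1)) (xx k) * ee i | k i.
        k \<in> {1..<m} \<and> i \<in> A} \<union>
     {ss j * ss k - ss k * ss j | j k. j \<in> {1..<m} \<and> k \<in> {1..<m} \<and> j \<noteq> k + 1 \<and> k \<noteq> j + 1} \<union>
     {(ss (k + 1) * ss k * ss (k + 1) - ss k * ss (k + 1) * ss k) * ee i -
        (if entry i k = entry i (k + 2)
         then Qquot p (entry i k) (entry i (k + 1)) (xx (k + 1)) (xx k) (xx (k + 2)) * ee i
         else 0) | k i. k \<ge> 1 \<and> k + 1 < m \<and> i \<in> A} \<union>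
     {(ss k * xx l - xx (adj_swap k l) * ss k) * ee i -
        (if l = k \<and> entry i k = entry i (k + 1) then - ee i
         else if l = k + 1 \<and> entry i k = entry i (k + 1) then ee i
         else 0) | k l i. k \<in> {1..<m} \<and> l \<in> {1..m} \<and> i \<in> A}"

definition klr_words :: "'k multiset \<Rightarrow> 'k list set" where
  "klr_words \<nu> = {i. mset i = \<nu>}"

definition klr_alg :: "'k::field \<Rightarrow> 'k multiset \<Rightarrow> 'k falg set ring" where
  "klr_alg p \<nu> =
     presented (klr_gens (size \<nu>) (klr_words \<nu>)) (klr_rels p (size \<nu>) (klr_words \<nu>))"

definition klr_class :: "'k::field \<Rightarrow> 'k multiset \<Rightarrow> 'k falg \<Rightarrow> 'k falg set" where
  "klr_class p \<nu> =
     pclass (klr_gens (size \<nu>) (klr_words \<nu>)) (klr_rels p (size \<nu>) (klr_words \<nu>))"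

definition theta_NI :: "'k::field \<Rightarrow> 'k \<Rightarrow> 'k multiset set" where
  "theta_NI p lam =
     {\<nu>. set_mset \<nu> \<subseteq> VI p lam \<and> (\<forall>i\<in>VI p lam. count \<nu> i = count \<nu> (inverse i))}"

definition vv_words :: "'k::field multiset \<Rightarrow> 'k list set" where
  "vv_words \<nu> = {i. mset i + mset (map inverse i) = \<nu>}"

text \<open>For \<open>m = 0\<close> there is no generator $\pi$; the presentation then gives the field \<open>'k\<close>.\<close>

definition vv_gens :: "nat \<Rightarrow> 'k list set \<Rightarrow> 'k gen set" where
  "vv_gens m A = klr_gens m A \<union> (if m = 0 then {} else {GP})"

definition vv_rels :: "'k::field \<Rightarrow> nat \<Rightarrow> 'k list set \<Rightarrow> 'k falg set" where
  "vv_rels p m A = klr_rels p m A \<union>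
     (if m = 0 then {} else
       {pp * ee i - ee (invert_first i) * pp | i. i \<in> A} \<union>
       {pp * xx 1 + xx 1 * pp} \<union>
       {pp * xx l - xx l * pp | l. l \<in> {2..m}} \<union>
       {pp * ss k - ss k * pp | k. k \<in> {2..<m}} \<union>
       {pp * pp - 1} \<union>
       (if m = 1 then {} else {(ss 1 * pp)\<^sup>2 - (pp * ss 1)\<^sup>2}))"

definition vv_alg :: "'k::field \<Rightarrow> 'k multiset \<Rightarrow> 'k falg set ring" where
  "vv_alg p \<nu> = (let m = size \<nu> div 2
     in presented (vv_gens m (vv_words \<nu>)) (vv_rels p m (vv_words \<nu>)))"

definition vv_class :: "'k::field \<Rightarrow> 'k multiset \<Rightarrow> 'k falg \<Rightarrow> 'k falg set" where
  "vv_class p \<nu> = (let m = size \<nu> div 2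
     in pclass (vv_gens m (vv_words \<nu>)) (vv_rels p m (vv_words \<nu>)))"


section \<open>Restriction and convolution\<close>

definition plus_part :: "'k::field \<Rightarrow> 'k \<Rightarrow> 'k multiset \<Rightarrow> 'k multiset" where
  "plus_part p lam \<alpha> = filter_mset (\<lambda>i. i \<in> VI_plus p lam) \<alpha>"

definition idem_plus :: "'k::field \<Rightarrow> 'k \<Rightarrow> 'k multiset \<Rightarrow> 'k falg" where
  "idem_plus p lam \<alpha> = (\<Sum>i\<in>klr_words (plus_part p lam \<alpha>). ee i)"

text \<open>The natural map from the KLR algebra of $\alpha^+$ to $\mathbf{e}\mathfrak{W}_\alpha\mathbf{e}$, sending
  generators $x_l$, $\sigma_k$, $e(\mathbf{i})$ to $x_l\mathbf{e}$, $\sigma_k\mathbf{e}$, $e(\mathbf{i})$.\<close>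

definition klr_to_vv :: "'k::field \<Rightarrow> 'k \<Rightarrow> 'k multiset \<Rightarrow> 'k falg set \<Rightarrow> 'k falg set" where
  "klr_to_vv p lam \<alpha> r =
     (\<Union>f\<in>r. vv_class p \<alpha> (idem_plus p lam \<alpha> * f * idem_plus p lam \<alpha>))"

definition Res :: "'k::field \<Rightarrow> 'k \<Rightarrow> 'k multiset \<Rightarrow> ('k falg set, 'm) module
    \<Rightarrow> ('k falg set, 'm) module" where
  "Res p lam \<alpha> M = M\<lparr>
     carrier := (\<lambda>x. vv_class p \<alpha> (idem_plus p lam \<alpha>) \<odot>\<^bsub>M\<^esub> x) ` carrier M,
     smult := (\<lambda>r x. klr_to_vv p lam \<alpha> r \<odot>\<^bsub>M\<^esub> x)\<rparr>"

definition idem_pair :: "'k::field \<Rightarrow> 'k \<Rightarrow> 'k multiset \<Rightarrow> 'k multiset \<Rightarrow> 'k falg" where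
  "idem_pair p lam \<beta> \<gamma> =
     (\<Sum>i\<in>klr_words (plus_part p lam \<beta>). \<Sum>j\<in>klr_words (plus_part p lam \<gamma>). ee (i @ j))"

definition ideal_module :: "'k::field \<Rightarrow> 'k \<Rightarrow> 'k multiset \<Rightarrow> 'k multiset
    \<Rightarrow> ('k falg set, 'k falg set) module" where
  "ideal_module p lam \<beta> \<gamma> =
     (let W = vv_alg p (\<beta> + \<gamma>)
      in (regular_module W)\<lparr>carrier :=
           (\<lambda>w. w \<otimes>\<^bsub>W\<^esub> vv_class p (\<beta> + \<gamma>) (idem_pair p lam \<beta> \<gamma>)) ` carrier W\<rparr>)"

text \<open>The homomorphism from the tensor product of the KLR algebras of $\beta^+$ and $\gamma^+$ to
  $e(\beta^+\gamma^+)\mathfrak{W}_{\beta+\gamma}e(\beta^+\gamma^+)$.  On elements $r \otimes 1$ and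
  $1 \otimes s$ it is given by the substitutions \<open>subst_left\<close> and \<open>subst_right\<close>.  In particular,
  $e(\mathbf{i}) \otimes e(\mathbf{j})$ is sent to $e(\mathbf{i}\mathbf{j})$.\<close>

definition subst_left :: "'k::field multiset \<Rightarrow> 'k gen \<Rightarrow> 'k falg" where
  "subst_left c g = (case g of GE i \<Rightarrow> (\<Sum>j\<in>klr_words c. ee (i @ j)) | _ \<Rightarrow> fvar g)"

definition subst_right :: "'k::field multiset \<Rightarrow> 'k gen \<Rightarrow> 'k falg" where
  "subst_right b g = (case g of GX l \<Rightarrow> xx (size b + l) | GS k \<Rightarrow> ss (size b + k) | GP \<Rightarrow> pp
     | GE j \<Rightarrow> (\<Sum>i\<in>klr_words b. ee (i @ j)))"

definition pair_emb :: "'k::field \<Rightarrow> 'k \<Rightarrow> 'k multiset \<Rightarrow> 'k multiset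
    \<Rightarrow> 'k falg set \<times> 'k falg set \<Rightarrow> 'k falg set" where
  "pair_emb p lam \<beta> \<gamma> = (\<lambda>(r, s). \<Union>f\<in>r. \<Union>g\<in>s. vv_class p (\<beta> + \<gamma>)
     (idem_pair p lam \<beta> \<gamma> * fsubst (subst_left (plus_part p lam \<gamma>)) f *
      fsubst (subst_right (plus_part p lam \<beta>)) g * idem_pair p lam \<beta> \<gamma>))"

definition tensor_emb :: "'k::field \<Rightarrow> 'k \<Rightarrow> 'k multiset \<Rightarrow> 'k multiset
    \<Rightarrow> ('k falg set \<times> 'k falg set \<Rightarrow>\<^sub>0 int) set \<Rightarrow> 'k falg set" where
  "tensor_emb p lam \<beta> \<gamma> t =
     (let W = vv_alg p (\<beta> + \<gamma>)
      in \<Union>h\<in>t. \<Oplus>\<^bsub>W\<^esub>rs\<in>Poly_Mapping.keys h.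
           [Poly_Mapping.lookup h rs] \<cdot>\<^bsub>W\<^esub> pair_emb p lam \<beta> \<gamma> rs)"

definition res_tensor :: "'k::field \<Rightarrow> 'k \<Rightarrow> 'k multiset \<Rightarrow> 'k multiset
    \<Rightarrow> ('k falg set, 'm) module \<Rightarrow> ('k falg set, 'n) module
    \<Rightarrow> (('k falg set \<times> 'k falg set \<Rightarrow>\<^sub>0 int) set, ('m \<times> 'n \<Rightarrow>\<^sub>0 int) set) module" where
  "res_tensor p lam \<beta> \<gamma> M N =
     outer_tensor (\<lambda>c. klr_class p (plus_part p lam \<beta>) (fscal c))
       (\<lambda>c. klr_class p (plus_part p lam \<gamma>) (fscal c)) (Res p lam \<beta> M) (Res p lam \<gamma> N)"

definition klr_tensor :: "'k::field \<Rightarrow> 'k \<Rightarrow> 'k multiset \<Rightarrow> 'k multiset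
    \<Rightarrow> (('k falg set \<times> 'k falg set \<Rightarrow>\<^sub>0 int) set, ('k falg set \<times> 'k falg set \<Rightarrow>\<^sub>0 int) set) module"
  where
  "klr_tensor p lam \<beta> \<gamma> =
     outer_tensor (\<lambda>c. klr_class p (plus_part p lam \<beta>) (fscal c))
       (\<lambda>c. klr_class p (plus_part p lam \<gamma>) (fscal c))
       (regular_module (klr_alg p (plus_part p lam \<beta>)))
       (regular_module (klr_alg p (plus_part p lam \<gamma>)))"

definition conv_class :: "'k::field \<Rightarrow> 'k \<Rightarrow> 'k multiset \<Rightarrow> 'k multiset
    \<Rightarrow> ('k falg set, 'm) module \<Rightarrow> ('k falg set, 'n) module
    \<Rightarrow> ('k falg set \<times> ('m \<times> 'n \<Rightarrow>\<^sub>0 int) set \<Rightarrow>\<^sub>0 int)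
    \<Rightarrow> ('k falg set \<times> ('m \<times> 'n \<Rightarrow>\<^sub>0 int) set \<Rightarrow>\<^sub>0 int) set" where
  "conv_class p lam \<beta> \<gamma> M N =
     tensor_class (carrier (klr_tensor p lam \<beta> \<gamma>))
       (ideal_module p lam \<beta> \<gamma>) (\<lambda>w t. w \<otimes>\<^bsub>vv_alg p (\<beta> + \<gamma>)\<^esub> tensor_emb p lam \<beta> \<gamma> t)
       (res_tensor p lam \<beta> \<gamma> M N) (smult (res_tensor p lam \<beta> \<gamma> M N))"

definition conv :: "'k::field \<Rightarrow> 'k \<Rightarrow> 'k multiset \<Rightarrow> 'k multiset
    \<Rightarrow> ('k falg set, 'm) module \<Rightarrow> ('k falg set, 'n) module
    \<Rightarrow> ('k falg set, ('k falg set \<times> ('m \<times> 'n \<Rightarrow>\<^sub>0 int) set \<Rightarrow>\<^sub>0 int) set) module" where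
  "conv p lam \<beta> \<gamma> M N =
     module_of_group
       (tensor_group (carrier (klr_tensor p lam \<beta> \<gamma>))
         (ideal_module p lam \<beta> \<gamma>) (\<lambda>w t. w \<otimes>\<^bsub>vv_alg p (\<beta> + \<gamma>)\<^esub> tensor_emb p lam \<beta> \<gamma> t)
         (res_tensor p lam \<beta> \<gamma> M N) (smult (res_tensor p lam \<beta> \<gamma> M N)))
       (\<lambda>w z. \<Union>f\<in>z. conv_class p lam \<beta> \<gamma> M N
          (frag_extend (\<lambda>(x, y). frag_of (w \<otimes>\<^bsub>vv_alg p (\<beta> + \<gamma>)\<^esub> x, y)) f))"

text \<open>The element $e(\beta^+\gamma^+) \otimes (m \otimes n)$ of $M \circ N$.\<close>

definition conv_unit :: "'k::field \<Rightarrow> 'k \<Rightarrow> 'k multiset \<Rightarrow> 'k multiset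
    \<Rightarrow> ('k falg set, 'm) module \<Rightarrow> ('k falg set, 'n) module \<Rightarrow> 'm \<Rightarrow> 'n
    \<Rightarrow> ('k falg set \<times> ('m \<times> 'n \<Rightarrow>\<^sub>0 int) set \<Rightarrow>\<^sub>0 int) set" where
  "conv_unit p lam \<beta> \<gamma> M N m n =
     conv_class p lam \<beta> \<gamma> M N
       (frag_of (vv_class p (\<beta> + \<gamma>) (idem_pair p lam \<beta> \<gamma>),
         tensor_class UNIV
           (Res p lam \<beta> M) (\<lambda>a c. klr_class p (plus_part p lam \<beta>) (fscal c) \<odot>\<^bsub>Res p lam \<beta> M\<^esub> a)
           (Res p lam \<gamma> N) (\<lambda>c b. klr_class p (plus_part p lam \<gamma>) (fscal c) \<odot>\<^bsub>Res p lam \<gamma> N\<^esub> b)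
           (frag_of (m, n))))"

end

theory Submission
  imports Defs
begin

text \<open>Write $\mathbf{R}$ for the KLR algebra of $\alpha^+$ and $\mathfrak{W}$ for $\mathfrak{W}_\alpha$.  Everything
  rests on an additive projection \<open>P\<close> from $\mathfrak{W}$ to $\mathbf{R}$ that is $\mathbf{R}$-linear on
  both sides and satisfies $P(1) = 1$; it inverts the natural map
  $\mathbf{R} \to \mathbf{e}\mathfrak{W}\mathbf{e}$.  To obtain it without a basis theorem, let
  $\mathfrak{W}$ act on families of elements of $\mathbf{R}$ indexed by the words $\mathbf{i} \in {}^\theta I^\alpha$:
  a word is sorted into a word over $I^+$ by moving its letters in $I \setminus I^+$ to the front and
  inverting them.  The generators act through the sorted word, which is possible since $I$ has no arrows
  between $I^+$ and its complement and $\pm 1, \pm p \notin I$.  Then \<open>P w\<close> is the sum of the components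
  at words over $I^+$ of \<open>w\<close> applied to the family of their idempotents.

  Given \<open>P\<close>, the isomorphism sends $w \otimes ((s \otimes (m \otimes l)) \otimes n)$ to
  $w\, P(s) \otimes (m \otimes (e \otimes (l \otimes n)))$, where $e$ is the idempotent of the inner product,
  and its inverse is given by the mirrored formula.  Both are well defined by the universal property
  of the tensor product and the associativity of the maps
  $\mathbf{R}_{\beta^+} \otimes \mathbf{R}_{\gamma^+} \to \mathbf{R}_{\beta^+ + \gamma^+}$.\<close>

section \<open>Free algebras and their quotients\<close>

text \<open>An element of Res(M o L) is a sum of terms e s (x) (m (x) l) with s in the VV algebra W.
  Only elements of the KLR algebra R may cross the outer tensor sign, so s has to be replaced by an
  element of R before it can act on w. The universal property of the inner product describes maps
  from all of M o L and not from its restriction; hence the projection is needed on the whole of W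
  and not just on the corner.

  The operators exist because letters of opposite sign are joined by no arrow: Q = 1 there, so such
  a crossing squares to the identity and may act trivially, and so may pi, whose square is 1. Only
  crossings of letters of equal sign are seen by R. This gives injectivity of R -> eWe. For
  surjectivity, let \<open>M i\<close> be the minimal coset representative of type B modulo type A
  that carries the sorted word to \<open>i\<close>. Left multiplication by a generator permutes the
  \<open>M i\<close> up to right factors from R, and these factors are the coefficients of the same
  operators, so one set of formulas serves both directions.\<close>

definition poly_extend :: "('w \<Rightarrow> 'k \<Rightarrow> 'a::comm_monoid_add) \<Rightarrow> ('w \<Rightarrow>\<^sub>0 'k::zero) \<Rightarrow> 'a" where
  "poly_extend u f = (\<Sum>w\<in>Poly_Mapping.keys f. u w (Poly_Mapping.lookup f w))"

lemma poly_extend_superset: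
  assumes "finite A" "Poly_Mapping.keys f \<subseteq> A" "\<And>w. u w 0 = 0"
  shows "poly_extend u f = (\<Sum>w\<in>A. u w (Poly_Mapping.lookup f w))"
  unfolding poly_extend_def using assms
  by (intro sum.mono_neutral_left) (auto simp: in_keys_iff)

lemma poly_extend_add:
  fixes f g :: "'w \<Rightarrow>\<^sub>0 'k::monoid_add"
  assumes "\<And>w. u w 0 = 0" "\<And>w a b. u w (a + b) = u w a + u w b"
  shows "poly_extend u (f + g) = poly_extend u f + poly_extend u g"
proof -
  let ?A = "Poly_Mapping.keys f \<union> Poly_Mapping.keys g"
  have "poly_extend u h = (\<Sum>w\<in>?A. u w (Poly_Mapping.lookup h w))"
    if "Poly_Mapping.keys h \<subseteq> ?A" for h
    using poly_extend_superset[of ?A h u] that assms by simp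
  then show ?thesis
    using Poly_Mapping.keys_add[of f g]
    by (simp add: Poly_Mapping.lookup_add assms sum.distrib)
qed

lemma poly_extend_single:
  assumes "u w 0 = 0"
  shows "poly_extend u (Poly_Mapping.single w c) = u w c"
  by (cases "c = 0") (auto simp: poly_extend_def assms)

lemma fscal_add: "fscal (a + b) = fscal a + fscal b"
  by (simp add: fscal_def single_add)

lemma fscal_0 [simp]: "fscal 0 = 0"
  by (simp add: fscal_def)

lemma fscal_1 [simp]: "fscal 1 = 1"
  by (simp add: fscal_def)

lemma fscal_mult: "fscal (a * b) = fscal a * fscal b"
  by (simp add: fscal_def mult_single)

lemma fscal_times_single: "fscal a * Poly_Mapping.single w c = Poly_Mapping.single w (a * c)"
  by (simp add: fscal_def mult_single)

lemma poly_mapping_sum_single: "f = (\<Sum>w\<in>Poly_Mapping.keys f. Poly_Mapping.single w (Poly_Mapping.lookup f w))"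
proof (rule poly_mapping_eqI)
  fix v
  have "(\<Sum>w\<in>Poly_Mapping.keys f. Poly_Mapping.lookup (Poly_Mapping.single w (Poly_Mapping.lookup f w)) v) =
      (\<Sum>w\<in>Poly_Mapping.keys f. if w = v then Poly_Mapping.lookup f v else 0)"
    by (intro sum.cong) (auto simp: lookup_single)
  also have "\<dots> = Poly_Mapping.lookup f v"
    by (simp add: in_keys_iff)
  finally show "Poly_Mapping.lookup f v =
      Poly_Mapping.lookup (\<Sum>w\<in>Poly_Mapping.keys f. Poly_Mapping.single w (Poly_Mapping.lookup f w)) v"
    by (simp add: lookup_sum)
qed

lemma carrier_free_alg: "carrier (free_alg G) = {f. \<forall>w\<in>Poly_Mapping.keys f. set (letters w) \<subseteq> G}"
  by (simp add: free_alg_def)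

lemma free_alg_fscal [simp]: "fscal c \<in> carrier (free_alg G)"
  by (auto simp: carrier_free_alg fscal_def zero_fword_def)

lemma free_alg_0 [simp]: "0 \<in> carrier (free_alg G)"
  by (auto simp: carrier_free_alg)

lemma free_alg_1 [simp]: "1 \<in> carrier (free_alg G)"
  using free_alg_fscal[of 1] by simp

lemma free_alg_fvar [simp]: "g \<in> G \<Longrightarrow> fvar g \<in> carrier (free_alg G)"
  by (auto simp: carrier_free_alg fvar_def)

lemma free_alg_add [simp]:
  "f \<in> carrier (free_alg G) \<Longrightarrow> g \<in> carrier (free_alg G) \<Longrightarrow> f + g \<in> carrier (free_alg G)"
  using Poly_Mapping.keys_add[of f g] by (auto simp: carrier_free_alg)

lemma free_alg_minus [simp]: "f \<in> carrier (free_alg G) \<Longrightarrow> - f \<in> carrier (free_alg G)"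
  by (auto simp: carrier_free_alg)

lemma free_alg_diff [simp]:
  "f \<in> carrier (free_alg G) \<Longrightarrow> g \<in> carrier (free_alg G) \<Longrightarrow> f - g \<in> carrier (free_alg G)"
  using free_alg_add[of f G "- g"] by simp

lemma free_alg_mult [simp]:
  "f \<in> carrier (free_alg G) \<Longrightarrow> g \<in> carrier (free_alg G) \<Longrightarrow> f * g \<in> carrier (free_alg G)"
  using Poly_Mapping.keys_mult[of f g] by (fastforce simp: carrier_free_alg plus_fword_def)

lemma free_alg_sum [simp]:
  "(\<And>i. i \<in> A \<Longrightarrow> f i \<in> carrier (free_alg G)) \<Longrightarrow> sum f A \<in> carrier (free_alg G)"
  by (induction A rule: infinite_finite_induct) auto

lemma free_alg_power [simp]: "f \<in> carrier (free_alg G) \<Longrightarrow> f ^ n \<in> carrier (free_alg G)"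
  by (induction n) auto

text \<open>Words are built from the left, so a property only has to be stable under scalars, sums
  and left multiplication by one generator. Multiplicativity of a map thus reduces to the case of a
  generator times an element.\<close>

lemma free_alg_induct [consumes 1, case_names scal var add]:
  fixes f :: "('g, 'k::field) fralg"
  assumes f: "f \<in> carrier (free_alg G)"
    and scal: "\<And>c. P (fscal c)"
    and var: "\<And>g f. g \<in> G \<Longrightarrow> f \<in> carrier (free_alg G) \<Longrightarrow> P f \<Longrightarrow> P (fvar g * f)"
    and add: "\<And>f g. f \<in> carrier (free_alg G) \<Longrightarrow> g \<in> carrier (free_alg G) \<Longrightarrow> P f \<Longrightarrow> P g \<Longrightarrow> P (f + g)"
  shows "P f"
proof -
  have word: "P (Poly_Mapping.single (FWord ws) c) \<and>
      Poly_Mapping.single (FWord ws) c \<in> carrier (free_alg G)" if "set ws \<subseteq> G" for ws c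
    using that
  proof (induction ws)
    case Nil
    then show ?case using scal[of c] by (simp add: fscal_def zero_fword_def)
      (auto simp: carrier_free_alg)
  next
    case (Cons a ws)
    have "Poly_Mapping.single (FWord (a # ws)) c = fvar a * Poly_Mapping.single (FWord ws) c"
      by (simp add: fvar_def mult_single plus_fword_def)
    then show ?case using Cons var[of a] by simp
  qed
  have "P (\<Sum>w\<in>A. Poly_Mapping.single w (Poly_Mapping.lookup f w)) \<and>
     (\<Sum>w\<in>A. Poly_Mapping.single w (Poly_Mapping.lookup f w)) \<in> carrier (free_alg G)"
    if "finite A" "A \<subseteq> Poly_Mapping.keys f" for A
    using that
  proof (induction A rule: finite_induct)
    case empty
    then show ?case using scal[of 0] by simp
  next
    case (insert w A)
    have "set (letters w) \<subseteq> G" using insert f by (auto simp: carrier_free_alg)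
    then show ?case
      using insert word[of "letters w"] add by simp
  qed
  from this[of "Poly_Mapping.keys f"] show ?thesis
    using poly_mapping_sum_single[of f] by simp
qed

lemma free_alg_UNIV [simp]: "f \<in> carrier (free_alg UNIV)"
  by (simp add: carrier_free_alg)

lemmas fralg_induct [case_names scal var add] = free_alg_induct[OF free_alg_UNIV, simplified]

lemma fsubst_poly_extend: "fsubst \<phi> = poly_extend (\<lambda>w c. fscal c * prod_list (map \<phi> (letters w)))"
  by (simp add: fun_eq_iff fsubst_def poly_extend_def)

lemma fscal_commute: "fscal c * f = f * fscal (c :: 'k::field)"
proof (induction f rule: fralg_induct)
  case (scal d)
  then show ?case by (simp add: mult.commute flip: fscal_mult)
next
  case (var g f)
  have "fscal c * (fvar g * f) = fvar g * (fscal c * f)"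
    by (simp add: fscal_def fvar_def mult_single flip: mult.assoc)
  then show ?case using var by (simp add: mult.assoc)
qed (simp add: algebra_simps)

lemma fsubst_add: "fsubst \<phi> (f + g) = fsubst \<phi> f + fsubst \<phi> g"
  unfolding fsubst_poly_extend
  by (rule poly_extend_add) (simp_all add: fscal_add algebra_simps)

lemma fsubst_fscal [simp]: "fsubst \<phi> (fscal c) = fscal c"
  unfolding fsubst_poly_extend
  by (simp add: poly_extend_single fscal_def[of c] zero_fword_def)

lemma fsubst_fvar [simp]: "fsubst \<phi> (fvar g) = \<phi> g"
  unfolding fsubst_poly_extend
  by (simp add: poly_extend_single fvar_def)

lemma fsubst_0 [simp]: "fsubst \<phi> 0 = 0"
  using fsubst_fscal[of \<phi> 0] by simp

lemma fsubst_1 [simp]: "fsubst \<phi> 1 = 1"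
  using fsubst_fscal[of \<phi> 1] by simp

lemma fsubst_minus: "fsubst \<phi> (- f) = - fsubst \<phi> f"
  by (metis add.inverse_unique fsubst_0 fsubst_add add.right_inverse)

lemma fsubst_diff: "fsubst \<phi> (f - g) = fsubst \<phi> f - fsubst \<phi> g"
  using fsubst_add[of \<phi> f "- g"] by (simp add: fsubst_minus)

lemma fsubst_single:
  "fsubst \<phi> (Poly_Mapping.single w c) = fscal c * prod_list (map \<phi> (letters w))"
  unfolding fsubst_poly_extend by (simp add: poly_extend_single)

lemma fsubst_fscal_mult: "fsubst \<phi> (fscal c * f) = fscal c * fsubst \<phi> f"
proof -
  have "fsubst \<phi> (fscal c * Poly_Mapping.single w d) = fscal c * fsubst \<phi> (Poly_Mapping.single w d)" for w d
    by (simp add: fscal_times_single fsubst_single fscal_mult mult.assoc)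
  then have "fsubst \<phi> (fscal c * (\<Sum>w\<in>A. Poly_Mapping.single w (d w))) =
     fscal c * fsubst \<phi> (\<Sum>w\<in>A. Poly_Mapping.single w (d w))" for A d
    by (induction A rule: infinite_finite_induct) (auto simp: fsubst_add algebra_simps)
  then show ?thesis using poly_mapping_sum_single[of f] by metis
qed

lemma fsubst_fvar_mult: "fsubst \<phi> (fvar g * f) = \<phi> g * fsubst \<phi> f"
proof -
  have "fsubst \<phi> (fvar g * Poly_Mapping.single w d) = \<phi> g * fsubst \<phi> (Poly_Mapping.single w d)" for w d
  proof -
    have "fvar g * Poly_Mapping.single w d = Poly_Mapping.single (FWord (g # letters w)) d"
      by (simp add: fvar_def mult_single plus_fword_def)
    then show ?thesis
      by (simp add: fsubst_single) (metis fscal_commute mult.assoc)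
  qed
  then have "fsubst \<phi> (fvar g * (\<Sum>w\<in>A. Poly_Mapping.single w (d w))) =
     \<phi> g * fsubst \<phi> (\<Sum>w\<in>A. Poly_Mapping.single w (d w))" for A d
    by (induction A rule: infinite_finite_induct) (auto simp: fsubst_add algebra_simps)
  then show ?thesis using poly_mapping_sum_single[of f] by metis
qed

lemma fsubst_mult: "fsubst \<phi> (f * g) = fsubst \<phi> f * fsubst \<phi> g"
  by (induction f rule: fralg_induct)
    (simp_all add: fsubst_fscal_mult fsubst_fvar_mult fsubst_add mult.assoc distrib_right)

lemma fsubst_sum: "fsubst \<phi> (sum f A) = (\<Sum>i\<in>A. fsubst \<phi> (f i))"
  by (induction A rule: infinite_finite_induct) (simp_all add: fsubst_add)

lemma fsubst_power: "fsubst \<phi> (f ^ n) = fsubst \<phi> f ^ n"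
  by (induction n) (simp_all add: fsubst_mult)

lemma fsubst_closed:
  assumes "f \<in> carrier (free_alg G)" "\<And>g. g \<in> G \<Longrightarrow> \<phi> g \<in> carrier (free_alg H)"
  shows "fsubst \<phi> f \<in> carrier (free_alg H)"
  using assms(1) by (induction f rule: free_alg_induct) (simp_all add: assms(2) fsubst_add fsubst_mult)

lemma fsubst_id_on:
  assumes "f \<in> carrier (free_alg G)" "\<And>g. g \<in> G \<Longrightarrow> \<phi> g = fvar g"
  shows "fsubst \<phi> f = f"
  using assms(1) by (induction f rule: free_alg_induct) (simp_all add: assms(2) fsubst_add fsubst_mult)


section \<open>Two-sided ideals and congruence modulo relations\<close>

inductive_set tsi :: "'a::ring_1 set \<Rightarrow> 'a set" for R :: "'a set" where
  tsi_gen: "r \<in> R \<Longrightarrow> a * r * b \<in> tsi R"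
| tsi_zero: "0 \<in> tsi R"
| tsi_add: "f \<in> tsi R \<Longrightarrow> g \<in> tsi R \<Longrightarrow> f + g \<in> tsi R"

lemma tsi_base: "r \<in> R \<Longrightarrow> r \<in> tsi R"
  using tsi_gen[of r R 1 1] by simp

lemma tsi_mult_left: "f \<in> tsi R \<Longrightarrow> a * f \<in> tsi R"
proof (induction rule: tsi.induct)
  case (tsi_gen r b c)
  then show ?case using tsi.tsi_gen[of r R "a * b" c] by (simp add: mult.assoc)
qed (auto simp: distrib_left intro: tsi.intros)

lemma tsi_mult_right: "f \<in> tsi R \<Longrightarrow> f * a \<in> tsi R"
proof (induction rule: tsi.induct)
  case (tsi_gen r b c)
  then show ?case using tsi.tsi_gen[of r R b "c * a"] by (simp add: mult.assoc)
qed (auto simp: distrib_right intro: tsi.intros)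

lemma tsi_minus: "f \<in> tsi R \<Longrightarrow> - f \<in> tsi R"
  using tsi_mult_left[of f R "-1"] by simp

lemma tsi_induct_ideal [consumes 1, case_names base zero add left right]:
  assumes "f \<in> tsi R" "\<And>r. r \<in> R \<Longrightarrow> P r" "P 0" "\<And>f g. P f \<Longrightarrow> P g \<Longrightarrow> P (f + g)"
    "\<And>a f. P f \<Longrightarrow> P (a * f)" "\<And>a f. P f \<Longrightarrow> P (f * a)"
  shows "P f"
  using assms(1) by induction (auto intro: assms)

definition eqv :: "'a::ring_1 \<Rightarrow> 'a set \<Rightarrow> 'a \<Rightarrow> bool" ("(_/ \<doteq>\<^bsub>_\<^esub> _)" [51,0,51] 50) where
  "f \<doteq>\<^bsub>R\<^esub> g \<longleftrightarrow> f - g \<in> tsi R"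

lemma eqv_refl [simp, intro!]: "f \<doteq>\<^bsub>R\<^esub> f"
  by (simp add: eqv_def tsi_zero)

lemma eqv_sym: "f \<doteq>\<^bsub>R\<^esub> g \<Longrightarrow> g \<doteq>\<^bsub>R\<^esub> f"
  using tsi_minus[of "f - g" R] by (simp add: eqv_def)

lemma eqv_trans [trans]: "f \<doteq>\<^bsub>R\<^esub> g \<Longrightarrow> g \<doteq>\<^bsub>R\<^esub> h \<Longrightarrow> f \<doteq>\<^bsub>R\<^esub> h"
  using tsi_add[of "f - g" R "g - h"] by (simp add: eqv_def)

lemma eqv_eq_trans [trans]: "f \<doteq>\<^bsub>R\<^esub> g \<Longrightarrow> g = h \<Longrightarrow> f \<doteq>\<^bsub>R\<^esub> h"
  by simp

lemma eq_eqv_trans [trans]: "f = g \<Longrightarrow> g \<doteq>\<^bsub>R\<^esub> h \<Longrightarrow> f \<doteq>\<^bsub>R\<^esub> h"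
  by simp

lemma eqv_add: "f \<doteq>\<^bsub>R\<^esub> f' \<Longrightarrow> g \<doteq>\<^bsub>R\<^esub> g' \<Longrightarrow> f + g \<doteq>\<^bsub>R\<^esub> f' + g'"
  using tsi_add[of "f - f'" R "g - g'"] by (simp add: eqv_def algebra_simps)

lemma eqv_minus: "f \<doteq>\<^bsub>R\<^esub> f' \<Longrightarrow> - f \<doteq>\<^bsub>R\<^esub> - f'"
  using tsi_minus[of "f - f'" R] by (simp add: eqv_def)

lemma eqv_mult_left: "g \<doteq>\<^bsub>R\<^esub> g' \<Longrightarrow> f * g \<doteq>\<^bsub>R\<^esub> f * g'"
  using tsi_mult_left[of "g - g'" R f] by (simp add: eqv_def algebra_simps)

lemma eqv_mult_right: "f \<doteq>\<^bsub>R\<^esub> f' \<Longrightarrow> f * g \<doteq>\<^bsub>R\<^esub> f' * g"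
  using tsi_mult_right[of "f - f'" R g] by (simp add: eqv_def algebra_simps)

lemma eqv_sum: "(\<And>i. i \<in> A \<Longrightarrow> f i \<doteq>\<^bsub>R\<^esub> g i) \<Longrightarrow> sum f A \<doteq>\<^bsub>R\<^esub> sum g A"
  by (induction A rule: infinite_finite_induct) (auto intro: eqv_add)

lemma eqv_relI: "f - g \<in> R \<Longrightarrow> f \<doteq>\<^bsub>R\<^esub> g"
  by (simp add: eqv_def tsi_base)

lemma ring_free_alg: "ring (free_alg G :: ('g, 'k::field) fralg ring)"
proof (rule ringI)
  show "abelian_group (free_alg G :: ('g, 'k) fralg ring)"
  proof (rule abelian_groupI)
    fix x :: "('g, 'k) fralg" assume "x \<in> carrier (free_alg G)"
    then show "\<exists>y\<in>carrier (free_alg G). y \<oplus>\<^bsub>free_alg G\<^esub> x = \<zero>\<^bsub>free_alg G\<^esub>"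
      by (intro bexI[of _ "- x"]) (simp_all add: free_alg_def)
  qed (simp_all add: free_alg_def[THEN arg_cong[of _ _ "ring.add"]] free_alg_def[THEN arg_cong[of _ _ "ring.zero"]] add_ac)
  show "Group.monoid (free_alg G :: ('g, 'k) fralg ring)"
    by (rule monoidI) (simp_all add: free_alg_def[THEN arg_cong[of _ _ "monoid.mult"]] free_alg_def[THEN arg_cong[of _ _ "monoid.one"]] mult.assoc)
qed (simp_all add: free_alg_def algebra_simps)

lemma free_alg_sel [simp]:
  "monoid.mult (free_alg G) = (*)" "monoid.one (free_alg G) = 1"
  "ring.zero (free_alg G) = 0" "ring.add (free_alg G) = (+)"
  by (simp_all add: free_alg_def)

context
  fixes G :: "'g set" and R :: "('g, 'k::field) fralg set"
  assumes R: "R \<subseteq> carrier (free_alg G)"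
begin

interpretation fa: ring "free_alg G :: ('g, 'k) fralg ring" by (rule ring_free_alg)

text \<open>Justifies computing in the ambient type-class ring. Multipliers in \<open>tsi\<close>
  range over the whole free algebra, those of the generated ideal only over words in
  \<open>G\<close>; a retraction shows that this makes no difference inside the carrier.\<close>

lemma Idl_free_alg: "Idl\<^bsub>free_alg G\<^esub> R = tsi R \<inter> carrier (free_alg G)"
proof
  have inv: "\<ominus>\<^bsub>free_alg G\<^esub> x = - x" if "x \<in> carrier (free_alg G)" for x :: "('g, 'k) fralg"
    using fa.minus_equality[of "- x" x] that by simp
  have "ideal (tsi R \<inter> carrier (free_alg G)) (free_alg G)"
  proof (rule idealI[OF fa.ring_axioms])
    show "subgroup (tsi R \<inter> carrier (free_alg G)) (add_monoid (free_alg G))"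
    proof (rule group.subgroupI[OF fa.a_group])
      show "inv\<^bsub>add_monoid (free_alg G)\<^esub> a \<in> tsi R \<inter> carrier (free_alg G)"
        if "a \<in> tsi R \<inter> carrier (free_alg G)" for a
        using inv[of a] that by (simp add: a_inv_def tsi_minus)
    qed (auto intro: tsi_add tsi_zero intro!: exI[of _ 0])
  qed (auto intro: tsi_mult_left tsi_mult_right)
  then show "Idl\<^bsub>free_alg G\<^esub> R \<subseteq> tsi R \<inter> carrier (free_alg G)"
    using R by (intro fa.genideal_minimal) (auto intro: tsi_base)
  interpret I: ideal "Idl\<^bsub>free_alg G\<^esub> R" "free_alg G" by (rule fa.genideal_ideal[OF R])
  \<comment> \<open>The algebra map that kills the generators outside \<open>G\<close>. It fixes
    \<open>R\<close> and the carrier, so it turns any expression of \<open>f\<close> through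
    \<open>R\<close> into one whose multipliers are words in \<open>G\<close>.\<close>
  define ret where "ret = fsubst (\<lambda>g. if g \<in> G then fvar g else (0 :: ('g, 'k) fralg))"
  have ret_closed: "ret f \<in> carrier (free_alg G)" for f
    unfolding ret_def by (rule fsubst_closed[of _ UNIV]) auto
  have ret_id: "ret f = f" if "f \<in> carrier (free_alg G)" for f
    unfolding ret_def using that by (rule fsubst_id_on) auto
  have "ret f \<in> Idl\<^bsub>free_alg G\<^esub> R" if "f \<in> tsi R" for f
    using that
  proof (induction rule: tsi_induct_ideal)
    case (base r)
    then show ?case using fa.genideal_self[OF R] ret_id[of r] R by auto
  next
    case zero
    then show ?case using I.zero_closed by (simp add: ret_def)
  next
    case (add f g)
    then show ?case using I.a_closed[of "ret f" "ret g"] by (simp add: ret_def fsubst_add)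
  next
    case (left a f)
    then show ?case using I.I_l_closed[of "ret f" "ret a"] ret_closed by (simp add: ret_def fsubst_mult)
  next
    case (right a f)
    then show ?case using I.I_r_closed[of "ret f" "ret a"] ret_closed by (simp add: ret_def fsubst_mult)
  qed
  then show "tsi R \<inter> carrier (free_alg G) \<subseteq> Idl\<^bsub>free_alg G\<^esub> R"
    using ret_id by force
qed

lemma pclass_eq_set:
  assumes "f \<in> carrier (free_alg G)"
  shows "pclass G R f = {g \<in> carrier (free_alg G). g \<doteq>\<^bsub>R\<^esub> f}"
proof -
  have "pclass G R f = (\<lambda>h. h + f) ` (tsi R \<inter> carrier (free_alg G))"
    by (auto simp: pclass_def Idl_free_alg a_r_coset_def r_coset_def)
  also have "\<dots> = {g \<in> carrier (free_alg G). g \<doteq>\<^bsub>R\<^esub> f}"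
  proof (intro equalityI subsetI)
    fix g assume "g \<in> {g \<in> carrier (free_alg G). g \<doteq>\<^bsub>R\<^esub> f}"
    then show "g \<in> (\<lambda>h. h + f) ` (tsi R \<inter> carrier (free_alg G))"
      using assms by (intro image_eqI[of _ _ "g - f"]) (auto simp: eqv_def)
  qed (use assms in \<open>auto simp: eqv_def\<close>)
  finally show ?thesis .
qed

lemma pclass_eq_iff:
  assumes "f \<in> carrier (free_alg G)" "g \<in> carrier (free_alg G)"
  shows "pclass G R f = pclass G R g \<longleftrightarrow> f \<doteq>\<^bsub>R\<^esub> g"
  using assms by (auto simp: pclass_eq_set intro: eqv_trans eqv_sym)

lemma carrier_presented: "carrier (presented G R) = pclass G R ` carrier (free_alg G)"
  by (auto simp: presented_def FactRing_def A_RCOSETS_def' pclass_def)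

lemma ring_presented: "ring (presented G R)"
  unfolding presented_def
  by (rule ideal.quotient_is_ring[OF fa.genideal_ideal[OF R]])

lemma presented_hom: "pclass G R \<in> ring_hom (free_alg G) (presented G R)"
  using ideal.rcos_ring_hom[OF fa.genideal_ideal[OF R]]
  by (simp add: presented_def pclass_def[abs_def])

lemma presented_mult:
  assumes "f \<in> carrier (free_alg G)" "g \<in> carrier (free_alg G)"
  shows "pclass G R f \<otimes>\<^bsub>presented G R\<^esub> pclass G R g = pclass G R (f * g)"
  using ring_hom_mult[OF presented_hom] assms by simp

lemma presented_add:
  assumes "f \<in> carrier (free_alg G)" "g \<in> carrier (free_alg G)"
  shows "pclass G R f \<oplus>\<^bsub>presented G R\<^esub> pclass G R g = pclass G R (f + g)"
  using ring_hom_add[OF presented_hom] assms by simp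

lemma presented_one: "\<one>\<^bsub>presented G R\<^esub> = pclass G R 1"
  using ring_hom_one[OF presented_hom] by simp

text \<open>Evaluates unions over representatives, the form in which the maps out of a presented
  algebra are defined.\<close>

lemma UN_pclass:
  assumes "f \<in> carrier (free_alg G)"
    and "\<And>g. g \<in> carrier (free_alg G) \<Longrightarrow> g \<doteq>\<^bsub>R\<^esub> f \<Longrightarrow> h g = h f"
  shows "(\<Union>g\<in>pclass G R f. h g) = h f"
proof -
  have "(\<Union>g\<in>pclass G R f. h g) = (\<Union>g\<in>pclass G R f. h f)"
    by (intro SUP_cong[OF refl] assms(2)) (use assms(1) in \<open>simp_all add: pclass_eq_set\<close>)
  moreover have "f \<in> pclass G R f" using assms(1) by (simp add: pclass_eq_set)
  ultimately show ?thesis by auto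
qed

end

section \<open>Tensor products\<close>

lemma abelian_group_sub:
  assumes "abelian_group M"
    and "carrier N \<subseteq> carrier M" "ring.add N = ring.add M" "ring.zero N = ring.zero M"
    and "\<zero>\<^bsub>M\<^esub> \<in> carrier N"
    and "\<And>x y. x \<in> carrier N \<Longrightarrow> y \<in> carrier N \<Longrightarrow> x \<oplus>\<^bsub>M\<^esub> y \<in> carrier N"
    and "\<And>x. x \<in> carrier N \<Longrightarrow> \<ominus>\<^bsub>M\<^esub> x \<in> carrier N"
  shows "abelian_group N"
proof -
  interpret M: abelian_group M by fact
  show ?thesis
  proof (rule abelian_groupI)
    fix x assume "x \<in> carrier N"
    then show "\<exists>y\<in>carrier N. y \<oplus>\<^bsub>N\<^esub> x = \<zero>\<^bsub>N\<^esub>"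
      using assms by (intro bexI[of _ "\<ominus>\<^bsub>M\<^esub> x"]) (auto simp: M.l_neg)
  next
    fix x y z assume "x \<in> carrier N" "y \<in> carrier N" "z \<in> carrier N"
    then show "x \<oplus>\<^bsub>N\<^esub> y \<oplus>\<^bsub>N\<^esub> z = x \<oplus>\<^bsub>N\<^esub> (y \<oplus>\<^bsub>N\<^esub> z)"
      using assms M.a_assoc by (simp add: subset_iff)
  qed (use assms in \<open>auto simp: subset_iff intro: M.a_comm\<close>)
qed

section \<open>Tensor products as quotients of free abelian groups\<close>

locale tensor_product = A: abelian_group A + B: abelian_group B
  for C :: "'r set" and A :: "('a, 'x) ring_scheme" and ra and B :: "('b, 'y) ring_scheme" and la +
  assumes ra_closed: "a \<in> carrier A \<Longrightarrow> c \<in> C \<Longrightarrow> ra a c \<in> carrier A"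
    and la_closed: "c \<in> C \<Longrightarrow> b \<in> carrier B \<Longrightarrow> la c b \<in> carrier B"
begin

abbreviation F where "F \<equiv> free_Abelian_group (carrier A \<times> carrier B)"
abbreviation N where "N \<equiv> generate F (tensor_rels C A ra B la)"
abbreviation T where "T \<equiv> tensor_group C A ra B la"
abbreviation cls where "cls \<equiv> tensor_class C A ra B la"
abbreviation pure where "pure a b \<equiv> cls (frag_of (a, b))"

lemma F_add: "f \<in> carrier F \<Longrightarrow> g \<in> carrier F \<Longrightarrow> f + g \<in> carrier F"
  using Poly_Mapping.keys_add[of f g] by auto

lemma F_minus: "f \<in> carrier F \<Longrightarrow> - f \<in> carrier F"
  by simp

lemma F_diff: "f \<in> carrier F \<Longrightarrow> g \<in> carrier F \<Longrightarrow> f - g \<in> carrier F"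
  using F_add[of f "- g"] by simp

lemma F_of: "a \<in> carrier A \<Longrightarrow> b \<in> carrier B \<Longrightarrow> frag_of (a, b) \<in> carrier F"
  by simp

lemma rels_subset: "tensor_rels C A ra B la \<subseteq> carrier F"
  unfolding tensor_rels_def
  by (auto simp del: carrier_free_Abelian_group_iff intro!: F_diff F_of A.a_closed B.a_closed ra_closed la_closed)

lemma N_subgroup: "subgroup N F"
  by (rule group.generate_is_subgroup[OF group_free_Abelian_group rels_subset])

lemma N_subset: "f \<in> N \<Longrightarrow> f \<in> carrier F"
  using subgroup.subset[OF N_subgroup] by blast

lemma N_0: "0 \<in> N"
  using subgroup.one_closed[OF N_subgroup] by simp

lemma N_add: "f \<in> N \<Longrightarrow> g \<in> N \<Longrightarrow> f + g \<in> N"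
  using subgroup.m_closed[OF N_subgroup, of f g] by simp

lemma N_minus: "f \<in> N \<Longrightarrow> - f \<in> N"
  using subgroup.m_inv_closed[OF N_subgroup, of f] N_subset[of f] by simp

lemma N_diff: "f \<in> N \<Longrightarrow> g \<in> N \<Longrightarrow> f - g \<in> N"
  using N_add[of f "- g"] N_minus[of g] by simp

lemma N_rel: "f \<in> tensor_rels C A ra B la \<Longrightarrow> f \<in> N"
  by (rule generate.incl)

text \<open>Closure under differences is enough: the inverse of \<open>h\<close> is
  \<open>0 - h\<close>, and the product of \<open>h1\<close> and \<open>h2\<close> is
  \<open>h1 - (0 - h2)\<close>.\<close>

lemma N_sub_induct [consumes 1, case_names rel zero diff]:
  assumes "f \<in> N" "\<And>f. f \<in> tensor_rels C A ra B la \<Longrightarrow> P f" "P 0"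
    "\<And>f g. f \<in> carrier F \<Longrightarrow> g \<in> carrier F \<Longrightarrow> P f \<Longrightarrow> P g \<Longrightarrow> P (f - g)"
  shows "P f"
  using assms(1)
proof induction
  case one
  then show ?case using assms(3) by simp
next
  case (incl h)
  then show ?case using assms(2) by simp
next
  case (inv h)
  then have "h \<in> carrier F" using rels_subset by blast
  then have "P (0 - h)" using assms(2)[of h] inv assms(3) assms(4)[of 0 h] by simp
  then show ?case using \<open>h \<in> carrier F\<close> by simp
next
  case (eng h1 h2)
  have c: "h1 \<in> carrier F" "h2 \<in> carrier F" using eng N_subset by blast+
  have "P (0 - h2)" using assms(4)[of 0 h2] assms(3) eng c by simp
  then have "P (h1 - (0 - h2))"
    using assms(4)[of h1 "0 - h2"] c eng by simp
  then show ?case by simp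
qed

lemma cls_eq_set: "cls f = {g. g - f \<in> N}"
proof -
  have "cls f = (\<lambda>h. h + f) ` N"
    by (auto simp: tensor_class_def Let_def r_coset_def)
  also have "\<dots> = {g. g - f \<in> N}"
    by (auto intro!: image_eqI[where x = "g - f" for g])
  finally show ?thesis .
qed

lemma cls_eq_iff: "cls f = cls g \<longleftrightarrow> f - g \<in> N"
proof
  assume "cls f = cls g"
  moreover have "f \<in> cls f" by (simp add: cls_eq_set N_0)
  ultimately show "f - g \<in> N" by (simp add: cls_eq_set)
next
  assume fg: "f - g \<in> N"
  have "h - f \<in> N \<longleftrightarrow> h - g \<in> N" for h
    using N_add[OF _ fg, of "h - f"] N_diff[OF _ fg, of "h - g"] by (auto simp: algebra_simps)
  then show "cls f = cls g" by (auto simp: cls_eq_set)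
qed

lemma UN_cls:
  assumes "\<And>g. g - f \<in> N \<Longrightarrow> h g = h f"
  shows "(\<Union>g\<in>cls f. h g) = h f"
proof -
  have "(\<Union>g\<in>cls f. h g) = (\<Union>g\<in>cls f. h f)"
    by (intro SUP_cong[OF refl] assms) (simp add: cls_eq_set)
  moreover have "f \<in> cls f" by (simp add: cls_eq_set N_0)
  ultimately show ?thesis by auto
qed

lemma rep_closed: "f \<in> carrier F \<Longrightarrow> g - f \<in> N \<Longrightarrow> g \<in> carrier F"
  using F_add[of "g - f" f] N_subset[of "g - f"] by simp

lemma T_eq: "T = F Mod N"
  by (simp add: tensor_group_def Let_def)

lemma N_normal: "N \<lhd> F"
  using comm_group.subgroup_imp_normal[OF abelian_free_Abelian_group N_subgroup] .

lemma comm_group_T: "comm_group T"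
  unfolding T_eq by (rule comm_group.abelian_FactGroup[OF abelian_free_Abelian_group N_subgroup])

lemma cls_hom: "cls \<in> hom F T"
  using normal.r_coset_hom_Mod[OF N_normal] by (simp add: T_eq tensor_class_def[abs_def] Let_def)

lemma carrier_T: "carrier T = cls ` carrier F"
  by (auto simp: T_eq tensor_class_def Let_def FactGroup_def RCOSETS_def)

lemma cls_closed: "f \<in> carrier F \<Longrightarrow> cls f \<in> carrier T"
  unfolding carrier_T by (rule imageI)

lemma pure_closed: "a \<in> carrier A \<Longrightarrow> b \<in> carrier B \<Longrightarrow> pure a b \<in> carrier T"
  by (intro cls_closed F_of)

lemma cls_add: "f \<in> carrier F \<Longrightarrow> g \<in> carrier F \<Longrightarrow> cls (f + g) = cls f \<otimes>\<^bsub>T\<^esub> cls g"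
  using hom_mult[OF cls_hom, of f g] by simp

lemma cls_0: "cls 0 = \<one>\<^bsub>T\<^esub>"
  using hom_one[OF cls_hom group_free_Abelian_group] comm_group.axioms(2)[OF comm_group_T] by simp

lemma N_add_left:
  assumes "a \<in> carrier A" "a' \<in> carrier A" "b \<in> carrier B"
  shows "frag_of (a \<oplus>\<^bsub>A\<^esub> a', b) - frag_of (a, b) - frag_of (a', b) \<in> N"
  by (rule N_rel) (use assms in \<open>auto simp: tensor_rels_def\<close>)

lemma N_add_right:
  assumes "a \<in> carrier A" "b \<in> carrier B" "b' \<in> carrier B"
  shows "frag_of (a, b \<oplus>\<^bsub>B\<^esub> b') - frag_of (a, b) - frag_of (a, b') \<in> N"
  by (rule N_rel) (use assms in \<open>auto simp: tensor_rels_def\<close>)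

lemma N_balanced:
  assumes "a \<in> carrier A" "c \<in> C" "b \<in> carrier B"
  shows "frag_of (ra a c, b) - frag_of (a, la c b) \<in> N"
  by (rule N_rel) (use assms in \<open>auto simp: tensor_rels_def\<close>)

lemma pure_add_left:
  assumes "a \<in> carrier A" "a' \<in> carrier A" "b \<in> carrier B"
  shows "pure (a \<oplus>\<^bsub>A\<^esub> a') b = pure a b \<otimes>\<^bsub>T\<^esub> pure a' b"
  using N_add_left[OF assms] assms
  by (simp add: diff_diff_eq flip: cls_eq_iff) (simp add: cls_add)

lemma pure_add_right:
  assumes "a \<in> carrier A" "b \<in> carrier B" "b' \<in> carrier B"
  shows "pure a (b \<oplus>\<^bsub>B\<^esub> b') = pure a b \<otimes>\<^bsub>T\<^esub> pure a b'"
  using N_add_right[OF assms] assms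
  by (simp add: diff_diff_eq flip: cls_eq_iff) (simp add: cls_add)

lemma pure_balanced:
  assumes "a \<in> carrier A" "c \<in> C" "b \<in> carrier B"
  shows "pure (ra a c) b = pure a (la c b)"
  unfolding cls_eq_iff by (rule N_balanced[OF assms])

lemma pure_zero_left:
  assumes "b \<in> carrier B"
  shows "pure \<zero>\<^bsub>A\<^esub> b = \<one>\<^bsub>T\<^esub>"
proof -
  interpret T: comm_group T by (rule comm_group_T)
  have "pure \<zero>\<^bsub>A\<^esub> b \<otimes>\<^bsub>T\<^esub> pure \<zero>\<^bsub>A\<^esub> b = pure \<zero>\<^bsub>A\<^esub> b"
    using pure_add_left[of "\<zero>\<^bsub>A\<^esub>" "\<zero>\<^bsub>A\<^esub>" b] assms by simp
  then show ?thesis using pure_closed[of "\<zero>\<^bsub>A\<^esub>" b] assms T.l_cancel_one' by fastforce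
qed

lemma pure_neg_left:
  assumes "a \<in> carrier A" "b \<in> carrier B"
  shows "pure (\<ominus>\<^bsub>A\<^esub> a) b = cls (- frag_of (a, b))"
proof -
  interpret T: comm_group T by (rule comm_group_T)
  have 1: "pure (\<ominus>\<^bsub>A\<^esub> a) b \<otimes>\<^bsub>T\<^esub> pure a b = \<one>\<^bsub>T\<^esub>"
    using assms pure_add_left[of "\<ominus>\<^bsub>A\<^esub> a" a b] pure_zero_left by (simp add: A.l_neg)
  have 2: "cls (- frag_of (a, b)) \<otimes>\<^bsub>T\<^esub> pure a b = \<one>\<^bsub>T\<^esub>"
    using assms cls_add[of "- frag_of (a, b)" "frag_of (a, b)"] by (simp add: cls_0)
  have "cls (- frag_of (a, b)) \<in> carrier T" by (rule cls_closed) (use assms in simp)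
  then show ?thesis using 1 2 assms
    by (metis T.right_cancel pure_closed A.a_inv_closed)
qed

text \<open>There is no case for inverses, since the negative of a pure tensor is pure by
  \<open>pure_neg_left\<close>. The induction carries \<open>f\<close> and \<open>- f\<close>
  together, so that a difference splits into a sum.\<close>

lemma tensor_induct [consumes 1, case_names pure mult]:
  assumes z: "z \<in> carrier T"
    and pure: "\<And>a b. a \<in> carrier A \<Longrightarrow> b \<in> carrier B \<Longrightarrow> P (pure a b)"
    and mult: "\<And>x y. x \<in> carrier T \<Longrightarrow> y \<in> carrier T \<Longrightarrow> P x \<Longrightarrow> P y \<Longrightarrow> P (x \<otimes>\<^bsub>T\<^esub> y)"
  shows "P z"
proof -
  obtain f where f: "Poly_Mapping.keys f \<subseteq> carrier A \<times> carrier B" and zf: "z = cls f"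
    using z by (auto simp: carrier_T)
  from f have "P (cls f) \<and> P (cls (- f)) \<and> Poly_Mapping.keys f \<subseteq> carrier A \<times> carrier B"
  proof (induction f rule: free_Abelian_group_induct[consumes 1, case_names zero diff one])
    case zero
    have "P (cls 0)" using pure[of "\<zero>\<^bsub>A\<^esub>" "\<zero>\<^bsub>B\<^esub>"] by (simp add: pure_zero_left cls_0)
    then show ?case by simp
  next
    case (diff f g)
    then have "P (cls f \<otimes>\<^bsub>T\<^esub> cls (- g))" "P (cls (- f) \<otimes>\<^bsub>T\<^esub> cls g)"
      by (auto intro!: mult cls_closed)
    moreover have "cls f \<otimes>\<^bsub>T\<^esub> cls (- g) = cls (f - g)" "cls (- f) \<otimes>\<^bsub>T\<^esub> cls g = cls (- (f - g))"
      using diff cls_add[of f "- g"] cls_add[of "- f" g] by auto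
    moreover have "f - g \<in> carrier F" using diff by (intro F_diff) auto
    ultimately show ?case by simp
  next
    case (one p)
    then show ?case
      using pure pure_neg_left[symmetric] by (cases p) (auto simp: A.a_inv_closed)
  qed
  then show ?thesis using zf by simp
qed

lemma hom_F_induced:
  assumes H: "comm_group H" and h: "h \<in> hom F H"
    and rel: "\<And>f. f \<in> tensor_rels C A ra B la \<Longrightarrow> h f = \<one>\<^bsub>H\<^esub>"
    and fg: "f \<in> carrier F" "g - f \<in> N"
  shows "h g = h f"
proof -
  interpret H: comm_group H by fact
  interpret gh: group_hom F H h
    using h H.group_axioms by (simp add: group_hom_def group_hom_axioms_def)
  have hdiff: "h (f - g) = h f \<otimes>\<^bsub>H\<^esub> inv\<^bsub>H\<^esub> h g" if "f \<in> carrier F" "g \<in> carrier F" for f g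
    using gh.hom_mult[of f "- g"] gh.hom_inv[of g] that F_minus[of g] by simp
  have "h n = \<one>\<^bsub>H\<^esub>" if "n \<in> N" for n
    using that
  proof (induction rule: N_sub_induct)
    case (rel f) then show ?case by (rule assms(3))
  next
    case zero then show ?case using gh.hom_one by simp
  next
    case (diff f g)
    then show ?case using hdiff[of f g] by simp
  qed
  then have "h ((g - f) + f) = h f"
    using fg N_subset[of "g - f"] gh.hom_mult[of "g - f" f] gh.hom_closed[of f] by simp
  then show ?thesis by simp
qed

lemma universal:
  assumes H: "comm_group H"
    and closed: "\<And>a b. a \<in> carrier A \<Longrightarrow> b \<in> carrier B \<Longrightarrow> h a b \<in> carrier H"
    and add_l: "\<And>a a' b. a \<in> carrier A \<Longrightarrow> a' \<in> carrier A \<Longrightarrow> b \<in> carrier B \<Longrightarrow> h (a \<oplus>\<^bsub>A\<^esub> a') b = h a b \<otimes>\<^bsub>H\<^esub> h a' b"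
    and add_r: "\<And>a b b'. a \<in> carrier A \<Longrightarrow> b \<in> carrier B \<Longrightarrow> b' \<in> carrier B \<Longrightarrow> h a (b \<oplus>\<^bsub>B\<^esub> b') = h a b \<otimes>\<^bsub>H\<^esub> h a b'"
    and bal: "\<And>a c b. a \<in> carrier A \<Longrightarrow> c \<in> C \<Longrightarrow> b \<in> carrier B \<Longrightarrow> h (ra a c) b = h a (la c b)"
  obtains \<phi> where "\<phi> \<in> hom T H" "\<And>a b. a \<in> carrier A \<Longrightarrow> b \<in> carrier B \<Longrightarrow> \<phi> (pure a b) = h a b"
proof -
  interpret H: comm_group H by fact
  obtain \<psi> where \<psi>: "\<psi> \<in> hom F H" "\<And>x. x \<in> carrier A \<times> carrier B \<Longrightarrow> \<psi> (frag_of x) = (case x of (a, b) \<Rightarrow> h a b)"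
  proof (rule H.free_Abelian_group_universal[of "\<lambda>(a, b). h a b" "carrier A \<times> carrier B"])
    show "(\<lambda>(a, b). h a b) ` (carrier A \<times> carrier B) \<subseteq> carrier H" using closed by auto
  qed blast
  interpret gh: group_hom F H \<psi>
    using \<psi> H.group_axioms by (simp add: group_hom_def group_hom_axioms_def)
  have diff: "\<psi> (f - g) = \<psi> f \<otimes>\<^bsub>H\<^esub> inv\<^bsub>H\<^esub> \<psi> g" if "f \<in> carrier F" "g \<in> carrier F" for f g
    using gh.hom_mult[of f "- g"] gh.hom_inv[of g] that F_minus[of g] by simp
  have diff2: "\<psi> (f - g - g') = \<psi> f \<otimes>\<^bsub>H\<^esub> inv\<^bsub>H\<^esub> \<psi> g \<otimes>\<^bsub>H\<^esub> inv\<^bsub>H\<^esub> \<psi> g'"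
    if "f \<in> carrier F" "g \<in> carrier F" "g' \<in> carrier F" for f g g'
    using diff[of "f - g" g'] diff[of f g] that F_diff[of f g] by simp
  have rel: "\<psi> f = \<one>\<^bsub>H\<^esub>" if f: "f \<in> tensor_rels C A ra B la" for f
  proof -
    from f consider
        (1) a a' b where "f = frag_of (a \<oplus>\<^bsub>A\<^esub> a', b) - frag_of (a, b) - frag_of (a', b)"
          "a \<in> carrier A" "a' \<in> carrier A" "b \<in> carrier B"
      | (2) a b b' where "f = frag_of (a, b \<oplus>\<^bsub>B\<^esub> b') - frag_of (a, b) - frag_of (a, b')"
          "a \<in> carrier A" "b \<in> carrier B" "b' \<in> carrier B"
      | (3) a b c where "f = frag_of (ra a c, b) - frag_of (a, la c b)"
          "a \<in> carrier A" "b \<in> carrier B" "c \<in> C"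
      unfolding tensor_rels_def by blast
    then show ?thesis
    proof cases
      case 1
      have "\<psi> f = h (a \<oplus>\<^bsub>A\<^esub> a') b \<otimes>\<^bsub>H\<^esub> inv\<^bsub>H\<^esub> h a b \<otimes>\<^bsub>H\<^esub> inv\<^bsub>H\<^esub> h a' b"
        unfolding 1(1) using 1(2-) by (subst diff2) (auto simp: \<psi>(2))
      then show ?thesis using 1 closed
        by (simp add: add_l H.m_ac(2)[of "h a b"] H.m_assoc)
    next
      case 2
      have "\<psi> f = h a (b \<oplus>\<^bsub>B\<^esub> b') \<otimes>\<^bsub>H\<^esub> inv\<^bsub>H\<^esub> h a b \<otimes>\<^bsub>H\<^esub> inv\<^bsub>H\<^esub> h a b'"
        unfolding 2(1) using 2(2-) by (subst diff2) (auto simp: \<psi>(2))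
      then show ?thesis using 2 closed
        by (simp add: add_r H.m_ac(2)[of "h a b"] H.m_assoc)
    next
      case 3
      have "\<psi> f = h (ra a c) b \<otimes>\<^bsub>H\<^esub> inv\<^bsub>H\<^esub> h a (la c b)"
        unfolding 3(1) using 3(2-) by (subst diff; (intro F_of ra_closed la_closed)?; simp add: \<psi>(2) ra_closed la_closed)
      then show ?thesis using 3 closed
        by (simp add: bal la_closed)
    qed
  qed
  \<comment> \<open>The value at an arbitrary representative; by \<open>hom_F_induced\<close> the
    choice is immaterial.\<close>
  define \<phi> where "\<phi> z = \<psi> (SOME f. f \<in> carrier F \<and> cls f = z)" for z
  have \<phi>: "\<phi> (cls f) = \<psi> f" if "f \<in> carrier F" for f
  proof -
    have "\<exists>g. g \<in> carrier F \<and> cls g = cls f" using that by blast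
    then have "(SOME g. g \<in> carrier F \<and> cls g = cls f) \<in> carrier F \<and> cls (SOME g. g \<in> carrier F \<and> cls g = cls f) = cls f"
      by (rule someI_ex)
    then show ?thesis unfolding \<phi>_def
      using hom_F_induced[OF H \<psi>(1) rel] that by (auto simp: cls_eq_iff)
  qed
  show thesis
  proof (rule that[of \<phi>])
    show "\<phi> \<in> hom T H"
    proof (rule homI)
      fix x assume "x \<in> carrier T"
      then show "\<phi> x \<in> carrier H" using \<phi> gh.hom_closed by (auto simp: carrier_T simp del: carrier_free_Abelian_group_iff)
    next
      fix x y assume "x \<in> carrier T" "y \<in> carrier T"
      then obtain f g where "f \<in> carrier F" "g \<in> carrier F" "x = cls f" "y = cls g"
        by (auto simp: carrier_T simp del: carrier_free_Abelian_group_iff)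
      then show "\<phi> (x \<otimes>\<^bsub>T\<^esub> y) = \<phi> x \<otimes>\<^bsub>H\<^esub> \<phi> y"
        using \<phi> gh.hom_mult[of f g] F_add[of f g] cls_add[of f g]
        by (simp del: carrier_free_Abelian_group_iff flip: cls_add)
    qed
  next
    fix a b assume "a \<in> carrier A" "b \<in> carrier B"
    then show "\<phi> (pure a b) = h a b" using \<phi>[of "frag_of (a, b)"] \<psi>(2)[of "(a, b)"] by simp
  qed
qed

text \<open>A test for well-definedness of a map given on pairs. In its uses \<open>Q\<close> is the
  relation subgroup of the target, and only the three kinds of generating relations have to be
  checked.\<close>

lemma frag_extend_N:
  assumes "f \<in> N"
    and "\<And>a a' b. a \<in> carrier A \<Longrightarrow> a' \<in> carrier A \<Longrightarrow> b \<in> carrier B \<Longrightarrow> u (a \<oplus>\<^bsub>A\<^esub> a', b) - u (a, b) - u (a', b) \<in> Q"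
    and "\<And>a b b'. a \<in> carrier A \<Longrightarrow> b \<in> carrier B \<Longrightarrow> b' \<in> carrier B \<Longrightarrow> u (a, b \<oplus>\<^bsub>B\<^esub> b') - u (a, b) - u (a, b') \<in> Q"
    and "\<And>a b c. a \<in> carrier A \<Longrightarrow> b \<in> carrier B \<Longrightarrow> c \<in> C \<Longrightarrow> u (ra a c, b) - u (a, la c b) \<in> Q"
    and "0 \<in> Q" "\<And>f g. f \<in> Q \<Longrightarrow> g \<in> Q \<Longrightarrow> f - g \<in> Q"
  shows "frag_extend u f \<in> Q"
  using assms(1)
proof (induction rule: N_sub_induct)
  case (rel f)
  then show ?case unfolding tensor_rels_def
    by (auto simp: frag_extend_diff intro: assms(2,3,4))
qed (auto simp: frag_extend_diff intro: assms(5,6))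

end

lemma frag_cmul_diff: "frag_cmul c (a - b) = frag_cmul c a - frag_cmul c b"
  by (rule poly_mapping_eqI) (simp add: lookup_minus right_diff_distrib)

lemma frag_extend_fun_diff: "frag_extend (\<lambda>x. u x - v x) f = frag_extend u f - frag_extend v f"
  by (simp add: frag_extend_def frag_cmul_diff sum_subtractf)

lemma frag_extend_fun_0: "frag_extend (\<lambda>x. 0) f = 0"
  by (simp add: frag_extend_def)

lemma frag_extend_closed:
  assumes "f \<in> carrier (free_Abelian_group S)"
    and "\<And>x. x \<in> S \<Longrightarrow> u x \<in> carrier (free_Abelian_group S')"
  shows "frag_extend u f \<in> carrier (free_Abelian_group S')"
  using keys_frag_extend[of u f] assms unfolding carrier_free_Abelian_group_iff by blast

lemma regular_left_module:
  assumes "ring R" shows "left_module R (regular_module R)"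
proof -
  interpret R: ring R by fact
  interpret M: abelian_group "regular_module R"
    by (rule abelian_group_sub[OF R.abelian_group_axioms]) (simp_all add: regular_module_def)
  show ?thesis
    by unfold_locales (simp_all add: regular_module_def R.l_distr R.r_distr R.m_assoc)
qed

lemma regular_sel:
  "carrier (regular_module R) = carrier R" "ring.add (regular_module R) = ring.add R"
  "ring.zero (regular_module R) = ring.zero R" "smult (regular_module R) = monoid.mult R"
  by (simp_all add: regular_module_def)

lemma module_of_group_sel [simp]:
  "carrier (module_of_group G act) = carrier G" "ring.add (module_of_group G act) = monoid.mult G"
  "ring.zero (module_of_group G act) = monoid.one G" "smult (module_of_group G act) = act"
  by (simp_all add: module_of_group_def)

lemma abelian_group_of_group:
  assumes "comm_group G" shows "abelian_group (module_of_group G act)"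
proof -
  interpret comm_group G by fact
  show ?thesis
  proof (rule abelian_groupI)
    fix x assume "x \<in> carrier (module_of_group G act)"
    then show "\<exists>y\<in>carrier (module_of_group G act). y \<oplus>\<^bsub>module_of_group G act\<^esub> x = \<zero>\<^bsub>module_of_group G act\<^esub>"
      by (intro bexI[of _ "inv\<^bsub>G\<^esub> x"]) auto
  qed (auto simp: m_assoc intro: m_comm)
qed

lemma (in left_module) smult_zero: "a \<in> carrier R \<Longrightarrow> a \<odot>\<^bsub>M\<^esub> \<zero>\<^bsub>M\<^esub> = \<zero>\<^bsub>M\<^esub>"
  using smult_r_distr[of a "\<zero>\<^bsub>M\<^esub>" "\<zero>\<^bsub>M\<^esub>"] smult_closed[of a "\<zero>\<^bsub>M\<^esub>"]
    M.add.l_cancel_one'[of "a \<odot>\<^bsub>M\<^esub> \<zero>\<^bsub>M\<^esub>" "a \<odot>\<^bsub>M\<^esub> \<zero>\<^bsub>M\<^esub>"] by simp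

section \<open>Modules over two algebras and their tensor product over the field\<close>

locale scalar_modules = A: left_module R A + B: left_module S B
  for R :: "('r, 'x) ring_scheme" and S :: "('s, 'y) ring_scheme"
    and A :: "('r, 'a) module" and B :: "('s, 'b) module"
    and sR :: "'k \<Rightarrow> 'r" and sS :: "'k \<Rightarrow> 's" +
  assumes sR: "sR c \<in> carrier R" "r \<in> carrier R \<Longrightarrow> sR c \<otimes>\<^bsub>R\<^esub> r = r \<otimes>\<^bsub>R\<^esub> sR c"
    and sS: "sS c \<in> carrier S" "s \<in> carrier S \<Longrightarrow> sS c \<otimes>\<^bsub>S\<^esub> s = s \<otimes>\<^bsub>S\<^esub> sS c"
begin

lemma KA: "left_module R (regular_module R)"
  by (rule regular_left_module) (rule A.R.ring_axioms)

lemma KB: "left_module S (regular_module S)"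
  by (rule regular_left_module) (rule B.R.ring_axioms)

sublocale O: tensor_product UNIV A "\<lambda>a c. sR c \<odot>\<^bsub>A\<^esub> a" B "\<lambda>c b. sS c \<odot>\<^bsub>B\<^esub> b"
  by unfold_locales (auto intro: A.smult_closed B.smult_closed sR sS)

sublocale K: tensor_product UNIV "regular_module R" "\<lambda>a c. sR c \<odot>\<^bsub>regular_module R\<^esub> a"
  "regular_module S" "\<lambda>c b. sS c \<odot>\<^bsub>regular_module S\<^esub> b"
  unfolding tensor_product_def tensor_product_axioms_def
  using KA KB by (auto simp: left_module_def regular_sel sR sS A.R.m_closed B.R.m_closed)

abbreviation E where
  "E f g \<equiv> frag_extend (\<lambda>(r, s). frag_extend (\<lambda>(a, b). frag_of (r \<odot>\<^bsub>A\<^esub> a, s \<odot>\<^bsub>B\<^esub> b)) g) f"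

abbreviation Omod where "Omod \<equiv> outer_tensor sR sS A B"
abbreviation act where "act \<equiv> smult Omod"

lemma E_diff_left: "E (f - f') g = E f g - E f' g"
  by (rule frag_extend_diff)

lemma E_diff_right: "E f (g - g') = E f g - E f g'"
proof -
  have "E f (g - g') = frag_extend (\<lambda>x. (case x of (r, s) \<Rightarrow> frag_extend (\<lambda>(a, b). frag_of (r \<odot>\<^bsub>A\<^esub> a, s \<odot>\<^bsub>B\<^esub> b)) g) -
     (case x of (r, s) \<Rightarrow> frag_extend (\<lambda>(a, b). frag_of (r \<odot>\<^bsub>A\<^esub> a, s \<odot>\<^bsub>B\<^esub> b)) g')) f"
    by (intro frag_extend_eq) (auto simp: frag_extend_diff)
  then show ?thesis by (simp add: frag_extend_fun_diff)
qed

lemma E_closed: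
  assumes f: "f \<in> carrier K.F" and g: "g \<in> carrier O.F"
  shows "E f g \<in> carrier O.F"
proof -
  have of: "E (frag_of (r, s)) g \<in> carrier O.F" if "r \<in> carrier R" "s \<in> carrier S" for r s
  proof -
    have k: "Poly_Mapping.keys g \<subseteq> carrier A \<times> carrier B" using g by simp
    then show ?thesis
    proof (induction rule: free_Abelian_group_induct[consumes 1, case_names zero diff one])
      case (diff x y)
      then show ?case using O.F_diff by (simp add: frag_extend_diff del: carrier_free_Abelian_group_iff)
    qed (use that in \<open>auto intro!: A.smult_closed B.smult_closed\<close>)
  qed
  have k: "Poly_Mapping.keys f \<subseteq> carrier R \<times> carrier S" using f by (simp add: regular_sel)
  then show ?thesis
  proof (induction rule: free_Abelian_group_induct[consumes 1, case_names zero diff one])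
    case (diff x y)
    then show ?case using O.F_diff by (simp add: frag_extend_diff del: carrier_free_Abelian_group_iff)
  qed (use of in \<open>auto simp del: carrier_free_Abelian_group_iff\<close>, simp)
qed

text \<open>Additivity reduces this to one pair \<open>(r, s)\<close> acting. The balancing relation
  survives because scalars are central: \<open>r\<close> commutes with \<open>sR c\<close>, and
  \<open>s\<close> with \<open>sS c\<close>.\<close>

lemma E_N_right:
  assumes f: "f \<in> carrier K.F" and g: "g \<in> O.N"
  shows "E f g \<in> O.N"
proof -
  have of: "E (frag_of (r, s)) g \<in> O.N" if rs: "r \<in> carrier R" "s \<in> carrier S" for r s
  proof -
    have "frag_extend (\<lambda>(a, b). frag_of (r \<odot>\<^bsub>A\<^esub> a, s \<odot>\<^bsub>B\<^esub> b)) g \<in> O.N"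
    proof (rule O.frag_extend_N[OF g])
      fix a b c assume "a \<in> carrier A" "b \<in> carrier B" "c \<in> (UNIV :: 'k set)"
      moreover from this rs have "r \<odot>\<^bsub>A\<^esub> (sR c \<odot>\<^bsub>A\<^esub> a) = sR c \<odot>\<^bsub>A\<^esub> (r \<odot>\<^bsub>A\<^esub> a)"
        "s \<odot>\<^bsub>B\<^esub> (sS c \<odot>\<^bsub>B\<^esub> b) = sS c \<odot>\<^bsub>B\<^esub> (s \<odot>\<^bsub>B\<^esub> b)"
        using sR sS by (simp_all flip: A.smult_assoc B.smult_assoc)
      ultimately show "(case (sR c \<odot>\<^bsub>A\<^esub> a, b) of (a, b) \<Rightarrow> frag_of (r \<odot>\<^bsub>A\<^esub> a, s \<odot>\<^bsub>B\<^esub> b)) -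
          (case (a, sS c \<odot>\<^bsub>B\<^esub> b) of (a, b) \<Rightarrow> frag_of (r \<odot>\<^bsub>A\<^esub> a, s \<odot>\<^bsub>B\<^esub> b)) \<in> O.N"
        using rs by (simp add: O.N_balanced A.smult_closed B.smult_closed)
    qed (use rs in \<open>simp_all add: O.N_0 O.N_diff O.N_add_left O.N_add_right
        A.smult_closed B.smult_closed A.smult_r_distr B.smult_r_distr\<close>)
    then show ?thesis by simp
  qed
  have k: "Poly_Mapping.keys f \<subseteq> carrier R \<times> carrier S" using f by (simp add: regular_sel)
  then show ?thesis
  proof (induction rule: free_Abelian_group_induct[consumes 1, case_names zero diff one])
    case (diff x y)
    then show ?case using O.N_diff by (simp add: frag_extend_diff)
  qed (use of O.N_0 in auto)
qed

text \<open>Additivity reduces this to one pair \<open>(a, b)\<close> acted upon. By associativity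
  of the actions, a balancing relation at \<open>(r, s)\<close> becomes the one at the images of
  \<open>a\<close> under \<open>r\<close> and of \<open>b\<close> under \<open>s\<close>.\<close>

lemma E_N_left:
  assumes f: "f \<in> K.N" and g: "g \<in> carrier O.F"
  shows "E f g \<in> O.N"
proof -
  have k: "Poly_Mapping.keys g \<subseteq> carrier A \<times> carrier B" using g by simp
  then show ?thesis
  proof (induction rule: free_Abelian_group_induct[consumes 1, case_names zero diff one])
    case (diff x y)
    then show ?case using O.N_diff by (simp add: E_diff_right)
  next
    case (one p)
    obtain a b where p: "p = (a, b)" and ab: "a \<in> carrier A" "b \<in> carrier B"
      using one by auto
    have "frag_extend (\<lambda>(r, s). frag_of (r \<odot>\<^bsub>A\<^esub> a, s \<odot>\<^bsub>B\<^esub> b)) f \<in> O.N"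
    proof (rule K.frag_extend_N[OF f])
      fix r s c assume "r \<in> carrier (regular_module R)" "s \<in> carrier (regular_module S)" "c \<in> (UNIV :: 'k set)"
      then show "(case (sR c \<odot>\<^bsub>regular_module R\<^esub> r, s) of (r, s) \<Rightarrow> frag_of (r \<odot>\<^bsub>A\<^esub> a, s \<odot>\<^bsub>B\<^esub> b)) -
          (case (r, sS c \<odot>\<^bsub>regular_module S\<^esub> s) of (r, s) \<Rightarrow> frag_of (r \<odot>\<^bsub>A\<^esub> a, s \<odot>\<^bsub>B\<^esub> b)) \<in> O.N"
        using ab sR(1)[of c] sS(1)[of c] O.N_balanced[of "r \<odot>\<^bsub>A\<^esub> a" c "s \<odot>\<^bsub>B\<^esub> b"]
        by (simp add: regular_sel A.smult_closed B.smult_closed A.smult_assoc B.smult_assoc)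
    qed (use ab in \<open>simp_all add: regular_sel O.N_0 O.N_diff O.N_add_left O.N_add_right
        A.smult_closed B.smult_closed A.smult_l_distr B.smult_l_distr\<close>)
    then show ?case by (simp add: p)
  qed (use O.N_0 in \<open>auto simp: frag_extend_fun_0\<close>)
qed

text \<open>The inner union is evaluated first, and for every representative \<open>f'\<close> of
  the acting class, because \<open>E_N_left\<close> compares two such representatives at a fixed
  \<open>g\<close>.\<close>

lemma act_cls:
  assumes f: "f \<in> carrier K.F" and g: "g \<in> carrier O.F"
  shows "act (K.cls f) (O.cls g) = O.cls (E f g)"
proof -
  have inner: "(\<Union>g'\<in>O.cls g. O.cls (E f' g')) = O.cls (E f' g)" if "f' \<in> carrier K.F" for f'
    by (rule O.UN_cls, unfold O.cls_eq_iff) (use E_N_right[OF that] in \<open>simp flip: E_diff_right\<close>)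
  have "(\<Union>f'\<in>K.cls f. \<Union>g'\<in>O.cls g. O.cls (E f' g')) = (\<Union>g'\<in>O.cls g. O.cls (E f g'))"
  proof (rule K.UN_cls)
    fix f' assume f': "f' - f \<in> K.N"
    then have "O.cls (E f' g) = O.cls (E f g)"
      unfolding O.cls_eq_iff using E_N_left[OF f' g] by (simp add: E_diff_left)
    then show "(\<Union>g'\<in>O.cls g. O.cls (E f' g')) = (\<Union>g'\<in>O.cls g. O.cls (E f g'))"
      using inner[OF f] inner[OF K.rep_closed[OF f f']] by simp
  qed
  then show ?thesis using inner[OF f] by (simp add: outer_tensor_def Let_def)
qed

lemma carrier_Omod: "carrier Omod = carrier O.T"
  by (simp add: outer_tensor_def Let_def)

lemma add_Omod: "ring.add Omod = monoid.mult O.T"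
  by (simp add: outer_tensor_def Let_def)

lemma abelian_group_Omod: "abelian_group Omod"
  unfolding outer_tensor_def Let_def by (rule abelian_group_of_group[OF O.comm_group_T])

lemma act_pure:
  assumes "r \<in> carrier R" "s \<in> carrier S" "a \<in> carrier A" "b \<in> carrier B"
  shows "act (K.pure r s) (O.pure a b) = O.pure (r \<odot>\<^bsub>A\<^esub> a) (s \<odot>\<^bsub>B\<^esub> b)"
  using assms by (subst act_cls) (auto simp: regular_sel)

lemma act_closed: "t \<in> carrier K.T \<Longrightarrow> z \<in> carrier O.T \<Longrightarrow> act t z \<in> carrier O.T"
  unfolding K.carrier_T O.carrier_T
  by (auto simp: act_cls simp del: carrier_free_Abelian_group_iff intro!: E_closed)

lemma act_mult_left:
  assumes "t \<in> carrier K.T" "t' \<in> carrier K.T" "z \<in> carrier O.T"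
  shows "act (t \<otimes>\<^bsub>K.T\<^esub> t') z = act t z \<otimes>\<^bsub>O.T\<^esub> act t' z"
proof -
  obtain f f' g where f: "f \<in> carrier K.F" "f' \<in> carrier K.F" "g \<in> carrier O.F"
    "t = K.cls f" "t' = K.cls f'" "z = O.cls g"
    using assms by (auto simp: K.carrier_T O.carrier_T simp del: carrier_free_Abelian_group_iff)
  show ?thesis
    using f K.F_add[OF f(1,2)] E_closed
    by (simp add: act_cls frag_extend_add del: carrier_free_Abelian_group_iff flip: K.cls_add O.cls_add)
qed

lemma E_add_right: "E f (g + g') = E f g + E f g'"
  using E_diff_right[of "g + g'" g' f] by simp

lemma act_mult_right:
  assumes "t \<in> carrier K.T" "z \<in> carrier O.T" "z' \<in> carrier O.T"
  shows "act t (z \<otimes>\<^bsub>O.T\<^esub> z') = act t z \<otimes>\<^bsub>O.T\<^esub> act t z'"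
proof -
  obtain f g' g where f: "f \<in> carrier K.F" "g' \<in> carrier O.F" "g \<in> carrier O.F"
    "t = K.cls f" "z' = O.cls g'" "z = O.cls g"
    using assms by (auto simp: K.carrier_T O.carrier_T simp del: carrier_free_Abelian_group_iff)
  show ?thesis
    using f O.F_add[OF f(3,2)] E_closed
    by (simp add: act_cls E_add_right del: carrier_free_Abelian_group_iff flip: O.cls_add)
qed

end

section \<open>The convolution product over abstract rings\<close>

locale convolution = scalar_modules R S A B sR sS + W: ring W
  for R :: "('r, 'x) ring_scheme" and S :: "('s, 'y) ring_scheme"
    and A :: "('r, 'a) module" and B :: "('s, 'b) module"
    and sR :: "'k \<Rightarrow> 'r" and sS :: "'k \<Rightarrow> 's" and W :: "('w set, 'z) ring_scheme" +
  fixes pe :: "'r \<times> 's \<Rightarrow> 'w set" and e :: "'w set"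
  assumes e_closed: "e \<in> carrier W" and e_idem: "e \<otimes>\<^bsub>W\<^esub> e = e"
    and pe_closed: "r \<in> carrier R \<Longrightarrow> s \<in> carrier S \<Longrightarrow> pe (r, s) \<in> carrier W"
    and pe_e: "r \<in> carrier R \<Longrightarrow> s \<in> carrier S \<Longrightarrow> pe (r, s) \<otimes>\<^bsub>W\<^esub> e = pe (r, s)"
    and pe_add_left: "r \<in> carrier R \<Longrightarrow> r' \<in> carrier R \<Longrightarrow> s \<in> carrier S \<Longrightarrow>
      pe (r \<oplus>\<^bsub>R\<^esub> r', s) = pe (r, s) \<oplus>\<^bsub>W\<^esub> pe (r', s)"
    and pe_add_right: "r \<in> carrier R \<Longrightarrow> s \<in> carrier S \<Longrightarrow> s' \<in> carrier S \<Longrightarrow>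
      pe (r, s \<oplus>\<^bsub>S\<^esub> s') = pe (r, s) \<oplus>\<^bsub>W\<^esub> pe (r, s')"
    and pe_balanced: "r \<in> carrier R \<Longrightarrow> s \<in> carrier S \<Longrightarrow> pe (sR c \<otimes>\<^bsub>R\<^esub> r, s) = pe (r, sS c \<otimes>\<^bsub>S\<^esub> s)"
begin

abbreviation "embsum h \<equiv> \<Oplus>\<^bsub>W\<^esub>rs\<in>Poly_Mapping.keys h. [Poly_Mapping.lookup h rs] \<cdot>\<^bsub>W\<^esub> pe rs"

text \<open>\<open>embsum\<close> is the sum by which \<open>tensor_emb\<close> is defined. It is
  shown to agree with the homomorphism \<open>\<psi>\<close> supplied by the universal property of
  the free abelian group and so inherits its additivity.\<close>

lemma embsum_hom: "embsum \<in> hom K.F (add_monoid W)"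
  and embsum_of: "r \<in> carrier R \<Longrightarrow> s \<in> carrier S \<Longrightarrow> embsum (frag_of (r, s)) = pe (r, s)"
proof -
  obtain \<psi> where \<psi>: "\<psi> \<in> hom (free_Abelian_group (carrier R \<times> carrier S)) (add_monoid W)"
      "\<And>x. x \<in> carrier R \<times> carrier S \<Longrightarrow> \<psi> (frag_of x) = pe x"
  proof (rule comm_group.free_Abelian_group_universal[OF W.a_comm_group, of pe "carrier R \<times> carrier S"])
    show "pe ` (carrier R \<times> carrier S) \<subseteq> carrier (add_monoid W)" using pe_closed by auto
  qed blast
  interpret gh: group_hom "free_Abelian_group (carrier R \<times> carrier S)" "add_monoid W" \<psi>
    using \<psi> W.a_group by (simp add: group_hom_def group_hom_axioms_def)
  have pe': "pe x \<in> carrier W" if "x \<in> carrier R \<times> carrier S" for x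
    using that pe_closed by auto
  have cl: "[n] \<cdot>\<^bsub>W\<^esub> pe x \<in> carrier W" if "x \<in> carrier R \<times> carrier S" for x and n :: int
    using W.add.int_pow_closed[OF pe'[OF that]] by (simp add: add_pow_def)
  have one: "\<psi> (frag_cmul n (frag_of x)) = [n] \<cdot>\<^bsub>W\<^esub> pe x" if "x \<in> carrier R \<times> carrier S" for n x
    using gh.hom_int_pow[of "frag_of x" n] that \<psi>(2)[OF that]
    by (simp add: add_pow_def)
  have fin: "\<psi> (\<Sum>x\<in>X'. frag_cmul (n x) (frag_of x)) = (\<Oplus>\<^bsub>W\<^esub>x\<in>X'. [n x] \<cdot>\<^bsub>W\<^esub> pe x)"
    if "finite X'" "X' \<subseteq> carrier R \<times> carrier S" for X' n
    using that
  proof (induction X' rule: finite_induct)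
    case empty
    then show ?case using gh.hom_one by (simp add: W.finsum_empty)
  next
    case (insert x X')
    have k: "Poly_Mapping.keys (\<Sum>x\<in>X'. frag_cmul (n x) (frag_of x)) \<subseteq> carrier R \<times> carrier S"
      unfolding carrier_free_Abelian_group_iff[symmetric]
      by (rule sum_closed_free_Abelian_group) (use insert in auto)
    have "\<psi> (\<Sum>x\<in>insert x X'. frag_cmul (n x) (frag_of x)) =
        \<psi> (frag_cmul (n x) (frag_of x)) \<oplus>\<^bsub>W\<^esub> \<psi> (\<Sum>x\<in>X'. frag_cmul (n x) (frag_of x))"
    proof -
      have x: "frag_cmul (n x) (frag_of x) \<in> carrier (free_Abelian_group (carrier R \<times> carrier S))"
        using insert(4) keys_cmul[of "n x" "frag_of x"] by auto
      show ?thesis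
        using gh.hom_mult[OF x k[folded carrier_free_Abelian_group_iff]] insert(1,2) by simp
    qed
    also have "\<dots> = (\<Oplus>\<^bsub>W\<^esub>x\<in>insert x X'. [n x] \<cdot>\<^bsub>W\<^esub> pe x)"
      using insert cl by (subst W.finsum_insert) (auto simp: one)
    finally show ?case .
  qed
  have eq: "\<psi> f = embsum f" if "f \<in> carrier K.F" for f
  proof -
    have "f = (\<Sum>x\<in>Poly_Mapping.keys f. frag_cmul (Poly_Mapping.lookup f x) (frag_of x))"
      using frag_expansion[of f] by (simp add: frag_extend_def)
    then show ?thesis
      using fin[of "Poly_Mapping.keys f" "Poly_Mapping.lookup f"] that by (simp add: regular_sel)
  qed
  have "\<psi> \<in> hom K.F (add_monoid W)" using \<psi>(1) by (simp add: regular_sel)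
  then show "embsum \<in> hom K.F (add_monoid W)" using eq K.F_add
    by (auto simp: hom_def Pi_iff simp del: carrier_free_Abelian_group_iff)
  show "embsum (frag_of (r, s)) = pe (r, s)" if "r \<in> carrier R" "s \<in> carrier S"
    by (rule trans[OF eq[symmetric] \<psi>(2)]) (use that in \<open>simp_all add: regular_sel\<close>)
qed

lemma embsum_rel:
  assumes f: "f \<in> carrier K.F" "g - f \<in> K.N"
  shows "embsum g = embsum f"
proof (rule K.hom_F_induced[OF W.a_comm_group embsum_hom _ f])
  interpret gh: group_hom K.F "add_monoid W" embsum
    using embsum_hom W.a_group by (simp add: group_hom_def group_hom_axioms_def)
  have diff: "embsum (f - g) = embsum f \<ominus>\<^bsub>W\<^esub> embsum g" if "f \<in> carrier K.F" "g \<in> carrier K.F" for f g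
    using gh.hom_mult[of f "- g"] gh.hom_inv[of g] that K.F_minus[of g]
    by (simp add: a_minus_def a_inv_def)
  fix f assume f: "f \<in> tensor_rels UNIV (regular_module R) (\<lambda>a c. sR c \<odot>\<^bsub>regular_module R\<^esub> a)
      (regular_module S) (\<lambda>c b. sS c \<odot>\<^bsub>regular_module S\<^esub> b)"
  have of: "frag_of (r, s) \<in> carrier K.F" if "r \<in> carrier R" "s \<in> carrier S" for r s
    using that by (simp add: regular_sel)
  from f consider
      (1) a a' b where "f = frag_of (a \<oplus>\<^bsub>R\<^esub> a', b) - frag_of (a, b) - frag_of (a', b)"
        "a \<in> carrier R" "a' \<in> carrier R" "b \<in> carrier S"
    | (2) a b b' where "f = frag_of (a, b \<oplus>\<^bsub>S\<^esub> b') - frag_of (a, b) - frag_of (a, b')"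
        "a \<in> carrier R" "b \<in> carrier S" "b' \<in> carrier S"
    | (3) a b c where "f = frag_of (sR c \<otimes>\<^bsub>R\<^esub> a, b) - frag_of (a, sS c \<otimes>\<^bsub>S\<^esub> b)"
        "a \<in> carrier R" "b \<in> carrier S"
    unfolding tensor_rels_def regular_sel by blast
  then have "embsum f = \<zero>\<^bsub>W\<^esub>"
  proof cases
    case 1
    have "embsum f = (pe (a, b) \<oplus>\<^bsub>W\<^esub> pe (a', b)) \<ominus>\<^bsub>W\<^esub> pe (a, b) \<ominus>\<^bsub>W\<^esub> pe (a', b)"
      unfolding 1(1) using 1(2-) pe_add_left[of a a' b]
      by (simp only: diff of K.F_diff embsum_of A.R.a_closed)
    then show ?thesis using 1 pe_closed by (simp add: a_minus_def W.a_ac W.r_neg W.r_neg1)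
  next
    case 2
    have "embsum f = (pe (a, b) \<oplus>\<^bsub>W\<^esub> pe (a, b')) \<ominus>\<^bsub>W\<^esub> pe (a, b) \<ominus>\<^bsub>W\<^esub> pe (a, b')"
      unfolding 2(1) using 2(2-) pe_add_right[of a b b']
      by (simp only: diff of K.F_diff embsum_of B.R.a_closed)
    then show ?thesis using 2 pe_closed by (simp add: a_minus_def W.a_ac W.r_neg W.r_neg1)
  next
    case 3
    have "embsum f = pe (a, sS c \<otimes>\<^bsub>S\<^esub> b) \<ominus>\<^bsub>W\<^esub> pe (a, sS c \<otimes>\<^bsub>S\<^esub> b)"
      unfolding 3(1) using 3(2-) pe_balanced[of a b c] sR(1)[of c] sS(1)[of c]
      by (simp only: diff of embsum_of A.R.m_closed B.R.m_closed)
    then show ?thesis using 3 pe_closed sS(1)[of c] by (simp add: a_minus_def W.r_neg)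
  qed
  then show "embsum f = \<one>\<^bsub>add_monoid W\<^esub>" by simp
qed

abbreviation temb where "temb t \<equiv> \<Union>h\<in>t. embsum h"

lemma temb_cls: "f \<in> carrier K.F \<Longrightarrow> temb (K.cls f) = embsum f"
  by (rule K.UN_cls) (rule embsum_rel)

lemma temb_pure: "r \<in> carrier R \<Longrightarrow> s \<in> carrier S \<Longrightarrow> temb (K.pure r s) = pe (r, s)"
  by (rule trans[OF temb_cls embsum_of]) (simp_all add: regular_sel)

lemma temb_hom: "temb \<in> hom K.T (add_monoid W)"
proof (rule homI)
  fix x assume "x \<in> carrier K.T"
  then show "temb x \<in> carrier (add_monoid W)"
    using hom_in_carrier[OF embsum_hom]
    by (auto simp: K.carrier_T temb_cls simp del: carrier_free_Abelian_group_iff)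
next
  fix x y assume "x \<in> carrier K.T" "y \<in> carrier K.T"
  then obtain f g where "f \<in> carrier K.F" "g \<in> carrier K.F" "x = K.cls f" "y = K.cls g"
    by (auto simp: K.carrier_T simp del: carrier_free_Abelian_group_iff)
  then show "temb (x \<otimes>\<^bsub>K.T\<^esub> y) = temb x \<otimes>\<^bsub>add_monoid W\<^esub> temb y"
    using hom_mult[OF embsum_hom, of f g] K.F_add[of f g]
    by (simp add: temb_cls del: carrier_free_Abelian_group_iff flip: K.cls_add)
qed

lemma temb_closed: "t \<in> carrier K.T \<Longrightarrow> temb t \<in> carrier W"
  using hom_in_carrier[OF temb_hom] by simp

lemma temb_add: "t \<in> carrier K.T \<Longrightarrow> t' \<in> carrier K.T \<Longrightarrow> temb (t \<otimes>\<^bsub>K.T\<^esub> t') = temb t \<oplus>\<^bsub>W\<^esub> temb t'"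
  using hom_mult[OF temb_hom] by simp

lemma temb_e: "t \<in> carrier K.T \<Longrightarrow> temb t \<otimes>\<^bsub>W\<^esub> e = temb t"
proof (induction rule: K.tensor_induct)
  case (pure r s)
  then have "r \<in> carrier R" "s \<in> carrier S" by (simp_all add: regular_sel)
  then show ?case by (simp only: temb_pure pe_e)
next
  case (mult x y)
  then show ?case by (simp only: temb_add temb_closed W.l_distr e_closed)
qed

abbreviation Wid where
  "Wid \<equiv> (regular_module W)\<lparr>carrier := (\<lambda>w. w \<otimes>\<^bsub>W\<^esub> e) ` carrier W\<rparr>"

text \<open>A left ideal generated by an idempotent consists of the elements fixed by right
  multiplication with it, so membership becomes an equation to rewrite with.\<close>

lemma Wid_iff: "w \<in> carrier Wid \<longleftrightarrow> w \<in> carrier W \<and> w \<otimes>\<^bsub>W\<^esub> e = w"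
  using e_closed e_idem by (auto simp: W.m_assoc intro!: image_eqI[of w _ w])

lemma Wid_sel: "ring.add Wid = ring.add W" "ring.zero Wid = ring.zero W"
  by (simp_all add: regular_sel)

lemma abelian_group_Wid: "abelian_group Wid"
proof (rule abelian_group_sub[OF W.abelian_group_axioms])
  show "\<zero>\<^bsub>W\<^esub> \<in> carrier Wid" using e_closed by (simp only: Wid_iff) simp
  show "x \<oplus>\<^bsub>W\<^esub> y \<in> carrier Wid" if "x \<in> carrier Wid" "y \<in> carrier Wid" for x y
    using that e_closed by (simp only: Wid_iff W.l_distr W.a_closed)
  show "\<ominus>\<^bsub>W\<^esub> x \<in> carrier Wid" if "x \<in> carrier Wid" for x
    using that e_closed by (simp only: Wid_iff W.l_minus W.a_inv_closed)
qed (use e_closed in \<open>auto simp: regular_sel\<close>)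

abbreviation rmul where "rmul \<equiv> \<lambda>w t. w \<otimes>\<^bsub>W\<^esub> temb t"

sublocale CV: tensor_product "carrier K.T" Wid rmul Omod act
proof -
  interpret abelian_group Omod by (rule abelian_group_Omod)
  interpret I: abelian_group Wid by (rule abelian_group_Wid)
  show "tensor_product (carrier K.T) Wid rmul Omod act"
  proof unfold_locales
    show "rmul w t \<in> carrier Wid" if "w \<in> carrier Wid" "t \<in> carrier K.T" for w t
      using that e_closed by (simp only: Wid_iff) (simp add: W.m_assoc temb_closed temb_e)
    show "act c b \<in> carrier Omod" if "c \<in> carrier K.T" "b \<in> carrier Omod" for c b
      using that act_closed by (simp add: carrier_Omod)
  qed
qed

definition conv_mod where
  "conv_mod = module_of_group CV.T (\<lambda>w z. \<Union>f\<in>z. CV.cls (frag_extend (\<lambda>(x, y). frag_of (w \<otimes>\<^bsub>W\<^esub> x, y)) f))"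

definition tens where "tens w m n = CV.pure w (O.pure m n)"

lemma carrier_conv: "carrier conv_mod = carrier CV.T"
  and add_conv: "ring.add conv_mod = monoid.mult CV.T"
  by (simp_all add: conv_mod_def)

lemma abelian_group_conv: "abelian_group conv_mod"
  unfolding conv_mod_def by (rule abelian_group_of_group[OF CV.comm_group_T])

lemma smult_cls:
  assumes a: "a \<in> carrier W" and f: "f \<in> carrier CV.F"
  shows "a \<odot>\<^bsub>conv_mod\<^esub> CV.cls f = CV.cls (frag_extend (\<lambda>(x, y). frag_of (a \<otimes>\<^bsub>W\<^esub> x, y)) f)"
proof -
  have "frag_extend (\<lambda>(x, y). frag_of (a \<otimes>\<^bsub>W\<^esub> x, y)) f \<in> CV.N" if "f \<in> CV.N" for f
    using that
  proof (rule CV.frag_extend_N)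
    have cl: "a \<otimes>\<^bsub>W\<^esub> w \<in> carrier Wid" if "w \<in> carrier Wid" for w
      using that a e_closed unfolding Wid_iff by (simp add: W.m_assoc)
    {
      fix w w' b assume w: "w \<in> carrier Wid" "w' \<in> carrier Wid" "b \<in> carrier Omod"
      have d: "a \<otimes>\<^bsub>W\<^esub> (w \<oplus>\<^bsub>W\<^esub> w') = a \<otimes>\<^bsub>W\<^esub> w \<oplus>\<^bsub>W\<^esub> a \<otimes>\<^bsub>W\<^esub> w'"
        using w a unfolding Wid_iff by (simp add: W.r_distr)
      show "(case (w \<oplus>\<^bsub>Wid\<^esub> w', b) of (x, y) \<Rightarrow> frag_of (a \<otimes>\<^bsub>W\<^esub> x, y)) - (case (w, b) of (x, y) \<Rightarrow> frag_of (a \<otimes>\<^bsub>W\<^esub> x, y)) -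
          (case (w', b) of (x, y) \<Rightarrow> frag_of (a \<otimes>\<^bsub>W\<^esub> x, y)) \<in> CV.N"
        using CV.N_add_left[OF cl[OF w(1)] cl[OF w(2)] w(3)] unfolding Wid_sel by (simp only: prod.case d)
    next
      fix w b b' assume w: "w \<in> carrier Wid" "b \<in> carrier Omod" "b' \<in> carrier Omod"
      show "(case (w, b \<oplus>\<^bsub>Omod\<^esub> b') of (x, y) \<Rightarrow> frag_of (a \<otimes>\<^bsub>W\<^esub> x, y)) - (case (w, b) of (x, y) \<Rightarrow> frag_of (a \<otimes>\<^bsub>W\<^esub> x, y)) -
          (case (w, b') of (x, y) \<Rightarrow> frag_of (a \<otimes>\<^bsub>W\<^esub> x, y)) \<in> CV.N"
        using CV.N_add_right[OF cl[OF w(1)] w(2,3)] by (simp only: prod.case)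
    next
      fix w b t assume w: "w \<in> carrier Wid" "b \<in> carrier Omod" "t \<in> carrier K.T"
      have d: "a \<otimes>\<^bsub>W\<^esub> (w \<otimes>\<^bsub>W\<^esub> temb t) = a \<otimes>\<^bsub>W\<^esub> w \<otimes>\<^bsub>W\<^esub> temb t"
        using w a temb_closed[OF w(3)] unfolding Wid_iff by (simp add: W.m_assoc)
      show "(case (rmul w t, b) of (x, y) \<Rightarrow> frag_of (a \<otimes>\<^bsub>W\<^esub> x, y)) -
          (case (w, act t b) of (x, y) \<Rightarrow> frag_of (a \<otimes>\<^bsub>W\<^esub> x, y)) \<in> CV.N"
        using CV.N_balanced[OF cl[OF w(1)] w(3,2)] by (simp only: prod.case d)
    }
  qed (rule CV.N_0, erule (1) CV.N_diff)
  then show ?thesis unfolding conv_mod_def module_of_group_sel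
    by (intro CV.UN_cls) (simp add: CV.cls_eq_iff flip: frag_extend_diff)
qed

lemma smult_hom:
  assumes a: "a \<in> carrier W"
  shows "(\<lambda>z. a \<odot>\<^bsub>conv_mod\<^esub> z) \<in> hom CV.T CV.T"
proof -
  have cl: "frag_extend (\<lambda>(x, y). frag_of (a \<otimes>\<^bsub>W\<^esub> x, y)) f \<in> carrier CV.F" if "f \<in> carrier CV.F" for f
  proof -
    have wcl: "a \<otimes>\<^bsub>W\<^esub> w \<in> carrier Wid" if "w \<in> carrier Wid" for w
      using that a e_closed unfolding Wid_iff by (simp add: W.m_assoc)
    have "(case p of (x, y) \<Rightarrow> frag_of (a \<otimes>\<^bsub>W\<^esub> x, y)) \<in> carrier CV.F" if pin: "p \<in> carrier Wid \<times> carrier Omod" for p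
    proof -
      obtain w y where p: "p = (w, y)" "w \<in> carrier Wid" "y \<in> carrier Omod" by (rule SigmaE[OF pin])
      show ?thesis unfolding p(1) prod.case by (rule CV.F_of[OF wcl[OF p(2)] p(3)])
    qed
    then show ?thesis by (rule frag_extend_closed[OF that])
  qed
  show ?thesis
  proof (rule homI)
    fix x assume "x \<in> carrier CV.T"
    then obtain f where f: "f \<in> carrier CV.F" "x = CV.cls f" unfolding CV.carrier_T by blast
    show "a \<odot>\<^bsub>conv_mod\<^esub> x \<in> carrier CV.T"
      unfolding f(2) smult_cls[OF a f(1)] by (rule CV.cls_closed[OF cl[OF f(1)]])
  next
    fix x y assume "x \<in> carrier CV.T" "y \<in> carrier CV.T"
    then obtain f g where fg: "f \<in> carrier CV.F" "x = CV.cls f" "g \<in> carrier CV.F" "y = CV.cls g" unfolding CV.carrier_T by blast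
    show "a \<odot>\<^bsub>conv_mod\<^esub> (x \<otimes>\<^bsub>CV.T\<^esub> y) = (a \<odot>\<^bsub>conv_mod\<^esub> x) \<otimes>\<^bsub>CV.T\<^esub> (a \<odot>\<^bsub>conv_mod\<^esub> y)"
      unfolding fg(2,4) smult_cls[OF a fg(1)] smult_cls[OF a fg(3)] CV.cls_add[OF fg(1,3), symmetric]
        smult_cls[OF a CV.F_add[OF fg(1,3)]] CV.cls_add[OF cl[OF fg(1)] cl[OF fg(3)], symmetric] frag_extend_add ..
  qed
qed

lemma tens_closed:
  assumes "w \<in> carrier Wid" "m \<in> carrier A" "n \<in> carrier B"
  shows "tens w m n \<in> carrier conv_mod"
  unfolding tens_def carrier_conv
  by (intro CV.pure_closed) (use assms O.pure_closed in \<open>simp_all only: carrier_Omod\<close>)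

lemma smult_tens:
  assumes "a \<in> carrier W" "w \<in> carrier Wid" "m \<in> carrier A" "n \<in> carrier B"
  shows "a \<odot>\<^bsub>conv_mod\<^esub> tens w m n = tens (a \<otimes>\<^bsub>W\<^esub> w) m n"
proof -
  have "O.pure m n \<in> carrier Omod" unfolding carrier_Omod by (rule O.pure_closed[OF assms(3,4)])
  then show ?thesis unfolding tens_def
    by (subst smult_cls[OF assms(1) CV.F_of[OF assms(2)]]) (simp_all only: frag_extend_of prod.case)
qed

lemma tens_add1:
  assumes "w \<in> carrier Wid" "w' \<in> carrier Wid" "m \<in> carrier A" "n \<in> carrier B"
  shows "tens (w \<oplus>\<^bsub>W\<^esub> w') m n = tens w m n \<oplus>\<^bsub>conv_mod\<^esub> tens w' m n"
  unfolding tens_def add_conv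
  using CV.pure_add_left[OF assms(1,2), of "O.pure m n"] assms O.pure_closed
  by (simp only: Wid_sel carrier_Omod)

lemma tens_add2:
  assumes "w \<in> carrier Wid" "m \<in> carrier A" "m' \<in> carrier A" "n \<in> carrier B"
  shows "tens w (m \<oplus>\<^bsub>A\<^esub> m') n = tens w m n \<oplus>\<^bsub>conv_mod\<^esub> tens w m' n"
  unfolding tens_def add_conv O.pure_add_left[OF assms(2-4)]
  using CV.pure_add_right[OF assms(1), of "O.pure m n" "O.pure m' n"] assms O.pure_closed
  by (simp only: add_Omod carrier_Omod)

lemma tens_add3:
  assumes "w \<in> carrier Wid" "m \<in> carrier A" "n \<in> carrier B" "n' \<in> carrier B"
  shows "tens w m (n \<oplus>\<^bsub>B\<^esub> n') = tens w m n \<oplus>\<^bsub>conv_mod\<^esub> tens w m n'"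
  unfolding tens_def add_conv O.pure_add_right[OF assms(2-4)]
  using CV.pure_add_right[OF assms(1), of "O.pure m n" "O.pure m n'"] assms O.pure_closed
  by (simp only: add_Omod carrier_Omod)

lemma tens_balanced:
  assumes "w \<in> carrier Wid" "m \<in> carrier A" "n \<in> carrier B" "r \<in> carrier R" "s \<in> carrier S"
  shows "tens (w \<otimes>\<^bsub>W\<^esub> pe (r, s)) m n = tens w (r \<odot>\<^bsub>A\<^esub> m) (s \<odot>\<^bsub>B\<^esub> n)"
proof -
  have "CV.pure (rmul w (K.pure r s)) (O.pure m n) = CV.pure w (act (K.pure r s) (O.pure m n))"
    by (rule CV.pure_balanced[OF assms(1)])
      (use assms O.pure_closed K.pure_closed in \<open>simp_all only: carrier_Omod regular_sel\<close>)
  then show ?thesis using assms by (simp only: tens_def temb_pure act_pure)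
qed

lemma conv_induct [consumes 1, case_names tens add]:
  assumes z: "z \<in> carrier conv_mod"
    and tens: "\<And>w m n. w \<in> carrier Wid \<Longrightarrow> m \<in> carrier A \<Longrightarrow> n \<in> carrier B \<Longrightarrow> P (tens w m n)"
    and add: "\<And>x y. x \<in> carrier conv_mod \<Longrightarrow> y \<in> carrier conv_mod \<Longrightarrow> P x \<Longrightarrow> P y \<Longrightarrow> P (x \<oplus>\<^bsub>conv_mod\<^esub> y)"
  shows "P z"
  using z unfolding carrier_conv
proof (induction rule: CV.tensor_induct)
  case (pure w y)
  from pure(2) show ?case unfolding carrier_Omod
  proof (induction rule: O.tensor_induct)
    case (pure m n)
    then show ?case using tens[OF \<open>w \<in> carrier Wid\<close>] by (simp add: tens_def)
  next
    case (mult x y)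
    then show ?case
      using CV.pure_add_right[OF \<open>w \<in> carrier Wid\<close>, of x y] add CV.pure_closed[OF \<open>w \<in> carrier Wid\<close>]
      by (simp add: carrier_Omod add_Omod carrier_conv add_conv)
  qed
next
  case (mult x y)
  then show ?case using add by (simp add: carrier_conv add_conv)
qed

lemma left_module_conv: "left_module W conv_mod"
proof -
  interpret M: abelian_group conv_mod by (rule abelian_group_conv)
  have cl: "a \<odot>\<^bsub>conv_mod\<^esub> x \<in> carrier conv_mod" if "a \<in> carrier W" "x \<in> carrier conv_mod" for a x
    using hom_in_carrier[OF smult_hom[OF that(1)]] that by (simp add: carrier_conv)
  have sadd: "a \<odot>\<^bsub>conv_mod\<^esub> (x \<oplus>\<^bsub>conv_mod\<^esub> y) = a \<odot>\<^bsub>conv_mod\<^esub> x \<oplus>\<^bsub>conv_mod\<^esub> a \<odot>\<^bsub>conv_mod\<^esub> y"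
    if "a \<in> carrier W" "x \<in> carrier conv_mod" "y \<in> carrier conv_mod" for a x y
    using hom_mult[OF smult_hom[OF that(1)]] that by (simp add: carrier_conv add_conv)
  have Wcl: "a \<otimes>\<^bsub>W\<^esub> w \<in> carrier Wid" if "w \<in> carrier Wid" "a \<in> carrier W" for a w
    using that e_closed unfolding Wid_iff by (simp add: W.m_assoc)
  show ?thesis
  proof unfold_locales
    fix a b x assume a: "a \<in> carrier W" and b: "b \<in> carrier W" and x: "x \<in> carrier conv_mod"
    from x show "(a \<oplus>\<^bsub>W\<^esub> b) \<odot>\<^bsub>conv_mod\<^esub> x = a \<odot>\<^bsub>conv_mod\<^esub> x \<oplus>\<^bsub>conv_mod\<^esub> b \<odot>\<^bsub>conv_mod\<^esub> x"
    proof (induction rule: conv_induct)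
      case (tens w m n)
      moreover have "w \<in> carrier W" using tens(1) unfolding Wid_iff by blast
      ultimately show ?case using a b
        by (simp only: smult_tens W.a_closed W.l_distr tens_add1 Wcl)
    next
      case (add x y)
      then show ?case using a b cl
        by (simp add: sadd M.a_ac)
    qed
    from x show "(a \<otimes>\<^bsub>W\<^esub> b) \<odot>\<^bsub>conv_mod\<^esub> x = a \<odot>\<^bsub>conv_mod\<^esub> (b \<odot>\<^bsub>conv_mod\<^esub> x)"
    proof (induction rule: conv_induct)
      case (tens w m n)
      moreover have "w \<in> carrier W" using tens(1) unfolding Wid_iff by blast
      ultimately show ?case using a b
        by (simp only: smult_tens W.m_closed W.m_assoc Wcl)
    next
      case (add x y)
      then show ?case using a b cl
        by (simp add: sadd)
    qed
  next
    fix x assume x: "x \<in> carrier conv_mod"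
    then show "\<one>\<^bsub>W\<^esub> \<odot>\<^bsub>conv_mod\<^esub> x = x"
    proof (induction rule: conv_induct)
      case (tens w m n)
      moreover have "w \<in> carrier W" using tens(1) unfolding Wid_iff by blast
      ultimately show ?case by (simp only: smult_tens W.one_closed W.l_one)
    next
      case (add x y)
      then show ?case by (simp add: sadd)
    qed
  qed (use cl sadd in auto)
qed

text \<open>The universal property of the tensor product is used twice: for fixed \<open>w\<close>
  on the inner tensor product, then in \<open>w\<close>. Balancing is asked only for pairs
  \<open>(r, s)\<close>, which includes linearity over the field as a special case.\<close>

lemma conv_universal:
  assumes Y: "abelian_group Y"
    and closed: "\<And>w m n. w \<in> carrier Wid \<Longrightarrow> m \<in> carrier A \<Longrightarrow> n \<in> carrier B \<Longrightarrow> h w m n \<in> carrier Y"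
    and add1: "\<And>w w' m n. w \<in> carrier Wid \<Longrightarrow> w' \<in> carrier Wid \<Longrightarrow> m \<in> carrier A \<Longrightarrow> n \<in> carrier B \<Longrightarrow>
      h (w \<oplus>\<^bsub>W\<^esub> w') m n = h w m n \<oplus>\<^bsub>Y\<^esub> h w' m n"
    and add2: "\<And>w m m' n. w \<in> carrier Wid \<Longrightarrow> m \<in> carrier A \<Longrightarrow> m' \<in> carrier A \<Longrightarrow> n \<in> carrier B \<Longrightarrow>
      h w (m \<oplus>\<^bsub>A\<^esub> m') n = h w m n \<oplus>\<^bsub>Y\<^esub> h w m' n"
    and add3: "\<And>w m n n'. w \<in> carrier Wid \<Longrightarrow> m \<in> carrier A \<Longrightarrow> n \<in> carrier B \<Longrightarrow> n' \<in> carrier B \<Longrightarrow>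
      h w m (n \<oplus>\<^bsub>B\<^esub> n') = h w m n \<oplus>\<^bsub>Y\<^esub> h w m n'"
    and bal: "\<And>w m n r s. w \<in> carrier Wid \<Longrightarrow> m \<in> carrier A \<Longrightarrow> n \<in> carrier B \<Longrightarrow> r \<in> carrier R \<Longrightarrow> s \<in> carrier S \<Longrightarrow>
      h (w \<otimes>\<^bsub>W\<^esub> pe (r, s)) m n = h w (r \<odot>\<^bsub>A\<^esub> m) (s \<odot>\<^bsub>B\<^esub> n)"
  obtains \<phi> where "\<And>x. x \<in> carrier conv_mod \<Longrightarrow> \<phi> x \<in> carrier Y"
    "\<And>x y. x \<in> carrier conv_mod \<Longrightarrow> y \<in> carrier conv_mod \<Longrightarrow> \<phi> (x \<oplus>\<^bsub>conv_mod\<^esub> y) = \<phi> x \<oplus>\<^bsub>Y\<^esub> \<phi> y"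
    "\<And>w m n. w \<in> carrier Wid \<Longrightarrow> m \<in> carrier A \<Longrightarrow> n \<in> carrier B \<Longrightarrow> \<phi> (tens w m n) = h w m n"
proof -
  interpret Y: abelian_group Y by fact
  have "\<exists>\<psi>. \<psi> \<in> hom O.T (add_monoid Y) \<and> (\<forall>m\<in>carrier A. \<forall>n\<in>carrier B. \<psi> (O.pure m n) = h w m n)"
    if w: "w \<in> carrier Wid" for w
  proof -
    obtain \<psi> where "\<psi> \<in> hom O.T (add_monoid Y)"
      "\<And>m n. m \<in> carrier A \<Longrightarrow> n \<in> carrier B \<Longrightarrow> \<psi> (O.pure m n) = h w m n"
    proof (rule O.universal[OF Y.a_comm_group, of "h w"])
      fix m n c assume mn: "m \<in> carrier A" "n \<in> carrier B" "c \<in> (UNIV :: 'k set)"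
      \<comment> \<open>A scalar travels from \<open>m\<close> to \<open>n\<close> through
        \<open>w\<close>: \<open>pe\<close> identifies \<open>sR c\<close> in the first factor with
        \<open>sS c\<close> in the second.\<close>
      have "h w (sR c \<odot>\<^bsub>A\<^esub> m) n = h w (sR c \<odot>\<^bsub>A\<^esub> m) (\<one>\<^bsub>S\<^esub> \<odot>\<^bsub>B\<^esub> n)"
        using mn by (simp add: B.smult_one)
      also have "\<dots> = h (w \<otimes>\<^bsub>W\<^esub> pe (sR c, \<one>\<^bsub>S\<^esub>)) m n"
        using mn w sR(1) by (intro bal[symmetric]) auto
      also have "pe (sR c, \<one>\<^bsub>S\<^esub>) = pe (\<one>\<^bsub>R\<^esub>, sS c)"
        using pe_balanced[of "\<one>\<^bsub>R\<^esub>" "\<one>\<^bsub>S\<^esub>" c] sR(1) sS(1) by simp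
      also have "h (w \<otimes>\<^bsub>W\<^esub> pe (\<one>\<^bsub>R\<^esub>, sS c)) m n = h w (\<one>\<^bsub>R\<^esub> \<odot>\<^bsub>A\<^esub> m) (sS c \<odot>\<^bsub>B\<^esub> n)"
        using mn w sS(1) by (intro bal) auto
      finally show "h w (sR c \<odot>\<^bsub>A\<^esub> m) n = h w m (sS c \<odot>\<^bsub>B\<^esub> n)"
        using mn by (simp add: A.smult_one)
    qed (use w closed add2 add3 in auto)
    then show ?thesis by blast
  qed
  then obtain H where H: "\<And>w. w \<in> carrier Wid \<Longrightarrow> H w \<in> hom O.T (add_monoid Y)"
    "\<And>w m n. w \<in> carrier Wid \<Longrightarrow> m \<in> carrier A \<Longrightarrow> n \<in> carrier B \<Longrightarrow> H w (O.pure m n) = h w m n"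
    by metis
  have Hcl: "H w y \<in> carrier Y" if "w \<in> carrier Wid" "y \<in> carrier O.T" for w y
    using hom_in_carrier[OF H(1)[OF that(1)] that(2)] by simp
  have Hadd: "H w (y \<otimes>\<^bsub>O.T\<^esub> y') = H w y \<oplus>\<^bsub>Y\<^esub> H w y'" if "w \<in> carrier Wid" "y \<in> carrier O.T" "y' \<in> carrier O.T" for w y y'
    using hom_mult[OF H(1)[OF that(1)] that(2,3)] by simp
  have Iadd: "w \<oplus>\<^bsub>W\<^esub> w' \<in> carrier Wid" if "w \<in> carrier Wid" "w' \<in> carrier Wid" for w w'
    using abelian_monoid.a_closed[OF abelian_group.axioms(1)[OF abelian_group_Wid] that] unfolding Wid_sel .
  have Hadd1: "H (w \<oplus>\<^bsub>W\<^esub> w') y = H w y \<oplus>\<^bsub>Y\<^esub> H w' y" if w: "w \<in> carrier Wid" "w' \<in> carrier Wid" and y: "y \<in> carrier O.T" for w w' y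
    using y
  proof (induction rule: O.tensor_induct)
    case (pure m n)
    then show ?case using w by (simp only: H(2) Iadd add1)
  next
    case (mult x y)
    moreover have "H w x \<in> carrier Y" "H w y \<in> carrier Y" "H w' x \<in> carrier Y" "H w' y \<in> carrier Y"
      using Hcl w mult by blast+
    ultimately show ?case using w by (simp only: Hadd Iadd) (simp add: Y.a_ac)
  qed
  \<comment> \<open>Both \<open>t\<close> and \<open>y\<close> are sums of pure tensors, so
    additivity spreads the balancing condition from pairs to all of \<open>K.T\<close> and
    \<open>O.T\<close>.\<close>
  have Hbal: "H (rmul w t) y = H w (act t y)" if w: "w \<in> carrier Wid" and t: "t \<in> carrier K.T" and y: "y \<in> carrier O.T" for w t y
    using t
  proof (induction rule: K.tensor_induct)
    case (pure r s)
    from y show ?case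
    proof (induction rule: O.tensor_induct)
      case (pure m n)
      have rs: "r \<in> carrier R" "s \<in> carrier S" using \<open>r \<in> carrier (regular_module R)\<close> \<open>s \<in> carrier (regular_module S)\<close> by (simp_all add: regular_sel)
      have "rmul w (K.pure r s) \<in> carrier Wid"
        using CV.ra_closed[OF w] K.pure_closed[of r s] rs by (simp add: regular_sel)
      then show ?case using w pure rs
        by (simp only: H(2) act_pure A.smult_closed B.smult_closed bal temb_pure)
    next
      case (mult x y)
      have 1: "rmul w (K.pure r s) \<in> carrier Wid" using CV.ra_closed[OF w] K.pure_closed pure by blast
      have 2: "K.pure r s \<in> carrier K.T" using K.pure_closed pure by blast
      show ?case using mult w 1 2 act_closed[OF 2] by (simp only: Hadd act_mult_right)
    qed
  next
    case (mult t t')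
    have 1: "rmul w t \<in> carrier Wid" "rmul w t' \<in> carrier Wid" using CV.ra_closed[OF w] mult by blast+
    have 2: "rmul w (t \<otimes>\<^bsub>K.T\<^esub> t') = rmul w t \<oplus>\<^bsub>W\<^esub> rmul w t'"
      using w mult temb_closed unfolding Wid_iff by (simp only: temb_add W.r_distr)
    show ?case unfolding 2 using mult w 1 y act_closed
      by (simp only: Hadd1 Hadd act_mult_left)
  qed
  obtain \<phi> where \<phi>: "\<phi> \<in> hom CV.T (add_monoid Y)"
    "\<And>w y. w \<in> carrier Wid \<Longrightarrow> y \<in> carrier Omod \<Longrightarrow> \<phi> (CV.pure w y) = H w y"
  proof (rule CV.universal[OF Y.a_comm_group, of H])
    show "H a b \<in> carrier (add_monoid Y)" if "a \<in> carrier Wid" "b \<in> carrier Omod" for a b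
      using Hcl that unfolding carrier_Omod by simp
    show "H (a \<oplus>\<^bsub>Wid\<^esub> a') b = H a b \<otimes>\<^bsub>add_monoid Y\<^esub> H a' b"
      if "a \<in> carrier Wid" "a' \<in> carrier Wid" "b \<in> carrier Omod" for a a' b
      using Hadd1 that unfolding carrier_Omod Wid_sel by simp
    show "H a (b \<oplus>\<^bsub>Omod\<^esub> b') = H a b \<otimes>\<^bsub>add_monoid Y\<^esub> H a b'"
      if "a \<in> carrier Wid" "b \<in> carrier Omod" "b' \<in> carrier Omod" for a b b'
      using Hadd that unfolding carrier_Omod add_Omod by simp
    show "H (rmul a c) b = H a (act c b)" if "a \<in> carrier Wid" "c \<in> carrier K.T" "b \<in> carrier Omod" for a c b
      using Hbal that unfolding carrier_Omod by blast
  qed blast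
  show thesis
  proof (rule that[of \<phi>])
    show "\<phi> x \<in> carrier Y" if "x \<in> carrier conv_mod" for x
      using hom_in_carrier[OF \<phi>(1)] that by (simp add: carrier_conv)
    show "\<phi> (x \<oplus>\<^bsub>conv_mod\<^esub> y) = \<phi> x \<oplus>\<^bsub>Y\<^esub> \<phi> y" if "x \<in> carrier conv_mod" "y \<in> carrier conv_mod" for x y
      using hom_mult[OF \<phi>(1)] that by (simp add: carrier_conv add_conv)
    show "\<phi> (tens w m n) = h w m n" if "w \<in> carrier Wid" "m \<in> carrier A" "n \<in> carrier B" for w m n
      using \<phi>(2)[OF that(1), of "O.pure m n"] H(2)[OF that] O.pure_closed[OF that(2,3)]
      unfolding tens_def carrier_Omod by simp
  qed
qed

end

section \<open>Congruences in KLR and VV algebras\<close>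

text \<open>The retraction \<open>ret\<close> confines the multipliers to
  \<open>carrier (free_alg G)\<close>. This matters when they have to act by operators or commute
  with an idempotent, which is known for generators in \<open>G\<close> only.\<close>

lemma tsi_induct_carrier [consumes 3, case_names base zero add left right]:
  fixes f :: "('g, 'k::field) fralg"
  assumes f: "f \<in> tsi R" "f \<in> carrier (free_alg G)" and R: "R \<subseteq> carrier (free_alg G)"
    and base: "\<And>r. r \<in> R \<Longrightarrow> P r" and zero: "P 0"
    and add: "\<And>f g. P f \<Longrightarrow> P g \<Longrightarrow> P (f + g)"
    and left: "\<And>a f. a \<in> carrier (free_alg G) \<Longrightarrow> f \<in> carrier (free_alg G) \<Longrightarrow> P f \<Longrightarrow> P (a * f)"
    and right: "\<And>a f. a \<in> carrier (free_alg G) \<Longrightarrow> f \<in> carrier (free_alg G) \<Longrightarrow> P f \<Longrightarrow> P (f * a)"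
  shows "P f"
proof -
  define ret where "ret = fsubst (\<lambda>g. if g \<in> G then fvar g else (0 :: ('g, 'k) fralg))"
  have ret_closed: "ret f \<in> carrier (free_alg G)" for f
    unfolding ret_def by (rule fsubst_closed[of _ UNIV]) auto
  have ret_id: "ret f = f" if "f \<in> carrier (free_alg G)" for f
    unfolding ret_def using that by (rule fsubst_id_on) auto
  from f(1) have "P (ret f)"
  proof (induction rule: tsi.induct)
    case (tsi_gen r a b)
    have "ret (a * r * b) = ret a * r * ret b"
      using ret_id[of r] R tsi_gen by (auto simp: ret_def fsubst_mult)
    then show ?case using base[OF tsi_gen] R tsi_gen ret_closed left right by auto
  qed (auto simp: ret_def fsubst_add intro: zero add)
  then show ?thesis using ret_id[OF f(2)] by simp
qed

lemma eqv_fscal_commute: "f * fscal c = fscal c * (f :: ('g, 'k::field) fralg)"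
  by (rule fscal_commute[symmetric])

lemma fsubst_commute_gens:
  fixes f :: "('g, 'k::field) fralg" and e :: "('h, 'k) fralg"
  assumes "f \<in> carrier (free_alg G)" "\<And>g. g \<in> G \<Longrightarrow> e * \<phi> g \<doteq>\<^bsub>R\<^esub> \<phi> g * e"
  shows "e * fsubst \<phi> f \<doteq>\<^bsub>R\<^esub> fsubst \<phi> f * e"
  using assms(1)
proof (induction f rule: free_alg_induct)
  case (scal c)
  then show ?case by (simp add: fscal_commute)
next
  case (var g f)
  have "e * (\<phi> g * fsubst \<phi> f) = (e * \<phi> g) * fsubst \<phi> f" by (simp add: mult.assoc)
  also have "\<dots> \<doteq>\<^bsub>R\<^esub> (\<phi> g * e) * fsubst \<phi> f" by (intro eqv_mult_right assms var)
  also have "\<dots> = \<phi> g * (e * fsubst \<phi> f)" by (simp add: mult.assoc)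
  also have "\<dots> \<doteq>\<^bsub>R\<^esub> \<phi> g * (fsubst \<phi> f * e)" by (intro eqv_mult_left var)
  finally show ?case by (simp add: fsubst_mult mult.assoc)
next
  case (add f g)
  then show ?case by (simp add: fsubst_add distrib_left distrib_right eqv_add)
qed

text \<open>A block embedding sends the sum of all e(i) to an idempotent \<open>e\<close> and not to
  1, so it respects the relations only after multiplication by \<open>e\<close>. As \<open>e\<close>
  commutes with the images of the generators, it can be moved past a multiplier on the left.\<close>

lemma corner_hom:
  fixes f :: "('g, 'k::field) fralg" and e :: "('h, 'k) fralg"
  assumes R: "R \<subseteq> carrier (free_alg G)" and fg: "f \<in> carrier (free_alg G)" "g \<in> carrier (free_alg G)" "f \<doteq>\<^bsub>R\<^esub> g"
    and comm: "\<And>g. g \<in> G \<Longrightarrow> e * \<phi> g \<doteq>\<^bsub>R'\<^esub> \<phi> g * e"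
    and rel: "\<And>r. r \<in> R \<Longrightarrow> e * fsubst \<phi> r \<doteq>\<^bsub>R'\<^esub> 0"
  shows "e * fsubst \<phi> f \<doteq>\<^bsub>R'\<^esub> e * fsubst \<phi> g"
proof -
  have "f - g \<in> tsi R" "f - g \<in> carrier (free_alg G)" using fg by (simp_all add: eqv_def)
  from this R have "e * fsubst \<phi> (f - g) \<doteq>\<^bsub>R'\<^esub> 0"
  proof (induction rule: tsi_induct_carrier)
    case (add f g)
    then show ?case using eqv_add[of "e * fsubst \<phi> f" R' 0 "e * fsubst \<phi> g" 0]
      by (simp add: fsubst_add distrib_left)
  next
    case (left a f)
    have "e * fsubst \<phi> (a * f) = (e * fsubst \<phi> a) * fsubst \<phi> f" by (simp add: fsubst_mult mult.assoc)
    also have "\<dots> \<doteq>\<^bsub>R'\<^esub> (fsubst \<phi> a * e) * fsubst \<phi> f"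
      by (intro eqv_mult_right fsubst_commute_gens[OF left(1)] comm)
    also have "\<dots> = fsubst \<phi> a * (e * fsubst \<phi> f)" by (simp add: mult.assoc)
    also have "\<dots> \<doteq>\<^bsub>R'\<^esub> fsubst \<phi> a * 0" by (intro eqv_mult_left left)
    finally show ?case by simp
  next
    case (right a f)
    then show ?case using eqv_mult_right[of "e * fsubst \<phi> f" R' 0 "fsubst \<phi> a"]
      by (simp add: fsubst_mult mult.assoc)
  qed (use rel in auto)
  then show ?thesis using eqv_add[of "e * fsubst \<phi> (f - g)" R' 0 "e * fsubst \<phi> g" "e * fsubst \<phi> g"]
    by (simp add: fsubst_diff right_diff_distrib)
qed

text \<open>Agreement on generators propagates along words because \<open>e\<close> commutes with
  the values of \<open>\<psi>\<close>. This serves to compare composed block embeddings in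
  \<open>mid_mid\<close>.\<close>

lemma corner_unique:
  fixes f :: "('g, 'k::field) fralg" and e :: "('h, 'k) fralg"
  assumes f: "f \<in> carrier (free_alg G)"
    and eq: "\<And>g. g \<in> G \<Longrightarrow> e * \<phi> g \<doteq>\<^bsub>R\<^esub> e * \<psi> g"
    and comm: "\<And>g. g \<in> G \<Longrightarrow> e * \<psi> g \<doteq>\<^bsub>R\<^esub> \<psi> g * e"
  shows "e * fsubst \<phi> f \<doteq>\<^bsub>R\<^esub> e * fsubst \<psi> f"
  using f
proof (induction f rule: free_alg_induct)
  case (var g f)
  have "e * fsubst \<phi> (fvar g * f) = (e * \<phi> g) * fsubst \<phi> f" by (simp add: fsubst_mult mult.assoc)
  also have "\<dots> \<doteq>\<^bsub>R\<^esub> (e * \<psi> g) * fsubst \<phi> f" by (intro eqv_mult_right eq var)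
  also have "\<dots> \<doteq>\<^bsub>R\<^esub> (\<psi> g * e) * fsubst \<phi> f" by (intro eqv_mult_right comm var)
  also have "\<dots> = \<psi> g * (e * fsubst \<phi> f)" by (simp add: mult.assoc)
  also have "\<dots> \<doteq>\<^bsub>R\<^esub> \<psi> g * (e * fsubst \<psi> f)" by (intro eqv_mult_left var)
  also have "\<dots> = (\<psi> g * e) * fsubst \<psi> f" by (simp add: mult.assoc)
  also have "\<dots> \<doteq>\<^bsub>R\<^esub> (e * \<psi> g) * fsubst \<psi> f" by (intro eqv_mult_right eqv_sym[OF comm] var)
  finally show ?case by (simp add: fsubst_mult mult.assoc)
next
  case (add f g)
  then show ?case by (simp add: fsubst_add distrib_left eqv_add)
qed simp

section \<open>Words, adjacent swaps and sums of idempotents\<close>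

lemma entry_append_left: "1 \<le> k \<Longrightarrow> k \<le> length u \<Longrightarrow> entry (u @ v) k = entry u k"
  by (cases k) (simp_all add: entry_def nth_append)

lemma entry_append_right: "1 \<le> k \<Longrightarrow> entry (u @ v) (length u + k) = entry v k"
  by (cases k) (simp_all add: entry_def nth_append)

lemma length_swap [simp]: "length (swap_entries k i) = length i"
  by (simp add: swap_entries_def)

lemma mset_swap: "1 \<le> k \<Longrightarrow> k < length i \<Longrightarrow> mset (swap_entries k i) = mset i"
  unfolding swap_entries_def entry_def using Multiset.mset_swap[of "k - 1" i k]
  by (subst list_update_swap) auto

lemma swap_swap: "1 \<le> k \<Longrightarrow> k < length i \<Longrightarrow> swap_entries k (swap_entries k i) = i"
  unfolding swap_entries_def entry_def
  by (rule nth_equalityI) (auto simp: nth_list_update)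

lemma swap_append_left: "1 \<le> k \<Longrightarrow> k < length u \<Longrightarrow> swap_entries k (u @ v) = swap_entries k u @ v"
  unfolding swap_entries_def entry_def
  by (auto simp: list_update_append nth_append)

lemma swap_append_right: "1 \<le> k \<Longrightarrow> k < length v \<Longrightarrow> swap_entries (length u + k) (u @ v) = u @ swap_entries k v"
  unfolding swap_entries_def entry_def
  by (auto simp: list_update_append nth_append)

lemma entry_swap:
  "1 \<le> k \<Longrightarrow> k < length i \<Longrightarrow> 1 \<le> l \<Longrightarrow> l \<le> length i \<Longrightarrow> entry (swap_entries k i) l = entry i (adj_swap k l)"
  unfolding swap_entries_def entry_def adj_swap_def
  by (auto simp: nth_list_update)

lemma finite_klr_words [simp]: "finite (klr_words b)"
proof -
  have "klr_words b \<subseteq> {xs. set xs \<subseteq> set_mset b \<and> length xs = size b}"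
    by (auto simp: klr_words_def)
  then show ?thesis by (rule finite_subset) (simp add: finite_lists_length_eq)
qed

lemma klr_words_length: "i \<in> klr_words b \<Longrightarrow> length i = size b"
  by (auto simp: klr_words_def)

lemma klr_words_swap: "i \<in> klr_words b \<Longrightarrow> 1 \<le> k \<Longrightarrow> k < size b \<Longrightarrow> swap_entries k i \<in> klr_words b"
  by (auto simp: klr_words_def mset_swap)

lemma klr_words_empty [simp]: "klr_words {#} = {[]}"
  by (auto simp: klr_words_def)

definition eset :: "'k::field list set \<Rightarrow> 'k falg" where
  "eset X' = (\<Sum>i\<in>X'. ee i)"

definition app_set :: "'a list set \<Rightarrow> 'a list set \<Rightarrow> 'a list set" where
  "app_set U V = {u @ v | u v. u \<in> U \<and> v \<in> V}"

lemma app_set_assoc: "app_set (app_set U V) Z = app_set U (app_set V Z)"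
  unfolding app_set_def by (auto; metis append.assoc)

lemma app_set_Nil [simp]: "app_set {[]} V = V" "app_set V {[]} = V"
  by (auto simp: app_set_def)

lemma app_set_klr_words: "app_set (klr_words a) (klr_words b) \<subseteq> klr_words (a + b)"
  by (auto simp: app_set_def klr_words_def)

lemma app_set_mono: "U \<subseteq> U' \<Longrightarrow> V \<subseteq> V' \<Longrightarrow> app_set U V \<subseteq> app_set U' V'"
  by (auto simp: app_set_def)

lemma eset_app_set:
  assumes "\<And>u. u \<in> U \<Longrightarrow> length u = n"
  shows "eset (app_set U V) = (\<Sum>u\<in>U. \<Sum>v\<in>V. ee (u @ v))"
proof -
  have img: "app_set U V = (\<lambda>(u, v). u @ v) ` (U \<times> V)" by (auto simp: app_set_def)
  have inj: "inj_on (\<lambda>(u, v). u @ v) (U \<times> V)"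
    using assms by (auto simp: inj_on_def)
  show ?thesis unfolding eset_def img
    by (subst sum.reindex[OF inj]) (simp add: sum.cartesian_product case_prod_unfold)
qed

text \<open>The common length \<open>n\<close> fixes the cutting point, so a word in both sets is
  cut in the same way.\<close>

lemma app_set_inter:
  assumes "\<And>u. u \<in> U \<union> U' \<Longrightarrow> length u = n"
  shows "app_set U V \<inter> app_set U' V' = app_set (U \<inter> U') (V \<inter> V')"
proof -
  have "u = u' \<and> v = v'" if "u @ v = u' @ v'" "u \<in> U" "u' \<in> U'" for u v u' v'
    using that assms[of u] assms[of u'] by simp
  then show ?thesis unfolding app_set_def by blast
qed

lemma eset_closed: "GE ` X' \<subseteq> G \<Longrightarrow> eset X' \<in> carrier (free_alg G)"
  by (auto simp: eset_def intro!: free_alg_sum free_alg_fvar)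

text \<open>The bounds on \<open>k\<close> are part of the notion so that swapping is an involution
  of \<open>X'\<close>; this reindexes the sum in \<open>s_eset\<close>.\<close>

definition swap_stable :: "nat \<Rightarrow> 'a list set \<Rightarrow> bool" where
  "swap_stable k X' \<longleftrightarrow> (\<forall>i\<in>X'. 1 \<le> k \<and> k < length i \<and> swap_entries k i \<in> X')"

lemma swap_stable_klr_words: "1 \<le> k \<Longrightarrow> k < size b \<Longrightarrow> swap_stable k (klr_words b)"
  by (auto simp: swap_stable_def klr_words_length klr_words_swap)

lemma swap_stable_app_left: "swap_stable k U \<Longrightarrow> swap_stable k (app_set U V)"
  unfolding swap_stable_def app_set_def by (fastforce simp: swap_append_left)

lemma swap_stable_app_right:
  assumes "swap_stable k V" "\<And>u. u \<in> U \<Longrightarrow> length u = n"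
  shows "swap_stable (n + k) (app_set U V)"
  unfolding swap_stable_def
proof
  fix i assume "i \<in> app_set U V"
  then obtain u v where i: "i = u @ v" "u \<in> U" "v \<in> V" by (auto simp: app_set_def)
  then have "n = length u" "1 \<le> k" "k < length v" "swap_entries k v \<in> V"
    using assms by (auto simp: swap_stable_def)
  then show "1 \<le> n + k \<and> n + k < length i \<and> swap_entries (n + k) i \<in> app_set U V"
    using i swap_append_right[of k v u] by (auto simp: app_set_def)
qed

text \<open>\<open>R\<close> may contain further relations and \<open>A\<close> is any finite set of
  words of length \<open>m\<close> closed under swaps. The same congruences therefore serve KLR
  algebras, with \<open>klr_words\<close>, and VV algebras, with \<open>vv_words\<close> and the
  relations for pi.\<close>

locale klr_cong =
  fixes p :: "'k::field" and m :: nat and A :: "'k list set" and R :: "'k falg set"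
  assumes rels: "klr_rels p m A \<subseteq> R" and finite_A: "finite A"
    and length_A: "i \<in> A \<Longrightarrow> length i = m"
    and swap_A: "i \<in> A \<Longrightarrow> 1 \<le> k \<Longrightarrow> k < m \<Longrightarrow> swap_entries k i \<in> A"
begin

lemma relI: "f - g \<in> klr_rels p m A \<Longrightarrow> f \<doteq>\<^bsub>R\<^esub> g"
  using rels by (auto intro: eqv_relI)

lemma ee_ee: "i \<in> A \<Longrightarrow> j \<in> A \<Longrightarrow> ee i * ee j \<doteq>\<^bsub>R\<^esub> (if i = j then ee i else 0)"
  by (rule relI) (unfold klr_rels_def, blast)

lemma eset_A: "eset A \<doteq>\<^bsub>R\<^esub> 1"
  by (rule relI) (simp add: eset_def klr_rels_def)

lemma s_ee: "i \<in> A \<Longrightarrow> 1 \<le> k \<Longrightarrow> k < m \<Longrightarrow> ss k * ee i \<doteq>\<^bsub>R\<^esub> ee (swap_entries k i) * ss k"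
  by (rule relI) (unfold klr_rels_def atLeastLessThan_iff, blast)

lemma x_ee: "i \<in> A \<Longrightarrow> 1 \<le> l \<Longrightarrow> l \<le> m \<Longrightarrow> xx l * ee i \<doteq>\<^bsub>R\<^esub> ee i * xx l"
  by (rule relI) (unfold klr_rels_def atLeastAtMost_iff, blast)

lemma x_x: "1 \<le> r \<Longrightarrow> r \<le> m \<Longrightarrow> 1 \<le> s \<Longrightarrow> s \<le> m \<Longrightarrow> xx r * xx s \<doteq>\<^bsub>R\<^esub> xx s * xx r"
  by (rule relI) (unfold klr_rels_def atLeastAtMost_iff, blast)

lemma s_s: "i \<in> A \<Longrightarrow> 1 \<le> k \<Longrightarrow> k < m \<Longrightarrow>
    ss k * ss k * ee i \<doteq>\<^bsub>R\<^esub> Qpoly p (entry i k) (entry i (k + 1)) (xx (k + 1)) (xx k) * ee i"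
  by (rule relI) (unfold klr_rels_def atLeastLessThan_iff, blast)

lemma s_far: "1 \<le> j \<Longrightarrow> j < m \<Longrightarrow> 1 \<le> k \<Longrightarrow> k < m \<Longrightarrow> j \<noteq> k + 1 \<Longrightarrow> k \<noteq> j + 1 \<Longrightarrow> ss j * ss k \<doteq>\<^bsub>R\<^esub> ss k * ss j"
  by (rule relI) (unfold klr_rels_def atLeastLessThan_iff, blast)

lemma s_braid: "i \<in> A \<Longrightarrow> 1 \<le> k \<Longrightarrow> k + 1 < m \<Longrightarrow>
    (ss (k + 1) * ss k * ss (k + 1) - ss k * ss (k + 1) * ss k) * ee i \<doteq>\<^bsub>R\<^esub>
        (if entry i k = entry i (k + 2)
         then Qquot p (entry i k) (entry i (k + 1)) (xx (k + 1)) (xx k) (xx (k + 2)) * ee i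
         else 0)"
  by (rule relI) (unfold klr_rels_def, blast)

lemma s_x: "i \<in> A \<Longrightarrow> 1 \<le> k \<Longrightarrow> k < m \<Longrightarrow> 1 \<le> l \<Longrightarrow> l \<le> m \<Longrightarrow>
    (ss k * xx l - xx (adj_swap k l) * ss k) * ee i \<doteq>\<^bsub>R\<^esub>
        (if l = k \<and> entry i k = entry i (k + 1) then - ee i
         else if l = k + 1 \<and> entry i k = entry i (k + 1) then ee i
         else 0)"
  by (rule relI) (unfold klr_rels_def atLeastLessThan_iff atLeastAtMost_iff, blast)

lemma sub_finite: "U \<subseteq> A \<Longrightarrow> finite U"
  using finite_A finite_subset by blast

lemma ee_eset: "i \<in> A \<Longrightarrow> U \<subseteq> A \<Longrightarrow> ee i * eset U \<doteq>\<^bsub>R\<^esub> (if i \<in> U then ee i else 0)"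
proof -
  assume i: "i \<in> A" "U \<subseteq> A"
  have "ee i * eset U \<doteq>\<^bsub>R\<^esub> (\<Sum>j\<in>U. if i = j then ee i else 0)"
    unfolding eset_def sum_distrib_left using i by (intro eqv_sum ee_ee) auto
  then show ?thesis using sub_finite[OF i(2)] by simp
qed

lemma eset_ee: "i \<in> A \<Longrightarrow> U \<subseteq> A \<Longrightarrow> eset U * ee i \<doteq>\<^bsub>R\<^esub> (if i \<in> U then ee i else 0)"
proof -
  assume i: "i \<in> A" "U \<subseteq> A"
  have "eset U * ee i \<doteq>\<^bsub>R\<^esub> (\<Sum>j\<in>U. if j = i then ee i else 0)"
    unfolding eset_def sum_distrib_right
    by (intro eqv_sum eqv_trans[OF ee_ee]) (use i in auto)
  then show ?thesis using sub_finite[OF i(2)] by simp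
qed

lemma eset_eset: "U \<subseteq> A \<Longrightarrow> V \<subseteq> A \<Longrightarrow> eset U * eset V \<doteq>\<^bsub>R\<^esub> eset (U \<inter> V)"
proof -
  assume U: "U \<subseteq> A" "V \<subseteq> A"
  have "eset U * eset V \<doteq>\<^bsub>R\<^esub> (\<Sum>i\<in>U. if i \<in> V then ee i else 0)"
    unfolding eset_def[of U] sum_distrib_right using U by (intro eqv_sum ee_eset) auto
  also have "\<dots> = eset (U \<inter> V)" using sub_finite[OF U(1)] by (simp add: eset_def sum.If_cases Int_def)
  finally show ?thesis .
qed

lemma x_eset: "U \<subseteq> A \<Longrightarrow> 1 \<le> l \<Longrightarrow> l \<le> m \<Longrightarrow> xx l * eset U \<doteq>\<^bsub>R\<^esub> eset U * xx l"
  unfolding eset_def sum_distrib_left sum_distrib_right by (intro eqv_sum x_ee) auto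

lemma s_eset: "U \<subseteq> A \<Longrightarrow> 1 \<le> k \<Longrightarrow> k < m \<Longrightarrow> swap_stable k U \<Longrightarrow> ss k * eset U \<doteq>\<^bsub>R\<^esub> eset U * ss k"
proof -
  assume U: "U \<subseteq> A" "1 \<le> k" "k < m" "swap_stable k U"
  have "ss k * eset U \<doteq>\<^bsub>R\<^esub> (\<Sum>i\<in>U. ee (swap_entries k i) * ss k)"
    unfolding eset_def sum_distrib_left using U by (intro eqv_sum s_ee) auto
  also have "\<dots> = (\<Sum>i\<in>U. ee i * ss k)"
    by (rule sum.reindex_bij_witness[of _ "swap_entries k" "swap_entries k"])
      (use U in \<open>auto simp: swap_stable_def swap_swap\<close>)
  finally show ?thesis by (simp add: eset_def sum_distrib_right)
qed

text \<open>The e(i) sum to 1, so a congruence may be tested behind each of them, which is the form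
  in which the defining relations come.\<close>

lemma eqv_by_ee:
  assumes "\<And>i. i \<in> A \<Longrightarrow> f * ee i \<doteq>\<^bsub>R\<^esub> g * ee i" shows "f \<doteq>\<^bsub>R\<^esub> g"
proof -
  have "f = f * 1" by simp
  also have "\<dots> \<doteq>\<^bsub>R\<^esub> f * eset A" by (intro eqv_mult_left eqv_sym[OF eset_A])
  also have "\<dots> \<doteq>\<^bsub>R\<^esub> g * eset A"
    unfolding eset_def sum_distrib_left by (intro eqv_sum assms)
  also have "\<dots> \<doteq>\<^bsub>R\<^esub> g * 1" by (intro eqv_mult_left eset_A)
  finally show ?thesis by simp
qed

lemma s_x_far: "1 \<le> k \<Longrightarrow> k < m \<Longrightarrow> 1 \<le> l \<Longrightarrow> l \<le> m \<Longrightarrow> l \<noteq> k \<Longrightarrow> l \<noteq> k + 1 \<Longrightarrow> ss k * xx l \<doteq>\<^bsub>R\<^esub> xx l * ss k"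
proof (rule eqv_by_ee)
  fix i assume "1 \<le> k" "k < m" "1 \<le> l" "l \<le> m" "l \<noteq> k" "l \<noteq> k + 1" "i \<in> A"
  then have "(ss k * xx l - xx l * ss k) * ee i \<doteq>\<^bsub>R\<^esub> 0"
    using s_x[of i k l] by (simp add: adj_swap_def)
  then show "ss k * xx l * ee i \<doteq>\<^bsub>R\<^esub> xx l * ss k * ee i"
    by (simp add: eqv_def left_diff_distrib)
qed

end

section \<open>Block embeddings of KLR algebras\<close>

abbreviation KG :: "'k multiset \<Rightarrow> 'k gen set" where "KG b \<equiv> klr_gens (size b) (klr_words b)"
abbreviation KJ :: "'k::field \<Rightarrow> 'k multiset \<Rightarrow> 'k falg set" where "KJ p b \<equiv> klr_rels p (size b) (klr_words b)"

lemma klr_cong_KJ: "KJ p b \<subseteq> R \<Longrightarrow> klr_cong p (size b) (klr_words b) R"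
  by unfold_locales (auto simp: klr_words_length klr_words_swap)

lemma Qpoly_closed:
  "u \<in> carrier (free_alg G) \<Longrightarrow> v \<in> carrier (free_alg G) \<Longrightarrow> Qpoly p i j u v \<in> carrier (free_alg G)"
  by (auto simp: Qpoly_def intro!: free_alg_mult free_alg_power free_alg_minus)

lemma Qquot_closed:
  "u \<in> carrier (free_alg G) \<Longrightarrow> v \<in> carrier (free_alg G) \<Longrightarrow> w \<in> carrier (free_alg G) \<Longrightarrow>
    Qquot p i j u v w \<in> carrier (free_alg G)"
  by (auto simp: Qquot_def Let_def intro!: free_alg_mult free_alg_power free_alg_minus free_alg_sum)

lemma klr_rels_closed:
  assumes swap: "\<And>i k. i \<in> A \<Longrightarrow> 1 \<le> k \<Longrightarrow> k < m \<Longrightarrow> swap_entries k i \<in> A"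
  shows "klr_rels p m A \<subseteq> carrier (free_alg (klr_gens m A))"
proof -
  have g: "xx l \<in> carrier (free_alg (klr_gens m A))" if "1 \<le> l" "l \<le> m" for l
    using that by (auto simp: klr_gens_def)
  have s: "ss k \<in> carrier (free_alg (klr_gens m A))" if "1 \<le> k" "k < m" for k
    using that by (auto simp: klr_gens_def)
  have e: "ee i \<in> carrier (free_alg (klr_gens m A))" if "i \<in> A" for i
    using that by (auto simp: klr_gens_def)
  have a: "1 \<le> adj_swap k l \<and> adj_swap k l \<le> m" if "1 \<le> k" "k < m" "1 \<le> l" "l \<le> m" for k l
    using that by (auto simp: adj_swap_def)
  show ?thesis unfolding klr_rels_def
    apply (intro Un_least subsetI)
            apply (auto intro!: free_alg_diff free_alg_mult free_alg_sum free_alg_minus Qpoly_closed Qquot_closed g s e swap)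
    using a by auto
qed

lemma KJ_closed: "KJ p b \<subseteq> carrier (free_alg (KG b))"
  by (rule klr_rels_closed) (auto simp: klr_words_swap)


lemma eset_app_single: "eset (app_set {u} V) = (\<Sum>v\<in>V. ee (u @ v))"
  using eset_app_set[of "{u}" "length u" V] by simp

lemma eset_app_sum:
  assumes "\<And>u. u \<in> U \<Longrightarrow> length u = n"
  shows "(\<Sum>u\<in>U. eset (app_set {u} V)) = eset (app_set U V)"
  by (simp add: eset_app_single eset_app_set[OF assms])

lemma eset_app_app_sum:
  assumes Y: "\<And>w. w \<in> Y \<Longrightarrow> length w = n" and U: "\<And>u. u \<in> U \<Longrightarrow> length u = m"
  shows "(\<Sum>w\<in>Y. eset (app_set U (app_set {w} V))) = eset (app_set U (app_set Y V))"
proof -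
  have "(\<Sum>w\<in>Y. eset (app_set U (app_set {w} V))) = (\<Sum>w\<in>Y. \<Sum>u\<in>U. \<Sum>v\<in>V. ee (u @ w @ v))"
  proof (rule sum.cong[OF refl])
    fix w
    have "app_set U (app_set {w} V) = app_set (app_set U {w}) V" by (simp add: app_set_assoc)
    moreover have "app_set U {w} = (\<lambda>u. u @ w) ` U" by (auto simp: app_set_def)
    moreover have "inj_on (\<lambda>u. u @ w) U" by (auto simp: inj_on_def)
    moreover have "eset (app_set ((\<lambda>u. u @ w) ` U) V) = (\<Sum>x\<in>(\<lambda>u. u @ w) ` U. \<Sum>v\<in>V. ee (x @ v))"
      by (rule eset_app_set[of _ "m + length w"]) (use U in auto)
    ultimately have "eset (app_set U (app_set {w} V)) = (\<Sum>u\<in>U. \<Sum>v\<in>V. ee ((u @ w) @ v))"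
      by (simp add: sum.reindex)
    then show "eset (app_set U (app_set {w} V)) = (\<Sum>u\<in>U. \<Sum>v\<in>V. ee (u @ w @ v))" by simp
  qed
  also have "\<dots> = (\<Sum>u\<in>U. \<Sum>w\<in>Y. \<Sum>v\<in>V. ee (u @ w @ v))" by (rule sum.swap)
  also have "\<dots> = (\<Sum>u\<in>U. \<Sum>z\<in>app_set Y V. ee (u @ z))"
  proof (rule sum.cong[OF refl])
    fix u
    have "app_set {u} (app_set Y V) = app_set (app_set {u} Y) V" by (simp add: app_set_assoc)
    moreover have "app_set {u} Y = (\<lambda>w. u @ w) ` Y" by (auto simp: app_set_def)
    moreover have "inj_on (\<lambda>w. u @ w) Y" by (auto simp: inj_on_def)
    moreover have "eset (app_set ((\<lambda>w. u @ w) ` Y) V) = (\<Sum>x\<in>(\<lambda>w. u @ w) ` Y. \<Sum>v\<in>V. ee (x @ v))"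
      by (rule eset_app_set[of _ "length u + n"]) (use Y in auto)
    ultimately have "eset (app_set {u} (app_set Y V)) = (\<Sum>w\<in>Y. \<Sum>v\<in>V. ee ((u @ w) @ v))"
      by (simp add: sum.reindex)
    then show "(\<Sum>w\<in>Y. \<Sum>v\<in>V. ee (u @ w @ v)) = (\<Sum>z\<in>app_set Y V. ee (u @ z))"
      by (simp add: eset_app_single)
  qed
  also have "\<dots> = eset (app_set U (app_set Y V))" by (rule eset_app_set[OF U, symmetric])
  finally show ?thesis .
qed

text \<open>Embeds an algebra as the middle one of three blocks. \<open>subst_left\<close> and
  \<open>subst_right\<close> are the cases of an empty left or right neighbour, and composites are
  again of this kind, so one proof covers all of them. \<open>GP\<close> is no generator of a KLR
  algebra; its value is chosen so that \<open>subst_left_mid\<close> and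
  \<open>subst_right_mid\<close> hold as equations of functions.\<close>

definition mid :: "'k multiset \<Rightarrow> 'k multiset \<Rightarrow> 'k gen \<Rightarrow> 'k::field falg" where
  "mid a c g = (case g of GX l \<Rightarrow> xx (size a + l) | GS k \<Rightarrow> ss (size a + k) | GP \<Rightarrow> pp
     | GE j \<Rightarrow> eset (app_set (klr_words a) (app_set {j} (klr_words c))))"

lemma mid_simps [simp]:
  "mid a c (GX l) = xx (size a + l)" "mid a c (GS k) = ss (size a + k)" "mid a c GP = pp"
  "mid a c (GE j) = eset (app_set (klr_words a) (app_set {j} (klr_words c)))"
  by (simp_all add: mid_def)

lemma subst_left_mid: "subst_left c = mid {#} c"
proof
  fix g show "subst_left c g = mid {#} c g"
    by (cases g) (simp_all add: subst_left_def eset_app_single)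
qed

lemma subst_right_mid: "subst_right b = mid b {#}"
proof
  fix g show "subst_right b g = mid b {#} g"
    by (cases g) (simp_all add: subst_right_def eset_app_set[OF klr_words_length])
qed

lemma fsubst_Qpoly: "fsubst \<phi> (Qpoly p i j u v) = Qpoly p i j (fsubst \<phi> u) (fsubst \<phi> v)"
  by (simp add: Qpoly_def fsubst_mult fsubst_power fsubst_minus fsubst_diff)

lemma fsubst_Qquot: "fsubst \<phi> (Qquot p i j u v w) = Qquot p i j (fsubst \<phi> u) (fsubst \<phi> v) (fsubst \<phi> w)"
  by (simp add: Qquot_def Let_def fsubst_mult fsubst_power fsubst_minus fsubst_diff fsubst_sum)

lemma klr_rels_cases [consumes 1, case_names ee sum s_ee x_ee x_x s_s s_far braid s_x]:
  assumes "r \<in> klr_rels p m A"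
  obtains i j where "r = ee i * ee j - (if i = j then ee i else 0)" "i \<in> A" "j \<in> A"
  | "r = (\<Sum>i\<in>A. ee i) - 1"
  | k i where "r = ss k * ee i - ee (swap_entries k i) * ss k" "1 \<le> k" "k < m" "i \<in> A"
  | l i where "r = xx l * ee i - ee i * xx l" "1 \<le> l" "l \<le> m" "i \<in> A"
  | l l' where "r = xx l * xx l' - xx l' * xx l" "1 \<le> l" "l \<le> m" "1 \<le> l'" "l' \<le> m"
  | k i where "r = ss k * ss k * ee i - Qpoly p (entry i k) (entry i (k + 1)) (xx (k + 1)) (xx k) * ee i"
      "1 \<le> k" "k < m" "i \<in> A"
  | j k where "r = ss j * ss k - ss k * ss j" "1 \<le> j" "j < m" "1 \<le> k" "k < m" "j \<noteq> k + 1" "k \<noteq> j + 1"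
  | k i where "r = (ss (k + 1) * ss k * ss (k + 1) - ss k * ss (k + 1) * ss k) * ee i -
        (if entry i k = entry i (k + 2)
         then Qquot p (entry i k) (entry i (k + 1)) (xx (k + 1)) (xx k) (xx (k + 2)) * ee i
         else 0)" "1 \<le> k" "k + 1 < m" "i \<in> A"
  | k l i where "r = (ss k * xx l - xx (adj_swap k l) * ss k) * ee i -
        (if l = k \<and> entry i k = entry i (k + 1) then - ee i
         else if l = k + 1 \<and> entry i k = entry i (k + 1) then ee i
         else 0)" "1 \<le> k" "k < m" "1 \<le> l" "l \<le> m" "i \<in> A"
  using assms unfolding klr_rels_def Un_iff atLeastLessThan_iff atLeastAtMost_iff
  by (elim disjE) (blast+)

context klr_cong
begin

lemma sum_ee_cong:
  assumes "U \<subseteq> A" "\<And>i. i \<in> U \<Longrightarrow> f * ee i \<doteq>\<^bsub>R\<^esub> g * ee i"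
  shows "f * eset U \<doteq>\<^bsub>R\<^esub> g * eset U"
  unfolding eset_def sum_distrib_left by (intro eqv_sum assms)

end

lemma eqv_diff_0: "f - g \<doteq>\<^bsub>R\<^esub> 0 \<longleftrightarrow> f \<doteq>\<^bsub>R\<^esub> g"
  by (simp add: eqv_def)

text \<open>The total \<open>n\<close> is a parameter tied by an equation, so that differently
  bracketed sums can refer to one and the same algebra.\<close>

locale mid_cong = N: klr_cong p "size n" "klr_words n" R for p :: "'k::field" and n and R :: "'k falg set" +
  fixes a b c :: "'k multiset"
  assumes n: "n = a + b + c"
begin

abbreviation P where "P j \<equiv> app_set (klr_words a) (app_set {j} (klr_words c))"
abbreviation blk where "blk \<equiv> app_set (klr_words a) (app_set (klr_words b) (klr_words c))"

lemma blk_sub: "blk \<subseteq> klr_words n"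
  by (auto simp: n app_set_def klr_words_def)

lemma P_sub: "j \<in> klr_words b \<Longrightarrow> P j \<subseteq> klr_words n"
  by (auto simp: n app_set_def klr_words_def)

lemma size_n: "size n = size a + size b + size c"
  by (simp add: n)

lemma entry_P:
  assumes "w \<in> P j" "j \<in> klr_words b" "1 \<le> l" "l \<le> size b"
  shows "entry w (size a + l) = entry j l"
proof -
  from assms(1) obtain u v where w: "w = u @ j @ v" "u \<in> klr_words a" by (auto simp: app_set_def)
  then have "size a = length u" "size b = length j" using assms(2) by (auto simp: klr_words_length)
  then show ?thesis using assms(3,4) w(1) by (simp add: entry_append_right entry_append_left)
qed

lemma swap_P:
  assumes "j \<in> klr_words b" "1 \<le> k" "k < size b"
  shows "P (swap_entries k j) = swap_entries (size a + k) ` P j"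
proof -
  have *: "swap_entries (size a + k) (u @ j @ v) = u @ swap_entries k j @ v" if "u \<in> klr_words a" for u v
    using swap_append_right[of k "j @ v" u] swap_append_left[of k j v] assms that by (simp add: klr_words_length)
  have P: "P i = {u @ i @ v | u v. u \<in> klr_words a \<and> v \<in> klr_words c}" for i by (auto simp: app_set_def)
  show ?thesis unfolding P by (auto simp: * intro!: image_eqI[where f = "swap_entries (size a + k)"]) (force simp: *)
qed

lemma P_disjoint:
  assumes "j \<in> klr_words b" "j' \<in> klr_words b" "j \<noteq> j'" shows "P j \<inter> P j' = {}"
  using assms by (auto simp: app_set_def klr_words_length append_eq_append_conv)

lemma mid_s_ee:
  assumes "j \<in> klr_words b" "1 \<le> k" "k < size b"
  shows "ss (size a + k) * eset (P j) \<doteq>\<^bsub>R\<^esub> eset (P (swap_entries k j)) * ss (size a + k)"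
proof -
  have len: "length w = size n" if "w \<in> P j" for w
    using P_sub[OF assms(1)] that klr_words_length by blast
  have "inj_on (swap_entries (size a + k)) (P j)"
    by (rule inj_on_inverseI[where g = "swap_entries (size a + k)"]) (use len assms size_n in \<open>simp add: swap_swap\<close>)
  then have "eset (P (swap_entries k j)) * ss (size a + k) = (\<Sum>w\<in>P j. ee (swap_entries (size a + k) w) * ss (size a + k))"
    unfolding swap_P[OF assms] eset_def by (simp add: sum.reindex sum_distrib_right)
  moreover have "ss (size a + k) * eset (P j) \<doteq>\<^bsub>R\<^esub> (\<Sum>w\<in>P j. ee (swap_entries (size a + k) w) * ss (size a + k))"
    unfolding eset_def sum_distrib_left using P_sub[OF assms(1)] assms size_n by (intro eqv_sum N.s_ee) auto
  ultimately show ?thesis by simp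
qed

text \<open>The factor \<open>eset blk\<close> is there for one relation: the sum of the e(j) minus
  1 is sent to \<open>eset blk - 1\<close>, which vanishes only in the corner. The other relations
  hold without it. Each e(j) becomes the sum over the words in \<open>P j\<close>, and on all of
  these the middle letters are those of \<open>j\<close>, so a relation can be applied word by
  word.\<close>

lemma mid_rel:
  assumes "r \<in> KJ p b"
  shows "eset blk * fsubst (mid a c) r \<doteq>\<^bsub>R\<^esub> 0"
proof -
  have red: "eset blk * f \<doteq>\<^bsub>R\<^esub> 0" if "f \<doteq>\<^bsub>R\<^esub> 0" for f
    using eqv_mult_left[OF that, of "eset blk"] by simp
  have add2: "size a + k + 2 = size a + (k + 2)" "size a + k + 1 = size a + (k + 1)" for k by simp_all
  from assms show ?thesis
  proof (cases rule: klr_rels_cases)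
    case (ee i j)
    have "fsubst (mid a c) r \<doteq>\<^bsub>R\<^esub> 0"
      unfolding ee(1) fsubst_diff eqv_diff_0
      using N.eset_eset[OF P_sub[OF ee(2)] P_sub[OF ee(3)]] P_disjoint[OF ee(2,3)]
      by (auto simp: fsubst_mult eset_def)
    then show ?thesis by (rule red)
  next
    case sum
    have "fsubst (mid a c) r = eset blk - 1"
      unfolding sum fsubst_diff fsubst_sum
      by (simp add: eset_app_app_sum[of _ "size b" _ "size a"] klr_words_length)
    then show ?thesis using N.eset_eset[OF blk_sub blk_sub] by (simp add: right_diff_distrib eqv_diff_0)
  next
    case (s_ee k i)
    have "fsubst (mid a c) r \<doteq>\<^bsub>R\<^esub> 0"
      unfolding s_ee(1) fsubst_diff eqv_diff_0 using mid_s_ee s_ee by (simp add: fsubst_mult)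
    then show ?thesis by (rule red)
  next
    case (x_ee l i)
    have "fsubst (mid a c) r \<doteq>\<^bsub>R\<^esub> 0"
      unfolding x_ee(1) fsubst_diff eqv_diff_0 using N.x_eset[OF P_sub] x_ee size_n by (simp add: fsubst_mult)
    then show ?thesis by (rule red)
  next
    case (x_x l l')
    have "fsubst (mid a c) r \<doteq>\<^bsub>R\<^esub> 0"
      unfolding x_x(1) fsubst_diff eqv_diff_0 using N.x_x x_x size_n by (simp add: fsubst_mult)
    then show ?thesis by (rule red)
  next
    case (s_s k i)
    have "fsubst (mid a c) r \<doteq>\<^bsub>R\<^esub> 0"
      unfolding s_s(1) fsubst_diff eqv_diff_0 fsubst_mult fsubst_Qpoly fsubst_fvar mid_simps
    proof (rule N.sum_ee_cong[OF P_sub[OF s_s(4)]])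
      fix w assume w: "w \<in> P i"
      have e: "entry w (size a + k) = entry i k" "entry w (size a + (k + 1)) = entry i (k + 1)"
        using entry_P[OF w s_s(4), of k] entry_P[OF w s_s(4), of "k + 1"] s_s by simp_all
      have "w \<in> klr_words n" using P_sub[OF s_s(4)] w by blast
      then show "ss (size a + k) * ss (size a + k) * ee w \<doteq>\<^bsub>R\<^esub>
          Qpoly p (entry i k) (entry i (k + 1)) (xx (size a + (k + 1))) (xx (size a + k)) * ee w"
        using N.s_s[of w "size a + k"] s_s size_n unfolding add2 e by auto
    qed
    then show ?thesis by (rule red)
  next
    case (s_far j k)
    have "fsubst (mid a c) r \<doteq>\<^bsub>R\<^esub> 0"
      unfolding s_far(1) fsubst_diff eqv_diff_0 using N.s_far s_far size_n by (simp add: fsubst_mult)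
    then show ?thesis by (rule red)
  next
    case (braid k i)
    have "(ss (size a + (k + 1)) * ss (size a + k) * ss (size a + (k + 1)) - ss (size a + k) * ss (size a + (k + 1)) * ss (size a + k)) * eset (P i) \<doteq>\<^bsub>R\<^esub>
      (if entry i k = entry i (k + 2)
         then Qquot p (entry i k) (entry i (k + 1)) (xx (size a + (k + 1))) (xx (size a + k)) (xx (size a + (k + 2)))
         else 0) * eset (P i)"
    proof (rule N.sum_ee_cong[OF P_sub[OF braid(4)]])
      fix w assume w: "w \<in> P i"
      have e: "entry w (size a + k) = entry i k" "entry w (size a + (k + 1)) = entry i (k + 1)" "entry w (size a + (k + 2)) = entry i (k + 2)"
        using entry_P[OF w braid(4), of k] entry_P[OF w braid(4), of "k + 1"] entry_P[OF w braid(4), of "k + 2"] braid by simp_all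
      have "w \<in> klr_words n" using P_sub[OF braid(4)] w by blast
      then show "(ss (size a + (k + 1)) * ss (size a + k) * ss (size a + (k + 1)) - ss (size a + k) * ss (size a + (k + 1)) * ss (size a + k)) * ee w \<doteq>\<^bsub>R\<^esub>
      (if entry i k = entry i (k + 2)
         then Qquot p (entry i k) (entry i (k + 1)) (xx (size a + (k + 1))) (xx (size a + k)) (xx (size a + (k + 2)))
         else 0) * ee w"
        using N.s_braid[of w "size a + k"] braid size_n unfolding add2 e by (auto split: if_splits)
    qed
    then have "fsubst (mid a c) r \<doteq>\<^bsub>R\<^esub> 0"
      unfolding braid(1) fsubst_diff eqv_diff_0 by (auto simp: fsubst_mult fsubst_diff fsubst_Qquot)
    then show ?thesis by (rule red)
  next
    case (s_x k l i)
    have ad: "adj_swap (size a + k) (size a + l) = size a + adj_swap k l" by (simp add: adj_swap_def)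
    have "(ss (size a + k) * xx (size a + l) - xx (size a + adj_swap k l) * ss (size a + k)) * eset (P i) \<doteq>\<^bsub>R\<^esub>
        (if l = k \<and> entry i k = entry i (k + 1) then - 1
         else if l = k + 1 \<and> entry i k = entry i (k + 1) then 1
         else 0) * eset (P i)"
    proof (rule N.sum_ee_cong[OF P_sub[OF s_x(6)]])
      fix w assume w: "w \<in> P i"
      have e: "entry w (size a + k) = entry i k" "entry w (size a + (k + 1)) = entry i (k + 1)"
        using entry_P[OF w s_x(6), of k] entry_P[OF w s_x(6), of "k + 1"] s_x by simp_all
      have "w \<in> klr_words n" using P_sub[OF s_x(6)] w by blast
      then show "(ss (size a + k) * xx (size a + l) - xx (size a + adj_swap k l) * ss (size a + k)) * ee w \<doteq>\<^bsub>R\<^esub>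
        (if l = k \<and> entry i k = entry i (k + 1) then - 1
         else if l = k + 1 \<and> entry i k = entry i (k + 1) then 1
         else 0) * ee w"
        using N.s_x[of w "size a + k" "size a + l"] s_x size_n unfolding add2 e ad by (auto split: if_splits)
    qed
    then have "fsubst (mid a c) r \<doteq>\<^bsub>R\<^esub> 0"
      unfolding s_x(1) fsubst_diff eqv_diff_0 by (auto simp: fsubst_mult fsubst_diff fsubst_minus split: if_splits)
    then show ?thesis by (rule red)
  qed
qed

lemma mid_closed: "g \<in> KG b \<Longrightarrow> mid a c g \<in> carrier (free_alg (KG n))"
proof -
  assume "g \<in> KG b"
  then consider l where "g = GX l" "1 \<le> l" "l \<le> size b" | k where "g = GS k" "1 \<le> k" "k < size b"
    | j where "g = GE j" "j \<in> klr_words b"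
    by (auto simp: klr_gens_def)
  then show ?thesis
  proof cases
    case (3 j)
    then show ?thesis using P_sub[OF 3(2)] unfolding 3(1) mid_simps by (intro eset_closed) (auto simp: klr_gens_def)
  qed (use size_n in \<open>auto simp: klr_gens_def intro!: free_alg_fvar\<close>)
qed

lemma mid_comm:
  assumes g: "g \<in> KG b" and Y: "Y \<subseteq> klr_words n"
    and st: "\<And>k. 1 \<le> k \<Longrightarrow> k < size b \<Longrightarrow> swap_stable (size a + k) Y"
  shows "eset Y * mid a c g \<doteq>\<^bsub>R\<^esub> mid a c g * eset Y"
proof -
  consider l where "g = GX l" "1 \<le> l" "l \<le> size b" | k where "g = GS k" "1 \<le> k" "k < size b"
    | j where "g = GE j" "j \<in> klr_words b"
    using g by (auto simp: klr_gens_def)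
  then show ?thesis
  proof cases
    case (1 l)
    then show ?thesis using N.x_eset[OF Y, of "size a + l"] size_n by (auto intro: eqv_sym)
  next
    case (2 k)
    then show ?thesis using N.s_eset[OF Y, of "size a + k"] st size_n by (auto intro: eqv_sym)
  next
    case (3 j)
    then show ?thesis
      using eqv_trans[OF N.eset_eset[OF Y P_sub] eqv_sym[OF N.eset_eset[OF P_sub Y, unfolded Int_commute[of _ Y]]]] by simp
  qed
qed

lemma blk_stable: "1 \<le> k \<Longrightarrow> k < size b \<Longrightarrow> swap_stable (size a + k) blk"
  by (intro swap_stable_app_right swap_stable_app_left swap_stable_klr_words klr_words_length)

end


lemma fsubst_fsubst: "fsubst \<phi> (fsubst \<psi> f) = fsubst (\<lambda>g. fsubst \<phi> (\<psi> g)) f"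
  by (induction f rule: fralg_induct) (simp_all add: fsubst_add fsubst_mult)

lemma KG_cases [consumes 1, case_names x s e]:
  assumes "g \<in> KG b"
  obtains l where "g = GX l" "1 \<le> l" "l \<le> size b" | k where "g = GS k" "1 \<le> k" "k < size b"
    | j where "g = GE j" "j \<in> klr_words b"
  using assms by (auto simp: klr_gens_def)

text \<open>Shifts of positions add up, so the composites agree on x and sigma. On e(j) they differ:
  the outer words are concatenations of two blocks in one case and arbitrary words of the total
  content in the other. Multiplication by \<open>eset Y\<close> cuts both down to the same set of
  words, hence the corner.\<close>

lemma mid_mid:
  assumes R: "klr_cong p (size n) (klr_words n) R" and n: "n = a + a' + b + c' + c"
    and f: "f \<in> carrier (free_alg (KG b))"
    and Y: "Y = app_set (klr_words a) (app_set (klr_words a') (app_set (klr_words b) (app_set (klr_words c') (klr_words c))))"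
  shows "eset Y * fsubst (mid a c) (fsubst (mid a' c') f) \<doteq>\<^bsub>R\<^esub> eset Y * fsubst (mid (a + a') (c' + c)) f"
  unfolding fsubst_fsubst
proof (rule corner_unique[OF f])
  interpret klr_cong p "size n" "klr_words n" R by fact
  interpret M: mid_cong p n R "a + a'" b "c' + c" by unfold_locales (simp add: n add_ac)
  have Ysub: "Y \<subseteq> klr_words n" unfolding Y n by (auto simp: app_set_def klr_words_def)
  have Y2: "Y = app_set (app_set (klr_words a) (klr_words a')) (app_set (klr_words b) (app_set (klr_words c') (klr_words c)))"
    unfolding Y by (simp add: app_set_assoc)
  have len: "length u = size (a + a')" if "u \<in> app_set (klr_words a) (klr_words a')" for u
    using that app_set_klr_words[of a a'] klr_words_length by blast
  fix g assume g: "g \<in> KG b"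
  show "eset Y * mid (a + a') (c' + c) g \<doteq>\<^bsub>R\<^esub> mid (a + a') (c' + c) g * eset Y"
  proof (rule M.mid_comm[OF g Ysub])
    fix k assume "1 \<le> k" "k < size b"
    then show "swap_stable (size (a + a') + k) Y" unfolding Y2
      by (intro swap_stable_app_right swap_stable_app_left swap_stable_klr_words len)
  qed
  from g show "eset Y * fsubst (mid a c) (mid a' c' g) \<doteq>\<^bsub>R\<^esub> eset Y * mid (a + a') (c' + c) g"
  proof (cases rule: KG_cases)
    case (e j)
    let ?Z = "app_set (klr_words a) (app_set (klr_words a') (app_set {j} (app_set (klr_words c') (klr_words c))))"
    have 1: "fsubst (mid a c) (mid a' c' g) = eset ?Z"
    proof -
      have "fsubst (mid a c) (mid a' c' g) =
          (\<Sum>w\<in>app_set (klr_words a') (app_set {j} (klr_words c')). eset (app_set (klr_words a) (app_set {w} (klr_words c))))"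
        by (simp add: e(1) eset_def[of "app_set (klr_words a') _"] fsubst_sum)
      also have "\<dots> = eset (app_set (klr_words a) (app_set (app_set (klr_words a') (app_set {j} (klr_words c'))) (klr_words c)))"
        by (rule eset_app_app_sum[of _ "size a' + length j + size c'" _ "size a"])
          (auto simp: app_set_def klr_words_length)
      finally show ?thesis by (simp add: app_set_assoc)
    qed
    have "?Z \<subseteq> klr_words n" using e(2) unfolding n by (auto simp: app_set_def klr_words_def)
    moreover have "Y \<inter> ?Z = ?Z" unfolding Y
      by (intro Int_absorb1 app_set_mono subset_refl) (use e(2) in simp)
    ultimately have 2: "eset Y * eset ?Z \<doteq>\<^bsub>R\<^esub> eset ?Z" using eset_eset[OF Ysub, of ?Z] by simp
    have "Y \<inter> M.P j = ?Z"
    proof -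
      have "Y \<inter> M.P j = app_set (app_set (klr_words a) (klr_words a') \<inter> klr_words (a + a'))
          (app_set (klr_words b) (app_set (klr_words c') (klr_words c)) \<inter> app_set {j} (klr_words (c' + c)))"
        unfolding Y2 by (rule app_set_inter[of _ _ "size (a + a')"]) (use len klr_words_length in blast)
      also have "app_set (klr_words b) (app_set (klr_words c') (klr_words c)) \<inter> app_set {j} (klr_words (c' + c)) =
          app_set (klr_words b \<inter> {j}) (app_set (klr_words c') (klr_words c) \<inter> klr_words (c' + c))"
        by (rule app_set_inter[of _ _ "size b"]) (use e(2) klr_words_length in blast)
      finally show ?thesis using e(2) app_set_klr_words[of a a'] app_set_klr_words[of c' c]
        by (simp add: Int_absorb2 Int_absorb1 app_set_assoc)
    qed
    then have "eset Y * mid (a + a') (c' + c) g \<doteq>\<^bsub>R\<^esub> eset ?Z"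
      using eset_eset[OF Ysub M.P_sub[OF e(2)]] by (simp add: e(1))
    then show ?thesis unfolding 1 using 2 eqv_sym eqv_trans by blast
  qed (simp_all add: add.assoc)
qed

section \<open>The pairing of two KLR algebras\<close>

definition e2 :: "'k multiset \<Rightarrow> 'k multiset \<Rightarrow> 'k::field falg" where
  "e2 b c = eset (app_set (klr_words b) (klr_words c))"

text \<open>On representatives this is the expression inside \<open>pair_emb\<close>. It is studied
  in the KLR algebra of the sum first and transported to the VV algebra afterwards.\<close>

definition kap :: "'k multiset \<Rightarrow> 'k multiset \<Rightarrow> 'k falg \<Rightarrow> 'k falg \<Rightarrow> 'k::field falg" where
  "kap b c f g = e2 b c * fsubst (mid {#} c) f * fsubst (mid b {#}) g * e2 b c"

lemma e2_closed: "e2 b c \<in> carrier (free_alg (KG (b + c)))"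
  using app_set_klr_words[of b c] by (auto simp: e2_def klr_gens_def intro!: eset_closed)

context
  fixes p :: "'k::field" and b c :: "'k multiset" and R :: "'k falg set"
  assumes R: "klr_cong p (size (b + c)) (klr_words (b + c)) R"
begin

interpretation N: klr_cong p "size (b + c)" "klr_words (b + c)" R by (rule R)
interpretation EL: mid_cong p "b + c" R "{#}" b c by unfold_locales simp
interpretation ER: mid_cong p "b + c" R b c "{#}" by unfold_locales simp

lemma e2_blk: "e2 b c = eset EL.blk" "e2 b c = eset ER.blk"
  by (simp_all add: e2_def)

lemma e2_idem: "e2 b c * e2 b c \<doteq>\<^bsub>R\<^esub> e2 b c"
  using N.eset_eset[OF EL.blk_sub EL.blk_sub] by (simp add: e2_blk(1))

lemma left_comm: "f \<in> carrier (free_alg (KG b)) \<Longrightarrow> e2 b c * fsubst (mid {#} c) f \<doteq>\<^bsub>R\<^esub> fsubst (mid {#} c) f * e2 b c"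
  unfolding e2_blk(1)
  by (rule fsubst_commute_gens, assumption) (rule EL.mid_comm[OF _ EL.blk_sub EL.blk_stable])

lemma right_comm: "f \<in> carrier (free_alg (KG c)) \<Longrightarrow> e2 b c * fsubst (mid b {#}) f \<doteq>\<^bsub>R\<^esub> fsubst (mid b {#}) f * e2 b c"
  unfolding e2_blk(2)
  by (rule fsubst_commute_gens, assumption) (rule ER.mid_comm[OF _ ER.blk_sub ER.blk_stable])

lemma left_cong:
  assumes "f \<in> carrier (free_alg (KG b))" "f' \<in> carrier (free_alg (KG b))" "f \<doteq>\<^bsub>KJ p b\<^esub> f'"
  shows "e2 b c * fsubst (mid {#} c) f \<doteq>\<^bsub>R\<^esub> e2 b c * fsubst (mid {#} c) f'"
  unfolding e2_blk(1)
  by (rule corner_hom[OF KJ_closed assms]) ((rule EL.mid_comm[OF _ EL.blk_sub EL.blk_stable]; assumption) | (rule EL.mid_rel; assumption))+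

lemma right_cong:
  assumes "f \<in> carrier (free_alg (KG c))" "f' \<in> carrier (free_alg (KG c))" "f \<doteq>\<^bsub>KJ p c\<^esub> f'"
  shows "e2 b c * fsubst (mid b {#}) f \<doteq>\<^bsub>R\<^esub> e2 b c * fsubst (mid b {#}) f'"
  unfolding e2_blk(2)
  by (rule corner_hom[OF KJ_closed assms]) ((rule ER.mid_comm[OF _ ER.blk_sub ER.blk_stable]; assumption) | (rule ER.mid_rel; assumption))+

text \<open>The two blocks occupy disjoint positions. Generators x and sigma of different blocks are
  far apart, and the idempotents of one block are stable under the swaps of the other.\<close>

lemma left_right_gens:
  assumes g: "g \<in> KG b" and h: "h \<in> KG c"
  shows "mid {#} c g * mid b {#} h \<doteq>\<^bsub>R\<^esub> mid b {#} h * mid {#} c g"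
proof -
  have "EL.P j \<subseteq> klr_words (b + c)" if "j \<in> klr_words b" for j using EL.P_sub that .
  moreover have "swap_stable (size b + k) (EL.P j)" if "j \<in> klr_words b" "1 \<le> k" "k < size c" for j k
    using that by (auto intro!: swap_stable_app_right swap_stable_klr_words simp: klr_words_length)
  ultimately have *: "eset (EL.P j) * mid b {#} h \<doteq>\<^bsub>R\<^esub> mid b {#} h * eset (EL.P j)" if "j \<in> klr_words b" for j
    using that by (intro ER.mid_comm[OF h])
  have **: "eset (ER.P j) * mid {#} c g \<doteq>\<^bsub>R\<^esub> mid {#} c g * eset (ER.P j)" if "j \<in> klr_words c" for j
  proof (rule EL.mid_comm[OF g ER.P_sub[OF that]])
    fix k assume "1 \<le> k" "k < size b"
    then show "swap_stable (size {#} + k) (ER.P j)"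
      by (simp add: swap_stable_app_left swap_stable_klr_words)
  qed
  from g show ?thesis
  proof (cases rule: KG_cases)
    case (e j)
    then show ?thesis using * by simp
  next
    case (x l)
    note x' = x
    from h show ?thesis
    proof (cases rule: KG_cases)
      case (e j)
      then show ?thesis using ** by (auto intro: eqv_sym)
    next
      case (s k)
      then show ?thesis using x' N.s_x_far[of "size b + k" l] by (auto intro: eqv_sym)
    qed (use x' N.x_x in auto)
  next
    case (s k)
    note s' = s
    from h show ?thesis
    proof (cases rule: KG_cases)
      case (e j)
      then show ?thesis using ** by (auto intro: eqv_sym)
    next
      case (x l)
      then show ?thesis using s' N.s_x_far[of k "size b + l"] by auto
    next
      case (s k')
      then show ?thesis using s' N.s_far[of k "size b + k'"] by auto
    qed
  qed
qed

lemma left_right: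
  assumes f: "f \<in> carrier (free_alg (KG b))" and g: "g \<in> carrier (free_alg (KG c))"
  shows "fsubst (mid {#} c) f * fsubst (mid b {#}) g \<doteq>\<^bsub>R\<^esub> fsubst (mid b {#}) g * fsubst (mid {#} c) f"
  by (rule fsubst_commute_gens[OF g])
    (rule eqv_sym, rule fsubst_commute_gens[OF f], rule eqv_sym, rule left_right_gens)

text \<open>\<open>e2\<close> commutes with the images of both blocks, so the copy on the right can
  be absorbed into the one on the left.\<close>

lemma kap_simp:
  assumes f: "f \<in> carrier (free_alg (KG b))" and g: "g \<in> carrier (free_alg (KG c))"
  shows "kap b c f g \<doteq>\<^bsub>R\<^esub> e2 b c * (fsubst (mid {#} c) f * fsubst (mid b {#}) g)"
proof -
  let ?f = "fsubst (mid {#} c) f" and ?g = "fsubst (mid b {#}) g"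
  have "kap b c f g = e2 b c * ?f * (?g * e2 b c)" by (simp add: kap_def mult.assoc)
  also have "\<dots> \<doteq>\<^bsub>R\<^esub> e2 b c * ?f * (e2 b c * ?g)" by (intro eqv_mult_left eqv_sym[OF right_comm[OF g]])
  also have "\<dots> = e2 b c * (?f * e2 b c) * ?g" by (simp add: mult.assoc)
  also have "\<dots> \<doteq>\<^bsub>R\<^esub> e2 b c * (e2 b c * ?f) * ?g" by (intro eqv_mult_left eqv_mult_right eqv_sym[OF left_comm[OF f]])
  also have "\<dots> = (e2 b c * e2 b c) * (?f * ?g)" by (simp add: mult.assoc)
  also have "\<dots> \<doteq>\<^bsub>R\<^esub> e2 b c * (?f * ?g)" by (intro eqv_mult_right e2_idem)
  finally show ?thesis .
qed

lemma kap_cong: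
  assumes f: "f \<in> carrier (free_alg (KG b))" "f' \<in> carrier (free_alg (KG b))" "f \<doteq>\<^bsub>KJ p b\<^esub> f'"
    and g: "g \<in> carrier (free_alg (KG c))" "g' \<in> carrier (free_alg (KG c))" "g \<doteq>\<^bsub>KJ p c\<^esub> g'"
  shows "kap b c f g \<doteq>\<^bsub>R\<^esub> kap b c f' g'"
proof -
  let ?f = "fsubst (mid {#} c) f" and ?g = "fsubst (mid b {#}) g"
  let ?f' = "fsubst (mid {#} c) f'" and ?g' = "fsubst (mid b {#}) g'"
  have "kap b c f g \<doteq>\<^bsub>R\<^esub> e2 b c * (?f * ?g)" by (rule kap_simp[OF f(1) g(1)])
  also have "\<dots> = (e2 b c * ?f) * ?g" by (simp add: mult.assoc)
  also have "\<dots> \<doteq>\<^bsub>R\<^esub> (e2 b c * ?f') * ?g" by (intro eqv_mult_right left_cong f)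
  also have "\<dots> \<doteq>\<^bsub>R\<^esub> (?f' * e2 b c) * ?g" by (intro eqv_mult_right left_comm f)
  also have "\<dots> = ?f' * (e2 b c * ?g)" by (simp add: mult.assoc)
  also have "\<dots> \<doteq>\<^bsub>R\<^esub> ?f' * (e2 b c * ?g')" by (intro eqv_mult_left right_cong g)
  also have "\<dots> = (?f' * e2 b c) * ?g'" by (simp add: mult.assoc)
  also have "\<dots> \<doteq>\<^bsub>R\<^esub> (e2 b c * ?f') * ?g'" by (intro eqv_mult_right eqv_sym[OF left_comm] f)
  also have "\<dots> = e2 b c * (?f' * ?g')" by (simp add: mult.assoc)
  also have "\<dots> \<doteq>\<^bsub>R\<^esub> kap b c f' g'" by (rule eqv_sym[OF kap_simp[OF f(2) g(2)]])
  finally show ?thesis .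
qed

lemma kap_mult:
  assumes f: "f \<in> carrier (free_alg (KG b))" "f' \<in> carrier (free_alg (KG b))"
    and g: "g \<in> carrier (free_alg (KG c))" "g' \<in> carrier (free_alg (KG c))"
  shows "kap b c (f * f') (g * g') \<doteq>\<^bsub>R\<^esub> kap b c f g * kap b c f' g'"
proof -
  let ?f = "fsubst (mid {#} c) f" and ?g = "fsubst (mid b {#}) g"
  let ?f' = "fsubst (mid {#} c) f'" and ?g' = "fsubst (mid b {#}) g'"
  let ?e = "e2 b c"
  have "kap b c (f * f') (g * g') \<doteq>\<^bsub>R\<^esub> ?e * (?f * (?f' * ?g) * ?g')"
    using kap_simp[of "f * f'" "g * g'"] f g by (simp add: fsubst_mult mult.assoc)
  also have "\<dots> \<doteq>\<^bsub>R\<^esub> ?e * (?f * (?g * ?f') * ?g')"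
    by (intro eqv_mult_left eqv_mult_right left_right f g)
  also have "\<dots> = (?e * (?f * ?g)) * (?f' * ?g')" by (simp add: mult.assoc)
  also have "\<dots> \<doteq>\<^bsub>R\<^esub> kap b c f g * (?f' * ?g')" by (intro eqv_mult_right eqv_sym[OF kap_simp] f g)
  also have "\<dots> = ?e * ?f * ?g * (?e * (?f' * ?g'))" by (simp add: kap_def mult.assoc)
  also have "\<dots> \<doteq>\<^bsub>R\<^esub> ?e * ?f * ?g * ((?e * ?e) * (?f' * ?g'))"
    by (intro eqv_mult_left eqv_mult_right eqv_sym[OF e2_idem])
  also have "\<dots> = kap b c f g * (?e * (?f' * ?g'))" by (simp add: kap_def mult.assoc)
  also have "\<dots> \<doteq>\<^bsub>R\<^esub> kap b c f g * kap b c f' g'" by (intro eqv_mult_left eqv_sym[OF kap_simp] f g)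
  finally show ?thesis .
qed

lemma left_right_closed:
  assumes f: "f \<in> carrier (free_alg (KG b))" and g: "g \<in> carrier (free_alg (KG c))"
  shows "e2 b c * (fsubst (mid {#} c) f * fsubst (mid b {#}) g) \<in> carrier (free_alg (KG (b + c)))"
  by (intro free_alg_mult e2_closed fsubst_closed[OF f] fsubst_closed[OF g] EL.mid_closed ER.mid_closed)

lemma kap_closed:
  assumes f: "f \<in> carrier (free_alg (KG b))" and g: "g \<in> carrier (free_alg (KG c))"
  shows "kap b c f g \<in> carrier (free_alg (KG (b + c)))"
  unfolding kap_def
  by (intro free_alg_mult e2_closed fsubst_closed[OF f] fsubst_closed[OF g] EL.mid_closed ER.mid_closed)

end

lemma kap_add_left: "kap b c (f + f') g = kap b c f g + kap b c f' g"
  by (simp add: kap_def fsubst_add algebra_simps)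

lemma kap_add_right: "kap b c f (g + g') = kap b c f g + kap b c f g'"
  by (simp add: kap_def fsubst_add algebra_simps)

lemma kap_scal: "kap b c (fscal s * f) g = kap b c f (fscal s * g)"
proof -
  have "fscal s * fsubst (mid {#} c) f * h = fsubst (mid {#} c) f * (fscal s * h)" for h
    by (metis fscal_commute mult.assoc)
  then show ?thesis by (simp add: kap_def fsubst_mult mult.assoc)
qed

text \<open>Let \<open>F\<close>, \<open>G\<close>, \<open>H\<close> be the images of
  \<open>f\<close>, \<open>g\<close>, \<open>h\<close> in the left, middle and right of three
  blocks, and \<open>eset Y\<close> the idempotent of the triple. Once \<open>mid_mid\<close> has
  collapsed the nested substitutions, both bracketings become
  \<open>F * (eset Y * G) * H\<close>.\<close>

lemma kap_assoc:
  fixes p :: "'k::field"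
  assumes R: "klr_cong p (size (b + a + c)) (klr_words (b + a + c)) R"
    and f: "f \<in> carrier (free_alg (KG b))" and g: "g \<in> carrier (free_alg (KG a))" and h: "h \<in> carrier (free_alg (KG c))"
  shows "kap (b + a) c (kap b a f g) h \<doteq>\<^bsub>R\<^esub> kap b (a + c) f (kap a c g h)"
proof -
  interpret klr_cong p "size (b + a + c)" "klr_words (b + a + c)" R by (rule R)
  have R': "klr_cong p (size (b + (a + c))) (klr_words (b + (a + c))) R" using R by (simp add: add.assoc)
  have Rba: "klr_cong p (size (b + a)) (klr_words (b + a)) (KJ p (b + a))" by (rule klr_cong_KJ) simp
  have Rac: "klr_cong p (size (a + c)) (klr_words (a + c)) (KJ p (a + c))" by (rule klr_cong_KJ) simp
  define Y where "Y = app_set (klr_words b) (app_set (klr_words a) (klr_words c))"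
  have Ysub: "Y \<subseteq> klr_words (b + a + c)" unfolding Y_def by (auto simp: app_set_def klr_words_def)
  define F where "F = fsubst (mid {#} (a + c)) f"
  define G where "G = fsubst (mid b c) g"
  define H where "H = fsubst (mid (b + a) {#}) h"
  interpret MF: mid_cong p "b + a + c" R "{#}" b "a + c" by unfold_locales (simp add: add.assoc)
  interpret MG: mid_cong p "b + a + c" R b a c by unfold_locales simp
  interpret MH: mid_cong p "b + a + c" R "b + a" c "{#}" by unfold_locales simp
  have Ycomm: "eset Y * F \<doteq>\<^bsub>R\<^esub> F * eset Y" "eset Y * G \<doteq>\<^bsub>R\<^esub> G * eset Y"
  proof -
    show "eset Y * F \<doteq>\<^bsub>R\<^esub> F * eset Y" unfolding F_def
    proof (rule fsubst_commute_gens[OF f], rule MF.mid_comm[OF _ Ysub])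
      fix k assume "1 \<le> k" "k < size b"
      then show "swap_stable (size {#} + k) Y" by (simp add: Y_def swap_stable_app_left swap_stable_klr_words)
    qed
    show "eset Y * G \<doteq>\<^bsub>R\<^esub> G * eset Y" unfolding G_def
    proof (rule fsubst_commute_gens[OF g], rule MG.mid_comm[OF _ Ysub])
      fix k assume "1 \<le> k" "k < size a"
      then show "swap_stable (size b + k) Y" unfolding Y_def
        by (intro swap_stable_app_right swap_stable_app_left swap_stable_klr_words klr_words_length)
    qed
  qed
  have 1: "eset Y * fsubst (mid {#} c) (fsubst (mid {#} a) f) \<doteq>\<^bsub>R\<^esub> eset Y * F"
    using mid_mid[OF R _ f, of "{#}" "{#}" a c Y] by (simp add: Y_def F_def)
  have 2: "eset Y * fsubst (mid {#} c) (fsubst (mid b {#}) g) \<doteq>\<^bsub>R\<^esub> eset Y * G"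
    using mid_mid[OF R _ g, of "{#}" b "{#}" c Y] by (simp add: Y_def G_def)
  have 3: "eset Y * fsubst (mid b {#}) (fsubst (mid {#} c) g) \<doteq>\<^bsub>R\<^esub> eset Y * G"
    using mid_mid[OF R _ g, of b "{#}" c "{#}" Y] by (simp add: Y_def G_def)
  have 4: "eset Y * fsubst (mid b {#}) (fsubst (mid a {#}) h) \<doteq>\<^bsub>R\<^esub> eset Y * H"
    using mid_mid[OF R _ h, of b a "{#}" "{#}" Y] by (simp add: Y_def H_def)
  have "kap (b + a) c (kap b a f g) h \<doteq>\<^bsub>R\<^esub> kap (b + a) c (e2 b a * (fsubst (mid {#} a) f * fsubst (mid b {#}) g)) h"
    by (rule kap_cong[OF R kap_closed[OF Rba f g] left_right_closed[OF Rba f g] kap_simp[OF Rba f g] h h eqv_refl])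
  also have "\<dots> \<doteq>\<^bsub>R\<^esub> e2 (b + a) c * (fsubst (mid {#} c) (e2 b a * (fsubst (mid {#} a) f * fsubst (mid b {#}) g)) * H)"
    unfolding H_def
    by (rule kap_simp[OF R left_right_closed[OF Rba f g] h])
  also have "\<dots> = (e2 (b + a) c * fsubst (mid {#} c) (e2 b a)) *
      (fsubst (mid {#} c) (fsubst (mid {#} a) f) * fsubst (mid {#} c) (fsubst (mid b {#}) g) * H)"
    by (simp add: fsubst_mult mult.assoc)
  also have "\<dots> \<doteq>\<^bsub>R\<^esub> eset Y * (fsubst (mid {#} c) (fsubst (mid {#} a) f) * fsubst (mid {#} c) (fsubst (mid b {#}) g) * H)"
  proof (intro eqv_mult_right)
    \<comment> \<open>Extending the idempotent of the inner pair by all words of the third block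
      gives the idempotent of the triple, which lies below the outer one.\<close>
    have "fsubst (mid {#} c) (e2 b a) = (\<Sum>w\<in>app_set (klr_words b) (klr_words a). eset (app_set {w} (klr_words c)))"
      by (simp add: e2_def eset_def[of "app_set (klr_words b) (klr_words a)"] fsubst_sum)
    also have "\<dots> = eset (app_set (app_set (klr_words b) (klr_words a)) (klr_words c))"
      by (rule eset_app_sum[of _ "size b + size a"]) (auto simp: app_set_def klr_words_length)
    finally have "fsubst (mid {#} c) (e2 b a) = eset Y" by (simp add: Y_def app_set_assoc)
    moreover have "app_set (klr_words (b + a)) (klr_words c) \<inter> Y = Y"
      unfolding Y_def app_set_assoc[symmetric] by (intro Int_absorb1 app_set_mono app_set_klr_words subset_refl)
    ultimately show "e2 (b + a) c * fsubst (mid {#} c) (e2 b a) \<doteq>\<^bsub>R\<^esub> eset Y"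
      using eset_eset[OF app_set_klr_words Ysub] by (simp add: e2_def)
  qed
  also have "\<dots> = (eset Y * fsubst (mid {#} c) (fsubst (mid {#} a) f)) * (fsubst (mid {#} c) (fsubst (mid b {#}) g) * H)"
    by (simp add: mult.assoc)
  also have "\<dots> \<doteq>\<^bsub>R\<^esub> (eset Y * F) * (fsubst (mid {#} c) (fsubst (mid b {#}) g) * H)" by (intro eqv_mult_right 1)
  also have "\<dots> \<doteq>\<^bsub>R\<^esub> (F * eset Y) * (fsubst (mid {#} c) (fsubst (mid b {#}) g) * H)" by (intro eqv_mult_right Ycomm)
  also have "\<dots> = F * (eset Y * fsubst (mid {#} c) (fsubst (mid b {#}) g)) * H" by (simp add: mult.assoc)
  also have "\<dots> \<doteq>\<^bsub>R\<^esub> F * (eset Y * G) * H" by (intro eqv_mult_right eqv_mult_left 2)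
  finally have L: "kap (b + a) c (kap b a f g) h \<doteq>\<^bsub>R\<^esub> F * (eset Y * G) * H" .
  have "kap b (a + c) f (kap a c g h) \<doteq>\<^bsub>R\<^esub> kap b (a + c) f (e2 a c * (fsubst (mid {#} c) g * fsubst (mid a {#}) h))"
    by (rule kap_cong[OF R' f f eqv_refl kap_closed[OF Rac g h] left_right_closed[OF Rac g h] kap_simp[OF Rac g h]])
  also have "\<dots> \<doteq>\<^bsub>R\<^esub> e2 b (a + c) * (F * fsubst (mid b {#}) (e2 a c * (fsubst (mid {#} c) g * fsubst (mid a {#}) h)))"
    unfolding F_def
    by (rule kap_simp[OF R' f left_right_closed[OF Rac g h]])
  also have "\<dots> = (e2 b (a + c) * F) * fsubst (mid b {#}) (e2 a c * (fsubst (mid {#} c) g * fsubst (mid a {#}) h))"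
    by (simp add: mult.assoc)
  also have "\<dots> \<doteq>\<^bsub>R\<^esub> (F * e2 b (a + c)) * fsubst (mid b {#}) (e2 a c * (fsubst (mid {#} c) g * fsubst (mid a {#}) h))"
    unfolding F_def by (intro eqv_mult_right left_comm[OF R' f])
  also have "\<dots> = F * (e2 b (a + c) * fsubst (mid b {#}) (e2 a c)) *
      (fsubst (mid b {#}) (fsubst (mid {#} c) g) * fsubst (mid b {#}) (fsubst (mid a {#}) h))"
    by (simp add: fsubst_mult mult.assoc)
  also have "\<dots> \<doteq>\<^bsub>R\<^esub> F * eset Y * (fsubst (mid b {#}) (fsubst (mid {#} c) g) * fsubst (mid b {#}) (fsubst (mid a {#}) h))"
  proof (intro eqv_mult_right eqv_mult_left)
    have "fsubst (mid b {#}) (e2 a c) = (\<Sum>w\<in>app_set (klr_words a) (klr_words c). eset (app_set (klr_words b) (app_set {w} {[]})))"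
      by (simp add: e2_def eset_def[of "app_set (klr_words a) (klr_words c)"] fsubst_sum)
    also have "\<dots> = eset (app_set (klr_words b) (app_set (app_set (klr_words a) (klr_words c)) {[]}))"
      by (rule eset_app_app_sum[of _ "size a + size c" _ "size b"]) (auto simp: app_set_def klr_words_length)
    finally have "fsubst (mid b {#}) (e2 a c) = eset Y" by (simp add: Y_def)
    moreover have "app_set (klr_words b) (klr_words (a + c)) \<inter> Y = Y"
      unfolding Y_def by (intro Int_absorb1 app_set_mono app_set_klr_words subset_refl)
    moreover have "app_set (klr_words b) (klr_words (a + c)) \<subseteq> klr_words (b + a + c)"
      using app_set_klr_words[of b "a + c"] by (simp add: add.assoc)
    ultimately show "e2 b (a + c) * fsubst (mid b {#}) (e2 a c) \<doteq>\<^bsub>R\<^esub> eset Y"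
      using eset_eset[OF _ Ysub] by (metis e2_def)
  qed
  also have "\<dots> = F * (eset Y * fsubst (mid b {#}) (fsubst (mid {#} c) g)) * fsubst (mid b {#}) (fsubst (mid a {#}) h)"
    by (simp add: mult.assoc)
  also have "\<dots> \<doteq>\<^bsub>R\<^esub> F * (eset Y * G) * fsubst (mid b {#}) (fsubst (mid a {#}) h)"
    by (intro eqv_mult_right eqv_mult_left 3)
  also have "\<dots> \<doteq>\<^bsub>R\<^esub> F * (G * eset Y) * fsubst (mid b {#}) (fsubst (mid a {#}) h)"
    by (intro eqv_mult_right eqv_mult_left Ycomm)
  also have "\<dots> = F * G * (eset Y * fsubst (mid b {#}) (fsubst (mid a {#}) h))"
    by (simp add: mult.assoc)
  also have "\<dots> \<doteq>\<^bsub>R\<^esub> F * G * (eset Y * H)" by (intro eqv_mult_left 4)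
  also have "\<dots> = F * (G * eset Y) * H" by (simp add: mult.assoc)
  also have "\<dots> \<doteq>\<^bsub>R\<^esub> F * (eset Y * G) * H" by (intro eqv_mult_right eqv_mult_left eqv_sym[OF Ycomm(2)])
  finally show ?thesis using L eqv_sym eqv_trans by blast
qed

section \<open>Sorting a word by signs\<close>

context
  fixes pos :: "'k::field \<Rightarrow> bool"
begin

text \<open>Moving each negative letter in turn to the front and inverting it there turns the word \<open>i\<close> into
  \<open>wsort i\<close>; the letter at place \<open>l\<close> ends up at place \<open>wpos i l\<close>.\<close>

definition wsgn :: "'k list \<Rightarrow> nat \<Rightarrow> bool" where
  "wsgn i l = pos (entry i l)"

definition wpos :: "'k list \<Rightarrow> nat \<Rightarrow> nat" where
  "wpos i l = (if wsgn i l then length (filter (Not \<circ> pos) i) + length (filter pos (take l i))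
     else length (filter (Not \<circ> pos) (drop (l - 1) i)))"

definition wsort :: "'k list \<Rightarrow> 'k list" where
  "wsort i = rev (map inverse (filter (Not \<circ> pos) i)) @ filter pos i"

lemma split_at:
  assumes "1 \<le> l" "l \<le> length i"
  obtains u x v where "i = u @ x # v" "l = Suc (length u)" "entry i l = x"
proof -
  have "l - 1 < length i" using assms by simp
  then have "i = take (l - 1) i @ entry i l # drop l i"
    using assms id_take_nth_drop[of "l - 1" i] by (simp add: entry_def)
  moreover have "l = Suc (length (take (l - 1) i))" using assms by simp
  ultimately show ?thesis using that by blast
qed

lemma split_at2:
  assumes "1 \<le> k" "k < length i"
  obtains u x y v where "i = u @ x # y # v" "k = Suc (length u)" "entry i k = x" "entry i (k + 1) = y"
proof -
  obtain u x v where 1: "i = u @ x # v" "k = Suc (length u)" "entry i k = x" using split_at[of k i] assms by auto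
  then obtain y v' where "v = y # v'" using assms by (cases v) auto
  then show ?thesis using that[of u x y v'] 1 by (simp add: entry_def nth_append)
qed

lemma length_filters: "length (filter (Not \<circ> pos) i) + length (filter pos i) = length i"
  by (induction i) auto

lemma entry_wsort_wpos:
  assumes "1 \<le> l" "l \<le> length i"
  shows "entry (wsort i) (wpos i l) = (if wsgn i l then entry i l else inverse (entry i l))"
proof -
  obtain u x v where i: "i = u @ x # v" "l = Suc (length u)" "entry i l = x" using split_at assms by blast
  show ?thesis
  proof (cases "pos x")
    case True
    then show ?thesis using i by (simp add: wsgn_def wpos_def wsort_def entry_def nth_append)
  next
    case False
    then show ?thesis using i by (simp add: wsgn_def wpos_def wsort_def entry_def nth_append)
  qed
qed

lemma wpos_bounds:
  assumes "1 \<le> l" "l \<le> length i" shows "1 \<le> wpos i l" "wpos i l \<le> length i"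
proof -
  obtain u x v where i: "i = u @ x # v" "l = Suc (length u)" "entry i l = x" using split_at assms by blast
  then show "1 \<le> wpos i l" by (simp add: wsgn_def wpos_def)
  show "wpos i l \<le> length i"
    using i length_filters[of u] length_filters[of v] by (auto simp: wsgn_def wpos_def)
qed

lemma wpos_Suc_pos:
  assumes "1 \<le> k" "k < length i" "wsgn i k" "wsgn i (k + 1)" shows "wpos i (k + 1) = wpos i k + 1"
proof -
  obtain u x y v where i: "i = u @ x # y # v" "k = Suc (length u)" "entry i k = x" "entry i (k + 1) = y"
    using split_at2 assms by blast
  then show ?thesis using assms by (simp add: wsgn_def wpos_def)
qed

text \<open>Negative letters go to the front one after another, which reverses their order.\<close>

lemma wpos_Suc_neg:
  assumes "1 \<le> k" "k < length i" "\<not> wsgn i k" "\<not> wsgn i (k + 1)" shows "wpos i k = wpos i (k + 1) + 1"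
proof -
  obtain u x y v where i: "i = u @ x # y # v" "k = Suc (length u)" "entry i k = x" "entry i (k + 1) = y"
    using split_at2 assms by blast
  then show ?thesis using assms by (simp add: wsgn_def wpos_def)
qed

lemma wsgn_swap:
  "1 \<le> k \<Longrightarrow> k < length i \<Longrightarrow> 1 \<le> l \<Longrightarrow> l \<le> length i \<Longrightarrow> wsgn (swap_entries k i) l = wsgn i (adj_swap k l)"
  by (simp add: wsgn_def entry_swap)

lemma swap_split: "swap_entries (Suc (length u)) (u @ x # y # v) = u @ y # x # v"
  by (simp add: swap_entries_def entry_def nth_append list_update_append)

text \<open>Places in the sorted word depend only on the pattern of signs. A swap of equal signs
  leaves the pattern unchanged; a mixed swap changes it, and the places follow the letters.\<close>

lemma wpos_swap:
  assumes "1 \<le> k" "k < length i" "1 \<le> l" "l \<le> length i"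
  shows "wpos (swap_entries k i) l = (if wsgn i k = wsgn i (k + 1) then wpos i l else wpos i (adj_swap k l))"
proof -
  obtain u x y v where i: "i = u @ x # y # v" "k = Suc (length u)" "entry i k = x" "entry i (k + 1) = y"
    using split_at2 assms by blast
  have s: "swap_entries k i = u @ y # x # v" unfolding i(1,2) by (rule swap_split)
  have sgk: "wsgn i k = pos x" "wsgn i (k + 1) = pos y" using i by (simp_all add: wsgn_def)
  consider "l \<le> length u" | "l = k" | "l = k + 1" | "length u + 2 < l"
    using i(2) by linarith
  then show ?thesis
  proof cases
    case 1
    have "entry (u @ y # x # v) l = entry u l" "entry i l = entry u l"
      using 1 assms(3) i(1) by (simp_all add: entry_append_left)
    moreover have "adj_swap k l = l" using 1 i(2) by (simp add: adj_swap_def)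
    moreover have "l - length u = 0" "l - Suc (length u) = 0" using 1 by simp_all
    ultimately show ?thesis using 1 unfolding s wpos_def wsgn_def by (auto simp: i(1))
  next
    case 2
    then show ?thesis unfolding s sgk using i by (auto simp: wpos_def wsgn_def entry_def nth_append adj_swap_def)
  next
    case 3
    then show ?thesis unfolding s sgk using i by (auto simp: wpos_def wsgn_def entry_def nth_append adj_swap_def)
  next
    case gt: 4
    define l' where "l' = l - length u - 3"
    have 4: "l = length u + 2 + Suc l'" using gt by (simp add: l'_def)
    have e: "entry (u @ y # x # v) l = v ! l'" "entry i l = v ! l'"
      unfolding i(1) 4 by (simp_all add: entry_def nth_append)
    moreover have "adj_swap k l = l" using 4 i(2) by (simp add: adj_swap_def)
    moreover have "wpos (u @ y # x # v) l = wpos i l"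
      unfolding wpos_def wsgn_def e unfolding i(1) 4 by (simp add: numeral_2_eq_2 numeral_3_eq_3)
    ultimately show ?thesis unfolding s by simp
  qed
qed

text \<open>The sorted word remembers the order only among letters of equal sign.\<close>

lemma wsort_swap_mixed:
  assumes "1 \<le> k" "k < length i" "wsgn i k \<noteq> wsgn i (k + 1)"
  shows "wsort (swap_entries k i) = wsort i"
proof -
  obtain u x y v where i: "i = u @ x # y # v" "k = Suc (length u)" "entry i k = x" "entry i (k + 1) = y"
    using split_at2 assms by blast
  have s: "swap_entries k i = u @ y # x # v" unfolding i(1,2) by (rule swap_split)
  show ?thesis unfolding s using i assms(3) by (auto simp: wsort_def wsgn_def)
qed

text \<open>Neighbours of equal sign stay neighbours after sorting, in the same order if positive
  and in the opposite order if negative; \<open>min\<close> picks the left one of the two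
  places.\<close>

lemma wsort_swap_same:
  assumes "1 \<le> k" "k < length i" "wsgn i k = wsgn i (k + 1)"
  shows "wsort (swap_entries k i) = swap_entries (min (wpos i k) (wpos i (k + 1))) (wsort i)"
proof -
  obtain u x y v where i: "i = u @ x # y # v" "k = Suc (length u)" "entry i k = x" "entry i (k + 1) = y"
    using split_at2 assms by blast
  have s: "swap_entries k i = u @ y # x # v" unfolding i(1,2) by (rule swap_split)
  show ?thesis
  proof (cases "pos x")
    case True
    then have y: "pos y" using assms(3) i by (simp add: wsgn_def)
    let ?u = "rev (map inverse (filter (Not \<circ> pos) i)) @ filter pos u"
    have "min (wpos i k) (wpos i (k + 1)) = Suc (length ?u)"
      using True y i by (simp add: wpos_def wsgn_def)
    moreover have "wsort i = ?u @ x # y # filter pos v" "wsort (u @ y # x # v) = ?u @ y # x # filter pos v"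
      using True y i by (simp_all add: wsort_def)
    ultimately show ?thesis unfolding s by (simp only: swap_split)
  next
    case False
    then have y: "\<not> pos y" using assms(3) i by (simp add: wsgn_def)
    let ?u = "rev (map inverse (filter (Not \<circ> pos) v))"
    let ?v = "rev (map inverse (filter (Not \<circ> pos) u)) @ filter pos i"
    have "min (wpos i k) (wpos i (k + 1)) = Suc (length ?u)"
      using False y i by (simp add: wpos_def wsgn_def)
    moreover have "wsort i = ?u @ inverse y # inverse x # ?v" "wsort (u @ y # x # v) = ?u @ inverse x # inverse y # ?v"
      using False y i by (simp_all add: wsort_def)
    ultimately show ?thesis unfolding s by (simp only: swap_split)
  qed
qed

lemma wpos_inj:
  assumes "1 \<le> l" "l < l'" "l' \<le> length i" shows "wpos i l \<noteq> wpos i l'"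
proof -
  obtain w y v where i: "i = w @ y # v" "l' = Suc (length w)" "entry i l' = y" using split_at[of l' i] assms by auto
  obtain u x w' where w: "w = u @ x # w'" "l = Suc (length u)" "entry w l = x" using split_at[of l w] assms i(2) by auto
  have e: "entry i l = x" using w i by (simp add: entry_def nth_append)
  show ?thesis unfolding wpos_def wsgn_def e i(3) using i(1,2) w(1,2) by auto
qed

lemma wpos_inj': "1 \<le> l \<Longrightarrow> l \<le> length i \<Longrightarrow> 1 \<le> l' \<Longrightarrow> l' \<le> length i \<Longrightarrow> wpos i l = wpos i l' \<longleftrightarrow> l = l'"
  using wpos_inj[of l l' i] wpos_inj[of l' l i] by (metis linorder_neqE_nat)

lemma length_wsort [simp]: "length (wsort i) = length i"
  using length_filters[of i] by (simp add: wsort_def)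

lemma wsort_pos: "(\<And>x. x \<in> set i \<Longrightarrow> pos x) \<Longrightarrow> wsort i = i"
  by (simp add: wsort_def filter_True filter_empty_conv)

lemma wpos_pos:
  assumes "\<And>x. x \<in> set i \<Longrightarrow> pos x" "1 \<le> l" "l \<le> length i" shows "wpos i l = l"
proof -
  have "entry i l \<in> set i" using assms(2,3) by (simp add: entry_def)
  moreover have "filter pos (take l i) = take l i" using assms(1) by (auto simp: filter_id_conv dest: in_set_takeD)
  moreover have "filter (Not \<circ> pos) i = []" using assms(1) by (auto simp: filter_empty_conv)
  ultimately show ?thesis using assms by (simp add: wpos_def wsgn_def)
qed

lemma wsgn_invert:
  assumes "i \<noteq> []" "pos (inverse (hd i)) \<noteq> pos (hd i)" "1 \<le> l"
  shows "wsgn (invert_first i) l = (if l = 1 then \<not> wsgn i l else wsgn i l)"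
  using assms by (cases i) (auto simp: wsgn_def entry_def invert_first_def nth_Cons')

text \<open>The first letter of a word is either the last of the reversed negative letters or the
  first of the positive ones. Counted in the sorted word this is the same place.\<close>

lemma wpos_invert:
  assumes "i \<noteq> []" "pos (inverse (hd i)) \<noteq> pos (hd i)" "1 \<le> l"
  shows "wpos (invert_first i) l = wpos i l"
proof -
  obtain x r where i: "i = x # r" using assms(1) by (cases i) auto
  obtain l' where l: "l = Suc l'" using assms(3) by (cases l) auto
  show ?thesis
    using assms(2) wsgn_invert[OF assms] by (cases l') (auto simp: wpos_def l i invert_first_def wsgn_def entry_def)
qed

lemma wsort_invert:
  assumes "i \<noteq> []" "pos (inverse (hd i)) \<noteq> pos (hd i)"
  shows "wsort (invert_first i) = wsort i"
  using assms by (cases i) (auto simp: wsort_def invert_first_def)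

end

section \<open>The action of a free algebra by operators\<close>

text \<open>\<open>foldr\<close> lets the last letter of a word act first, as in a left module.
  Families are functions of the index, so the operators may permute components as well as multiply
  them.\<close>

definition lact :: "('g \<Rightarrow> ('i \<Rightarrow> ('h, 'k::field) fralg) \<Rightarrow> 'i \<Rightarrow> ('h, 'k) fralg) \<Rightarrow> ('g, 'k) fralg
    \<Rightarrow> ('i \<Rightarrow> ('h, 'k) fralg) \<Rightarrow> 'i \<Rightarrow> ('h, 'k) fralg" where
  "lact op f \<phi> i = poly_extend (\<lambda>w c. fscal c * foldr op (letters w) \<phi> i) f"

lemma lact_add: "lact op (f + g) \<phi> i = lact op f \<phi> i + lact op g \<phi> i"
  unfolding lact_def by (rule poly_extend_add) (simp_all add: fscal_add algebra_simps)

lemma lact_single: "lact op (Poly_Mapping.single w c) \<phi> i = fscal c * foldr op (letters w) \<phi> i"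
  unfolding lact_def by (simp add: poly_extend_single)

lemma lact_fscal: "lact op (fscal c) \<phi> i = fscal c * \<phi> i"
  by (simp add: fscal_def lact_single zero_fword_def) 

lemma lact_0 [simp]: "lact op 0 \<phi> i = 0"
  using lact_fscal[of op 0] by simp

lemma lact_1 [simp]: "lact op 1 \<phi> = \<phi>"
  using lact_fscal[of op 1 \<phi>] by (simp add: fun_eq_iff)

lemma lact_minus: "lact op (- f) \<phi> i = - lact op f \<phi> i"
  using lact_add[of op f "- f" \<phi> i] by (simp add: eq_neg_iff_add_eq_0 add.commute)

lemma lact_diff: "lact op (f - g) \<phi> i = lact op f \<phi> i - lact op g \<phi> i"
  using lact_add[of op f "- g" \<phi> i] by (simp add: lact_minus)

lemma lact_sum: "lact op (sum f U) \<phi> i = (\<Sum>u\<in>U. lact op (f u) \<phi> i)"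
  by (induction U rule: infinite_finite_induct) (simp_all add: lact_add)

lemma lact_fscal_mult: "lact op (fscal c * f) \<phi> i = fscal c * lact op f \<phi> i"
proof -
  have "lact op (fscal c * Poly_Mapping.single w d) \<phi> i = fscal c * lact op (Poly_Mapping.single w d) \<phi> i" for w d
    by (simp add: fscal_times_single lact_single fscal_mult mult.assoc)
  then have "lact op (fscal c * (\<Sum>w\<in>U. Poly_Mapping.single w (d w))) \<phi> i =
     fscal c * lact op (\<Sum>w\<in>U. Poly_Mapping.single w (d w)) \<phi> i" for U d
    by (simp add: sum_distrib_left lact_sum)
  then show ?thesis using poly_mapping_sum_single[of f] by metis
qed

text \<open>Families carry a right module structure over the target algebra. That the operators
  commute with it later yields right linearity of the projection.\<close>

locale linear_ops =
  fixes op :: "'g \<Rightarrow> ('i \<Rightarrow> ('h, 'k::field) fralg) \<Rightarrow> 'i \<Rightarrow> ('h, 'k) fralg"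
  assumes op_add: "op g (\<lambda>i. \<phi> i + \<psi> i) = (\<lambda>i. op g \<phi> i + op g \<psi> i)"
    and op_right: "op g (\<lambda>i. \<phi> i * r) = (\<lambda>i. op g \<phi> i * r)"
    and op_scal: "op g (\<lambda>i. fscal c * \<phi> i) = (\<lambda>i. fscal c * op g \<phi> i)"
begin

lemma op_0: "op g (\<lambda>i. 0) = (\<lambda>i. 0)"
  using op_right[of g "\<lambda>i. 0" 0] by simp

lemma op_sum: "op g (\<lambda>i. \<Sum>u\<in>U. \<phi> u i) = (\<lambda>i. \<Sum>u\<in>U. op g (\<phi> u) i)"
  by (induction U rule: infinite_finite_induct) (simp_all add: op_0 op_add)

lemma lact_fvar_mult: "lact op (fvar g * f) \<phi> = op g (lact op f \<phi>)"
proof -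
  have f: "lact op f \<phi> = (\<lambda>i. \<Sum>w\<in>Poly_Mapping.keys f. fscal (Poly_Mapping.lookup f w) * foldr op (letters w) \<phi> i)"
    by (simp add: fun_eq_iff lact_def poly_extend_def)
  have s: "fvar g * Poly_Mapping.single w d = Poly_Mapping.single (FWord (g # letters w)) d" for w d
    by (simp add: fvar_def mult_single plus_fword_def)
  have "lact op (fvar g * f) \<phi> =
      (\<lambda>i. \<Sum>w\<in>Poly_Mapping.keys f. lact op (fvar g * Poly_Mapping.single w (Poly_Mapping.lookup f w)) \<phi> i)"
    by (subst poly_mapping_sum_single[of f]) (simp add: fun_eq_iff sum_distrib_left lact_sum)
  also have "\<dots> = op g (lact op f \<phi>)"
    unfolding f s op_sum op_scal lact_single by simp
  finally show ?thesis .
qed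

lemma lact_fvar: "lact op (fvar g) \<phi> = op g \<phi>"
  using lact_fvar_mult[of g 1 \<phi>] by simp

lemma lact_mult: "lact op (f * g) \<phi> = lact op f (lact op g \<phi>)"
proof (induction f rule: fralg_induct)
  case (scal c)
  show ?case by (simp add: fun_eq_iff lact_fscal_mult lact_fscal)
next
  case (var x f)
  then show ?case by (simp add: mult.assoc lact_fvar_mult)
next
  case (add f h)
  then show ?case by (simp add: fun_eq_iff distrib_right lact_add)
qed

lemma lact_right: "lact op f (\<lambda>i. \<phi> i * r) = (\<lambda>i. lact op f \<phi> i * r)"
proof (induction f rule: fralg_induct)
  case (var g f)
  then show ?case by (simp only: lact_fvar_mult op_right)
qed (simp_all add: fun_eq_iff lact_fscal lact_add mult.assoc distrib_right)

end

section \<open>A module over the VV algebra\<close>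

text \<open>\<open>Vs\<close> stands for I, \<open>pos\<close> for membership in the positive half,
  and \<open>b\<close> for the positive part, so that the VV algebra belongs to \<open>b\<close>
  together with its inverses. \<open>arrow_pos\<close> says that no arrow joins letters of opposite
  sign.\<close>

locale vv_data =
  fixes p :: "'k::field" and Vs :: "'k set" and pos :: "'k \<Rightarrow> bool" and b :: "'k multiset"
  assumes nonzero: "x \<in> Vs \<Longrightarrow> x \<noteq> 0" and inv_Vs: "x \<in> Vs \<Longrightarrow> inverse x \<in> Vs"
    and pos_inv: "x \<in> Vs \<Longrightarrow> pos (inverse x) \<longleftrightarrow> \<not> pos x"
    and arrow_pos: "x \<in> Vs \<Longrightarrow> y \<in> Vs \<Longrightarrow> x = p\<^sup>2 * y \<Longrightarrow> pos x = pos y"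
    and p0: "p \<noteq> 0"
    and b: "x \<in># b \<Longrightarrow> x \<in> Vs \<and> pos x"
begin

abbreviation sg where "sg \<equiv> wsgn pos"
abbreviation ps where "ps \<equiv> wpos pos"
abbreviation srt where "srt \<equiv> wsort pos"
abbreviation m where "m \<equiv> size b"
abbreviation A where "A \<equiv> vv_words (b + image_mset inverse b)"
abbreviation J where "J \<equiv> KJ p b"
abbreviation VR where "VR \<equiv> vv_rels p m A"
abbreviation VG where "VG \<equiv> vv_gens m A"

lemma A_iff: "i \<in> A \<longleftrightarrow> mset i + image_mset inverse (mset i) = b + image_mset inverse b"
  by (simp add: vv_words_def)

lemma A_Vs: "i \<in> A \<Longrightarrow> x \<in> set i \<Longrightarrow> x \<in> Vs"
proof -
  assume i: "i \<in> A" "x \<in> set i"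
  then have "x \<in># b + image_mset inverse b" unfolding A_iff by (metis UnCI set_mset_mset set_mset_union)
  then show ?thesis using b inv_Vs by auto
qed

lemma A_length: "i \<in> A \<Longrightarrow> length i = m"
proof -
  assume "i \<in> A"
  then have "size (mset i + image_mset inverse (mset i)) = size (b + image_mset inverse b)" unfolding A_iff by simp
  then show ?thesis by simp
qed

lemma A_swap: "i \<in> A \<Longrightarrow> 1 \<le> k \<Longrightarrow> k < m \<Longrightarrow> swap_entries k i \<in> A"
  using mset_swap[of k i] A_length[of i] by (simp add: A_iff)

lemma A_invert: "i \<in> A \<Longrightarrow> 1 \<le> m \<Longrightarrow> invert_first i \<in> A"
  using A_length[of i] by (cases i) (auto simp: A_iff invert_first_def add_mset_commute)

lemma klr_words_A: "i \<in> klr_words b \<Longrightarrow> i \<in> A"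
  by (auto simp: A_iff klr_words_def)

lemma klr_words_pos: "i \<in> klr_words b \<Longrightarrow> x \<in> set i \<Longrightarrow> pos x"
  using b by (auto simp: klr_words_def)

lemma finite_A: "finite A"
proof -
  have "A \<subseteq> {xs. set xs \<subseteq> set_mset (b + image_mset inverse b) \<and> length xs = m}"
  proof
    fix i assume i: "i \<in> A"
    have "set_mset (mset i) \<subseteq> set_mset (mset i + image_mset inverse (mset i))" by simp
    then show "i \<in> {xs. set xs \<subseteq> set_mset (b + image_mset inverse b) \<and> length xs = m}"
      using A_length[OF i] i unfolding A_iff by simp
  qed
  then show ?thesis by (rule finite_subset) (simp add: finite_lists_length_eq)
qed

text \<open>The multiset of the letters of \<open>i\<close> and their inverses has as its positive
  half the positive letters of \<open>i\<close> and the inverses of the negative ones; these are the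
  letters of the sorted word.\<close>

lemma srt_A: "i \<in> A \<Longrightarrow> srt i \<in> klr_words b"
proof -
  assume i: "i \<in> A"
  have inv: "filter_mset pos (image_mset inverse M) = image_mset inverse (filter_mset (\<lambda>x. \<not> pos x) M)"
    if "set_mset M \<subseteq> Vs" for M
    unfolding filter_mset_image_mset using that pos_inv by (intro arg_cong[where f = "image_mset inverse"] filter_mset_cong) auto
  have "mset (srt i) = filter_mset pos (mset i + image_mset inverse (mset i))"
    using A_Vs[OF i] by (simp add: wsort_def inv subset_iff o_def flip: mset_filter)
  also have "\<dots> = filter_mset pos (b + image_mset inverse b)" using i unfolding A_iff by simp
  also have "\<dots> = filter_mset pos b + image_mset inverse (filter_mset (\<lambda>x. \<not> pos x) b)" using b by (simp add: inv subset_iff)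
  also have "filter_mset pos b = b" using b by (simp add: filter_mset_eq_conv)
  also have "filter_mset (\<lambda>x. \<not> pos x) b = {#}" using b by simp
  finally show ?thesis by (simp add: klr_words_def)
qed

lemma srt_klr: "i \<in> klr_words b \<Longrightarrow> srt i = i"
  using klr_words_pos wsort_pos by blast

sublocale B: klr_cong p m "klr_words b" J
  by (rule klr_cong_KJ) simp

sublocale W: klr_cong p m A VR
  by unfold_locales (auto simp: vv_rels_def finite_A A_length intro: A_swap[unfolded One_nat_def])

lemma entry_Vs: "i \<in> A \<Longrightarrow> 1 \<le> l \<Longrightarrow> l \<le> m \<Longrightarrow> entry i l \<in> Vs"
  using A_Vs[of i] A_length[of i] by (simp add: entry_def)

text \<open>Letters of equal sign are neighbours in the sorted word, where their crossing takes
  place. Letters of opposite sign cross without changing the sorted word, and the coefficient 1 is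
  consistent with Q = 1.\<close>

definition ck :: "'k list \<Rightarrow> nat \<Rightarrow> 'k falg" where
  "ck i k = (if sg i k = sg i (k + 1) then ss (min (ps i k) (ps i (k + 1))) else 1)"

text \<open>A negative letter of \<open>i\<close> has passed pi once on its way from the sorted
  word, and pi anticommutes with x at the first place; hence the sign.\<close>

definition xi :: "'k list \<Rightarrow> nat \<Rightarrow> 'k falg" where
  "xi i l = (if sg i l then xx (ps i l) else - xx (ps i l))"

definition op :: "'k gen \<Rightarrow> ('k list \<Rightarrow> 'k falg) \<Rightarrow> 'k list \<Rightarrow> 'k falg" where
  "op g \<phi> i = (case g of GX l \<Rightarrow> xi i l * \<phi> i | GS k \<Rightarrow> ck i k * \<phi> (swap_entries k i)
     | GP \<Rightarrow> \<phi> (invert_first i) | GE j \<Rightarrow> (if i = j then \<phi> i else 0))"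

lemma op_simps [simp]:
  "op (GX l) \<phi> i = xi i l * \<phi> i" "op (GS k) \<phi> i = ck i k * \<phi> (swap_entries k i)"
  "op GP \<phi> i = \<phi> (invert_first i)" "op (GE j) \<phi> i = (if i = j then \<phi> i else 0)"
  by (simp_all add: op_def)

lemma fscal_left_commute: "f * (fscal c * g) = fscal c * (f * g)" for f g :: "'k falg"
  by (metis fscal_commute mult.assoc)

sublocale linear_ops op
proof
  fix g :: "'k gen" and \<phi> \<psi> :: "'k list \<Rightarrow> 'k falg" and r c
  show "op g (\<lambda>i. \<phi> i + \<psi> i) = (\<lambda>i. op g \<phi> i + op g \<psi> i)"
    by (cases g) (auto simp: fun_eq_iff distrib_left)
  show "op g (\<lambda>i. \<phi> i * r) = (\<lambda>i. op g \<phi> i * r)"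
    by (cases g) (auto simp: fun_eq_iff mult.assoc)
  show "op g (\<lambda>i. fscal c * \<phi> i) = (\<lambda>i. fscal c * op g \<phi> i)"
    by (cases g) (auto simp: fun_eq_iff fscal_left_commute)
qed

text \<open>Each component has to absorb the idempotent of its sorted word. Otherwise the relations
  of the KLR algebra that depend on the letters, such as the one for the square of sigma, could not
  be applied to it.\<close>

definition adm :: "('k list \<Rightarrow> 'k falg) \<Rightarrow> bool" where
  "adm \<phi> \<longleftrightarrow> (\<forall>i\<in>A. ee (srt i) * \<phi> i \<doteq>\<^bsub>J\<^esub> \<phi> i)"

definition null :: "('k list \<Rightarrow> 'k falg) \<Rightarrow> bool" where
  "null \<phi> \<longleftrightarrow> (\<forall>i\<in>A. \<phi> i \<doteq>\<^bsub>J\<^esub> 0)"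

lemma VG_cases [consumes 1, case_names x s e pi]:
  assumes "g \<in> VG"
  obtains l where "g = GX l" "1 \<le> l" "l \<le> m" | k where "g = GS k" "1 \<le> k" "k < m"
    | j where "g = GE j" "j \<in> A" | "g = GP" "1 \<le> m"
  using assms by (auto simp: vv_gens_def klr_gens_def Suc_le_eq split: if_splits)

lemma hd_inv: "i \<in> A \<Longrightarrow> 1 \<le> m \<Longrightarrow> i \<noteq> [] \<and> pos (inverse (hd i)) \<noteq> pos (hd i)"
  using A_length[of i] A_Vs[of i "hd i"] pos_inv by (cases i) auto

text \<open>Transfers a relation at the idempotent of the sorted word to the component at
  \<open>i\<close>, which absorbs that idempotent.\<close>

lemma adm_cong:
  assumes "adm \<phi>" "i \<in> A" "f * ee (srt i) \<doteq>\<^bsub>J\<^esub> g * ee (srt i)"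
  shows "f * \<phi> i \<doteq>\<^bsub>J\<^esub> g * \<phi> i"
proof -
  have \<phi>: "ee (srt i) * \<phi> i \<doteq>\<^bsub>J\<^esub> \<phi> i" using assms by (simp add: adm_def)
  have "f * \<phi> i \<doteq>\<^bsub>J\<^esub> f * (ee (srt i) * \<phi> i)" by (intro eqv_mult_left eqv_sym[OF \<phi>])
  also have "\<dots> = f * ee (srt i) * \<phi> i" by (simp add: mult.assoc)
  also have "\<dots> \<doteq>\<^bsub>J\<^esub> g * ee (srt i) * \<phi> i" by (intro eqv_mult_right assms)
  also have "\<dots> = g * (ee (srt i) * \<phi> i)" by (simp add: mult.assoc)
  also have "\<dots> \<doteq>\<^bsub>J\<^esub> g * \<phi> i" by (intro eqv_mult_left \<phi>)
  finally show ?thesis .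
qed

lemma ps_range: "i \<in> A \<Longrightarrow> 1 \<le> l \<Longrightarrow> l \<le> m \<Longrightarrow> 1 \<le> ps i l \<and> ps i l \<le> m"
  using wpos_bounds[of l i pos] A_length[of i] by simp

lemma min_ps:
  assumes "i \<in> A" "1 \<le> k" "k < m" "sg i k = sg i (k + 1)"
  shows "1 \<le> min (ps i k) (ps i (k + 1))" "min (ps i k) (ps i (k + 1)) < m"
    "sg i k \<Longrightarrow> min (ps i k) (ps i (k + 1)) = ps i k \<and> ps i (k + 1) = ps i k + 1"
    "\<not> sg i k \<Longrightarrow> min (ps i k) (ps i (k + 1)) = ps i (k + 1) \<and> ps i k = ps i (k + 1) + 1"
proof -
  have r: "1 \<le> ps i k \<and> ps i k \<le> m" "1 \<le> ps i (k + 1) \<and> ps i (k + 1) \<le> m"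
    using ps_range[of i k] ps_range[of i "k + 1"] assms by auto
  have d: "(sg i k \<and> ps i (k + 1) = ps i k + 1) \<or> (\<not> sg i k \<and> ps i k = ps i (k + 1) + 1)"
    using wpos_Suc_pos[of k i pos] wpos_Suc_neg[of k i pos] assms A_length[of i] by metis
  show "1 \<le> min (ps i k) (ps i (k + 1))" using r by linarith
  show "min (ps i k) (ps i (k + 1)) < m" using r d by linarith
  show "sg i k \<Longrightarrow> min (ps i k) (ps i (k + 1)) = ps i k \<and> ps i (k + 1) = ps i k + 1" using d by linarith
  show "\<not> sg i k \<Longrightarrow> min (ps i k) (ps i (k + 1)) = ps i (k + 1) \<and> ps i k = ps i (k + 1) + 1" using d by linarith
qed

lemma op_adm:
  assumes g: "g \<in> VG" and \<phi>: "adm \<phi>" shows "adm (op g \<phi>)"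
  unfolding adm_def
proof
  fix i assume i: "i \<in> A"
  have \<phi>i: "ee (srt j) * \<phi> j \<doteq>\<^bsub>J\<^esub> \<phi> j" if "j \<in> A" for j using \<phi> that by (simp add: adm_def)
  from g show "ee (srt i) * op g \<phi> i \<doteq>\<^bsub>J\<^esub> op g \<phi> i"
  proof (cases rule: VG_cases)
    case (x l)
    have "ee (srt i) * xi i l \<doteq>\<^bsub>J\<^esub> xi i l * ee (srt i)"
      using eqv_sym[OF B.x_ee[OF srt_A[OF i], of "ps i l"]] ps_range[OF i x(2,3)]
      by (auto simp: xi_def intro: eqv_minus)
    then have "ee (srt i) * xi i l * \<phi> i \<doteq>\<^bsub>J\<^esub> xi i l * ee (srt i) * \<phi> i" by (rule eqv_mult_right)
    also have "\<dots> = xi i l * (ee (srt i) * \<phi> i)" by (simp add: mult.assoc)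
    also have "\<dots> \<doteq>\<^bsub>J\<^esub> xi i l * \<phi> i" by (intro eqv_mult_left \<phi>i i)
    finally show ?thesis by (simp add: x(1) mult.assoc)
  next
    case (s k)
    let ?j = "swap_entries k i"
    have j: "?j \<in> A" by (rule A_swap[OF i s(2,3)])
    have len: "k < length i" using s A_length[OF i] by simp
    show ?thesis
    proof (cases "sg i k = sg i (k + 1)")
      case False
      then show ?thesis using \<phi>i[OF j] wsort_swap_mixed[OF s(2) len False] by (simp add: s(1) ck_def)
    next
      case True
      let ?q = "min (ps i k) (ps i (k + 1))"
      have q: "1 \<le> ?q" "?q < m" using min_ps[OF i s(2,3) True] by simp_all
      have srt: "srt ?j = swap_entries ?q (srt i)" by (rule wsort_swap_same[OF s(2) len True])
      have bk: "swap_entries ?q (srt ?j) = srt i" unfolding srt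
        by (rule swap_swap) (use q A_length[OF i] in simp_all)
      have "ee (srt i) * (ss ?q * \<phi> ?j) = (ee (swap_entries ?q (srt ?j)) * ss ?q) * \<phi> ?j"
        by (simp only: bk mult.assoc)
      also have "\<dots> \<doteq>\<^bsub>J\<^esub> (ss ?q * ee (srt ?j)) * \<phi> ?j"
        by (intro eqv_mult_right eqv_sym[OF B.s_ee] srt_A j q)
      also have "\<dots> = ss ?q * (ee (srt ?j) * \<phi> ?j)" by (simp add: mult.assoc)
      also have "\<dots> \<doteq>\<^bsub>J\<^esub> ss ?q * \<phi> ?j" by (intro eqv_mult_left \<phi>i j)
      finally show ?thesis using True by (simp add: s(1) ck_def)
    qed
  next
    case (e j)
    then show ?thesis using \<phi>i[OF i] by (cases "i = j") simp_all
  next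
    case pi
    have "invert_first i \<in> A" by (rule A_invert[OF i pi(2)])
    then show ?thesis using \<phi>i[of "invert_first i"] wsort_invert[of i pos] hd_inv[OF i pi(2)] by (simp add: pi(1))
  qed
qed

lemma op_null:
  assumes g: "g \<in> VG" and \<phi>: "null \<phi>" shows "null (op g \<phi>)"
  unfolding null_def
proof
  fix i assume i: "i \<in> A"
  have \<phi>i: "f * \<phi> j \<doteq>\<^bsub>J\<^esub> 0" if "j \<in> A" for j f
    using eqv_mult_left[of "\<phi> j" J 0 f] \<phi> that by (simp add: null_def)
  from g show "op g \<phi> i \<doteq>\<^bsub>J\<^esub> 0"
  proof (cases rule: VG_cases)
    case pi
    then show ?thesis using \<phi>i[OF A_invert[OF i], of 1] by simp
  next
    case (e j)
    then show ?thesis using \<phi>i[OF i, of 1] by (cases "i = j") simp_all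
  next
    case (x l)
    then show ?thesis using \<phi>i[OF i] by simp
  next
    case (s k)
    then show ?thesis using \<phi>i[OF A_swap[OF i]] by simp
  qed
qed

lemma lact_adm: "f \<in> carrier (free_alg VG) \<Longrightarrow> adm \<phi> \<Longrightarrow> adm (lact op f \<phi>)"
proof (induction f rule: free_alg_induct)
  case (scal c)
  then show ?case using eqv_mult_left by (fastforce simp: adm_def lact_fscal fscal_left_commute)
next
  case (var g f)
  then show ?case by (simp add: lact_fvar_mult op_adm)
next
  case (add f g)
  then show ?case by (auto simp: adm_def lact_add distrib_left intro!: eqv_add)
qed

lemma lact_null: "f \<in> carrier (free_alg VG) \<Longrightarrow> null \<phi> \<Longrightarrow> null (lact op f \<phi>)"
proof (induction f rule: free_alg_induct)
  case (scal c)
  then show ?case using eqv_mult_left by (fastforce simp: null_def lact_fscal)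
next
  case (var g f)
  then show ?case by (simp add: lact_fvar_mult op_null)
next
  case (add f g)
  then show ?case using eqv_add by (fastforce simp: null_def lact_add)
qed

lemma sg_sw: "i \<in> A \<Longrightarrow> 1 \<le> k \<Longrightarrow> k < m \<Longrightarrow> 1 \<le> l \<Longrightarrow> l \<le> m \<Longrightarrow> sg (swap_entries k i) l = sg i (adj_swap k l)"
  using wsgn_swap[of k i l pos] A_length[of i] by simp

lemma ps_sw: "i \<in> A \<Longrightarrow> 1 \<le> k \<Longrightarrow> k < m \<Longrightarrow> 1 \<le> l \<Longrightarrow> l \<le> m \<Longrightarrow>
    ps (swap_entries k i) l = (if sg i k = sg i (k + 1) then ps i l else ps i (adj_swap k l))"
  using wpos_swap[of k i l pos] A_length[of i] by simp

lemma sg_iv: "i \<in> A \<Longrightarrow> 1 \<le> m \<Longrightarrow> 1 \<le> l \<Longrightarrow> sg (invert_first i) l = (if l = 1 then \<not> sg i l else sg i l)"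
  using wsgn_invert[of i pos l] hd_inv[of i] by simp

lemma ps_iv: "i \<in> A \<Longrightarrow> 1 \<le> m \<Longrightarrow> 1 \<le> l \<Longrightarrow> ps (invert_first i) l = ps i l"
  using wpos_invert[of i pos l] hd_inv[of i] by simp

lemma sw_sw: "i \<in> A \<Longrightarrow> 1 \<le> k \<Longrightarrow> k < m \<Longrightarrow> swap_entries k (swap_entries k i) = i"
  using swap_swap[of k i] A_length[of i] by simp

lemma iv_iv: "i \<in> A \<Longrightarrow> 1 \<le> m \<Longrightarrow> invert_first (invert_first i) = i"
  using A_length[of i] by (cases i) (auto simp: invert_first_def)

lemma xi_pow: "lact op ((xx a - xx c) ^ n) \<phi> i = (xi i a - xi i c) ^ n * \<phi> i"
proof (induction n arbitrary: \<phi>)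
  case (Suc n)
  have "lact op ((xx a - xx c) ^ Suc n) \<phi> i = lact op (xx a - xx c) (lact op ((xx a - xx c) ^ n) \<phi>) i"
    by (simp add: lact_mult)
  also have "\<dots> = (xi i a - xi i c) * lact op ((xx a - xx c) ^ n) \<phi> i"
    by (simp add: lact_diff lact_fvar left_diff_distrib)
  finally show ?case using Suc by (simp add: mult.assoc)
qed simp

lemma neg_one_pow: "(- 1) ^ n * f = (if even n then f else - f)" for f :: "'k falg"
  by (induction n) auto

lemma lact_sign: "lact op ((- 1) ^ n * f) \<phi> i = (- 1) ^ n * lact op f \<phi> i"
  by (simp add: neg_one_pow lact_minus)

lemma lact_Qpoly: "lact op (Qpoly p u v (xx a) (xx c)) \<phi> i = Qpoly p u v (xi i a) (xi i c) * \<phi> i"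
  by (simp add: Qpoly_def lact_sign xi_pow mult.assoc)

lemma lact_Qquot: "lact op (Qquot p u v (xx a) (xx c) (xx d)) \<phi> i = Qquot p u v (xi i a) (xi i c) (xi i d) * \<phi> i"
proof -
  have "lact op (\<Sum>s<n. (xx a - xx c) ^ s * (xx a - xx d) ^ (n - 1 - s)) \<phi> i =
      (\<Sum>s<n. (xi i a - xi i c) ^ s * (xi i a - xi i d) ^ (n - 1 - s)) * \<phi> i" for n
    by (simp add: lact_sum lact_mult xi_pow sum_distrib_right mult.assoc)
  then show ?thesis by (simp add: Qquot_def Let_def lact_minus lact_sign mult.assoc)
qed

lemma arrows_0: "i \<in> A \<Longrightarrow> 1 \<le> k \<Longrightarrow> k \<le> m \<Longrightarrow> 1 \<le> l \<Longrightarrow> l \<le> m \<Longrightarrow> sg i k \<noteq> sg i l \<Longrightarrow>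
    entry i k \<noteq> entry i l \<and> arrows p (entry i k) (entry i l) = 0"
  using arrow_pos[OF entry_Vs entry_Vs, of i k i l] by (auto simp: arrows_def wsgn_def)

lemma arrows_inverse:
  assumes "x \<in> Vs" "y \<in> Vs" shows "arrows p (inverse x) (inverse y) = arrows p y x"
proof -
  have "inverse x = p\<^sup>2 * inverse y \<longleftrightarrow> y = p\<^sup>2 * x"
    using nonzero[OF assms(1)] nonzero[OF assms(2)] by (auto simp: field_simps)
  then show ?thesis by (simp add: arrows_def)
qed

lemma entry_srt: "i \<in> A \<Longrightarrow> 1 \<le> l \<Longrightarrow> l \<le> m \<Longrightarrow> entry (srt i) (ps i l) = (if sg i l then entry i l else inverse (entry i l))"
  using entry_wsort_wpos[of l i pos] A_length[of i] by simp


section \<open>The KLR relations for letters of equal sign, read in the sorted word\<close>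

lemma xi_comm: "i \<in> A \<Longrightarrow> 1 \<le> l \<Longrightarrow> l \<le> m \<Longrightarrow> 1 \<le> l' \<Longrightarrow> l' \<le> m \<Longrightarrow> xi i l * xi i l' \<doteq>\<^bsub>J\<^esub> xi i l' * xi i l"
  using B.x_x[of "ps i l" "ps i l'"] ps_range[of i l] ps_range[of i l'] by (auto simp: xi_def intro: eqv_minus)

lemma ck_sw: "i \<in> A \<Longrightarrow> 1 \<le> k \<Longrightarrow> k < m \<Longrightarrow> ck (swap_entries k i) k = ck i k"
  by (auto simp: ck_def sg_sw ps_sw adj_swap_def)

text \<open>Inversion reverses arrows. This compensates the exchange of the two letters, while the
  change of sign of both variables matches their exchange in the difference.\<close>

lemma Qpoly_neg:
  fixes u v :: "'k falg"
  assumes "x \<in> Vs" "y \<in> Vs"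
  shows "Qpoly p x y (- u) (- v) = Qpoly p (inverse y) (inverse x) v u"
  by (auto simp: Qpoly_def arrows_inverse assms add.commute)

text \<open>There are at most two arrows between two letters, so the quotient has degree at most one
  and the few arrow patterns can be checked separately.\<close>

lemma Qquot_neg:
  fixes u v w :: "'k falg"
  assumes "x \<in> Vs" "y \<in> Vs"
  shows "Qquot p x y (- u) (- v) (- w) = - Qquot p (inverse x) (inverse y) u w v"
proof -
  have "arrows p x y = 0 \<or> arrows p x y = 1" "arrows p y x = 0 \<or> arrows p y x = 1" by (simp_all add: arrows_def)
  then show ?thesis
    by (auto simp: Qquot_def Let_def arrows_inverse[OF assms] arrows_inverse[OF assms(2,1)] numeral_2_eq_2)
qed

text \<open>For negative letters three things change at once: their order, the letters themselves
  and the sign of both x. By \<open>Qpoly_neg\<close> these changes cancel.\<close>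

lemma Q_same:
  assumes i: "i \<in> A" and k: "1 \<le> k" "k < m" and same: "sg i k = sg i (k + 1)"
  shows "ck i k * ck i k * ee (srt i) \<doteq>\<^bsub>J\<^esub> Qpoly p (entry i k) (entry i (k + 1)) (xi i (k + 1)) (xi i k) * ee (srt i)"
proof (cases "sg i k")
  case True
  then have q: "min (ps i k) (ps i (k + 1)) = ps i k" "ps i (k + 1) = ps i k + 1"
    using min_ps(3)[OF i k same] by auto
  show ?thesis
    using B.s_s[OF srt_A[OF i], of "ps i k"] min_ps(1,2)[OF i k same] True same entry_srt[OF i, of k] entry_srt[OF i, of "k + 1"] k
    unfolding ck_def xi_def q by simp
next
  case False
  then have q: "min (ps i k) (ps i (k + 1)) = ps i (k + 1)" "ps i k = ps i (k + 1) + 1"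
    using min_ps(4)[OF i k same] by auto
  have e: "entry (srt i) (ps i (k + 1)) = inverse (entry i (k + 1))" "entry (srt i) (ps i (k + 1) + 1) = inverse (entry i k)"
    using entry_srt[OF i, of k] entry_srt[OF i, of "k + 1"] k False same unfolding q by auto
  have "Qpoly p (entry i k) (entry i (k + 1)) (xi i (k + 1)) (xi i k) =
      Qpoly p (inverse (entry i (k + 1))) (inverse (entry i k)) (xx (ps i (k + 1) + 1)) (xx (ps i (k + 1)))"
    using False same Qpoly_neg[OF entry_Vs[OF i, of k] entry_Vs[OF i, of "k + 1"]] k unfolding xi_def q by simp
  then show ?thesis
    using B.s_s[OF srt_A[OF i], of "ps i (k + 1)"] min_ps(1,2)[OF i k same] same
    unfolding ck_def q e by simp
qed

text \<open>Reversal exchanges the roles of \<open>k\<close> and \<open>k + 1\<close> for negative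
  letters, so the left side changes its sign. The quotient on the right does the same by
  \<open>Qquot_neg\<close>.\<close>

lemma braid_same:
  assumes i: "i \<in> A" and k: "1 \<le> k" "k + 1 < m" and same: "sg i k = sg i (k + 1)" "sg i (k + 1) = sg i (k + 2)"
  shows "(ck i (k + 1) * ck i k * ck i (k + 1) - ck i k * ck i (k + 1) * ck i k) * ee (srt i) \<doteq>\<^bsub>J\<^esub>
     (if entry i k = entry i (k + 2)
      then Qquot p (entry i k) (entry i (k + 1)) (xi i (k + 1)) (xi i k) (xi i (k + 2)) else 0) * ee (srt i)"
proof -
  have k': "1 \<le> k + 1" "k + 1 < m" "k < m" and same': "sg i (k + 1) = sg i (k + 1 + 1)" using k same by simp_all
  have kk: "k + 1 + 1 = k + 2" by simp
  show ?thesis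
  proof (cases "sg i k")
    case True
    let ?q = "ps i k"
    have q1: "ps i (k + 1) = ?q + 1" using min_ps(3)[OF i k(1) k'(3) same(1)] True by auto
    have q2: "ps i (k + 2) = ?q + 2" using min_ps(3)[OF i k'(1,2) same'] True same q1 by auto
    have c: "ck i k = ss ?q" "ck i (k + 1) = ss (?q + 1)" using same True q1 q2 by (simp_all add: ck_def)
    have e: "entry (srt i) ?q = entry i k" "entry (srt i) (?q + 1) = entry i (k + 1)" "entry (srt i) (?q + 2) = entry i (k + 2)"
      using entry_srt[OF i, of k] entry_srt[OF i, of "k + 1"] entry_srt[OF i, of "k + 2"] k True same q1 q2 by simp_all
    have r: "1 \<le> ?q" "?q + 1 < m" using ps_range[OF i, of k] ps_range[OF i, of "k + 2"] k q2 by auto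
    have x: "xi i k = xx ?q" "xi i (k + 1) = xx (?q + 1)" "xi i (k + 2) = xx (?q + 2)"
      using True same q1 q2 by (simp_all add: xi_def)
    show ?thesis using B.s_braid[OF srt_A[OF i] r] unfolding c e x by (simp split: if_splits)
  next
    case False
    let ?q = "ps i (k + 2)"
    have q1: "ps i (k + 1) = ?q + 1" using min_ps(4)[OF i k'(1,2) same'] False same by (simp add: kk)
    have q2: "ps i k = ?q + 2" using min_ps(4)[OF i k(1) k'(3) same(1)] False same q1 by auto
    have c: "ck i k = ss (?q + 1)" "ck i (k + 1) = ss ?q" using same False q1 q2 by (simp_all add: ck_def)
    have e: "entry (srt i) ?q = inverse (entry i (k + 2))" "entry (srt i) (?q + 1) = inverse (entry i (k + 1))" "entry (srt i) (?q + 2) = inverse (entry i k)"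
      using entry_srt[OF i, of k] entry_srt[OF i, of "k + 1"] entry_srt[OF i, of "k + 2"] k False same q1 q2 by simp_all
    have r: "1 \<le> ?q" "?q + 1 < m" using ps_range[OF i, of k] ps_range[OF i, of "k + 2"] k q2 by auto
    have x: "xi i k = - xx (?q + 2)" "xi i (k + 1) = - xx (?q + 1)" "xi i (k + 2) = - xx ?q"
      using False same q1 q2 by (simp_all add: xi_def)
    have "- ((ss (?q + 1) * ss ?q * ss (?q + 1) - ss ?q * ss (?q + 1) * ss ?q) * ee (srt i)) \<doteq>\<^bsub>J\<^esub>
        - (if inverse (entry i (k + 2)) = inverse (entry i k) then Qquot p (inverse (entry i (k + 2))) (inverse (entry i (k + 1))) (xx (?q + 1)) (xx ?q) (xx (?q + 2)) * ee (srt i) else 0)"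
      using B.s_braid[OF srt_A[OF i] r] unfolding e by (rule eqv_minus)
    moreover have "- (if inverse (entry i (k + 2)) = inverse (entry i k) then Qquot p (inverse (entry i (k + 2))) (inverse (entry i (k + 1))) (xx (?q + 1)) (xx ?q) (xx (?q + 2)) * ee (srt i) else 0) =
       (if entry i k = entry i (k + 2)
      then Qquot p (entry i k) (entry i (k + 1)) (xi i (k + 1)) (xi i k) (xi i (k + 2)) else 0) * ee (srt i)"
      using Qquot_neg[OF entry_Vs[OF i, of k] entry_Vs[OF i, of "k + 1"], of "xx (?q + 1)" "xx (?q + 2)" "xx ?q"] k unfolding x by auto
    ultimately show ?thesis unfolding c by (simp add: left_diff_distrib)
  qed
qed

lemma ps_eq: "i \<in> A \<Longrightarrow> 1 \<le> l \<Longrightarrow> l \<le> m \<Longrightarrow> 1 \<le> l' \<Longrightarrow> l' \<le> m \<Longrightarrow> ps i l = ps i l' \<longleftrightarrow> l = l'"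
  using wpos_inj'[of l i l' pos] A_length[of i] by simp

text \<open>For negative letters the sign on the right is reversed twice: the two places are
  exchanged, and \<open>xi\<close> carries a minus sign.\<close>

lemma s_xi_same:
  assumes i: "i \<in> A" and k: "1 \<le> k" "k < m" and l: "1 \<le> l" "l \<le> m" and same: "sg i k = sg i (k + 1)"
  shows "(ck i k * xi i l - xi i (adj_swap k l) * ck i k) * ee (srt i) \<doteq>\<^bsub>J\<^esub>
     (if l = k \<and> entry i k = entry i (k + 1) then - 1
      else if l = k + 1 \<and> entry i k = entry i (k + 1) then 1 else 0) * ee (srt i)"
proof -
  let ?q = "min (ps i k) (ps i (k + 1))"
  have q: "1 \<le> ?q" "?q < m" by (rule min_ps[OF i k same])+
  have pl: "1 \<le> ps i l" "ps i l \<le> m" using ps_range[OF i l] by auto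
  note rel = B.s_x[OF srt_A[OF i] q pl]
  have eqk: "ps i l = ps i k \<longleftrightarrow> l = k" "ps i l = ps i (k + 1) \<longleftrightarrow> l = k + 1"
    using ps_eq[OF i l, of k] ps_eq[OF i l, of "k + 1"] k by auto
  have rhs: "(if ps i l = ps i k \<and> C then - E else if ps i l = ps i (k + 1) \<and> C then E else 0) =
      (if l = k \<and> C then - 1 else if l = k + 1 \<and> C then 1 else 0) * E" for C and E :: "'k falg"
    unfolding eqk by simp
  have rhs': "(if ps i l = ps i (k + 1) \<and> inverse (entry i (k + 1)) = inverse (entry i k) then - E
      else if ps i l = ps i k \<and> inverse (entry i (k + 1)) = inverse (entry i k) then E else 0) =
      - ((if l = k \<and> entry i k = entry i (k + 1) then - 1 else if l = k + 1 \<and> entry i k = entry i (k + 1) then 1 else 0) * E)"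
    for E :: "'k falg"
    unfolding eqk by (auto dest: sym)
  show ?thesis
  proof (cases "sg i k")
    case True
    then have q: "?q = ps i k" "ps i (k + 1) = ps i k + 1" using min_ps(3)[OF i k same] by auto
    have ad: "adj_swap (ps i k) (ps i l) = ps i (adj_swap k l)"
      using eqk q(2) by (auto simp: adj_swap_def)
    have sgad: "sg i (adj_swap k l) = sg i l" using same by (simp add: adj_swap_def)
    have e: "entry (srt i) (ps i k) = entry i k" "entry (srt i) (ps i (k + 1)) = entry i (k + 1)"
      using entry_srt[OF i, of k] entry_srt[OF i, of "k + 1"] k True same q(2) by simp_all
    have c: "ck i k = ss (ps i k)" using same q by (simp add: ck_def)
    have rel': "(ss (ps i k) * xx (ps i l) - xx (ps i (adj_swap k l)) * ss (ps i k)) * ee (srt i) \<doteq>\<^bsub>J\<^esub>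
        (if l = k \<and> entry i k = entry i (k + 1) then - 1
      else if l = k + 1 \<and> entry i k = entry i (k + 1) then 1 else 0) * ee (srt i)"
      using rel unfolding q(1) ad q(2)[symmetric] e rhs .
    show ?thesis
    proof (cases "sg i l")
      case True
      then show ?thesis using rel' unfolding c xi_def sgad by simp
    next
      case False
      \<comment> \<open>The letter at \<open>l\<close> has the other sign, so it is not one of the
        two crossed letters. The right side is then 0, and the sign in \<open>xi i l\<close> does no
        harm.\<close>
      then have "l \<noteq> k" "l \<noteq> k + 1" using \<open>sg i k\<close> same by auto
      then show ?thesis using eqv_minus[OF rel'] False unfolding c xi_def sgad by (simp add: left_diff_distrib)
    qed
  next
    case False
    then have q: "?q = ps i (k + 1)" "ps i k = ps i (k + 1) + 1" using min_ps(4)[OF i k same] by auto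
    have ad: "adj_swap (ps i (k + 1)) (ps i l) = ps i (adj_swap k l)"
      using eqk q(2) by (auto simp: adj_swap_def)
    have sgad: "sg i (adj_swap k l) = sg i l" using same by (simp add: adj_swap_def)
    have e: "entry (srt i) (ps i (k + 1)) = inverse (entry i (k + 1))" "entry (srt i) (ps i k) = inverse (entry i k)"
      using entry_srt[OF i, of k] entry_srt[OF i, of "k + 1"] k False same q(2) by simp_all
    have c: "ck i k = ss (ps i (k + 1))" using same q by (simp add: ck_def)
    have rel': "(ss (ps i (k + 1)) * xx (ps i l) - xx (ps i (adj_swap k l)) * ss (ps i (k + 1))) * ee (srt i) \<doteq>\<^bsub>J\<^esub>
        - ((if l = k \<and> entry i k = entry i (k + 1) then - 1
      else if l = k + 1 \<and> entry i k = entry i (k + 1) then 1 else 0) * ee (srt i))"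
      using rel unfolding q(1) ad q(2)[symmetric] e rhs' .
    show ?thesis
    proof (cases "sg i l")
      case False
      then show ?thesis using eqv_minus[OF rel'] unfolding c xi_def sgad by (simp add: left_diff_distrib)
    next
      case True
      then have "l \<noteq> k" "l \<noteq> k + 1" using \<open>\<not> sg i k\<close> same by auto
      then show ?thesis using rel' True unfolding c xi_def sgad by simp
    qed
  qed
qed

lemma list_eq_entry: "length i = n \<Longrightarrow> length j = n \<Longrightarrow> (\<And>l. 1 \<le> l \<Longrightarrow> l \<le> n \<Longrightarrow> entry i l = entry j l) \<Longrightarrow> i = j"
  for i j :: "'k list"
proof (rule nth_equalityI)
  fix t assume "length i = n" "length j = n" "\<And>l. 1 \<le> l \<Longrightarrow> l \<le> n \<Longrightarrow> entry i l = entry j l" "t < length i"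
  then show "i ! t = j ! t" by (force simp: entry_def dest: meta_spec[of _ "Suc t"])
qed simp

lemma entry_sw: "i \<in> A \<Longrightarrow> 1 \<le> k \<Longrightarrow> k < m \<Longrightarrow> 1 \<le> l \<Longrightarrow> l \<le> m \<Longrightarrow> entry (swap_entries k i) l = entry i (adj_swap k l)"
  using entry_swap[of k i l] A_length[of i] by simp

lemma adj_range: "1 \<le> k \<Longrightarrow> k < m \<Longrightarrow> 1 \<le> l \<Longrightarrow> l \<le> m \<Longrightarrow> 1 \<le> adj_swap k l \<and> adj_swap k l \<le> m"
  by (auto simp: adj_swap_def)

lemma sw_far:
  assumes "i \<in> A" "1 \<le> j" "j < m" "1 \<le> k" "k < m" "j \<noteq> k + 1" "k \<noteq> j + 1"
  shows "swap_entries k (swap_entries j i) = swap_entries j (swap_entries k i)"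
proof (rule list_eq_entry[of _ m])
  fix l assume "1 \<le> l" "l \<le> m"
  then show "entry (swap_entries k (swap_entries j i)) l = entry (swap_entries j (swap_entries k i)) l"
    using assms adj_range[of k l] adj_range[of j l] A_swap[of i]
    by (simp add: entry_sw) (auto simp: adj_swap_def)
qed (use assms A_length in simp_all)

lemma sw_braid:
  assumes "i \<in> A" "1 \<le> k" "k + 1 < m"
  shows "swap_entries (k + 1) (swap_entries k (swap_entries (k + 1) i)) = swap_entries k (swap_entries (k + 1) (swap_entries k i))"
proof (rule list_eq_entry[of _ m])
  fix l assume l: "1 \<le> l" "l \<le> m"
  have "1 \<le> k" "k < m" "1 \<le> k + 1" using assms by auto
  then show "entry (swap_entries (k + 1) (swap_entries k (swap_entries (k + 1) i))) l = entry (swap_entries k (swap_entries (k + 1) (swap_entries k i))) l"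
    using assms l adj_range by (simp only: entry_sw A_swap adj_range) (auto simp: adj_swap_def)
qed (use assms A_length in simp_all)

lemma sw_same: "i \<in> A \<Longrightarrow> 1 \<le> k \<Longrightarrow> k < m \<Longrightarrow> entry i k = entry i (k + 1) \<Longrightarrow> swap_entries k i = i"
  using A_length[of i] by (intro list_eq_entry[of _ m]) (auto simp: entry_sw adj_swap_def)

lemma sw_braid_same:
  assumes "i \<in> A" "1 \<le> k" "k + 1 < m" "entry i k = entry i (k + 2)"
  shows "swap_entries k (swap_entries (k + 1) (swap_entries k i)) = i"
proof (rule list_eq_entry[of _ m])
  fix l assume l: "1 \<le> l" "l \<le> m"
  have "1 \<le> k" "k < m" "1 \<le> k + 1" using assms by auto
  then show "entry (swap_entries k (swap_entries (k + 1) (swap_entries k i))) l = entry i l"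
    using assms l adj_range by (simp only: entry_sw A_swap adj_range) (auto simp: adj_swap_def)
qed (use assms A_length in simp_all)

end

lemma vv_rels_cases [consumes 1, case_names klr pi_ee pi_x1 pi_x pi_s pi_pi s_pi]:
  assumes "r \<in> vv_rels p m A"
  obtains "r \<in> klr_rels p m A"
    | j where "r = pp * ee j - ee (invert_first j) * pp" "j \<in> A" "1 \<le> m"
    | "r = pp * xx 1 + xx 1 * pp" "1 \<le> m"
    | l where "r = pp * xx l - xx l * pp" "2 \<le> l" "l \<le> m" "1 \<le> m"
    | k where "r = pp * ss k - ss k * pp" "2 \<le> k" "k < m" "1 \<le> m"
    | "r = pp * pp - 1" "1 \<le> m"
    | "r = (ss 1 * pp)\<^sup>2 - (pp * ss 1)\<^sup>2" "1 < m"
proof -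
  have "r \<in> klr_rels p m A \<or> 1 \<le> m \<and> ((\<exists>j\<in>A. r = pp * ee j - ee (invert_first j) * pp) \<or>
      r = pp * xx 1 + xx 1 * pp \<or> (\<exists>l. 2 \<le> l \<and> l \<le> m \<and> r = pp * xx l - xx l * pp) \<or>
      (\<exists>k. 2 \<le> k \<and> k < m \<and> r = pp * ss k - ss k * pp) \<or> r = pp * pp - 1 \<or>
      1 < m \<and> r = (ss 1 * pp)\<^sup>2 - (pp * ss 1)\<^sup>2)"
  proof (cases "m = 0")
    case True
    then show ?thesis using assms by (simp add: vv_rels_def)
  next
    case False
    then have "1 \<le> m" by simp
    then show ?thesis using assms False unfolding vv_rels_def
      by (cases "m = 1") (simp_all only: if_False if_True Un_iff mem_Collect_eq atLeastAtMost_iff atLeastLessThan_iff simp_thms empty_iff insert_iff, blast, (metis less_one nat_neq_iff))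
  qed
  then show ?thesis using that by blast
qed

section \<open>The operators satisfy the relations of the VV algebra\<close>

context vv_data
begin

lemma ck_far:
  assumes "i \<in> A" "1 \<le> j" "j < m" "1 \<le> k" "k < m" "j \<noteq> k" "j \<noteq> k + 1" "k \<noteq> j + 1"
  shows "ck (swap_entries j i) k = ck i k"
  using assms by (simp add: ck_def sg_sw ps_sw adj_swap_def)

text \<open>A pair of equal sign occupies two consecutive places of the sorted word. Places are
  distinct, so far pairs occupy disjoint pairs of places and their crossings are far apart as
  well.\<close>

lemma ck_comm:
  assumes i: "i \<in> A" and j: "1 \<le> j" "j < m" and k: "1 \<le> k" "k < m" and far: "j \<noteq> k + 1" "k \<noteq> j + 1"
  shows "ck i j * ck i k \<doteq>\<^bsub>J\<^esub> ck i k * ck i j"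
proof (cases "sg i j = sg i (j + 1) \<and> sg i k = sg i (k + 1) \<and> j \<noteq> k")
  case True
  let ?q = "min (ps i j) (ps i (j + 1))" and ?r = "min (ps i k) (ps i (k + 1))"
  have ne: "ps i j \<noteq> ps i k" "ps i j \<noteq> ps i (k + 1)" "ps i (j + 1) \<noteq> ps i k" "ps i (j + 1) \<noteq> ps i (k + 1)"
    using ps_eq[OF i, of j k] ps_eq[OF i, of j "k + 1"] ps_eq[OF i, of "j + 1" k] ps_eq[OF i, of "j + 1" "k + 1"]
      j k far True by auto
  have q: "(?q = ps i j \<and> ?q + 1 = ps i (j + 1)) \<or> (?q = ps i (j + 1) \<and> ?q + 1 = ps i j)"
    using min_ps(3,4)[OF i j] True by (metis)
  have r: "(?r = ps i k \<and> ?r + 1 = ps i (k + 1)) \<or> (?r = ps i (k + 1) \<and> ?r + 1 = ps i k)"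
    using min_ps(3,4)[OF i k] True by (metis)
  have "?q \<noteq> ?r + 1" "?r \<noteq> ?q + 1" using q r ne by auto
  then show ?thesis using B.s_far[of ?q ?r] min_ps(1,2)[OF i j] min_ps(1,2)[OF i k] True unfolding ck_def by simp
next
  case False
  then show ?thesis by (auto simp: ck_def)
qed

text \<open>If all letters involved in a relation have the same sign, it is the corresponding KLR
  relation at the sorted word. Otherwise no arrows join the letters of opposite sign, so Q = 1 or
  the correction term vanishes, and both sides agree literally.\<close>

lemma rel_klr_null:
  assumes r: "r \<in> klr_rels p m A" and \<phi>: "adm \<phi>" and i: "i \<in> A"
  shows "lact op r \<phi> i \<doteq>\<^bsub>J\<^esub> 0"
  using r
proof (cases rule: klr_rels_cases)
  case (ee j j')
  then show ?thesis by (simp add: lact_diff lact_mult lact_fvar)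
next
  case sum
  then show ?thesis using i finite_A by (simp add: lact_diff lact_sum lact_fvar)
next
  case (s_ee k j)
  have "swap_entries k i = j \<longleftrightarrow> i = swap_entries k j"
    using sw_sw[OF i s_ee(2,3)] sw_sw[OF s_ee(4,2,3)] by auto
  then show ?thesis by (simp add: s_ee(1) lact_diff lact_mult lact_fvar)
next
  case (x_ee l j)
  then show ?thesis by (simp add: lact_diff lact_mult lact_fvar)
next
  case (x_x l l')
  then show ?thesis using eqv_mult_right[OF xi_comm[OF i, of l l'], of "\<phi> i"]
    by (simp add: lact_diff lact_mult lact_fvar eqv_diff_0 mult.assoc)
next
  case (s_s k j)
  show ?thesis
  proof (cases "i = j")
    case False
    then show ?thesis using sw_sw[OF i s_s(2,3)] by (simp add: s_s(1) lact_diff lact_mult lact_fvar lact_Qpoly)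
  next
    case True
    have "ck i k * ck i k * \<phi> i \<doteq>\<^bsub>J\<^esub> Qpoly p (entry i k) (entry i (k + 1)) (xi i (k + 1)) (xi i k) * \<phi> i"
    proof (cases "sg i k = sg i (k + 1)")
      case True
      then show ?thesis by (intro adm_cong[OF \<phi> i] Q_same[OF i s_s(2,3)])
    next
      case False
      then have "Qpoly p (entry i k) (entry i (k + 1)) (xi i (k + 1)) (xi i k) = 1"
        using arrows_0[OF i, of k "k + 1"] arrows_0[OF i, of "k + 1" k] s_s(2,3) by (simp add: Qpoly_def)
      then show ?thesis using False by (simp add: ck_def)
    qed
    then show ?thesis using sw_sw[OF i s_s(2,3)] ck_sw[OF i s_s(2,3)] True
      by (simp add: s_s(1) lact_diff lact_mult lact_fvar lact_Qpoly eqv_diff_0 mult.assoc)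
  qed
next
  case (s_far j k)
  have "ck i j * ck i k * \<phi> (swap_entries k (swap_entries j i)) \<doteq>\<^bsub>J\<^esub> ck i k * ck i j * \<phi> (swap_entries k (swap_entries j i))"
    by (intro eqv_mult_right ck_comm[OF i]) (use s_far in auto)
  then show ?thesis using ck_far[OF i s_far(2-5)] ck_far[OF i s_far(4,5,2,3)] sw_far[OF i s_far(2-7)] s_far
    by (cases "j = k") (simp_all add: lact_diff lact_mult lact_fvar eqv_diff_0 mult.assoc)
next
  case (braid k j)
  have k: "1 \<le> k" "k < m" "1 \<le> k + 1" "k + 1 < m" using braid by auto
  let ?s = "swap_entries k" and ?t = "swap_entries (k + 1)"
  \<comment> \<open>The word at which both sides of the braid relation evaluate the family; the
    idempotent then requires that it be \<open>j\<close>.\<close>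
  define h where "h = ?s (?t (?s i))"
  have h': "?t (?s (?t i)) = h" unfolding h_def by (rule sw_braid[OF i braid(2,3)])
  have in_A: "?s i \<in> A" "?t i \<in> A" "?s (?t i) \<in> A" "?t (?s i) \<in> A" "h \<in> A"
    using A_swap i k unfolding h_def by auto
  have ih: "i = ?s (?t (?s h))" unfolding h_def using sw_sw in_A i k by simp
  have L: "lact op r \<phi> i = ck i (k + 1) * (ck (?t i) k * (ck (?s (?t i)) (k + 1) * (if h = j then \<phi> h else 0)))
       - ck i k * (ck (?s i) (k + 1) * (ck (?t (?s i)) k * (if h = j then \<phi> h else 0)))
       - (if entry j k = entry j (k + 2)
         then Qquot p (entry j k) (entry j (k + 1)) (xi i (k + 1)) (xi i k) (xi i (k + 2)) * (if i = j then \<phi> i else 0)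
         else 0)"
    by (simp only: braid(1) lact_diff lact_mult lact_fvar op_simps h' h_def[symmetric] if_distrib[where f = "\<lambda>f. lact op f \<phi> i"] lact_Qquot lact_0)
  show ?thesis
  proof (cases "h = j")
    case False
    have "entry j k = entry j (k + 2) \<Longrightarrow> i \<noteq> j"
      using sw_braid_same[OF i k(1,4)] False h_def by metis
    then show ?thesis using False unfolding L by auto
  next
    case hj: True
    show ?thesis
    proof (cases "sg i k = sg i (k + 1) \<and> sg i (k + 1) = sg i (k + 2)")
      case True
      then have same: "sg i k = sg i (k + 1)" "sg i (k + 1) = sg i (k + 2)" by auto
      have inv: "sg h l = sg i l" "ps h l = ps i l" if "l \<in> {k, k + 1, k + 2}" for l
        unfolding h_def using that k i in_A same
        by (auto simp: sg_sw ps_sw adj_swap_def)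
      have cks: "ck (?t i) k = ck i k" "ck (?s (?t i)) (k + 1) = ck i (k + 1)" "ck (?s i) (k + 1) = ck i (k + 1)" "ck (?t (?s i)) k = ck i k"
        using k i in_A same by (simp_all add: ck_def sg_sw ps_sw adj_swap_def)
      have ckh: "ck h k = ck i k" "ck h (k + 1) = ck i (k + 1)" using inv by (simp_all add: ck_def)
      have xih: "xi h k = xi i k" "xi h (k + 1) = xi i (k + 1)" "xi h (k + 2) = xi i (k + 2)" using inv by (simp_all add: xi_def)
      have sameh: "sg h k = sg h (k + 1)" "sg h (k + 1) = sg h (k + 2)" using inv same by simp_all
      have "(ck i (k + 1) * ck i k * ck i (k + 1) - ck i k * ck i (k + 1) * ck i k) * \<phi> h \<doteq>\<^bsub>J\<^esub>
         (if entry h k = entry h (k + 2)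
      then Qquot p (entry h k) (entry h (k + 1)) (xi i (k + 1)) (xi i k) (xi i (k + 2)) else 0) * \<phi> h"
        using adm_cong[OF \<phi> in_A(5) braid_same[OF in_A(5) k(1,4) sameh]] unfolding ckh xih .
      \<comment> \<open>The correction term involves the component at \<open>i\<close>, the products
        of crossings the one at \<open>h\<close>. Equal outer letters make these two words the
        same.\<close>
      moreover have "entry h k = entry h (k + 2) \<Longrightarrow> i = h"
        using sw_braid_same[OF in_A(5) k(1,4)] ih by simp
      ultimately show ?thesis unfolding L cks using hj
        by (auto simp: left_diff_distrib mult.assoc eqv_diff_0)
    next
      case False
      \<comment> \<open>Exactly one of the three pairs of letters has equal signs. Every pair is
        crossed once on each side, so each side consists of this one crossing.\<close>
      have "ck i (k + 1) * (ck (?t i) k * ck (?s (?t i)) (k + 1)) = ck i k * (ck (?s i) (k + 1) * ck (?t (?s i)) k)"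
        using k i in_A False
        by (cases "sg i k"; cases "sg i (k + 1)"; cases "sg i (k + 2)"; simp add: ck_def sg_sw ps_sw adj_swap_def min.commute)
      from arg_cong[OF this, of "\<lambda>x. x * f" for f]
      have c: "ck i (k + 1) * (ck (?t i) k * (ck (?s (?t i)) (k + 1) * f)) = ck i k * (ck (?s i) (k + 1) * (ck (?t (?s i)) k * f))" for f
        by (simp only: mult.assoc)
      have sgh: "sg h k = sg i (k + 2)" "sg h (k + 1) = sg i (k + 1)" "sg h (k + 2) = sg i k"
        unfolding h_def using k i in_A by (simp_all add: sg_sw adj_swap_def)
      \<comment> \<open>If the outer letters coincide, the middle one must have the opposite sign
        and is joined to them by no arrow.\<close>
      have "Qquot p (entry h k) (entry h (k + 1)) u v w = 0" if "entry h k = entry h (k + 2)" for u v w :: "'k falg"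
      proof -
        have "sg h k = sg h (k + 2)" using that by (simp add: wsgn_def)
        then have "sg h k \<noteq> sg h (k + 1)" using False sgh by auto
        then show ?thesis using arrows_0[OF in_A(5), of k "k + 1"] arrows_0[OF in_A(5), of "k + 1" k] k by (simp add: Qquot_def)
      qed
      then show ?thesis unfolding L c using hj by auto
    qed
  qed
next
  case (s_x k l j)
  let ?s = "swap_entries k"
  have si: "?s i \<in> A" by (rule A_swap[OF i s_x(2,3)])
  have L: "lact op r \<phi> i = ck i k * (xi (?s i) l * (if ?s i = j then \<phi> (?s i) else 0))
      - xi i (adj_swap k l) * (ck i k * (if ?s i = j then \<phi> (?s i) else 0))
      - (if l = k \<and> entry j k = entry j (k + 1) then - 1
      else if l = k + 1 \<and> entry j k = entry j (k + 1) then 1 else 0) * (if i = j then \<phi> i else 0)"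
    by (simp add: s_x(1) lact_diff lact_mult lact_fvar lact_minus)
  show ?thesis
  proof (cases "?s i = j")
    case False
    have "entry j k = entry j (k + 1) \<Longrightarrow> i \<noteq> j" using sw_same[OF i s_x(2,3)] False by auto
    then show ?thesis using False unfolding L by auto
  next
    case sij: True
    then have j: "j \<in> A" and ij: "i = ?s j" using si sw_sw[OF i s_x(2,3)] by auto
    show ?thesis
    proof (cases "sg i k = sg i (k + 1)")
      case True
      have inv: "sg j l = sg i l" "ps j l = ps i l" if "1 \<le> l" "l \<le> m" for l
        unfolding sij[symmetric] using sg_sw[OF i s_x(2,3) that] ps_sw[OF i s_x(2,3) that] True by (auto simp: adj_swap_def)
      have cj: "ck j k = ck i k" using ck_sw[OF i s_x(2,3)] sij by simp
      have xj: "xi j l = xi i l" if "1 \<le> l" "l \<le> m" for l using inv[OF that] by (simp add: xi_def)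
      have samej: "sg j k = sg j (k + 1)" using inv[of k] inv[of "k + 1"] s_x True by simp
      have "(ck i k * xi j l - xi i (adj_swap k l) * ck i k) * \<phi> j \<doteq>\<^bsub>J\<^esub>
       (if l = k \<and> entry j k = entry j (k + 1) then - 1
      else if l = k + 1 \<and> entry j k = entry j (k + 1) then 1 else 0) * \<phi> j"
        using adm_cong[OF \<phi> j s_xi_same[OF j s_x(2-5) samej]] adj_range[OF s_x(2-5)] unfolding cj by (simp add: xj)
      moreover have "entry j k = entry j (k + 1) \<Longrightarrow> i = j" using sw_same[OF j s_x(2,3)] ij by simp
      ultimately show ?thesis unfolding L sij by (auto simp: left_diff_distrib mult.assoc eqv_diff_0 split: if_splits)
    next
      case False
      have x: "xi (?s i) l = xi i (adj_swap k l)"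
        using sg_sw[OF i s_x(2-5)] ps_sw[OF i s_x(2-5)] False by (simp add: xi_def)
      have "sg j k \<noteq> sg j (k + 1)" using False sg_sw[OF i s_x(2,3), of k] sg_sw[OF i s_x(2,3), of "k + 1"] s_x(2,3) sij
        by (simp add: adj_swap_def)
      then have "entry j k \<noteq> entry j (k + 1)" by (auto simp: wsgn_def)
      then show ?thesis unfolding L x using False by (simp add: ck_def)
    qed
  qed
qed

lemma entry_iv: "i \<in> A \<Longrightarrow> 1 \<le> m \<Longrightarrow> 1 \<le> l \<Longrightarrow> l \<le> m \<Longrightarrow> entry (invert_first i) l = (if l = 1 then inverse (entry i l) else entry i l)"
  using A_length[of i] by (cases i) (auto simp: entry_def invert_first_def nth_Cons')

lemma iv_sw:
  assumes "i \<in> A" "2 \<le> k" "k < m" shows "swap_entries k (invert_first i) = invert_first (swap_entries k i)"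
  by (rule list_eq_entry[of _ m])
    (use assms A_invert A_swap A_length adj_range in \<open>auto simp: entry_sw entry_iv\<close>, auto simp: adj_swap_def split: if_splits)

lemma rel_null:
  assumes r: "r \<in> VR" and \<phi>: "adm \<phi>"
  shows "null (lact op r \<phi>)"
  unfolding null_def
proof
  fix i assume i: "i \<in> A"
  from r show "lact op r \<phi> i \<doteq>\<^bsub>J\<^esub> 0"
  proof (cases rule: vv_rels_cases)
    case klr
    then show ?thesis by (rule rel_klr_null[OF _ \<phi> i])
  next
    case (pi_ee j)
    have "invert_first i = j \<longleftrightarrow> i = invert_first j" using iv_iv i pi_ee(2,3) by metis
    then show ?thesis by (simp add: pi_ee(1) lact_diff lact_mult lact_fvar)
  next
    case pi_x1
    have "xi (invert_first i) 1 = - xi i 1" using i pi_x1(2) by (simp add: xi_def sg_iv ps_iv)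
    then show ?thesis by (simp add: pi_x1(1) lact_add lact_mult lact_fvar)
  next
    case (pi_x l)
    have "xi (invert_first i) l = xi i l" using i pi_x by (simp add: xi_def sg_iv ps_iv)
    then show ?thesis by (simp add: pi_x(1) lact_diff lact_mult lact_fvar)
  next
    case (pi_s k)
    have "ck (invert_first i) k = ck i k" using i pi_s by (simp add: ck_def sg_iv ps_iv)
    then show ?thesis using iv_sw[OF i pi_s(2,3)] by (simp add: pi_s(1) lact_diff lact_mult lact_fvar)
  next
    case pi_pi
    then show ?thesis using iv_iv[OF i] by (simp add: pi_pi(1) lact_diff lact_mult lact_fvar)
  next
    case s_pi
    let ?s = "swap_entries 1" and ?v = invert_first
    have m: "1 \<le> m" "1 < m" using s_pi by auto
    have in_A: "?s i \<in> A" "?v i \<in> A" "?v (?s i) \<in> A" "?s (?v i) \<in> A" "?s (?v (?s i)) \<in> A" "?v (?s (?v i)) \<in> A"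
      using i m A_swap A_invert by auto
    have w: "?v (?s (?v (?s i))) = ?s (?v (?s (?v i)))"
    proof -
      obtain x i' where "i = x # i'" using A_length[OF i] m by (cases i) auto
      moreover from this obtain y z where "i' = y # z" using A_length[OF i] m by (cases i') auto
      ultimately show ?thesis by (simp add: swap_entries_def entry_def invert_first_def)
    qed
    \<comment> \<open>Each side crosses the first two letters twice, once before and once after one
      of them is inverted. The signs agree in exactly one of the two crossings, which leaves the
      same sigma on both sides.\<close>
    have c: "ck i 1 * ck (?v (?s i)) 1 = ck (?v i) 1 * ck (?v (?s (?v i))) 1"
      using in_A i m by (cases "sg i 1"; cases "sg i 2"; simp add: ck_def sg_sw ps_sw sg_iv ps_iv adj_swap_def min.commute numeral_2_eq_2)
    have "lact op r \<phi> i = ck i 1 * ck (?v (?s i)) 1 * \<phi> (?v (?s (?v (?s i)))) - ck (?v i) 1 * ck (?v (?s (?v i))) 1 * \<phi> (?s (?v (?s (?v i))))"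
      by (simp add: s_pi(1) power2_eq_square lact_diff lact_mult lact_fvar mult.assoc)
    then show ?thesis unfolding w c by simp
  qed
qed

lemma VR_closed: "VR \<subseteq> carrier (free_alg VG)"
proof
  fix r assume "r \<in> VR"
  have pi: "pp \<in> carrier (free_alg VG)" if "1 \<le> m" using that by (intro free_alg_fvar) (auto simp: vv_gens_def)
  have x: "xx l \<in> carrier (free_alg VG)" if "1 \<le> l" "l \<le> m" for l
    using that by (intro free_alg_fvar) (auto simp: vv_gens_def klr_gens_def)
  have s: "ss k \<in> carrier (free_alg VG)" if "1 \<le> k" "k < m" for k
    using that by (intro free_alg_fvar) (auto simp: vv_gens_def klr_gens_def)
  have e: "ee i \<in> carrier (free_alg VG)" if "i \<in> A" for i
    using that by (intro free_alg_fvar) (auto simp: vv_gens_def klr_gens_def)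
  from \<open>r \<in> VR\<close> show "r \<in> carrier (free_alg VG)"
  proof (cases rule: vv_rels_cases)
    case klr
    have "klr_rels p m A \<subseteq> carrier (free_alg (klr_gens m A))"
      by (rule klr_rels_closed) (use A_swap in auto)
    moreover have "carrier (free_alg (klr_gens m A)) \<subseteq> carrier (free_alg VG)"
      by (auto simp: carrier_free_alg vv_gens_def)
    ultimately show ?thesis using klr by blast
  qed (auto intro!: free_alg_diff free_alg_add free_alg_mult free_alg_power pi x s e A_invert)
qed

text \<open>The ideal generated by the relations acts by zero: left multipliers preserve null
  families, right ones preserve admissible families. The induction quantifies over all families
  because a right multiplier changes the family acted upon.\<close>

lemma lact_VR_null:
  assumes f: "f \<doteq>\<^bsub>VR\<^esub> g" "f \<in> carrier (free_alg VG)" "g \<in> carrier (free_alg VG)" and \<phi>: "adm \<phi>"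
  shows "null (\<lambda>i. lact op f \<phi> i - lact op g \<phi> i)"
proof -
  have "f - g \<in> tsi VR" "f - g \<in> carrier (free_alg VG)" using f by (simp_all add: eqv_def)
  from this VR_closed have "\<forall>\<phi>. adm \<phi> \<longrightarrow> null (lact op (f - g) \<phi>)"
  proof (induction rule: tsi_induct_carrier)
    case (base r)
    then show ?case using rel_null by blast
  next
    case zero
    then show ?case by (simp add: null_def)
  next
    case (add f g)
    then show ?case using eqv_add by (fastforce simp: null_def lact_add)
  next
    case (left a f)
    then show ?case by (simp add: lact_mult lact_null)
  next
    case (right a f)
    then show ?case by (simp add: lact_mult lact_adm)
  qed
  then show ?thesis using \<phi> by (simp add: lact_diff null_def)
qed


lemma adm_diff_null: "null (\<lambda>i. \<phi> i - \<psi> i) \<longleftrightarrow> (\<forall>i\<in>A. \<phi> i \<doteq>\<^bsub>J\<^esub> \<psi> i)"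
  by (simp add: null_def eqv_diff_0)

lemma op_diff: "op g (\<lambda>i. \<phi> i - \<psi> i) = (\<lambda>i. op g \<phi> i - op g \<psi> i)"
  using op_add[of g \<phi> "\<lambda>i. \<psi> i * (- 1)"] op_right[of g \<psi> "- 1"] by simp

lemma lact_fun_diff: "lact op f (\<lambda>i. \<phi> i - \<psi> i) i = lact op f \<phi> i - lact op f \<psi> i"
proof (induction f arbitrary: i rule: fralg_induct)
  case (scal c)
  then show ?case by (simp add: lact_fscal right_diff_distrib)
next
  case (var g f)
  have "lact op f (\<lambda>i. \<phi> i - \<psi> i) = (\<lambda>i. lact op f \<phi> i - lact op f \<psi> i)" using var by (simp add: fun_eq_iff)
  then show ?case by (simp only: lact_fvar_mult op_diff)
next
  case (add f g)
  then show ?case by (simp add: lact_add)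
qed

lemma lact_cong:
  assumes "f \<in> carrier (free_alg VG)" "\<And>i. i \<in> A \<Longrightarrow> \<phi> i \<doteq>\<^bsub>J\<^esub> \<psi> i" "i \<in> A"
  shows "lact op f \<phi> i \<doteq>\<^bsub>J\<^esub> lact op f \<psi> i"
proof -
  have "null (lact op f (\<lambda>i. \<phi> i - \<psi> i))"
    using lact_null[OF assms(1)] assms(2) by (simp add: adm_diff_null)
  then show ?thesis using assms(3) by (simp add: null_def lact_fun_diff eqv_diff_0)
qed

section \<open>The projection from the VV algebra to the KLR algebra\<close>

definition phi0 :: "'k list \<Rightarrow> 'k falg" where
  "phi0 i = (if i \<in> klr_words b then ee i else 0)"

definition csum :: "('k list \<Rightarrow> 'k falg) \<Rightarrow> 'k falg" where
  "csum \<phi> = (\<Sum>i\<in>klr_words b. \<phi> i)"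

definition Pj :: "'k falg \<Rightarrow> 'k falg" where
  "Pj f = csum (lact op f phi0)"

lemma adm_phi0: "adm phi0"
proof -
  have "ee i * ee i \<doteq>\<^bsub>J\<^esub> ee i" if "i \<in> klr_words b" for i using B.ee_ee[OF that that] by simp
  then show ?thesis by (auto simp: adm_def phi0_def srt_klr)
qed

lemma KG_VG: "g \<in> KG b \<Longrightarrow> g \<in> VG"
  using klr_words_A by (auto simp: vv_gens_def klr_gens_def)

lemma KG_VG_carrier: "f \<in> carrier (free_alg (KG b)) \<Longrightarrow> f \<in> carrier (free_alg VG)"
  using KG_VG by (fastforce simp: carrier_free_alg)

lemma klr_sg: "i \<in> klr_words b \<Longrightarrow> 1 \<le> l \<Longrightarrow> l \<le> m \<Longrightarrow> sg i l"
  using klr_words_pos[of i "entry i l"] klr_words_length[of i b] by (simp add: wsgn_def entry_def)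

lemma klr_ps: "i \<in> klr_words b \<Longrightarrow> 1 \<le> l \<Longrightarrow> l \<le> m \<Longrightarrow> ps i l = l"
  using wpos_pos[of i pos l] klr_words_pos klr_words_length[of i b] by auto

lemma klr_xi: "i \<in> klr_words b \<Longrightarrow> 1 \<le> l \<Longrightarrow> l \<le> m \<Longrightarrow> xi i l = xx l"
  by (simp add: xi_def klr_sg klr_ps)

lemma klr_ck: "i \<in> klr_words b \<Longrightarrow> 1 \<le> k \<Longrightarrow> k < m \<Longrightarrow> ck i k = ss k"
  by (simp add: ck_def klr_sg klr_ps)

text \<open>At a word of positive letters every letter is at its sorted place already, so the
  operators of x and sigma multiply by the generators themselves. The operator of e(j) selects one
  component, as left multiplication by e(j) does on an admissible family.\<close>

lemma csum_op:
  assumes \<psi>: "adm \<psi>" and g: "g \<in> KG b"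
  shows "csum (op g \<psi>) \<doteq>\<^bsub>J\<^esub> fvar g * csum \<psi>"
  using g
proof (cases rule: KG_cases)
  case (x l)
  then show ?thesis by (simp add: csum_def klr_xi sum_distrib_left)
next
  case (s k)
  have "(\<Sum>i\<in>klr_words b. ss k * \<psi> (swap_entries k i)) = (\<Sum>i\<in>klr_words b. ss k * \<psi> i)"
    by (rule sum.reindex_bij_witness[of _ "swap_entries k" "swap_entries k"])
      (use s in \<open>auto simp: klr_words_swap swap_swap klr_words_length\<close>)
  then show ?thesis using s by (simp add: csum_def klr_ck sum_distrib_left)
next
  case (e j)
  have \<psi>i: "ee i * \<psi> i \<doteq>\<^bsub>J\<^esub> \<psi> i" if "i \<in> klr_words b" for i
    using \<psi> klr_words_A[OF that] srt_klr[OF that] by (auto simp: adm_def)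
  have "fvar g * csum \<psi> = (\<Sum>i\<in>klr_words b. ee j * \<psi> i)" by (simp add: e(1) csum_def sum_distrib_left)
  also have "\<dots> \<doteq>\<^bsub>J\<^esub> (\<Sum>i\<in>klr_words b. if i = j then \<psi> i else 0)"
  proof (rule eqv_sum)
    fix i assume i: "i \<in> klr_words b"
    have "ee j * \<psi> i \<doteq>\<^bsub>J\<^esub> ee j * (ee i * \<psi> i)" by (intro eqv_mult_left eqv_sym[OF \<psi>i[OF i]])
    also have "\<dots> = (ee j * ee i) * \<psi> i" by (simp add: mult.assoc)
    also have "\<dots> \<doteq>\<^bsub>J\<^esub> (if j = i then ee j else 0) * \<psi> i" by (intro eqv_mult_right B.ee_ee e i)
    also have "\<dots> \<doteq>\<^bsub>J\<^esub> (if i = j then \<psi> i else 0)" using \<psi>i[OF i] by auto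
    finally show "ee j * \<psi> i \<doteq>\<^bsub>J\<^esub> (if i = j then \<psi> i else 0)" .
  qed
  finally show ?thesis by (simp add: e(1) csum_def eqv_sym)
qed

lemma csum_lact:
  assumes f: "f \<in> carrier (free_alg (KG b))" and \<phi>: "adm \<phi>"
  shows "csum (lact op f \<phi>) \<doteq>\<^bsub>J\<^esub> f * csum \<phi>"
  using f
proof (induction f rule: free_alg_induct)
  case (scal c)
  then show ?case by (simp add: csum_def lact_fscal sum_distrib_left)
next
  case (var g f)
  have "csum (lact op (fvar g * f) \<phi>) \<doteq>\<^bsub>J\<^esub> fvar g * csum (lact op f \<phi>)"
    unfolding lact_fvar_mult by (intro csum_op lact_adm KG_VG_carrier var \<phi>)
  also have "\<dots> \<doteq>\<^bsub>J\<^esub> fvar g * (f * csum \<phi>)" by (intro eqv_mult_left var)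
  finally show ?case by (simp add: mult.assoc)
next
  case (add f g)
  then show ?case by (simp add: csum_def lact_add sum.distrib distrib_right eqv_add)
qed

lemma Pj_left:
  assumes "f \<in> carrier (free_alg (KG b))" "w \<in> carrier (free_alg VG)"
  shows "Pj (f * w) \<doteq>\<^bsub>J\<^esub> f * Pj w"
  unfolding Pj_def lact_mult by (intro csum_lact assms lact_adm adm_phi0)

lemma Pj_add: "Pj (f + g) = Pj f + Pj g"
  by (simp add: Pj_def csum_def lact_add sum.distrib)

lemma Pj_one: "Pj 1 \<doteq>\<^bsub>J\<^esub> 1"
proof -
  have "Pj 1 = eset (klr_words b)" by (simp add: Pj_def csum_def phi0_def eset_def)
  then show ?thesis using B.eset_A by simp
qed

lemma Pj_cong:
  assumes "f \<doteq>\<^bsub>VR\<^esub> g" "f \<in> carrier (free_alg VG)" "g \<in> carrier (free_alg VG)"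
  shows "Pj f \<doteq>\<^bsub>J\<^esub> Pj g"
  unfolding Pj_def csum_def
  using lact_VR_null[OF assms adm_phi0] klr_words_A by (intro eqv_sum) (auto simp: adm_diff_null)

text \<open>\<open>phi0\<close> behaves like the idempotent of the corner: the KLR generators
  commute with it, so acting on the left is the same as multiplying on the right.\<close>

lemma op_phi0:
  assumes g: "g \<in> KG b" and i: "i \<in> A"
  shows "op g phi0 i \<doteq>\<^bsub>J\<^esub> phi0 i * fvar g"
  using g
proof (cases rule: KG_cases)
  case (x l)
  then show ?thesis using B.x_ee[of i l] by (simp add: phi0_def klr_xi)
next
  case (s k)
  have "swap_entries k i \<in> klr_words b \<longleftrightarrow> i \<in> klr_words b"
    using klr_words_swap[of _ b k] s(2,3) sw_sw[OF i s(2,3)] by metis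
  moreover have "ss k * ee (swap_entries k i) \<doteq>\<^bsub>J\<^esub> ee i * ss k" if "i \<in> klr_words b"
    using B.s_ee[OF klr_words_swap[OF that s(2,3)] s(2,3)] sw_sw[OF i s(2,3)] by simp
  ultimately show ?thesis using s by (simp add: phi0_def klr_ck)
next
  case (e j)
  then show ?thesis using eqv_sym[OF B.ee_ee[of i j]] by (auto simp: phi0_def)
qed

lemma lact_phi0:
  assumes f: "f \<in> carrier (free_alg (KG b))" and i: "i \<in> A"
  shows "lact op f phi0 i \<doteq>\<^bsub>J\<^esub> phi0 i * f"
  using f i
proof (induction f arbitrary: i rule: free_alg_induct)
  case (scal c)
  then show ?case by (simp add: lact_fscal fscal_commute)
next
  case (var g f)
  have "fvar g \<in> carrier (free_alg VG)" using KG_VG[OF var(1)] by simp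
  then have "lact op (fvar g) (lact op f phi0) i \<doteq>\<^bsub>J\<^esub> lact op (fvar g) (\<lambda>i. phi0 i * f) i"
    by (rule lact_cong) (use var in auto)
  also have "\<dots> = op g phi0 i * f" by (simp add: lact_fvar op_right)
  also have "\<dots> \<doteq>\<^bsub>J\<^esub> phi0 i * fvar g * f" by (intro eqv_mult_right op_phi0 var)
  finally show ?case by (simp add: lact_fvar lact_fvar_mult mult.assoc)
next
  case (add f g)
  then show ?case by (simp add: lact_add distrib_left eqv_add)
qed

text \<open>The right factor enters as an operator on \<open>phi0\<close>, becomes a right
  multiplication by \<open>lact_phi0\<close>, and leaves through \<open>w\<close> since all
  operators commute with right multiplication.\<close>

lemma Pj_right:
  assumes f: "f \<in> carrier (free_alg (KG b))" and w: "w \<in> carrier (free_alg VG)"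
  shows "Pj (w * f) \<doteq>\<^bsub>J\<^esub> Pj w * f"
proof -
  have "lact op (w * f) phi0 i \<doteq>\<^bsub>J\<^esub> lact op w phi0 i * f" if "i \<in> klr_words b" for i
    using lact_cong[OF w lact_phi0[OF f] klr_words_A[OF that]] by (simp add: lact_mult lact_right)
  then show ?thesis unfolding Pj_def csum_def sum_distrib_right by (intro eqv_sum)
qed

lemma op_closed:
  assumes "g \<in> VG" "\<And>i. i \<in> A \<Longrightarrow> \<phi> i \<in> carrier (free_alg (KG b))" "i \<in> A"
  shows "op g \<phi> i \<in> carrier (free_alg (KG b))"
  using assms(1)
proof (cases rule: VG_cases)
  case (x l)
  have "xi i l \<in> carrier (free_alg (KG b))"
    using ps_range[OF assms(3) x(2,3)] by (auto simp: xi_def klr_gens_def intro!: free_alg_minus free_alg_fvar)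
  then show ?thesis using assms x by simp
next
  case (s k)
  have "ck i k \<in> carrier (free_alg (KG b))"
    using min_ps(1,2)[OF assms(3) s(2,3)] by (auto simp: ck_def klr_gens_def intro!: free_alg_fvar)
  then show ?thesis using assms s A_swap by simp
next
  case (e j)
  then show ?thesis using assms by simp
next
  case pi
  then show ?thesis using assms A_invert by simp
qed

lemma lact_closed:
  assumes "f \<in> carrier (free_alg VG)" "\<And>i. i \<in> A \<Longrightarrow> \<phi> i \<in> carrier (free_alg (KG b))" "i \<in> A"
  shows "lact op f \<phi> i \<in> carrier (free_alg (KG b))"
  using assms(1,3)
proof (induction f arbitrary: i rule: free_alg_induct)
  case (scal c)
  then show ?case using assms(2) by (simp add: lact_fscal)
next
  case (var g f)
  then show ?case by (simp add: lact_fvar_mult op_closed)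
next
  case (add f g)
  then show ?case by (simp add: lact_add)
qed

lemma Pj_closed: "f \<in> carrier (free_alg VG) \<Longrightarrow> Pj f \<in> carrier (free_alg (KG b))"
  unfolding Pj_def csum_def
  by (intro free_alg_sum lact_closed klr_words_A) (auto simp: phi0_def klr_gens_def)

end

section \<open>Surjectivity onto the corner\<close>

text \<open>This is sigma_n ... sigma_1, which carries the first letter to place n + 1.\<close>

primrec cyc :: "nat \<Rightarrow> 'k::field falg" where
  "cyc 0 = 1"
| "cyc (Suc n) = ss (Suc n) * cyc n"

section \<open>Coset representatives and their products with the generators\<close>

context vv_data
begin

lemma VR_relI: "f - g \<in> VR \<Longrightarrow> f \<doteq>\<^bsub>VR\<^esub> g"
  by (rule eqv_relI)

lemma pi_ee: "i \<in> A \<Longrightarrow> 1 \<le> m \<Longrightarrow> pp * ee i \<doteq>\<^bsub>VR\<^esub> ee (invert_first i) * pp"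
  by (rule VR_relI) (auto simp: vv_rels_def)

lemma pi_x1: "1 \<le> m \<Longrightarrow> pp * xx 1 \<doteq>\<^bsub>VR\<^esub> - (xx 1 * pp)"
  by (rule VR_relI) (auto simp: vv_rels_def)

lemma pi_x: "1 \<le> m \<Longrightarrow> 2 \<le> l \<Longrightarrow> l \<le> m \<Longrightarrow> pp * xx l \<doteq>\<^bsub>VR\<^esub> xx l * pp"
  by (rule VR_relI) (auto simp: vv_rels_def)

lemma pi_s: "2 \<le> k \<Longrightarrow> k < m \<Longrightarrow> pp * ss k \<doteq>\<^bsub>VR\<^esub> ss k * pp"
  by (rule VR_relI) (auto simp: vv_rels_def)

lemma pi_pi: "1 \<le> m \<Longrightarrow> pp * pp \<doteq>\<^bsub>VR\<^esub> 1"
  by (rule VR_relI) (auto simp: vv_rels_def)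

lemma s_pi: "2 \<le> m \<Longrightarrow> ss 1 * pp * ss 1 * pp \<doteq>\<^bsub>VR\<^esub> pp * ss 1 * pp * ss 1"
  by (rule VR_relI) (auto simp: vv_rels_def power2_eq_square mult.assoc)

text \<open>The number \<open>n\<close> counts the letters already passed. A negative letter at
  place n + 1 is inverted in front by pi and then carried to its place by \<open>cyc n\<close>. The
  rightmost factor acts first, so the last negative letter is the first one taken from the sorted
  word, in accordance with the reversal.\<close>

primrec tauw :: "nat \<Rightarrow> 'k list \<Rightarrow> 'k falg" where
  "tauw n [] = 1"
| "tauw n (x # w) = (if pos x then tauw (Suc n) w else cyc n * pp * tauw (Suc n) w)"

text \<open>The length of \<open>tauw n w\<close>: a negative letter contributes the
  \<open>n\<close> crossings of \<open>cyc n\<close> and one pi. It is the measure of the inductions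
  below.\<close>

primrec mu :: "nat \<Rightarrow> 'k list \<Rightarrow> nat" where
  "mu n [] = 0"
| "mu n (x # w) = (if pos x then 0 else Suc n) + mu (Suc n) w"

text \<open>The representative of the minimal coset of the Weyl group of type \<open>B\<close> that carries the
  sorted word to \<open>i\<close>.\<close>

definition M :: "'k list \<Rightarrow> 'k falg" where
  "M i = tauw 0 i * ee (srt i)"

lemma tauw_append: "(\<And>x. x \<in> set u \<Longrightarrow> pos x) \<Longrightarrow> tauw n (u @ w) = tauw (n + length u) w"
  by (induction u arbitrary: n) auto

lemma mu_append: "mu n (u @ w) = mu n u + mu (n + length u) w"
  by (induction u arbitrary: n) auto

lemma M_klr: "i \<in> klr_words b \<Longrightarrow> M i = ee i"
  using tauw_append[of i 0 "[]"] klr_words_pos[of i] by (simp add: M_def srt_klr)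

text \<open>A negative first letter contributes \<open>cyc 0 * pp\<close>, which is pi alone, as the
  leftmost factor; inverting the letter removes just this factor.\<close>

lemma M_invert:
  assumes "i \<in> A" "1 \<le> m" "\<not> sg i 1"
  shows "M i = pp * M (invert_first i)" "mu 0 (invert_first i) < mu 0 i"
proof -
  obtain x w where i: "i = x # w" using A_length[OF assms(1)] assms(2) by (cases i) auto
  have x: "\<not> pos x" using assms(3) i by (simp add: wsgn_def entry_def)
  moreover have "pos (inverse x)" using x hd_inv[OF assms(1,2)] i by simp
  ultimately show "M i = pp * M (invert_first i)" "mu 0 (invert_first i) < mu 0 i"
    using wsort_invert[of i pos] hd_inv[OF assms(1,2)] unfolding M_def i
    by (simp_all add: invert_first_def mult.assoc)
qed

lemma mu_swap:
  assumes "i \<in> A" "1 \<le> k" "k < m" "sg i k" "\<not> sg i (k + 1)"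
  shows "mu 0 (swap_entries k i) < mu 0 i"
proof -
  have len: "k < length i" using assms A_length by simp
  obtain u x y w where i: "i = u @ x # y # w" "k = Suc (length u)" "entry i k = x" "entry i (k + 1) = y"
    using split_at2[OF assms(2) len] by blast
  have s: "swap_entries k i = u @ y # x # w" unfolding i(1,2) by (rule swap_split)
  have "pos x" "\<not> pos y" using assms(4,5) i by (simp_all add: wsgn_def)
  then show ?thesis unfolding s unfolding i(1) by (simp add: mu_append)
qed

text \<open>Positive letters contribute nothing, so the leftmost factor comes from the first
  negative letter. If that stands at place \<open>k + 1\<close>, the factor is \<open>cyc k\<close>,
  whose leftmost factor is sigma_k.\<close>

lemma M_step:
  assumes "i \<in> A" "1 \<le> k" "k < m" "\<And>l. 1 \<le> l \<Longrightarrow> l \<le> k \<Longrightarrow> sg i l" "\<not> sg i (k + 1)"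
  shows "M i = ss k * M (swap_entries k i)"
proof -
  have len: "k < length i" using assms A_length by simp
  obtain u x y w where i: "i = u @ x # y # w" "k = Suc (length u)" "entry i k = x" "entry i (k + 1) = y"
    using split_at2[OF assms(2) len] by blast
  have u: "pos z" if z: "z \<in> set u" for z
  proof -
    obtain t where t: "t < length u" "u ! t = z" using z by (auto simp: in_set_conv_nth)
    then have "sg i (Suc t)" using assms(4)[of "Suc t"] i(2) by simp
    then show ?thesis using t by (simp add: wsgn_def i(1) entry_def nth_append)
  qed
  have xy: "pos x" "\<not> pos y" using assms(4)[of k] assms(2,5) i by (simp_all add: wsgn_def)
  have s: "swap_entries k i = u @ y # x # w" unfolding i(1,2) by (rule swap_split)
  have "srt (swap_entries k i) = srt i"
    using wsort_swap_mixed[OF assms(2) len, of pos] assms(2,4,5) by auto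
  moreover have "tauw 0 i = ss k * tauw 0 (swap_entries k i)"
    unfolding s unfolding i(1) using xy tauw_append[OF u] by (simp add: i(2) mult.assoc)
  ultimately show "M i = ss k * M (swap_entries k i)" by (simp add: M_def mult.assoc)
qed

text \<open>The case distinction behind the inductions on \<open>mu\<close>: the place of the first
  negative letter decides which factor of \<open>M i\<close> can be split off on the left.\<close>

lemma first_neg:
  assumes i: "i \<in> A"
  obtains (klr) "i \<in> klr_words b" | (inv) "1 \<le> m" "\<not> sg i 1"
    | (step) k where "1 \<le> k" "k < m" "\<And>l. 1 \<le> l \<Longrightarrow> l \<le> k \<Longrightarrow> sg i l" "\<not> sg i (k + 1)"
proof (cases "\<exists>l. 1 \<le> l \<and> l \<le> m \<and> \<not> sg i l")
  case True
  define l where "l = (LEAST l. 1 \<le> l \<and> l \<le> m \<and> \<not> sg i l)"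
  have l: "1 \<le> l \<and> l \<le> m \<and> \<not> sg i l" unfolding l_def using True by (rule LeastI_ex)
  have least: "sg i l'" if "1 \<le> l'" "l' < l" for l'
    using not_less_Least[of l' "\<lambda>l. 1 \<le> l \<and> l \<le> m \<and> \<not> sg i l"] that l unfolding l_def[symmetric] by auto
  show ?thesis
  proof (cases "l = 1")
    case True
    then show ?thesis using inv l by auto
  next
    case False
    then show ?thesis using step[of "l - 1"] l least by auto
  qed
next
  case False
  have "pos x" if x: "x \<in> set i" for x
  proof -
    obtain t where t: "t < length i" "i ! t = x" using x by (auto simp: in_set_conv_nth)
    then have "sg i (Suc t)" using False A_length[OF i] by auto
    then show ?thesis using t by (simp add: wsgn_def entry_def)
  qed
  then show ?thesis using klr srt_A[OF i] wsort_pos[of i pos] by simp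
qed

lemma ee_M: "i \<in> A \<Longrightarrow> ee i * M i \<doteq>\<^bsub>VR\<^esub> M i"
proof (induction "mu 0 i" arbitrary: i rule: less_induct)
  case less
  from less.prems show ?case
  proof (cases rule: first_neg)
    case klr
    then show ?thesis using W.ee_ee[OF less.prems less.prems] by (simp add: M_klr)
  next
    case inv
    let ?j = "invert_first i"
    have j: "?j \<in> A" by (rule A_invert[OF less.prems inv(1)])
    have "ee i * M i = (ee (invert_first ?j) * pp) * M ?j"
      by (simp add: M_invert[OF less.prems inv] iv_iv[OF less.prems inv(1)] mult.assoc)
    also have "\<dots> \<doteq>\<^bsub>VR\<^esub> (pp * ee ?j) * M ?j" by (intro eqv_mult_right eqv_sym[OF pi_ee] j inv)
    also have "\<dots> = pp * (ee ?j * M ?j)" by (simp add: mult.assoc)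
    also have "\<dots> \<doteq>\<^bsub>VR\<^esub> pp * M ?j" by (intro eqv_mult_left less.hyps M_invert less.prems inv j)
    finally show ?thesis by (simp add: M_invert[OF less.prems inv])
  next
    case (step k)
    let ?j = "swap_entries k i"
    have j: "?j \<in> A" by (rule A_swap[OF less.prems step(1,2)])
    have "ee i * M i = (ee (swap_entries k ?j) * ss k) * M ?j"
      by (simp add: M_step[OF less.prems step] sw_sw[OF less.prems step(1,2)] mult.assoc)
    also have "\<dots> \<doteq>\<^bsub>VR\<^esub> (ss k * ee ?j) * M ?j" by (intro eqv_mult_right eqv_sym[OF W.s_ee] j step)
    also have "\<dots> = ss k * (ee ?j * M ?j)" by (simp add: mult.assoc)
    also have "\<dots> \<doteq>\<^bsub>VR\<^esub> ss k * M ?j" by (intro eqv_mult_left less.hyps mu_swap less.prems step j) (use step in auto)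
    finally show ?thesis by (simp add: M_step[OF less.prems step])
  qed
qed

text \<open>Generalizes \<open>M_step\<close> to a negative letter that need not be the first one.
  The leftmost factor of \<open>M i\<close> is then pi with \<open>k\<close> at least 2, or a
  sigma_j with \<open>k\<close> at least \<open>j + 2\<close>; it commutes with sigma_k, which is
  why only a congruence holds.\<close>

lemma M_desc: "i \<in> A \<Longrightarrow> 1 \<le> k \<Longrightarrow> k < m \<Longrightarrow> sg i k \<Longrightarrow> \<not> sg i (k + 1) \<Longrightarrow> M i \<doteq>\<^bsub>VR\<^esub> ss k * M (swap_entries k i)"
proof (induction "mu 0 i" arbitrary: i rule: less_induct)
  case less
  note i = less.prems(1) and k = less.prems(2,3)
  have si: "swap_entries k i \<in> A" by (rule A_swap[OF i k])
  from i show ?case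
  proof (cases rule: first_neg)
    case klr
    then show ?thesis using klr_sg[OF klr, of "k + 1"] less.prems by simp
  next
    case inv
    have k2: "2 \<le> k" using inv less.prems by (cases "k = 1") auto
    have sg: "sg (invert_first i) k" "\<not> sg (invert_first i) (k + 1)" using i inv k2 less.prems by (simp_all add: sg_iv)
    have inv': "\<not> sg (swap_entries k i) 1" using inv sg_sw[OF i k, of 1] k2 k by (simp add: adj_swap_def)
    have "M i = pp * M (invert_first i)" by (rule M_invert[OF i inv])
    also have "\<dots> \<doteq>\<^bsub>VR\<^esub> pp * (ss k * M (swap_entries k (invert_first i)))"
      by (intro eqv_mult_left less.hyps M_invert i inv k sg A_invert)
    also have "\<dots> = (pp * ss k) * M (invert_first (swap_entries k i))" by (simp add: iv_sw[OF i k2 k(2)] mult.assoc)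
    also have "\<dots> \<doteq>\<^bsub>VR\<^esub> (ss k * pp) * M (invert_first (swap_entries k i))" by (intro eqv_mult_right pi_s k k2)
    also have "\<dots> = ss k * M (swap_entries k i)" by (simp add: M_invert(1)[OF si inv(1) inv'] mult.assoc)
    finally show ?thesis .
  next
    case (step j)
    show ?thesis
    proof (cases "j = k")
      case True
      then show ?thesis using M_step[OF i step] by simp
    next
      case False
      have jk: "j + 2 \<le> k"
      proof (rule ccontr)
        assume "\<not> j + 2 \<le> k"
        then have "k = j + 1 \<or> k + 1 \<le> j" using False by linarith
        then show False using step(3)[of "k + 1"] step(4) less.prems by auto
      qed
      have sg: "sg (swap_entries j i) k" "\<not> sg (swap_entries j i) (k + 1)"
        using sg_sw[OF i step(1,2), of k] sg_sw[OF i step(1,2), of "k + 1"] jk k less.prems by (simp_all add: adj_swap_def)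
      have st: "sg (swap_entries k i) l" if "1 \<le> l" "l \<le> j" for l
        using sg_sw[OF i k, of l] step(3)[OF that] that jk k by (simp add: adj_swap_def)
      have st': "\<not> sg (swap_entries k i) (j + 1)"
        using sg_sw[OF i k, of "j + 1"] step(4) jk k by (simp add: adj_swap_def)
      have "M i = ss j * M (swap_entries j i)" by (rule M_step[OF i step])
      also have "\<dots> \<doteq>\<^bsub>VR\<^esub> ss j * (ss k * M (swap_entries k (swap_entries j i)))"
        by (intro eqv_mult_left less.hyps mu_swap[OF i step(1,2) step(3)[OF step(1) order_refl] step(4)] k sg A_swap i step)
      also have "\<dots> = (ss j * ss k) * M (swap_entries j (swap_entries k i))"
        using sw_far[OF i step(1,2) k] jk by (simp add: mult.assoc)
      also have "\<dots> \<doteq>\<^bsub>VR\<^esub> (ss k * ss j) * M (swap_entries j (swap_entries k i))"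
        by (intro eqv_mult_right W.s_far step k) (use jk in auto)
      also have "\<dots> = ss k * M (swap_entries k i)" using M_step[OF si step(1,2) st st'] by (simp add: mult.assoc)
      finally show ?thesis .
    qed
  qed
qed

lemma ss_M:
  assumes i: "i \<in> A" and k: "1 \<le> k" "k < m" and mixed: "sg i k \<noteq> sg i (k + 1)"
  shows "ss k * ss k * M i \<doteq>\<^bsub>VR\<^esub> M i"
proof -
  have Q: "Qpoly p (entry i k) (entry i (k + 1)) (xx (k + 1)) (xx k :: 'k falg) = 1"
    using arrows_0[OF i, of k "k + 1"] arrows_0[OF i, of "k + 1" k] k mixed by (simp add: Qpoly_def)
  have "ss k * ss k * M i \<doteq>\<^bsub>VR\<^esub> ss k * ss k * (ee i * M i)" by (intro eqv_mult_left eqv_sym[OF ee_M] i)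
  also have "\<dots> = (ss k * ss k * ee i) * M i" by (simp add: mult.assoc)
  also have "\<dots> \<doteq>\<^bsub>VR\<^esub> ee i * M i" using eqv_mult_right[OF W.s_s[OF i k], of "M i"] unfolding Q by simp
  also have "\<dots> \<doteq>\<^bsub>VR\<^esub> M i" by (rule ee_M[OF i])
  finally show ?thesis .
qed

text \<open>If the positive letter comes first, \<open>M i\<close> has sigma_k as a left factor and
  the square of sigma_k cancels because Q = 1. In the other order this is \<open>M_desc\<close> for
  the swapped word.\<close>

lemma s_M_mixed:
  assumes i: "i \<in> A" and k: "1 \<le> k" "k < m" and mixed: "sg i k \<noteq> sg i (k + 1)"
  shows "ss k * M i \<doteq>\<^bsub>VR\<^esub> M (swap_entries k i)"
proof -
  let ?j = "swap_entries k i"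
  have j: "?j \<in> A" by (rule A_swap[OF i k])
  have sgj: "sg ?j k = sg i (k + 1)" "sg ?j (k + 1) = sg i k"
    using sg_sw[OF i k, of k] sg_sw[OF i k, of "k + 1"] k by (simp_all add: adj_swap_def)
  show ?thesis
  proof (cases "sg i k")
    case True
    have "ss k * M i \<doteq>\<^bsub>VR\<^esub> ss k * (ss k * M ?j)" by (intro eqv_mult_left M_desc i k) (use True mixed in auto)
    also have "\<dots> = ss k * ss k * M ?j" by (simp add: mult.assoc)
    also have "\<dots> \<doteq>\<^bsub>VR\<^esub> M ?j" by (intro ss_M j k) (use sgj mixed in auto)
    finally show ?thesis .
  next
    case False
    then show ?thesis using eqv_sym[OF M_desc[OF j k]] sgj mixed sw_sw[OF i k] by simp
  qed
qed

lemma pi_M: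
  assumes i: "i \<in> A" and m: "1 \<le> m"
  shows "pp * M i \<doteq>\<^bsub>VR\<^esub> M (invert_first i)"
proof (cases "sg i 1")
  case True
  have "\<not> sg (invert_first i) 1" using sg_iv[OF i m, of 1] True by simp
  then show ?thesis using M_invert(1)[OF A_invert[OF i m] m] iv_iv[OF i m] by simp
next
  case False
  have "pp * M i = (pp * pp) * M (invert_first i)" using M_invert(1)[OF i m False] by (simp add: mult.assoc)
  also have "\<dots> \<doteq>\<^bsub>VR\<^esub> 1 * M (invert_first i)" by (intro eqv_mult_right pi_pi m)
  finally show ?thesis by simp
qed

text \<open>Outer letters of opposite sign are different, so the braid relation has no correction
  term.\<close>

lemma braid_M:
  assumes i: "i \<in> A" and k: "1 \<le> k" "k + 1 < m" and mixed: "sg i k \<noteq> sg i (k + 2)"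
  shows "ss (k + 1) * (ss k * (ss (k + 1) * M i)) \<doteq>\<^bsub>VR\<^esub> ss k * (ss (k + 1) * (ss k * M i))"
proof -
  have "entry i k \<noteq> entry i (k + 2)" using mixed by (auto simp: wsgn_def)
  then have "(ss (k + 1) * ss k * ss (k + 1) - ss k * ss (k + 1) * ss k) * ee i \<doteq>\<^bsub>VR\<^esub> 0"
    using W.s_braid[OF i k] by simp
  then have *: "(ss (k + 1) * ss k * ss (k + 1)) * ee i \<doteq>\<^bsub>VR\<^esub> (ss k * ss (k + 1) * ss k) * ee i"
    by (simp add: left_diff_distrib eqv_diff_0)
  have "ss (k + 1) * ss k * ss (k + 1) * M i \<doteq>\<^bsub>VR\<^esub> ss (k + 1) * ss k * ss (k + 1) * (ee i * M i)"
    by (intro eqv_mult_left eqv_sym[OF ee_M] i)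
  also have "\<dots> = (ss (k + 1) * ss k * ss (k + 1) * ee i) * M i" by (simp add: mult.assoc)
  also have "\<dots> \<doteq>\<^bsub>VR\<^esub> (ss k * ss (k + 1) * ss k * ee i) * M i" by (intro eqv_mult_right *)
  also have "\<dots> = ss k * ss (k + 1) * ss k * (ee i * M i)" by (simp add: mult.assoc)
  also have "\<dots> \<doteq>\<^bsub>VR\<^esub> ss k * ss (k + 1) * ss k * M i" by (intro eqv_mult_left ee_M i)
  finally show ?thesis by (simp add: mult.assoc)
qed

text \<open>A crossing of equal signs passes through the representative and comes out on the right
  as a crossing in the sorted word. The leftmost factors of \<open>M i\<close> are split off and
  sigma_k is moved past them by commutation, by the braid relation or by the type B relation, until
  a shorter representative is reached.\<close>

lemma s_M_same: "i \<in> A \<Longrightarrow> 1 \<le> k \<Longrightarrow> k < m \<Longrightarrow> sg i k = sg i (k + 1) \<Longrightarrow> ss k * M i \<doteq>\<^bsub>VR\<^esub> M (swap_entries k i) * ck i k"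
proof (induction "mu 0 i" arbitrary: i k rule: less_induct)
  case less
  note i = less.prems(1) and k = less.prems(2,3) and same = less.prems(4)
  have si: "swap_entries k i \<in> A" by (rule A_swap[OF i k])
  from i show ?case
  proof (cases rule: first_neg)
    case klr
    then show ?thesis using W.s_ee[OF i k] klr_words_swap[OF klr k] by (simp add: M_klr klr_ck[OF klr k])
  next
    case inv
    let ?v = invert_first
    show ?thesis
    proof (cases "k = 1")
      case False
      then have k2: "2 \<le> k" using k by simp
      have same': "sg (?v i) k = sg (?v i) (k + 1)" using i inv k2 same by (simp add: sg_iv)
      have ckv: "ck (?v i) k = ck i k" using i inv k2 by (simp add: ck_def sg_iv ps_iv)
      have "ss k * M i = (ss k * pp) * M (?v i)" using M_invert(1)[OF i inv] by (simp add: mult.assoc)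
      also have "\<dots> \<doteq>\<^bsub>VR\<^esub> (pp * ss k) * M (?v i)" by (intro eqv_mult_right eqv_sym[OF pi_s] k k2)
      also have "\<dots> = pp * (ss k * M (?v i))" by (simp add: mult.assoc)
      also have "\<dots> \<doteq>\<^bsub>VR\<^esub> pp * (M (swap_entries k (?v i)) * ck (?v i) k)"
        by (intro eqv_mult_left less.hyps M_invert[OF i inv] A_invert i inv k same')
      also have "\<dots> = (pp * M (?v (swap_entries k i))) * ck i k" by (simp add: iv_sw[OF i k2 k(2)] ckv mult.assoc)
      also have "\<dots> \<doteq>\<^bsub>VR\<^esub> M (?v (?v (swap_entries k i))) * ck i k" by (intro eqv_mult_right pi_M A_invert si inv)
      finally show ?thesis using iv_iv[OF si inv(1)] by simp
    next
      case True
      let ?s = "swap_entries 1"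
      have m2: "2 \<le> m" "1 < m" "(1::nat) \<le> 1" using k True by auto
      \<comment> \<open>The first two letters are negative. Inverting, swapping and inverting again
        makes both positive in \<open>i3\<close>, so that \<open>M i\<close> is congruent to pi
        sigma_1 pi times \<open>M i3\<close>; the type B relation moves sigma_1 past these
        factors.\<close>
      define i1 where "i1 = ?v i"
      define i2 where "i2 = ?s i1"
      define i3 where "i3 = ?v i2"
      have in_A: "i1 \<in> A" "i2 \<in> A" "i3 \<in> A" "?s i3 \<in> A" "?v (?s i3) \<in> A" "?s (?v (?s i3)) \<in> A"
        unfolding i1_def i2_def i3_def using i m2 inv A_swap A_invert by simp_all
      have sgs: "\<not> sg i 1" "\<not> sg i 2" using inv same True by (simp_all add: numeral_2_eq_2)
      have sg1: "sg i1 1" "\<not> sg i1 2" using sgs i inv unfolding i1_def by (simp_all add: sg_iv)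
      have sg2: "\<not> sg i2 1" "sg i2 2" using sg1 in_A m2 unfolding i2_def by (simp_all add: sg_sw adj_swap_def numeral_2_eq_2)
      have sg3: "sg i3 1" "sg i3 2" using sg2 in_A inv unfolding i3_def by (simp_all add: sg_iv)
      have mu: "mu 0 i3 < mu 0 i"
      proof -
        have "mu 0 i1 < mu 0 i" unfolding i1_def by (rule M_invert[OF i inv])
        moreover have "mu 0 i2 < mu 0 i1" unfolding i2_def
          by (rule mu_swap[OF in_A(1) m2(3,2)]) (use sg1 in \<open>auto simp: numeral_2_eq_2\<close>)
        moreover have "mu 0 i3 < mu 0 i2" unfolding i3_def by (rule M_invert[OF in_A(2) inv(1) sg2(1)])
        ultimately show ?thesis by simp
      qed
      have ck3: "ck i3 1 = ck i 1"
        unfolding i3_def i2_def i1_def using i in_A[unfolded i3_def i2_def i1_def] inv(1) m2 sgs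
        by (simp add: ck_def sg_iv ps_iv sg_sw ps_sw adj_swap_def numeral_2_eq_2 min.commute)
      have word: "?v (?s (?v (?s i3))) = ?s i"
      proof -
        obtain x i' where x: "i = x # i'" using A_length[OF i] m2 by (cases i) auto
        moreover from this obtain y z where "i' = y # z" using A_length[OF i] m2 by (cases i') auto
        ultimately show ?thesis using nonzero A_Vs[OF i] unfolding i3_def i2_def i1_def
          by (simp add: swap_entries_def entry_def invert_first_def)
      qed
      have M3: "M i \<doteq>\<^bsub>VR\<^esub> pp * (ss 1 * (pp * M i3))"
      proof -
        have "M i = pp * M i1" unfolding i1_def by (rule M_invert[OF i inv])
        also have "\<dots> \<doteq>\<^bsub>VR\<^esub> pp * (ss 1 * M i2)" unfolding i2_def
          by (intro eqv_mult_left M_desc in_A m2 sg1) (use sg1 in \<open>simp add: numeral_2_eq_2\<close>)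
        also have "\<dots> = pp * (ss 1 * (pp * M i3))" using M_invert(1)[OF in_A(2) inv(1) sg2(1)] by (simp add: i3_def)
        finally show ?thesis .
      qed
      have "ss 1 * M i \<doteq>\<^bsub>VR\<^esub> ss 1 * (pp * (ss 1 * (pp * M i3)))" by (intro eqv_mult_left M3)
      also have "\<dots> = (ss 1 * pp * ss 1 * pp) * M i3" by (simp add: mult.assoc)
      also have "\<dots> \<doteq>\<^bsub>VR\<^esub> (pp * ss 1 * pp * ss 1) * M i3" by (intro eqv_mult_right s_pi m2)
      also have "\<dots> = pp * (ss 1 * (pp * (ss 1 * M i3)))" by (simp add: mult.assoc)
      also have "\<dots> \<doteq>\<^bsub>VR\<^esub> pp * (ss 1 * (pp * (M (?s i3) * ck i3 1)))"
        by (intro eqv_mult_left less.hyps mu in_A m2) (use sg3 in \<open>simp add: numeral_2_eq_2\<close>)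
      also have "\<dots> = pp * (ss 1 * (pp * M (?s i3))) * ck i 1" by (simp only: ck3 mult.assoc)
      also have "\<dots> \<doteq>\<^bsub>VR\<^esub> pp * (ss 1 * M (?v (?s i3))) * ck i 1"
        by (intro eqv_mult_right eqv_mult_left pi_M in_A inv)
      also have "\<dots> \<doteq>\<^bsub>VR\<^esub> pp * M (?s (?v (?s i3))) * ck i 1"
        by (intro eqv_mult_right eqv_mult_left s_M_mixed in_A m2)
          (use sg3 in_A m2 inv in \<open>simp add: sg_iv sg_sw adj_swap_def numeral_2_eq_2\<close>)
      also have "\<dots> \<doteq>\<^bsub>VR\<^esub> M (?v (?s (?v (?s i3)))) * ck i 1" by (intro eqv_mult_right pi_M in_A inv)
      finally show ?thesis unfolding word True .
    qed
  next
    case (step j)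
    have jk: "j \<noteq> k" using step(3)[of j] step(1,4) same by auto
    let ?t = "swap_entries j"
    have ti: "?t i \<in> A" by (rule A_swap[OF i step(1,2)])
    \<comment> \<open>The place of the crossing relative to the leftmost factor sigma_j. The case
      \<open>j = k\<close> is excluded, as the letters at \<open>j\<close> and \<open>j + 1\<close>
      differ in sign.\<close>
    consider (far) "j \<noteq> k + 1" "k \<noteq> j + 1" | (right) "j = k + 1" | (left) "k = j + 1" using jk by auto
    then show ?thesis
    proof cases
      case far
      have same': "sg (?t i) k = sg (?t i) (k + 1)"
        using sg_sw[OF i step(1,2), of k] sg_sw[OF i step(1,2), of "k + 1"] far jk k same by (simp add: adj_swap_def)
      have mixed: "sg (?t (swap_entries k i)) j \<noteq> sg (?t (swap_entries k i)) (j + 1)"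
        using si i step k far jk step(3)[of j] by (simp add: sg_sw adj_swap_def)
      have "ss k * M i = (ss k * ss j) * M (?t i)" using M_step[OF i step] by (simp add: mult.assoc)
      also have "\<dots> \<doteq>\<^bsub>VR\<^esub> (ss j * ss k) * M (?t i)" by (intro eqv_mult_right W.s_far step k) (use far in auto)
      also have "\<dots> = ss j * (ss k * M (?t i))" by (simp add: mult.assoc)
      also have "\<dots> \<doteq>\<^bsub>VR\<^esub> ss j * (M (swap_entries k (?t i)) * ck (?t i) k)"
        by (intro eqv_mult_left less.hyps mu_swap[OF i step(1,2) step(3)[OF step(1) order_refl] step(4)] ti k same')
      also have "\<dots> = (ss j * M (?t (swap_entries k i))) * ck i k"
        using sw_far[OF i step(1,2) k far] ck_far[OF i step(1,2) k jk far] by (simp add: mult.assoc)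
      also have "\<dots> \<doteq>\<^bsub>VR\<^esub> M (?t (?t (swap_entries k i))) * ck i k"
        by (intro eqv_mult_right s_M_mixed A_swap si step mixed)
      finally show ?thesis using sw_sw[OF si step(1,2)] by simp
    next
      \<comment> \<open>The signs at \<open>k\<close>, \<open>k + 1\<close>, \<open>k + 2\<close>
        are plus, plus, minus. Two steps bring the negative letter in front of the pair, and the
        braid relation turns sigma_k into the crossing of the pair at its new place
        \<open>k + 1\<close>.\<close>
      case right
      let ?s = "swap_entries k"
      have kk: "1 \<le> k" "k + 1 < m" "1 \<le> k + 1" using k right step by auto
      define i1 where "i1 = swap_entries (k + 1) i"
      define i2 where "i2 = ?s i1"
      let ?t = "swap_entries (k + 1)"
      have in_A: "i1 \<in> A" "i2 \<in> A" "?t i2 \<in> A" "?s (?t i2) \<in> A" "?t (?s (?t i2)) \<in> A"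
        unfolding i1_def i2_def using i k kk A_swap by simp_all
      have sgi: "sg i k" "sg i (k + 1)" "\<not> sg i (k + 2)" using step(3)[of k] step(3)[of "k + 1"] step(4) right kk by auto
      have sg1: "sg i1 k" "\<not> sg i1 (k + 1)" "sg i1 (k + 2)" unfolding i1_def using sgi i kk by (simp_all add: sg_sw adj_swap_def)
      have sg2: "\<not> sg i2 k" "sg i2 (k + 1)" "sg i2 (k + 2)" unfolding i2_def using sg1 in_A kk k by (simp_all add: sg_sw adj_swap_def)
      have mu: "mu 0 i2 < mu 0 i"
      proof -
        have "mu 0 i1 < mu 0 i" unfolding i1_def by (rule mu_swap[OF i kk(3,2)]) (use sgi in auto)
        moreover have "mu 0 i2 < mu 0 i1" unfolding i2_def by (rule mu_swap[OF in_A(1) k sg1(1,2)])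
        ultimately show ?thesis by simp
      qed
      have ck2: "ck i2 (k + 1) = ck i k"
        unfolding i2_def i1_def using i in_A[unfolded i2_def i1_def] k kk sgi
        by (simp add: ck_def sg_sw ps_sw adj_swap_def)
      have word: "?t (?s (?t i2)) = ?s i"
        using sw_braid[OF in_A(2) kk(1,2)] sw_sw[OF in_A(1) k] sw_sw[OF i kk(3,2)] unfolding i2_def i1_def by simp
      have "ss k * M i \<doteq>\<^bsub>VR\<^esub> ss k * (ss (k + 1) * M i1)" unfolding i1_def
        by (intro eqv_mult_left M_desc i kk) (use sgi in auto)
      also have "\<dots> \<doteq>\<^bsub>VR\<^esub> ss k * (ss (k + 1) * (ss k * M i2))" unfolding i2_def
        by (intro eqv_mult_left M_desc in_A k sg1)
      also have "\<dots> \<doteq>\<^bsub>VR\<^esub> ss (k + 1) * (ss k * (ss (k + 1) * M i2))"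
        by (rule eqv_sym[OF braid_M[OF in_A(2) kk(1,2)]]) (use sg2 in auto)
      also have "\<dots> \<doteq>\<^bsub>VR\<^esub> ss (k + 1) * (ss k * (M (?t i2) * ck i2 (k + 1)))"
        by (intro eqv_mult_left less.hyps mu in_A kk) (use sg2 in auto)
      also have "\<dots> = ss (k + 1) * (ss k * M (?t i2)) * ck i k" by (simp only: ck2 mult.assoc)
      also have "\<dots> \<doteq>\<^bsub>VR\<^esub> ss (k + 1) * M (?s (?t i2)) * ck i k"
        by (intro eqv_mult_right eqv_mult_left s_M_mixed in_A k) (use sg2 in_A kk in \<open>simp add: sg_sw adj_swap_def\<close>)
      also have "\<dots> \<doteq>\<^bsub>VR\<^esub> M (?t (?s (?t i2))) * ck i k"
        by (intro eqv_mult_right s_M_mixed in_A kk) (use sg2 in_A kk k in \<open>simp add: sg_sw adj_swap_def\<close>)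
      finally show ?thesis unfolding word .
    next
      \<comment> \<open>The signs at \<open>j\<close>, \<open>j + 1\<close>, \<open>j + 2\<close>
        are plus, minus, minus. Two steps bring the positive letter behind the pair, whose crossing
        is then at place \<open>j\<close>.\<close>
      case left
      let ?s = "swap_entries j" and ?t = "swap_entries (j + 1)"
      have j: "1 \<le> j" "j < m" "j + 1 < m" "1 \<le> j + 1" using k left step by auto
      define i1 where "i1 = ?s i"
      define i2 where "i2 = ?t i1"
      have in_A: "i1 \<in> A" "i2 \<in> A" "?s i2 \<in> A" "?t (?s i2) \<in> A" "?s (?t (?s i2)) \<in> A"
        unfolding i1_def i2_def using i j A_swap by simp_all
      have sgi: "sg i j" "\<not> sg i (j + 1)" "\<not> sg i (j + 2)" using step(3)[of j] step(4) left j same by auto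
      have sg1: "\<not> sg i1 j" "sg i1 (j + 1)" "\<not> sg i1 (j + 2)" unfolding i1_def using sgi i j by (simp_all add: sg_sw adj_swap_def)
      have sg2: "\<not> sg i2 j" "\<not> sg i2 (j + 1)" "sg i2 (j + 2)" unfolding i2_def using sg1 in_A j by (simp_all add: sg_sw adj_swap_def)
      have mu: "mu 0 i2 < mu 0 i"
      proof -
        have "mu 0 i1 < mu 0 i" unfolding i1_def by (rule mu_swap[OF i j(1,2) sgi(1,2)])
        moreover have "mu 0 i2 < mu 0 i1" unfolding i2_def
          by (rule mu_swap[OF in_A(1) j(4,3)]) (use sg1 in auto)
        ultimately show ?thesis by simp
      qed
      have ck2: "ck i2 j = ck i k"
        unfolding i2_def i1_def left using i in_A[unfolded i2_def i1_def] j sgi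
        by (simp add: ck_def sg_sw ps_sw adj_swap_def)
      have word: "?s (?t (?s i2)) = ?t i"
        using sw_braid[OF in_A(2) j(1,3)] sw_sw[OF in_A(1) j(4,3)] sw_sw[OF i j(1,2)] unfolding i2_def i1_def by simp
      have "ss (j + 1) * M i \<doteq>\<^bsub>VR\<^esub> ss (j + 1) * (ss j * M i1)" unfolding i1_def
        by (intro eqv_mult_left M_desc i j) (use sgi in auto)
      also have "\<dots> \<doteq>\<^bsub>VR\<^esub> ss (j + 1) * (ss j * (ss (j + 1) * M i2))" unfolding i2_def
        by (intro eqv_mult_left M_desc in_A j) (use sg1 in auto)
      also have "\<dots> \<doteq>\<^bsub>VR\<^esub> ss j * (ss (j + 1) * (ss j * M i2))"
        by (rule braid_M[OF in_A(2) j(1,3)]) (use sg2 in auto)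
      also have "\<dots> \<doteq>\<^bsub>VR\<^esub> ss j * (ss (j + 1) * (M (?s i2) * ck i2 j))"
        by (intro eqv_mult_left less.hyps mu in_A j) (use sg2 in auto)
      also have "\<dots> = ss j * (ss (j + 1) * M (?s i2)) * ck i k" by (simp only: ck2 mult.assoc)
      also have "\<dots> \<doteq>\<^bsub>VR\<^esub> ss j * M (?t (?s i2)) * ck i k"
        by (intro eqv_mult_right eqv_mult_left s_M_mixed in_A j) (use sg2 in_A j in \<open>simp add: sg_sw adj_swap_def\<close>)
      also have "\<dots> \<doteq>\<^bsub>VR\<^esub> M (?s (?t (?s i2))) * ck i k"
        by (intro eqv_mult_right s_M_mixed in_A j) (use sg2 in_A j in \<open>simp add: sg_sw adj_swap_def\<close>)
      finally show ?thesis unfolding word left .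
    qed
  qed
qed


lemma s_M: "i \<in> A \<Longrightarrow> 1 \<le> k \<Longrightarrow> k < m \<Longrightarrow> ss k * M i \<doteq>\<^bsub>VR\<^esub> M (swap_entries k i) * ck i k"
  using s_M_same[of i k] s_M_mixed[of i k] by (cases "sg i k = sg i (k + 1)") (simp_all add: ck_def)

lemma x_s_mixed:
  assumes i: "i \<in> A" and k: "1 \<le> k" "k < m" and l: "1 \<le> l" "l \<le> m" and mixed: "sg i k \<noteq> sg i (k + 1)"
  shows "xx l * ss k * ee i \<doteq>\<^bsub>VR\<^esub> ss k * xx (adj_swap k l) * ee i"
proof -
  have "adj_swap k (adj_swap k l) = l" by (simp add: adj_swap_def)
  moreover have "entry i k \<noteq> entry i (k + 1)" using mixed by (auto simp: wsgn_def)
  ultimately have "(ss k * xx (adj_swap k l) - xx l * ss k) * ee i \<doteq>\<^bsub>VR\<^esub> 0"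
    using W.s_x[OF i k, of "adj_swap k l"] adj_range[OF k l] by simp
  then show ?thesis by (simp add: left_diff_distrib eqv_diff_0 eqv_sym)
qed

text \<open>The crossings in \<open>M i\<close> exchange letters of opposite sign, hence different
  letters, so x moves past them without correction. The only change of sign comes from pi, which a
  letter passes exactly if it is negative in \<open>i\<close>.\<close>

lemma x_M: "i \<in> A \<Longrightarrow> 1 \<le> l \<Longrightarrow> l \<le> m \<Longrightarrow> xx l * M i \<doteq>\<^bsub>VR\<^esub> M i * xi i l"
proof (induction "mu 0 i" arbitrary: i l rule: less_induct)
  case less
  note i = less.prems(1) and l = less.prems(2,3)
  from i show ?case
  proof (cases rule: first_neg)
    case klr
    then show ?thesis using W.x_ee[OF i l] by (simp add: M_klr klr_xi[OF klr l])
  next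
    case inv
    let ?v = "invert_first i"
    have v: "?v \<in> A" by (rule A_invert[OF i inv(1)])
    have xi: "xi ?v l = (if l = 1 then - xi i l else xi i l)" using i inv l by (simp add: xi_def sg_iv ps_iv)
    have c: "xx l * pp \<doteq>\<^bsub>VR\<^esub> pp * (if l = 1 then - xx l else xx l)"
      using eqv_minus[OF pi_x1[OF inv(1)]] pi_x[OF inv(1), of l] l by (cases "l = 1") (auto intro: eqv_sym)
    have "xx l * M i = (xx l * pp) * M ?v" using M_invert(1)[OF i inv] by (simp add: mult.assoc)
    also have "\<dots> \<doteq>\<^bsub>VR\<^esub> (pp * (if l = 1 then - xx l else xx l)) * M ?v" by (intro eqv_mult_right c)
    also have "\<dots> = pp * (if l = 1 then - (xx l * M ?v) else xx l * M ?v)" by (simp add: mult.assoc)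
    also have "\<dots> \<doteq>\<^bsub>VR\<^esub> pp * (if l = 1 then - (M ?v * xi ?v l) else M ?v * xi ?v l)"
      using less.hyps[OF M_invert(2)[OF i inv] v l] by (auto intro!: eqv_mult_left eqv_minus)
    also have "\<dots> = M i * xi i l" unfolding M_invert(1)[OF i inv] xi by (simp add: mult.assoc)
    finally show ?thesis .
  next
    case (step k)
    let ?j = "swap_entries k i"
    have sgk: "sg i k" using step by auto
    have j: "?j \<in> A" by (rule A_swap[OF i step(1,2)])
    have mixed: "sg ?j k \<noteq> sg ?j (k + 1)"
      using sg_sw[OF i step(1,2), of k] sg_sw[OF i step(1,2), of "k + 1"] step sgk by (simp add: adj_swap_def)
    have ad: "1 \<le> adj_swap k l" "adj_swap k l \<le> m" using adj_range[OF step(1,2) l] by auto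
    have adad: "adj_swap k (adj_swap k l) = l" by (simp add: adj_swap_def)
    have xi: "xi ?j (adj_swap k l) = xi i l"
      using sg_sw[OF i step(1,2) ad] ps_sw[OF i step(1,2) ad] step(4) sgk unfolding adad by (simp add: xi_def)
    have "xx l * M i = xx l * ss k * M ?j" using M_step[OF i step] by (simp add: mult.assoc)
    also have "\<dots> \<doteq>\<^bsub>VR\<^esub> xx l * ss k * (ee ?j * M ?j)" by (intro eqv_mult_left eqv_sym[OF ee_M] j)
    also have "\<dots> = (xx l * ss k * ee ?j) * M ?j" by (simp add: mult.assoc)
    also have "\<dots> \<doteq>\<^bsub>VR\<^esub> (ss k * xx (adj_swap k l) * ee ?j) * M ?j"
      by (intro eqv_mult_right x_s_mixed j step l mixed)
    also have "\<dots> = ss k * xx (adj_swap k l) * (ee ?j * M ?j)" by (simp add: mult.assoc)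
    also have "\<dots> \<doteq>\<^bsub>VR\<^esub> ss k * xx (adj_swap k l) * M ?j" by (intro eqv_mult_left ee_M j)
    also have "\<dots> = ss k * (xx (adj_swap k l) * M ?j)" by (simp add: mult.assoc)
    also have "\<dots> \<doteq>\<^bsub>VR\<^esub> ss k * (M ?j * xi ?j (adj_swap k l))"
      by (intro eqv_mult_left less.hyps mu_swap[OF i step(1,2) sgk step(4)] j ad)
    also have "\<dots> = M i * xi i l" using M_step[OF i step] by (simp add: xi mult.assoc)
    finally show ?thesis .
  qed
qed

text \<open>Realizes a family inside the VV algebra; by \<open>Tm_lact\<close> left multiplication
  corresponds to the action by operators.\<close>

definition Tm :: "('k list \<Rightarrow> 'k falg) \<Rightarrow> 'k falg" where
  "Tm \<phi> = (\<Sum>i\<in>A. M i * \<phi> i)"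

lemma Tm_op:
  assumes g: "g \<in> VG"
  shows "fvar g * Tm \<phi> \<doteq>\<^bsub>VR\<^esub> Tm (op g \<phi>)"
  using g
proof (cases rule: VG_cases)
  case (x l)
  have "(\<Sum>i\<in>A. xx l * M i * \<phi> i) \<doteq>\<^bsub>VR\<^esub> (\<Sum>i\<in>A. M i * xi i l * \<phi> i)"
    by (intro eqv_sum eqv_mult_right x_M x)
  then show ?thesis by (simp add: x(1) Tm_def sum_distrib_left mult.assoc)
next
  case (s k)
  have "(\<Sum>i\<in>A. ss k * M i * \<phi> i) \<doteq>\<^bsub>VR\<^esub> (\<Sum>i\<in>A. M (swap_entries k i) * ck i k * \<phi> i)"
    by (intro eqv_sum eqv_mult_right s_M s)
  also have "\<dots> = (\<Sum>i\<in>A. M i * ck i k * \<phi> (swap_entries k i))"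
    by (rule sum.reindex_bij_witness[of _ "swap_entries k" "swap_entries k"])
      (use s in \<open>auto simp: A_swap sw_sw ck_sw\<close>)
  finally show ?thesis by (simp add: s(1) Tm_def sum_distrib_left mult.assoc)
next
  case (e j)
  have "(\<Sum>i\<in>A. ee j * M i * \<phi> i) \<doteq>\<^bsub>VR\<^esub> (\<Sum>i\<in>A. M i * (if i = j then \<phi> i else 0))"
  proof (rule eqv_sum)
    fix i assume i: "i \<in> A"
    have "ee j * M i \<doteq>\<^bsub>VR\<^esub> ee j * (ee i * M i)" by (intro eqv_mult_left eqv_sym[OF ee_M] i)
    also have "\<dots> = (ee j * ee i) * M i" by (simp add: mult.assoc)
    also have "\<dots> \<doteq>\<^bsub>VR\<^esub> (if j = i then ee j else 0) * M i" by (intro eqv_mult_right W.ee_ee e i)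
    also have "\<dots> \<doteq>\<^bsub>VR\<^esub> (if i = j then M i else 0)" using ee_M[OF i] by auto
    finally have "ee j * M i * \<phi> i \<doteq>\<^bsub>VR\<^esub> (if i = j then M i else 0) * \<phi> i" by (rule eqv_mult_right)
    then show "ee j * M i * \<phi> i \<doteq>\<^bsub>VR\<^esub> M i * (if i = j then \<phi> i else 0)" by (cases "i = j") simp_all
  qed
  then show ?thesis by (simp add: e(1) Tm_def sum_distrib_left mult.assoc)
next
  case pi
  have "(\<Sum>i\<in>A. pp * M i * \<phi> i) \<doteq>\<^bsub>VR\<^esub> (\<Sum>i\<in>A. M (invert_first i) * \<phi> i)"
    by (intro eqv_sum eqv_mult_right pi_M pi)
  also have "\<dots> = (\<Sum>i\<in>A. M i * \<phi> (invert_first i))"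
    by (rule sum.reindex_bij_witness[of _ invert_first invert_first])
      (use pi in \<open>auto simp: A_invert iv_iv\<close>)
  finally show ?thesis by (simp add: pi(1) Tm_def sum_distrib_left mult.assoc)
qed

lemma Tm_lact:
  assumes "f \<in> carrier (free_alg VG)"
  shows "f * Tm \<phi> \<doteq>\<^bsub>VR\<^esub> Tm (lact op f \<phi>)"
  using assms
proof (induction f rule: free_alg_induct)
  case (scal c)
  show ?case by (simp add: Tm_def lact_fscal sum_distrib_left fscal_left_commute)
next
  case (var g f)
  have "fvar g * (f * Tm \<phi>) \<doteq>\<^bsub>VR\<^esub> fvar g * Tm (lact op f \<phi>)" by (intro eqv_mult_left var)
  also have "\<dots> \<doteq>\<^bsub>VR\<^esub> Tm (op g (lact op f \<phi>))" by (rule Tm_op[OF var(1)])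
  finally show ?case by (simp add: lact_fvar_mult mult.assoc)
next
  case (add f g)
  then show ?case by (simp add: Tm_def lact_add distrib_left distrib_right sum.distrib eqv_add)
qed

abbreviation ep where "ep \<equiv> eset (klr_words b)"

lemma klr_sub_A: "klr_words b \<subseteq> A"
  using klr_words_A by blast

lemma ep_idem: "ep * ep \<doteq>\<^bsub>VR\<^esub> ep"
  using W.eset_eset[OF klr_sub_A klr_sub_A] by simp

lemma ep_comm: "f \<in> carrier (free_alg (KG b)) \<Longrightarrow> ep * f \<doteq>\<^bsub>VR\<^esub> f * ep"
proof -
  assume f: "f \<in> carrier (free_alg (KG b))"
  have "ep * fsubst fvar f \<doteq>\<^bsub>VR\<^esub> fsubst fvar f * ep"
  proof (rule fsubst_commute_gens[OF f])
    fix g assume "g \<in> KG b"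
    then show "ep * fvar g \<doteq>\<^bsub>VR\<^esub> fvar g * ep"
    proof (cases rule: KG_cases)
      case (x l)
      then show ?thesis using W.x_eset[OF klr_sub_A, of l] by (auto intro: eqv_sym)
    next
      case (s k)
      then show ?thesis using W.s_eset[OF klr_sub_A, of k] swap_stable_klr_words[of k b] by (auto intro: eqv_sym)
    next
      case (e j)
      then show ?thesis
        using eqv_trans[OF W.eset_ee[of j "klr_words b"] eqv_sym[OF W.ee_eset[of j "klr_words b"]]] klr_sub_A by auto
    qed
  qed
  then show ?thesis using fsubst_id_on[OF f, of fvar] by simp
qed

lemma ep_cong:
  assumes "f \<in> carrier (free_alg (KG b))" "g \<in> carrier (free_alg (KG b))" "f \<doteq>\<^bsub>J\<^esub> g"
  shows "ep * f \<doteq>\<^bsub>VR\<^esub> ep * g"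
proof -
  have "ep * fsubst fvar f \<doteq>\<^bsub>VR\<^esub> ep * fsubst fvar g"
  proof (rule corner_hom[OF KJ_closed assms])
    show "ep * fvar g \<doteq>\<^bsub>VR\<^esub> fvar g * ep" if "g \<in> KG b" for g using ep_comm[of "fvar g"] that by simp
    fix r assume r: "r \<in> J"
    show "ep * fsubst fvar r \<doteq>\<^bsub>VR\<^esub> 0"
    \<comment> \<open>The sum of the idempotents over \<open>klr_words b\<close> is 1 in the KLR
      algebra but only \<open>ep\<close> in the VV algebra. All other KLR relations are relations of
      the VV algebra as well.\<close>
    proof (cases "r = ep - 1")
      case True
      have "fsubst fvar r = r" by (rule fsubst_id_on[OF _ refl]) (use r KJ_closed in blast)
      then show ?thesis using ep_idem True by (simp add: right_diff_distrib eqv_diff_0)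
    next
      case False
      then have "r \<in> klr_rels p m A" using r klr_sub_A unfolding klr_rels_def eset_def
        by (simp only: Un_iff) (elim disjE; blast)
      then have "r \<doteq>\<^bsub>VR\<^esub> 0" using W.relI[of r 0] by simp
      moreover have "fsubst fvar r = r" by (rule fsubst_id_on[OF _ refl]) (use r KJ_closed in blast)
      ultimately show ?thesis using eqv_mult_left[of r VR 0 ep] by simp
    qed
  qed
  moreover have "fsubst fvar f = f" "fsubst fvar g = g" using fsubst_id_on assms(1,2) by blast+
  ultimately show ?thesis by simp
qed

text \<open>\<open>Tm phi0\<close> is congruent to \<open>ep\<close>, so \<open>s * ep\<close> is
  the image under \<open>Tm\<close> of \<open>s\<close> acting on \<open>phi0\<close>.
  Multiplication by \<open>ep\<close> on the left kills \<open>M i\<close> unless \<open>i\<close>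
  is a word of positive letters, in which case \<open>M i\<close> is e(i). What remains is the sum
  that defines \<open>Pj s\<close>.\<close>

lemma ep_surj:
  assumes s: "s \<in> carrier (free_alg VG)"
  shows "ep * s * ep \<doteq>\<^bsub>VR\<^esub> ep * Pj s * ep"
proof -
  have T0: "Tm phi0 \<doteq>\<^bsub>VR\<^esub> ep"
  proof -
    have "Tm phi0 = (\<Sum>i\<in>klr_words b. M i * phi0 i)" unfolding Tm_def
      by (rule sum.mono_neutral_right) (auto simp: finite_A klr_words_A phi0_def)
    also have "\<dots> = (\<Sum>i\<in>klr_words b. ee i * ee i)" by (intro sum.cong) (auto simp: M_klr phi0_def)
    also have "\<dots> \<doteq>\<^bsub>VR\<^esub> (\<Sum>i\<in>klr_words b. ee i)"
      using W.ee_ee klr_words_A by (intro eqv_sum) fastforce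
    finally show ?thesis by (simp add: eset_def)
  qed
  let ?\<phi> = "lact op s phi0"
  have "ep * s * ep = ep * (s * ep)" by (simp add: mult.assoc)
  also have "\<dots> \<doteq>\<^bsub>VR\<^esub> ep * (s * Tm phi0)" by (intro eqv_mult_left eqv_sym[OF T0])
  also have "\<dots> \<doteq>\<^bsub>VR\<^esub> ep * Tm ?\<phi>" by (intro eqv_mult_left Tm_lact s)
  also have "\<dots> = (\<Sum>i\<in>A. ep * M i * ?\<phi> i)" by (simp add: Tm_def sum_distrib_left mult.assoc)
  also have "\<dots> \<doteq>\<^bsub>VR\<^esub> (\<Sum>i\<in>A. if i \<in> klr_words b then ep * ?\<phi> i else 0)"
  proof (rule eqv_sum)
    fix i assume i: "i \<in> A"
    show "ep * M i * ?\<phi> i \<doteq>\<^bsub>VR\<^esub> (if i \<in> klr_words b then ep * ?\<phi> i else 0)"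
    proof (cases "i \<in> klr_words b")
      case True
      have cl: "?\<phi> i \<in> carrier (free_alg (KG b))"
        by (rule lact_closed[OF s _ i]) (auto simp: phi0_def klr_gens_def)
      \<comment> \<open>This congruence holds in the KLR algebra; \<open>ep_cong\<close> carries it
        over to the VV algebra behind the factor \<open>ep\<close>.\<close>
      have "ee i * ?\<phi> i \<doteq>\<^bsub>J\<^esub> ?\<phi> i" using lact_adm[OF s adm_phi0] i srt_klr[OF True] by (auto simp: adm_def)
      then have "ep * (ee i * ?\<phi> i) \<doteq>\<^bsub>VR\<^esub> ep * ?\<phi> i"
        using True cl by (intro ep_cong) (auto simp: klr_gens_def)
      then show ?thesis using True by (simp add: M_klr mult.assoc)
    next
      case False
      have "ep * M i \<doteq>\<^bsub>VR\<^esub> ep * (ee i * M i)" by (intro eqv_mult_left eqv_sym[OF ee_M] i)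
      also have "\<dots> = (ep * ee i) * M i" by (simp add: mult.assoc)
      also have "\<dots> \<doteq>\<^bsub>VR\<^esub> 0 * M i" using W.eset_ee[OF i klr_sub_A] False by (intro eqv_mult_right) simp
      finally show ?thesis using eqv_mult_right[of "ep * M i" VR 0 "?\<phi> i"] False by simp
    qed
  qed
  also have "\<dots> = ep * Pj s"
    using klr_sub_A finite_A by (simp add: Pj_def csum_def sum_distrib_left sum.If_cases Int_absorb1)
  also have "\<dots> \<doteq>\<^bsub>VR\<^esub> (ep * ep) * Pj s" by (intro eqv_mult_right eqv_sym[OF ep_idem])
  also have "\<dots> = ep * (ep * Pj s)" by (simp add: mult.assoc)
  also have "\<dots> \<doteq>\<^bsub>VR\<^esub> ep * (Pj s * ep)" by (intro eqv_mult_left ep_comm Pj_closed s)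
  finally show ?thesis by (simp add: mult.assoc)
qed

end

section \<open>Associativity from the corner isomorphisms\<close>

text \<open>\<open>K\<close> is the KLR algebra and \<open>W\<close> the VV algebra;
  \<open>rho\<close> sends the unit of \<open>K\<close> to the idempotent of the corner. The
  linearity of \<open>P\<close> with \<open>P_one\<close> makes \<open>rho\<close> injective, see
  \<open>P_rho\<close>, and \<open>rho_P\<close> says that its image is the whole corner.\<close>

locale corner = K: ring K + W: ring W
  for K :: "('t, 'x) ring_scheme" and W :: "('w set, 'y) ring_scheme" +
  fixes rho :: "'t \<Rightarrow> 'w set" and P :: "'w set \<Rightarrow> 't"
  assumes rho_closed: "r \<in> carrier K \<Longrightarrow> rho r \<in> carrier W"
    and rho_add: "r \<in> carrier K \<Longrightarrow> s \<in> carrier K \<Longrightarrow> rho (r \<oplus>\<^bsub>K\<^esub> s) = rho r \<oplus>\<^bsub>W\<^esub> rho s"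
    and rho_mult: "r \<in> carrier K \<Longrightarrow> s \<in> carrier K \<Longrightarrow> rho (r \<otimes>\<^bsub>K\<^esub> s) = rho r \<otimes>\<^bsub>W\<^esub> rho s"
    and P_closed: "w \<in> carrier W \<Longrightarrow> P w \<in> carrier K"
    and P_add: "w \<in> carrier W \<Longrightarrow> v \<in> carrier W \<Longrightarrow> P (w \<oplus>\<^bsub>W\<^esub> v) = P w \<oplus>\<^bsub>K\<^esub> P v"
    and P_left: "r \<in> carrier K \<Longrightarrow> w \<in> carrier W \<Longrightarrow> P (rho r \<otimes>\<^bsub>W\<^esub> w) = r \<otimes>\<^bsub>K\<^esub> P w"
    and P_right: "r \<in> carrier K \<Longrightarrow> w \<in> carrier W \<Longrightarrow> P (w \<otimes>\<^bsub>W\<^esub> rho r) = P w \<otimes>\<^bsub>K\<^esub> r"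
    and P_one: "P \<one>\<^bsub>W\<^esub> = \<one>\<^bsub>K\<^esub>"
    and rho_P: "w \<in> carrier W \<Longrightarrow> rho (P w) = rho \<one>\<^bsub>K\<^esub> \<otimes>\<^bsub>W\<^esub> w \<otimes>\<^bsub>W\<^esub> rho \<one>\<^bsub>K\<^esub>"
begin

lemma P_rho: "r \<in> carrier K \<Longrightarrow> P (rho r) = r"
  using P_left[of r "\<one>\<^bsub>W\<^esub>"] by (simp add: rho_closed P_one)

text \<open>A new record and not an update of \<open>M\<close>, since the type of the scalars
  changes.\<close>

definition resm :: "('w set, 'm) module \<Rightarrow> ('t, 'm) module" where
  "resm M = \<lparr>carrier = (\<lambda>x. rho \<one>\<^bsub>K\<^esub> \<odot>\<^bsub>M\<^esub> x) ` carrier M, monoid.mult = monoid.mult M, monoid.one = monoid.one M,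
     ring.zero = ring.zero M, ring.add = ring.add M, smult = (\<lambda>r x. rho r \<odot>\<^bsub>M\<^esub> x)\<rparr>"

lemma resm_sel [simp]: "ring.add (resm M) = ring.add M" "ring.zero (resm M) = ring.zero M"
  "smult (resm M) = (\<lambda>r x. rho r \<odot>\<^bsub>M\<^esub> x)"
  by (simp_all add: resm_def)

lemma resm_iff:
  assumes "left_module W M"
  shows "x \<in> carrier (resm M) \<longleftrightarrow> x \<in> carrier M \<and> rho \<one>\<^bsub>K\<^esub> \<odot>\<^bsub>M\<^esub> x = x"
proof -
  interpret M: left_module W M by fact
  have "rho \<one>\<^bsub>K\<^esub> \<odot>\<^bsub>M\<^esub> (rho \<one>\<^bsub>K\<^esub> \<odot>\<^bsub>M\<^esub> x) = rho \<one>\<^bsub>K\<^esub> \<odot>\<^bsub>M\<^esub> x" if "x \<in> carrier M" for x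
    using that by (simp add: rho_closed flip: M.smult_assoc rho_mult)
  then show ?thesis using M.smult_closed rho_closed[OF K.one_closed] by (auto simp: resm_def intro: image_eqI[of _ _ x])
qed

lemma resm_mem:
  assumes "left_module W M" "x \<in> carrier M"
  shows "rho \<one>\<^bsub>K\<^esub> \<odot>\<^bsub>M\<^esub> x \<in> carrier (resm M)"
  using assms(2) by (simp add: resm_def)

lemma left_module_resm:
  assumes "left_module W M" shows "left_module K (resm M)"
proof -
  interpret M: left_module W M by fact
  have e: "rho \<one>\<^bsub>K\<^esub> \<in> carrier W" by (simp add: rho_closed)
  have ab: "abelian_group (resm M)"
  proof (rule abelian_group_sub[OF M.M.abelian_group_axioms])
    show "carrier (resm M) \<subseteq> carrier M" using resm_iff[OF assms] by blast
    show "\<zero>\<^bsub>M\<^esub> \<in> carrier (resm M)" using e by (simp add: resm_iff[OF assms] M.smult_zero)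
    show "x \<oplus>\<^bsub>M\<^esub> y \<in> carrier (resm M)" if "x \<in> carrier (resm M)" "y \<in> carrier (resm M)" for x y
      using that e by (simp add: resm_iff[OF assms] M.smult_r_distr)
    show "\<ominus>\<^bsub>M\<^esub> x \<in> carrier (resm M)" if "x \<in> carrier (resm M)" for x
    proof -
      have x: "x \<in> carrier M" "rho \<one>\<^bsub>K\<^esub> \<odot>\<^bsub>M\<^esub> x = x" using that resm_iff[OF assms] by auto
      have "rho \<one>\<^bsub>K\<^esub> \<odot>\<^bsub>M\<^esub> (\<ominus>\<^bsub>M\<^esub> x) \<oplus>\<^bsub>M\<^esub> x = \<zero>\<^bsub>M\<^esub>"
        using M.smult_r_distr[OF e, of "\<ominus>\<^bsub>M\<^esub> x" x] x M.smult_zero[OF e] by (simp add: M.M.l_neg)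
      then have "rho \<one>\<^bsub>K\<^esub> \<odot>\<^bsub>M\<^esub> (\<ominus>\<^bsub>M\<^esub> x) = \<ominus>\<^bsub>M\<^esub> x"
        using x e by (metis M.M.a_inv_closed M.M.minus_equality M.smult_closed)
      then show ?thesis using x by (simp add: resm_iff[OF assms])
    qed
  qed simp_all
  interpret R: abelian_group "resm M" by (rule ab)
  show ?thesis
  proof unfold_locales
    fix a x assume a: "a \<in> carrier K" and x: "x \<in> carrier (resm M)"
    have x': "x \<in> carrier M" using x resm_iff[OF assms] by blast
    have "rho \<one>\<^bsub>K\<^esub> \<odot>\<^bsub>M\<^esub> (rho a \<odot>\<^bsub>M\<^esub> x) = rho a \<odot>\<^bsub>M\<^esub> x"
      using a x' by (simp add: rho_closed flip: M.smult_assoc rho_mult)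
    then show "a \<odot>\<^bsub>resm M\<^esub> x \<in> carrier (resm M)"
      using a x' by (simp add: resm_iff[OF assms] M.smult_closed rho_closed)
  qed (simp_all add: resm_iff[OF assms] rho_add rho_mult rho_closed M.smult_l_distr M.smult_r_distr M.smult_assoc)
qed

end

locale pairing = K1: ring K1 + K2: ring K2 + K3: ring K3
  for K1 :: "('t, 'x) ring_scheme" and K2 :: "('t, 'y) ring_scheme" and K3 :: "('t, 'z) ring_scheme" +
  fixes ka :: "'t \<Rightarrow> 't \<Rightarrow> 't" and s1 s2 :: "'k \<Rightarrow> 't"
  assumes ka_closed: "r \<in> carrier K1 \<Longrightarrow> s \<in> carrier K2 \<Longrightarrow> ka r s \<in> carrier K3"
    and ka_add_left: "r \<in> carrier K1 \<Longrightarrow> r' \<in> carrier K1 \<Longrightarrow> s \<in> carrier K2 \<Longrightarrow>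
      ka (r \<oplus>\<^bsub>K1\<^esub> r') s = ka r s \<oplus>\<^bsub>K3\<^esub> ka r' s"
    and ka_add_right: "r \<in> carrier K1 \<Longrightarrow> s \<in> carrier K2 \<Longrightarrow> s' \<in> carrier K2 \<Longrightarrow>
      ka r (s \<oplus>\<^bsub>K2\<^esub> s') = ka r s \<oplus>\<^bsub>K3\<^esub> ka r s'"
    and ka_mult: "r \<in> carrier K1 \<Longrightarrow> r' \<in> carrier K1 \<Longrightarrow> s \<in> carrier K2 \<Longrightarrow> s' \<in> carrier K2 \<Longrightarrow>
      ka (r \<otimes>\<^bsub>K1\<^esub> r') (s \<otimes>\<^bsub>K2\<^esub> s') = ka r s \<otimes>\<^bsub>K3\<^esub> ka r' s'"
    and ka_balanced: "r \<in> carrier K1 \<Longrightarrow> s \<in> carrier K2 \<Longrightarrow> ka (s1 c \<otimes>\<^bsub>K1\<^esub> r) s = ka r (s2 c \<otimes>\<^bsub>K2\<^esub> s)"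
    and s1_closed: "s1 c \<in> carrier K1" and s1_central: "r \<in> carrier K1 \<Longrightarrow> s1 c \<otimes>\<^bsub>K1\<^esub> r = r \<otimes>\<^bsub>K1\<^esub> s1 c"
    and s2_closed: "s2 c \<in> carrier K2" and s2_central: "s \<in> carrier K2 \<Longrightarrow> s2 c \<otimes>\<^bsub>K2\<^esub> s = s \<otimes>\<^bsub>K2\<^esub> s2 c"
begin

lemma ka_one_right: "r \<in> carrier K1 \<Longrightarrow> s \<in> carrier K2 \<Longrightarrow> ka r s \<otimes>\<^bsub>K3\<^esub> ka \<one>\<^bsub>K1\<^esub> \<one>\<^bsub>K2\<^esub> = ka r s"
  by (simp flip: ka_mult)

lemma ka_one_left: "r \<in> carrier K1 \<Longrightarrow> s \<in> carrier K2 \<Longrightarrow> ka \<one>\<^bsub>K1\<^esub> \<one>\<^bsub>K2\<^esub> \<otimes>\<^bsub>K3\<^esub> ka r s = ka r s"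
  by (simp flip: ka_mult)

end

locale conv_setup = C: corner K3 W rho P + pairing K1 K2 K3 ka s1 s2 + MA: left_module K1 A + MB: left_module K2 B
  for K1 :: "('t, 'x) ring_scheme" and K2 :: "('t, 'y) ring_scheme" and K3 :: "('t, 'z) ring_scheme"
    and W :: "('w set, 'u) ring_scheme" and rho P ka and s1 s2 :: "'k \<Rightarrow> 't"
    and A :: "('t, 'a) module" and B :: "('t, 'b) module" +
  fixes pe :: "'t \<times> 't \<Rightarrow> 'w set" and e :: "'w set"
  assumes pe: "r \<in> carrier K1 \<Longrightarrow> s \<in> carrier K2 \<Longrightarrow> pe (r, s) = rho (ka r s)"
    and e: "e = rho (ka \<one>\<^bsub>K1\<^esub> \<one>\<^bsub>K2\<^esub>)"
begin

sublocale convolution K1 K2 A B s1 s2 W pe e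
proof unfold_locales
  show "e \<otimes>\<^bsub>W\<^esub> e = e" unfolding e by (simp add: ka_one_right ka_closed flip: C.rho_mult)
  show "pe (r, s) \<otimes>\<^bsub>W\<^esub> e = pe (r, s)" if "r \<in> carrier K1" "s \<in> carrier K2" for r s
    unfolding e using that by (simp add: pe ka_one_right ka_closed flip: C.rho_mult)
  show "pe (s1 c \<otimes>\<^bsub>K1\<^esub> r, s) = pe (r, s2 c \<otimes>\<^bsub>K2\<^esub> s)" if "r \<in> carrier K1" "s \<in> carrier K2" for r s c
    using that by (simp add: pe s1_closed s2_closed ka_balanced)
qed (auto simp: s1_closed s1_central s2_closed s2_central e pe C.rho_closed ka_closed ka_add_left ka_add_right C.rho_add)

end


text \<open>The indices throughout: \<open>S1\<close> is M o L, \<open>S2\<close> is (M o L) o N,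
  \<open>S3\<close> is L o N and \<open>S4\<close> is M o (L o N). The letters b, a, c belong to M,
  L, N in this order; M o L is a module over \<open>W1\<close>, L o N over \<open>W2\<close>, and
  both iterated products over \<open>Wn\<close>.\<close>

locale assoc_setup =
  S1: conv_setup Kb Ka Kba W1 rho1 P1 ka1 sb sa M L pe1 e1 +
  S3: conv_setup Ka Kc Kac W2 rho2 P2 ka3 sa sc L N pe3 e3 +
  Cn: corner Kn Wn rho P +
  p2: pairing Kba Kc Kn ka2 sba sc + p4: pairing Kb Kac Kn ka4 sb sac
  for Kb Ka Kc Kba Kac Kn :: "'t ring" and W1 W2 Wn :: "'w set ring"
    and rho1 P1 rho2 P2 rho P ka1 ka2 ka3 ka4 and sb sa sc sba sac :: "'k \<Rightarrow> 't"
    and M :: "('t, 'm) module" and L :: "('t, 'l) module" and N :: "('t, 'n) module"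
    and pe1 e1 pe3 e3 +
  fixes pe2 e2 pe4 e4
  assumes pe2: "r \<in> carrier Kba \<Longrightarrow> s \<in> carrier Kc \<Longrightarrow> pe2 (r, s) = rho (ka2 r s)"
    and e2: "e2 = rho (ka2 \<one>\<^bsub>Kba\<^esub> \<one>\<^bsub>Kc\<^esub>)"
    and pe4: "r \<in> carrier Kb \<Longrightarrow> s \<in> carrier Kac \<Longrightarrow> pe4 (r, s) = rho (ka4 r s)"
    and e4: "e4 = rho (ka4 \<one>\<^bsub>Kb\<^esub> \<one>\<^bsub>Kac\<^esub>)"
    and assoc: "r \<in> carrier Kb \<Longrightarrow> s \<in> carrier Ka \<Longrightarrow> t \<in> carrier Kc \<Longrightarrow>
      ka2 (ka1 r s) t = ka4 r (ka3 s t)"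
begin

sublocale S2: conv_setup Kba Kc Kn Wn rho P ka2 sba sc "S1.C.resm S1.conv_mod" N pe2 e2
  using S1.C.left_module_resm[OF S1.left_module_conv] S3.MB.left_module_axioms
  by (intro conv_setup.intro conv_setup_axioms.intro Cn.corner_axioms p2.pairing_axioms) (auto simp: pe2 e2)

sublocale S4: conv_setup Kb Kac Kn Wn rho P ka4 sb sac M "S3.C.resm S3.conv_mod" pe4 e4
  using S3.C.left_module_resm[OF S3.left_module_conv] S1.MA.left_module_axioms
  by (intro conv_setup.intro conv_setup_axioms.intro Cn.corner_axioms p4.pairing_axioms) (auto simp: pe4 e4)

abbreviation "R1 \<equiv> S1.C.resm S1.conv_mod"
abbreviation "R3 \<equiv> S3.C.resm S3.conv_mod"
abbreviation "yt m l \<equiv> S1.tens e1 m l"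
abbreviation "zt l n \<equiv> S3.tens e3 l n"
abbreviation "\<epsilon>1 \<equiv> rho1 \<one>\<^bsub>Kba\<^esub>"
abbreviation "\<epsilon>3 \<equiv> rho2 \<one>\<^bsub>Kac\<^esub>"

lemmas R1_iff = S1.C.resm_iff[OF S1.left_module_conv]
lemmas R3_iff = S3.C.resm_iff[OF S3.left_module_conv]

lemma e1_W: "e1 \<in> carrier S1.Wid" "e1 \<in> carrier W1"
  unfolding S1.Wid_iff using S1.e_closed S1.e_idem by auto

lemma e3_W: "e3 \<in> carrier S3.Wid" "e3 \<in> carrier W2"
  unfolding S3.Wid_iff using S3.e_closed S3.e_idem by auto

lemma Wid_mult1: "w \<in> carrier W1 \<Longrightarrow> s \<in> carrier S1.Wid \<Longrightarrow> w \<otimes>\<^bsub>W1\<^esub> s \<in> carrier S1.Wid"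
  unfolding S1.Wid_iff by (simp add: S1.C.W.m_assoc S1.e_closed)

lemma Wid_mult3: "w \<in> carrier W2 \<Longrightarrow> s \<in> carrier S3.Wid \<Longrightarrow> w \<otimes>\<^bsub>W2\<^esub> s \<in> carrier S3.Wid"
  unfolding S3.Wid_iff by (simp add: S3.C.W.m_assoc S3.e_closed)

lemma Wid_mult2: "w \<in> carrier Wn \<Longrightarrow> s \<in> carrier S2.Wid \<Longrightarrow> w \<otimes>\<^bsub>Wn\<^esub> s \<in> carrier S2.Wid"
  unfolding S2.Wid_iff by (simp add: Cn.W.m_assoc S2.e_closed)

lemma Wid_W: "s \<in> carrier S1.Wid \<Longrightarrow> s \<in> carrier W1" "t \<in> carrier S3.Wid \<Longrightarrow> t \<in> carrier W2"
  "w \<in> carrier S2.Wid \<Longrightarrow> w \<in> carrier Wn" "v \<in> carrier S4.Wid \<Longrightarrow> v \<in> carrier Wn"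
  unfolding S1.Wid_iff S2.Wid_iff S3.Wid_iff S4.Wid_iff by blast+

lemma kk1: "r \<in> carrier Kb \<Longrightarrow> s \<in> carrier Ka \<Longrightarrow> ka1 r s \<in> carrier Kba" by (rule S1.ka_closed)
lemma kk3: "r \<in> carrier Ka \<Longrightarrow> s \<in> carrier Kc \<Longrightarrow> ka3 r s \<in> carrier Kac" by (rule S3.ka_closed)
lemma kk2: "r \<in> carrier Kba \<Longrightarrow> s \<in> carrier Kc \<Longrightarrow> rho (ka2 r s) \<in> carrier Wn" by (intro Cn.rho_closed p2.ka_closed)
lemma kk4: "r \<in> carrier Kb \<Longrightarrow> s \<in> carrier Kac \<Longrightarrow> rho (ka4 r s) \<in> carrier Wn" by (intro Cn.rho_closed p4.ka_closed)

lemma yt_R1: "m \<in> carrier M \<Longrightarrow> l \<in> carrier L \<Longrightarrow> yt m l \<in> carrier R1"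
proof -
  assume ml: "m \<in> carrier M" "l \<in> carrier L"
  have "\<epsilon>1 \<otimes>\<^bsub>W1\<^esub> e1 = e1" unfolding S1.e by (simp add: kk1 flip: S1.C.rho_mult)
  then show ?thesis unfolding R1_iff using ml e1_W S1.tens_closed[OF e1_W(1) ml]
    by (simp add: S1.smult_tens S1.C.rho_closed)
qed

lemma zt_R3: "l \<in> carrier L \<Longrightarrow> n \<in> carrier N \<Longrightarrow> zt l n \<in> carrier R3"
proof -
  assume ln: "l \<in> carrier L" "n \<in> carrier N"
  have "\<epsilon>3 \<otimes>\<^bsub>W2\<^esub> e3 = e3" unfolding S3.e by (simp add: kk3 flip: S3.C.rho_mult)
  then show ?thesis unfolding R3_iff using ln e3_W S3.tens_closed[OF e3_W(1) ln]
    by (simp add: S3.smult_tens S3.C.rho_closed)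
qed

lemma yt_smult:
  assumes "r \<in> carrier Kb" "s \<in> carrier Ka" "m \<in> carrier M" "l \<in> carrier L"
  shows "ka1 r s \<odot>\<^bsub>R1\<^esub> yt m l = yt (r \<odot>\<^bsub>M\<^esub> m) (s \<odot>\<^bsub>L\<^esub> l)"
proof -
  have "rho1 (ka1 r s) \<otimes>\<^bsub>W1\<^esub> e1 = e1 \<otimes>\<^bsub>W1\<^esub> pe1 (r, s)"
    unfolding S1.e using assms by (simp add: S1.pe kk1 S1.ka_one_left S1.ka_one_right flip: S1.C.rho_mult)
  then show ?thesis using assms S1.tens_balanced[OF e1_W(1) assms(3,4,1,2)] e1_W(1)
    by (simp add: S1.smult_tens S1.C.rho_closed kk1)
qed

lemma zt_smult:
  assumes "r \<in> carrier Ka" "s \<in> carrier Kc" "l \<in> carrier L" "n \<in> carrier N"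
  shows "ka3 r s \<odot>\<^bsub>R3\<^esub> zt l n = zt (r \<odot>\<^bsub>L\<^esub> l) (s \<odot>\<^bsub>N\<^esub> n)"
proof -
  have "rho2 (ka3 r s) \<otimes>\<^bsub>W2\<^esub> e3 = e3 \<otimes>\<^bsub>W2\<^esub> pe3 (r, s)"
    unfolding S3.e using assms by (simp add: S3.pe kk3 S3.ka_one_left S3.ka_one_right flip: S3.C.rho_mult)
  then show ?thesis using assms S3.tens_balanced[OF e3_W(1) assms(3,4,1,2)] e3_W(1)
    by (simp add: S3.smult_tens S3.C.rho_closed kk3)
qed

text \<open>An element of the triple tensor product crosses both tensor signs at once;
  \<open>assoc\<close> brings it into the shape required by the outer balancing relation.\<close>

lemma move4:
  assumes "u \<in> carrier S4.Wid" "r \<in> carrier Kb" "s \<in> carrier Ka" "t \<in> carrier Kc"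
    "m \<in> carrier M" "l \<in> carrier L" "n \<in> carrier N"
  shows "S4.tens (u \<otimes>\<^bsub>Wn\<^esub> rho (ka2 (ka1 r s) t)) m (zt l n) = S4.tens u (r \<odot>\<^bsub>M\<^esub> m) (zt (s \<odot>\<^bsub>L\<^esub> l) (t \<odot>\<^bsub>N\<^esub> n))"
  using S4.tens_balanced[OF assms(1,5) zt_R3[OF assms(6,7)] assms(2) kk3[OF assms(3,4)]] assms
  unfolding zt_smult[OF assms(3,4,6,7)] by (simp add: assoc pe4 kk3)

lemma move2:
  assumes "u \<in> carrier S2.Wid" "r \<in> carrier Kb" "s \<in> carrier Ka" "t \<in> carrier Kc"
    "m \<in> carrier M" "l \<in> carrier L" "n \<in> carrier N"
  shows "S2.tens (u \<otimes>\<^bsub>Wn\<^esub> rho (ka4 r (ka3 s t))) (yt m l) n = S2.tens u (yt (r \<odot>\<^bsub>M\<^esub> m) (s \<odot>\<^bsub>L\<^esub> l)) (t \<odot>\<^bsub>N\<^esub> n)"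
  using S2.tens_balanced[OF assms(1) yt_R1[OF assms(5,6)] assms(7) kk1[OF assms(2,3)] assms(4)] assms
  unfolding yt_smult[OF assms(2,3,5,6)] by (simp add: pe2 kk1 flip: assoc)

lemma P1_abs: "s \<in> carrier S1.Wid \<Longrightarrow> P1 s \<otimes>\<^bsub>Kba\<^esub> ka1 \<one>\<^bsub>Kb\<^esub> \<one>\<^bsub>Ka\<^esub> = P1 s"
  unfolding S1.Wid_iff using S1.C.P_right[of "ka1 \<one>\<^bsub>Kb\<^esub> \<one>\<^bsub>Ka\<^esub>" s] by (simp add: kk1 S1.e)

lemma P2_abs: "s \<in> carrier S3.Wid \<Longrightarrow> P2 s \<otimes>\<^bsub>Kac\<^esub> ka3 \<one>\<^bsub>Ka\<^esub> \<one>\<^bsub>Kc\<^esub> = P2 s"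
  unfolding S3.Wid_iff using S3.C.P_right[of "ka3 \<one>\<^bsub>Ka\<^esub> \<one>\<^bsub>Kc\<^esub>" s] by (simp add: kk3 S3.e)

text \<open>The isomorphism sends \<open>S2.tens w (S1.tens s m l) n\<close> to \<open>S4.tens (ul w s) m (zt l n)\<close>, where
  projecting \<open>s\<close> to the KLR algebra by \<open>P1\<close> makes it act on the right of \<open>w\<close>; the inverse is given
  by \<open>ur\<close>.\<close>

definition ul where "ul w s = w \<otimes>\<^bsub>Wn\<^esub> rho (ka2 (P1 s) \<one>\<^bsub>Kc\<^esub>)"
definition ur where "ur w s = w \<otimes>\<^bsub>Wn\<^esub> rho (ka4 \<one>\<^bsub>Kb\<^esub> (P2 s))"

lemma P1_K: "s \<in> carrier S1.Wid \<Longrightarrow> P1 s \<in> carrier Kba"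
  using Wid_W(1) S1.C.P_closed by blast

lemma P2_K: "s \<in> carrier S3.Wid \<Longrightarrow> P2 s \<in> carrier Kac"
  using Wid_W(2) S3.C.P_closed by blast

text \<open>\<open>P1 s\<close> absorbs the inner idempotent on the right. Paired with the unit of
  \<open>Kc\<close>, that idempotent is the one of the triple, which by \<open>assoc\<close> also
  lies below \<open>e4\<close>.\<close>

lemma ul_closed:
  assumes "w \<in> carrier Wn" "s \<in> carrier S1.Wid" shows "ul w s \<in> carrier S4.Wid"
proof -
  let ?k = "ka2 (ka1 \<one>\<^bsub>Kb\<^esub> \<one>\<^bsub>Ka\<^esub>) \<one>\<^bsub>Kc\<^esub>"
  have k: "?k = ka4 \<one>\<^bsub>Kb\<^esub> (ka3 \<one>\<^bsub>Ka\<^esub> \<one>\<^bsub>Kc\<^esub>)" by (simp add: assoc)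
  have p: "P1 s \<in> carrier Kba" by (rule P1_K[OF assms(2)])
  have "ka2 (P1 s) \<one>\<^bsub>Kc\<^esub> = ka2 (P1 s) \<one>\<^bsub>Kc\<^esub> \<otimes>\<^bsub>Kn\<^esub> ?k"
    using p P1_abs[OF assms(2)] by (simp add: kk1 flip: p2.ka_mult)
  moreover have "?k \<otimes>\<^bsub>Kn\<^esub> ka4 \<one>\<^bsub>Kb\<^esub> \<one>\<^bsub>Kac\<^esub> = ?k" unfolding k by (simp add: p4.ka_one_right kk3)
  moreover have "?k \<in> carrier Kn" "ka2 (P1 s) \<one>\<^bsub>Kc\<^esub> \<in> carrier Kn" "ka4 \<one>\<^bsub>Kb\<^esub> \<one>\<^bsub>Kac\<^esub> \<in> carrier Kn"
    using p by (simp_all add: p2.ka_closed kk1 p4.ka_closed)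
  ultimately have "ka2 (P1 s) \<one>\<^bsub>Kc\<^esub> \<otimes>\<^bsub>Kn\<^esub> ka4 \<one>\<^bsub>Kb\<^esub> \<one>\<^bsub>Kac\<^esub> = ka2 (P1 s) \<one>\<^bsub>Kc\<^esub>"
    by (metis Cn.K.m_assoc)
  then have "rho (ka2 (P1 s) \<one>\<^bsub>Kc\<^esub>) \<otimes>\<^bsub>Wn\<^esub> e4 = rho (ka2 (P1 s) \<one>\<^bsub>Kc\<^esub>)"
    unfolding e4 using p by (simp add: p2.ka_closed p4.ka_closed flip: Cn.rho_mult)
  then show ?thesis unfolding S4.Wid_iff ul_def using assms p kk2[OF p, of "\<one>\<^bsub>Kc\<^esub>"] S4.e_closed
    by (simp add: Cn.W.m_assoc)
qed

lemma ur_closed: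
  assumes "w \<in> carrier Wn" "s \<in> carrier S3.Wid" shows "ur w s \<in> carrier S2.Wid"
proof -
  let ?k = "ka4 \<one>\<^bsub>Kb\<^esub> (ka3 \<one>\<^bsub>Ka\<^esub> \<one>\<^bsub>Kc\<^esub>)"
  have k: "?k = ka2 (ka1 \<one>\<^bsub>Kb\<^esub> \<one>\<^bsub>Ka\<^esub>) \<one>\<^bsub>Kc\<^esub>" by (simp add: assoc)
  have p: "P2 s \<in> carrier Kac" by (rule P2_K[OF assms(2)])
  have "ka4 \<one>\<^bsub>Kb\<^esub> (P2 s) = ka4 \<one>\<^bsub>Kb\<^esub> (P2 s) \<otimes>\<^bsub>Kn\<^esub> ?k"
    using p P2_abs[OF assms(2)] by (simp add: kk3 flip: p4.ka_mult)
  moreover have "?k \<otimes>\<^bsub>Kn\<^esub> ka2 \<one>\<^bsub>Kba\<^esub> \<one>\<^bsub>Kc\<^esub> = ?k" unfolding k by (simp add: p2.ka_one_right kk1)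
  moreover have "?k \<in> carrier Kn" "ka4 \<one>\<^bsub>Kb\<^esub> (P2 s) \<in> carrier Kn" "ka2 \<one>\<^bsub>Kba\<^esub> \<one>\<^bsub>Kc\<^esub> \<in> carrier Kn"
    using p by (simp_all add: p2.ka_closed kk3 p4.ka_closed)
  ultimately have "ka4 \<one>\<^bsub>Kb\<^esub> (P2 s) \<otimes>\<^bsub>Kn\<^esub> ka2 \<one>\<^bsub>Kba\<^esub> \<one>\<^bsub>Kc\<^esub> = ka4 \<one>\<^bsub>Kb\<^esub> (P2 s)"
    by (metis Cn.K.m_assoc)
  then have "rho (ka4 \<one>\<^bsub>Kb\<^esub> (P2 s)) \<otimes>\<^bsub>Wn\<^esub> e2 = rho (ka4 \<one>\<^bsub>Kb\<^esub> (P2 s))"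
    unfolding e2 using p by (simp add: p2.ka_closed p4.ka_closed flip: Cn.rho_mult)
  then show ?thesis unfolding S2.Wid_iff ur_def using assms p kk4[OF _ p, of "\<one>\<^bsub>Kb\<^esub>"] S2.e_closed
    by (simp add: Cn.W.m_assoc)
qed

lemma ul_left: "a \<in> carrier Wn \<Longrightarrow> w \<in> carrier Wn \<Longrightarrow> s \<in> carrier S1.Wid \<Longrightarrow> ul (a \<otimes>\<^bsub>Wn\<^esub> w) s = a \<otimes>\<^bsub>Wn\<^esub> ul w s"
  unfolding ul_def using kk2[OF P1_K] by (simp add: Cn.W.m_assoc)

lemma ul_add1: "w \<in> carrier Wn \<Longrightarrow> v \<in> carrier Wn \<Longrightarrow> s \<in> carrier S1.Wid \<Longrightarrow> ul (w \<oplus>\<^bsub>Wn\<^esub> v) s = ul w s \<oplus>\<^bsub>Wn\<^esub> ul v s"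
  unfolding ul_def using kk2[OF P1_K] by (simp add: Cn.W.l_distr)

lemma ur_add1: "w \<in> carrier Wn \<Longrightarrow> v \<in> carrier Wn \<Longrightarrow> s \<in> carrier S3.Wid \<Longrightarrow> ur (w \<oplus>\<^bsub>Wn\<^esub> v) s = ur w s \<oplus>\<^bsub>Wn\<^esub> ur v s"
  unfolding ur_def using kk4[OF _ P2_K] by (simp add: Cn.W.l_distr)

lemma ul_add2: "w \<in> carrier Wn \<Longrightarrow> s \<in> carrier S1.Wid \<Longrightarrow> t \<in> carrier S1.Wid \<Longrightarrow> ul w (s \<oplus>\<^bsub>W1\<^esub> t) = ul w s \<oplus>\<^bsub>Wn\<^esub> ul w t"
  unfolding ul_def using kk2[OF P1_K] P1_K Wid_W(1)
  by (simp add: Cn.W.r_distr S1.C.P_add p2.ka_add_left Cn.rho_add p2.ka_closed)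

lemma ur_add2: "w \<in> carrier Wn \<Longrightarrow> s \<in> carrier S3.Wid \<Longrightarrow> t \<in> carrier S3.Wid \<Longrightarrow> ur w (s \<oplus>\<^bsub>W2\<^esub> t) = ur w s \<oplus>\<^bsub>Wn\<^esub> ur w t"
  unfolding ur_def using kk4[OF _ P2_K] P2_K Wid_W(2)
  by (simp add: Cn.W.r_distr S3.C.P_add p4.ka_add_right Cn.rho_add p4.ka_closed)

lemma ul_right:
  assumes "w \<in> carrier Wn" "s \<in> carrier S1.Wid" "r \<in> carrier Kb" "r' \<in> carrier Ka"
  shows "ul w (s \<otimes>\<^bsub>W1\<^esub> pe1 (r, r')) = ul w s \<otimes>\<^bsub>Wn\<^esub> rho (ka2 (ka1 r r') \<one>\<^bsub>Kc\<^esub>)"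
proof -
  have p: "P1 s \<in> carrier Kba" by (rule P1_K[OF assms(2)])
  have "P1 (s \<otimes>\<^bsub>W1\<^esub> pe1 (r, r')) = P1 s \<otimes>\<^bsub>Kba\<^esub> ka1 r r'"
    using assms Wid_W(1)[OF assms(2)] by (simp add: S1.pe S1.C.P_right kk1)
  moreover have "ka2 (P1 s \<otimes>\<^bsub>Kba\<^esub> ka1 r r') \<one>\<^bsub>Kc\<^esub> = ka2 (P1 s) \<one>\<^bsub>Kc\<^esub> \<otimes>\<^bsub>Kn\<^esub> ka2 (ka1 r r') \<one>\<^bsub>Kc\<^esub>"
    using assms p by (simp add: kk1 flip: p2.ka_mult)
  ultimately show ?thesis unfolding ul_def
    using assms p by (simp add: Cn.rho_mult p2.ka_closed kk1 Cn.W.m_assoc Cn.rho_closed)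
qed

lemma ur_right:
  assumes "w \<in> carrier Wn" "s \<in> carrier S3.Wid" "r \<in> carrier Ka" "r' \<in> carrier Kc"
  shows "ur w (s \<otimes>\<^bsub>W2\<^esub> pe3 (r, r')) = ur w s \<otimes>\<^bsub>Wn\<^esub> rho (ka4 \<one>\<^bsub>Kb\<^esub> (ka3 r r'))"
proof -
  have p: "P2 s \<in> carrier Kac" by (rule P2_K[OF assms(2)])
  have "P2 (s \<otimes>\<^bsub>W2\<^esub> pe3 (r, r')) = P2 s \<otimes>\<^bsub>Kac\<^esub> ka3 r r'"
    using assms Wid_W(2)[OF assms(2)] by (simp add: S3.pe S3.C.P_right kk3)
  moreover have "ka4 \<one>\<^bsub>Kb\<^esub> (P2 s \<otimes>\<^bsub>Kac\<^esub> ka3 r r') = ka4 \<one>\<^bsub>Kb\<^esub> (P2 s) \<otimes>\<^bsub>Kn\<^esub> ka4 \<one>\<^bsub>Kb\<^esub> (ka3 r r')"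
    using assms p by (simp add: kk3 flip: p4.ka_mult)
  ultimately show ?thesis unfolding ur_def
    using assms p by (simp add: Cn.rho_mult p4.ka_closed kk3 Cn.W.m_assoc Cn.rho_closed)
qed

text \<open>The source of the outer balancing relation: \<open>r\<close> joins \<open>s\<close>
  because \<open>P1\<close> is linear on the left, and \<open>t\<close> moves to the right of
  \<open>P1 s\<close> because the two act on different blocks.\<close>

lemma ul_swap:
  assumes "w \<in> carrier Wn" "s \<in> carrier S1.Wid" "r \<in> carrier Kba" "t \<in> carrier Kc"
  shows "ul (w \<otimes>\<^bsub>Wn\<^esub> pe2 (r, t)) s = ul w (rho1 r \<otimes>\<^bsub>W1\<^esub> s) \<otimes>\<^bsub>Wn\<^esub> rho (ka2 (ka1 \<one>\<^bsub>Kb\<^esub> \<one>\<^bsub>Ka\<^esub>) t)"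
proof -
  have p: "P1 s \<in> carrier Kba" by (rule P1_K[OF assms(2)])
  have q: "P1 (rho1 r \<otimes>\<^bsub>W1\<^esub> s) = r \<otimes>\<^bsub>Kba\<^esub> P1 s" using assms Wid_W(1)[OF assms(2)] by (simp add: S1.C.P_left)
  have "ka2 r t \<otimes>\<^bsub>Kn\<^esub> ka2 (P1 s) \<one>\<^bsub>Kc\<^esub> = ka2 (r \<otimes>\<^bsub>Kba\<^esub> (P1 s \<otimes>\<^bsub>Kba\<^esub> ka1 \<one>\<^bsub>Kb\<^esub> \<one>\<^bsub>Ka\<^esub>)) (\<one>\<^bsub>Kc\<^esub> \<otimes>\<^bsub>Kc\<^esub> t)"
    using assms p P1_abs[OF assms(2)] by (simp flip: p2.ka_mult)
  also have "\<dots> = ka2 (r \<otimes>\<^bsub>Kba\<^esub> P1 s) \<one>\<^bsub>Kc\<^esub> \<otimes>\<^bsub>Kn\<^esub> ka2 (ka1 \<one>\<^bsub>Kb\<^esub> \<one>\<^bsub>Ka\<^esub>) t"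
    using assms p by (simp add: kk1 S1.C.K.m_assoc flip: p2.ka_mult)
  finally have "rho (ka2 r t) \<otimes>\<^bsub>Wn\<^esub> rho (ka2 (P1 s) \<one>\<^bsub>Kc\<^esub>) =
      rho (ka2 (r \<otimes>\<^bsub>Kba\<^esub> P1 s) \<one>\<^bsub>Kc\<^esub>) \<otimes>\<^bsub>Wn\<^esub> rho (ka2 (ka1 \<one>\<^bsub>Kb\<^esub> \<one>\<^bsub>Ka\<^esub>) t)"
    using assms p by (simp add: p2.ka_closed kk1 flip: Cn.rho_mult)
  then show ?thesis unfolding ul_def q
    using assms p by (simp add: pe2 Cn.W.m_assoc Cn.rho_closed p2.ka_closed kk1)
qed

lemma ur_swap:
  assumes "w \<in> carrier Wn" "s \<in> carrier S3.Wid" "r \<in> carrier Kb" "t \<in> carrier Kac"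
  shows "ur (w \<otimes>\<^bsub>Wn\<^esub> pe4 (r, t)) s = ur w (rho2 t \<otimes>\<^bsub>W2\<^esub> s) \<otimes>\<^bsub>Wn\<^esub> rho (ka4 r (ka3 \<one>\<^bsub>Ka\<^esub> \<one>\<^bsub>Kc\<^esub>))"
proof -
  have p: "P2 s \<in> carrier Kac" by (rule P2_K[OF assms(2)])
  have q: "P2 (rho2 t \<otimes>\<^bsub>W2\<^esub> s) = t \<otimes>\<^bsub>Kac\<^esub> P2 s" using assms Wid_W(2)[OF assms(2)] by (simp add: S3.C.P_left)
  have "ka4 r t \<otimes>\<^bsub>Kn\<^esub> ka4 \<one>\<^bsub>Kb\<^esub> (P2 s) = ka4 (\<one>\<^bsub>Kb\<^esub> \<otimes>\<^bsub>Kb\<^esub> r) (t \<otimes>\<^bsub>Kac\<^esub> (P2 s \<otimes>\<^bsub>Kac\<^esub> ka3 \<one>\<^bsub>Ka\<^esub> \<one>\<^bsub>Kc\<^esub>))"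
    using assms p P2_abs[OF assms(2)] by (simp flip: p4.ka_mult)
  also have "\<dots> = ka4 \<one>\<^bsub>Kb\<^esub> (t \<otimes>\<^bsub>Kac\<^esub> P2 s) \<otimes>\<^bsub>Kn\<^esub> ka4 r (ka3 \<one>\<^bsub>Ka\<^esub> \<one>\<^bsub>Kc\<^esub>)"
    using assms p by (simp add: kk3 S3.C.K.m_assoc flip: p4.ka_mult)
  finally have "rho (ka4 r t) \<otimes>\<^bsub>Wn\<^esub> rho (ka4 \<one>\<^bsub>Kb\<^esub> (P2 s)) =
      rho (ka4 \<one>\<^bsub>Kb\<^esub> (t \<otimes>\<^bsub>Kac\<^esub> P2 s)) \<otimes>\<^bsub>Wn\<^esub> rho (ka4 r (ka3 \<one>\<^bsub>Ka\<^esub> \<one>\<^bsub>Kc\<^esub>))"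
    using assms p by (simp add: p4.ka_closed kk3 flip: Cn.rho_mult)
  then show ?thesis unfolding ur_def q
    using assms p by (simp add: pe4 Cn.W.m_assoc Cn.rho_closed p4.ka_closed kk3)
qed

end

section \<open>The isomorphism and its inverse\<close>

context assoc_setup
begin

lemma R1_add: "x \<oplus>\<^bsub>R1\<^esub> y = x \<oplus>\<^bsub>S1.conv_mod\<^esub> y" and R3_add: "x' \<oplus>\<^bsub>R3\<^esub> y' = x' \<oplus>\<^bsub>S3.conv_mod\<^esub> y'"
  by simp_all

lemma R1_conv: "z \<in> carrier R1 \<Longrightarrow> z \<in> carrier S1.conv_mod" and R3_conv: "z' \<in> carrier R3 \<Longrightarrow> z' \<in> carrier S3.conv_mod"
  unfolding R1_iff R3_iff by blast+

text \<open>The first of two stages: \<open>w\<close> and \<open>n\<close> are fixed and only the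
  inner product varies. The map lives on all of M o L, where the universal property applies; it is
  restricted in the second stage.\<close>

lemma ex_Hl:
  assumes w: "w \<in> carrier Wn" and n: "n \<in> carrier N"
  shows "\<exists>H. (\<forall>x\<in>carrier S1.conv_mod. H x \<in> carrier S4.conv_mod) \<and>
    (\<forall>x\<in>carrier S1.conv_mod. \<forall>y\<in>carrier S1.conv_mod. H (x \<oplus>\<^bsub>S1.conv_mod\<^esub> y) = H x \<oplus>\<^bsub>S4.conv_mod\<^esub> H y) \<and>
    (\<forall>s\<in>carrier S1.Wid. \<forall>m\<in>carrier M. \<forall>l\<in>carrier L. H (S1.tens s m l) = S4.tens (ul w s) m (zt l n))"
proof (rule S1.conv_universal[OF S4.abelian_group_conv, of "\<lambda>s m l. S4.tens (ul w s) m (zt l n)"])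
  fix s m l assume s: "s \<in> carrier S1.Wid" and m: "m \<in> carrier M" and l: "l \<in> carrier L"
  show "S4.tens (ul w s) m (zt l n) \<in> carrier S4.conv_mod"
    by (rule S4.tens_closed[OF ul_closed[OF w s] m zt_R3[OF l n]])
  show "S4.tens (ul w (s \<oplus>\<^bsub>W1\<^esub> s')) m (zt l n) = S4.tens (ul w s) m (zt l n) \<oplus>\<^bsub>S4.conv_mod\<^esub> S4.tens (ul w s') m (zt l n)"
    if s': "s' \<in> carrier S1.Wid" for s'
    unfolding ul_add2[OF w s s'] by (rule S4.tens_add1[OF ul_closed[OF w s] ul_closed[OF w s'] m zt_R3[OF l n]])
  show "S4.tens (ul w s) (m \<oplus>\<^bsub>M\<^esub> m') (zt l n) = S4.tens (ul w s) m (zt l n) \<oplus>\<^bsub>S4.conv_mod\<^esub> S4.tens (ul w s) m' (zt l n)"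
    if m': "m' \<in> carrier M" for m'
    by (rule S4.tens_add2[OF ul_closed[OF w s] m m' zt_R3[OF l n]])
  show "S4.tens (ul w s) m (zt (l \<oplus>\<^bsub>L\<^esub> l') n) = S4.tens (ul w s) m (zt l n) \<oplus>\<^bsub>S4.conv_mod\<^esub> S4.tens (ul w s) m (zt l' n)"
    if l': "l' \<in> carrier L" for l'
    unfolding S3.tens_add2[OF e3_W(1) l l' n] R3_add[symmetric]
    by (rule S4.tens_add3[OF ul_closed[OF w s] m zt_R3[OF l n] zt_R3[OF l' n]])
  show "S4.tens (ul w (s \<otimes>\<^bsub>W1\<^esub> pe1 (r, r'))) m (zt l n) = S4.tens (ul w s) (r \<odot>\<^bsub>M\<^esub> m) (zt (r' \<odot>\<^bsub>L\<^esub> l) n)"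
    if r: "r \<in> carrier Kb" "r' \<in> carrier Ka" for r r'
    unfolding ul_right[OF w s r] move4[OF ul_closed[OF w s] r S3.K2.one_closed m l n]
      S3.MB.smult_one[OF n] ..
qed blast

lemma ex_Hr:
  assumes w: "w \<in> carrier Wn" and m: "m \<in> carrier M"
  shows "\<exists>H. (\<forall>x\<in>carrier S3.conv_mod. H x \<in> carrier S2.conv_mod) \<and>
    (\<forall>x\<in>carrier S3.conv_mod. \<forall>y\<in>carrier S3.conv_mod. H (x \<oplus>\<^bsub>S3.conv_mod\<^esub> y) = H x \<oplus>\<^bsub>S2.conv_mod\<^esub> H y) \<and>
    (\<forall>s\<in>carrier S3.Wid. \<forall>l\<in>carrier L. \<forall>n\<in>carrier N. H (S3.tens s l n) = S2.tens (ur w s) (yt m l) n)"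
proof (rule S3.conv_universal[OF S2.abelian_group_conv, of "\<lambda>s l n. S2.tens (ur w s) (yt m l) n"])
  fix s l n assume s: "s \<in> carrier S3.Wid" and n: "n \<in> carrier N" and l: "l \<in> carrier L"
  show "S2.tens (ur w s) (yt m l) n \<in> carrier S2.conv_mod"
    by (rule S2.tens_closed[OF ur_closed[OF w s] yt_R1[OF m l] n])
  show "S2.tens (ur w (s \<oplus>\<^bsub>W2\<^esub> s')) (yt m l) n = S2.tens (ur w s) (yt m l) n \<oplus>\<^bsub>S2.conv_mod\<^esub> S2.tens (ur w s') (yt m l) n"
    if s': "s' \<in> carrier S3.Wid" for s'
    unfolding ur_add2[OF w s s'] by (rule S2.tens_add1[OF ur_closed[OF w s] ur_closed[OF w s'] yt_R1[OF m l] n])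
  show "S2.tens (ur w s) (yt m (l \<oplus>\<^bsub>L\<^esub> l')) n = S2.tens (ur w s) (yt m l) n \<oplus>\<^bsub>S2.conv_mod\<^esub> S2.tens (ur w s) (yt m l') n"
    if l': "l' \<in> carrier L" for l'
    unfolding S1.tens_add3[OF e1_W(1) m l l'] R1_add[symmetric]
    by (rule S2.tens_add2[OF ur_closed[OF w s] yt_R1[OF m l] yt_R1[OF m l'] n])
  show "S2.tens (ur w s) (yt m l) (n \<oplus>\<^bsub>N\<^esub> n') = S2.tens (ur w s) (yt m l) n \<oplus>\<^bsub>S2.conv_mod\<^esub> S2.tens (ur w s) (yt m l) n'"
    if n': "n' \<in> carrier N" for n'
    by (rule S2.tens_add3[OF ur_closed[OF w s] yt_R1[OF m l] n n'])
  show "S2.tens (ur w (s \<otimes>\<^bsub>W2\<^esub> pe3 (r, r'))) (yt m l) n = S2.tens (ur w s) (yt m (r \<odot>\<^bsub>L\<^esub> l)) (r' \<odot>\<^bsub>N\<^esub> n)"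
    if r: "r \<in> carrier Ka" "r' \<in> carrier Kc" for r r'
    unfolding ur_right[OF w s r] move2[OF ur_closed[OF w s] S1.K1.one_closed r m l n]
      S1.MA.smult_one[OF m] ..
qed blast

text \<open>The map is chosen separately for each \<open>w\<close> and \<open>n\<close>. Its values
  on tensors determine it on M o L, so additivity in \<open>w\<close> and \<open>n\<close> is
  recovered by \<open>conv_induct\<close>.\<close>

definition Hl where "Hl w n = (SOME H. (\<forall>x\<in>carrier S1.conv_mod. H x \<in> carrier S4.conv_mod) \<and>
    (\<forall>x\<in>carrier S1.conv_mod. \<forall>y\<in>carrier S1.conv_mod. H (x \<oplus>\<^bsub>S1.conv_mod\<^esub> y) = H x \<oplus>\<^bsub>S4.conv_mod\<^esub> H y) \<and>
    (\<forall>s\<in>carrier S1.Wid. \<forall>m\<in>carrier M. \<forall>l\<in>carrier L. H (S1.tens s m l) = S4.tens (ul w s) m (zt l n)))"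

definition Hr where "Hr w m = (SOME H. (\<forall>x\<in>carrier S3.conv_mod. H x \<in> carrier S2.conv_mod) \<and>
    (\<forall>x\<in>carrier S3.conv_mod. \<forall>y\<in>carrier S3.conv_mod. H (x \<oplus>\<^bsub>S3.conv_mod\<^esub> y) = H x \<oplus>\<^bsub>S2.conv_mod\<^esub> H y) \<and>
    (\<forall>s\<in>carrier S3.Wid. \<forall>l\<in>carrier L. \<forall>n\<in>carrier N. H (S3.tens s l n) = S2.tens (ur w s) (yt m l) n))"

lemma Hl:
  assumes "w \<in> carrier Wn" "n \<in> carrier N"
  shows "x \<in> carrier S1.conv_mod \<Longrightarrow> Hl w n x \<in> carrier S4.conv_mod"
    "x \<in> carrier S1.conv_mod \<Longrightarrow> y \<in> carrier S1.conv_mod \<Longrightarrow>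
      Hl w n (x \<oplus>\<^bsub>S1.conv_mod\<^esub> y) = Hl w n x \<oplus>\<^bsub>S4.conv_mod\<^esub> Hl w n y"
    "s \<in> carrier S1.Wid \<Longrightarrow> m \<in> carrier M \<Longrightarrow> l \<in> carrier L \<Longrightarrow>
      Hl w n (S1.tens s m l) = S4.tens (ul w s) m (zt l n)"
  using someI_ex[OF ex_Hl[OF assms]] unfolding Hl_def[symmetric] by blast+

lemma Hr:
  assumes "w \<in> carrier Wn" "m \<in> carrier M"
  shows "x \<in> carrier S3.conv_mod \<Longrightarrow> Hr w m x \<in> carrier S2.conv_mod"
    "x \<in> carrier S3.conv_mod \<Longrightarrow> y \<in> carrier S3.conv_mod \<Longrightarrow>
      Hr w m (x \<oplus>\<^bsub>S3.conv_mod\<^esub> y) = Hr w m x \<oplus>\<^bsub>S2.conv_mod\<^esub> Hr w m y"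
    "s \<in> carrier S3.Wid \<Longrightarrow> l \<in> carrier L \<Longrightarrow> n \<in> carrier N \<Longrightarrow>
      Hr w m (S3.tens s l n) = S2.tens (ur w s) (yt m l) n"
  using someI_ex[OF ex_Hr[OF assms]] unfolding Hr_def[symmetric] by blast+

interpretation C1: left_module W1 S1.conv_mod by (rule S1.left_module_conv)
interpretation C2: left_module Wn S2.conv_mod by (rule S2.left_module_conv)
interpretation C3: left_module W2 S3.conv_mod by (rule S3.left_module_conv)
interpretation C4: left_module Wn S4.conv_mod by (rule S4.left_module_conv)

lemma Hl_add1:
  assumes w: "w \<in> carrier Wn" "v \<in> carrier Wn" and n: "n \<in> carrier N" and z: "z \<in> carrier S1.conv_mod"
  shows "Hl (w \<oplus>\<^bsub>Wn\<^esub> v) n z = Hl w n z \<oplus>\<^bsub>S4.conv_mod\<^esub> Hl v n z"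
  using z
proof (induction rule: S1.conv_induct)
  case (tens s m l)
  show ?case
    unfolding Hl(3)[OF Cn.W.a_closed[OF w] n tens] Hl(3)[OF w(1) n tens] Hl(3)[OF w(2) n tens] ul_add1[OF w tens(1)]
    by (rule S4.tens_add1[OF ul_closed[OF w(1) tens(1)] ul_closed[OF w(2) tens(1)] tens(2) zt_R3[OF tens(3) n]])
next
  case (add x y)
  then show ?case using Hl(1)[OF w(1) n] Hl(1)[OF w(2) n]
    by (simp add: Hl(2)[OF Cn.W.a_closed[OF w] n] Hl(2)[OF w(1) n] Hl(2)[OF w(2) n] C4.M.a_ac)
qed

lemma Hl_add2:
  assumes w: "w \<in> carrier Wn" and n: "n \<in> carrier N" "n' \<in> carrier N" and z: "z \<in> carrier S1.conv_mod"
  shows "Hl w (n \<oplus>\<^bsub>N\<^esub> n') z = Hl w n z \<oplus>\<^bsub>S4.conv_mod\<^esub> Hl w n' z"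
  using z
proof (induction rule: S1.conv_induct)
  case (tens s m l)
  show ?case
    unfolding Hl(3)[OF w S3.MB.M.a_closed[OF n] tens] Hl(3)[OF w n(1) tens] Hl(3)[OF w n(2) tens]
      S3.tens_add3[OF e3_W(1) tens(3) n] R3_add[symmetric]
    by (rule S4.tens_add3[OF ul_closed[OF w tens(1)] tens(2) zt_R3[OF tens(3) n(1)] zt_R3[OF tens(3) n(2)]])
next
  case (add x y)
  then show ?case using Hl(1)[OF w n(1)] Hl(1)[OF w n(2)]
    by (simp add: Hl(2)[OF w S3.MB.M.a_closed[OF n]] Hl(2)[OF w n(1)] Hl(2)[OF w n(2)] C4.M.a_ac)
qed

lemma Hl_left:
  assumes w: "a \<in> carrier Wn" "w \<in> carrier Wn" and n: "n \<in> carrier N" and z: "z \<in> carrier S1.conv_mod"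
  shows "Hl (a \<otimes>\<^bsub>Wn\<^esub> w) n z = a \<odot>\<^bsub>S4.conv_mod\<^esub> Hl w n z"
  using z
proof (induction rule: S1.conv_induct)
  case (tens s m l)
  show ?case
    unfolding Hl(3)[OF Cn.W.m_closed[OF w] n tens] Hl(3)[OF w(2) n tens] ul_left[OF w tens(1)]
    by (rule S4.smult_tens[OF w(1) ul_closed[OF w(2) tens(1)] tens(2) zt_R3[OF tens(3) n], symmetric])
next
  case (add x y)
  then show ?case using Hl(1)[OF w(2) n] w
    by (simp add: Hl(2)[OF Cn.W.m_closed[OF w] n] Hl(2)[OF w(2) n] C4.smult_r_distr)
qed

lemma Hl_balanced:
  assumes w: "w \<in> carrier Wn" and n: "n \<in> carrier N" and z: "z \<in> carrier S1.conv_mod"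
    and r: "r \<in> carrier Kba" "t \<in> carrier Kc"
  shows "Hl (w \<otimes>\<^bsub>Wn\<^esub> pe2 (r, t)) n z = Hl w (t \<odot>\<^bsub>N\<^esub> n) (rho1 r \<odot>\<^bsub>S1.conv_mod\<^esub> z)"
  using z
proof (induction rule: S1.conv_induct)
  case (tens s m l)
  have wp: "w \<otimes>\<^bsub>Wn\<^esub> pe2 (r, t) \<in> carrier Wn" using w r kk2 by (simp add: pe2)
  have rs: "rho1 r \<in> carrier W1" by (rule S1.C.rho_closed[OF r(1)])
  have tn: "t \<odot>\<^bsub>N\<^esub> n \<in> carrier N" by (rule S3.MB.smult_closed[OF r(2) n])
  have rss: "rho1 r \<otimes>\<^bsub>W1\<^esub> s \<in> carrier S1.Wid" by (rule Wid_mult1[OF rs tens(1)])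
  show ?case
    unfolding S1.smult_tens[OF rs tens] Hl(3)[OF wp n tens] Hl(3)[OF w tn rss tens(2,3)] ul_swap[OF w tens(1) r]
      move4[OF ul_closed[OF w rss] S1.K1.one_closed S1.K2.one_closed r(2) tens(2,3) n]
      S1.MA.smult_one[OF tens(2)] S1.MB.smult_one[OF tens(3)] ..
next
  case (add x y)
  have wp: "w \<otimes>\<^bsub>Wn\<^esub> pe2 (r, t) \<in> carrier Wn" using w r kk2 by (simp add: pe2)
  have rs: "rho1 r \<in> carrier W1" by (rule S1.C.rho_closed[OF r(1)])
  have tn: "t \<odot>\<^bsub>N\<^esub> n \<in> carrier N" by (rule S3.MB.smult_closed[OF r(2) n])
  show ?case using add rs
    by (simp add: Hl(2)[OF wp n] Hl(2)[OF w tn] C1.smult_r_distr C1.smult_closed)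
qed

lemma Hr_add1:
  assumes w: "w \<in> carrier Wn" "v \<in> carrier Wn" and m: "m \<in> carrier M" and z: "z \<in> carrier S3.conv_mod"
  shows "Hr (w \<oplus>\<^bsub>Wn\<^esub> v) m z = Hr w m z \<oplus>\<^bsub>S2.conv_mod\<^esub> Hr v m z"
  using z
proof (induction rule: S3.conv_induct)
  case (tens s l n)
  show ?case
    unfolding Hr(3)[OF Cn.W.a_closed[OF w] m tens] Hr(3)[OF w(1) m tens] Hr(3)[OF w(2) m tens] ur_add1[OF w tens(1)]
    by (rule S2.tens_add1[OF ur_closed[OF w(1) tens(1)] ur_closed[OF w(2) tens(1)] yt_R1[OF m tens(2)] tens(3)])
next
  case (add x y)
  then show ?case using Hr(1)[OF w(1) m] Hr(1)[OF w(2) m]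
    by (simp add: Hr(2)[OF Cn.W.a_closed[OF w] m] Hr(2)[OF w(1) m] Hr(2)[OF w(2) m] C2.M.a_ac)
qed

lemma Hr_add2:
  assumes w: "w \<in> carrier Wn" and m: "m \<in> carrier M" "m' \<in> carrier M" and z: "z \<in> carrier S3.conv_mod"
  shows "Hr w (m \<oplus>\<^bsub>M\<^esub> m') z = Hr w m z \<oplus>\<^bsub>S2.conv_mod\<^esub> Hr w m' z"
  using z
proof (induction rule: S3.conv_induct)
  case (tens s l n)
  show ?case
    unfolding Hr(3)[OF w S1.MA.M.a_closed[OF m] tens] Hr(3)[OF w m(1) tens] Hr(3)[OF w m(2) tens]
      S1.tens_add2[OF e1_W(1) m tens(2)] R1_add[symmetric]
    by (rule S2.tens_add2[OF ur_closed[OF w tens(1)] yt_R1[OF m(1) tens(2)] yt_R1[OF m(2) tens(2)] tens(3)])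
next
  case (add x y)
  then show ?case using Hr(1)[OF w m(1)] Hr(1)[OF w m(2)]
    by (simp add: Hr(2)[OF w S1.MA.M.a_closed[OF m]] Hr(2)[OF w m(1)] Hr(2)[OF w m(2)] C2.M.a_ac)
qed

lemma Hr_balanced:
  assumes w: "w \<in> carrier Wn" and m: "m \<in> carrier M" and z: "z \<in> carrier S3.conv_mod"
    and r: "r \<in> carrier Kb" "t \<in> carrier Kac"
  shows "Hr (w \<otimes>\<^bsub>Wn\<^esub> pe4 (r, t)) m z = Hr w (r \<odot>\<^bsub>M\<^esub> m) (rho2 t \<odot>\<^bsub>S3.conv_mod\<^esub> z)"
  using z
proof (induction rule: S3.conv_induct)
  case (tens s l n)
  have wp: "w \<otimes>\<^bsub>Wn\<^esub> pe4 (r, t) \<in> carrier Wn" using w r kk4 by (simp add: pe4)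
  have rs: "rho2 t \<in> carrier W2" by (rule S3.C.rho_closed[OF r(2)])
  have rm: "r \<odot>\<^bsub>M\<^esub> m \<in> carrier M" by (rule S1.MA.smult_closed[OF r(1) m])
  have rss: "rho2 t \<otimes>\<^bsub>W2\<^esub> s \<in> carrier S3.Wid" by (rule Wid_mult3[OF rs tens(1)])
  show ?case
    unfolding S3.smult_tens[OF rs tens] Hr(3)[OF wp m tens] Hr(3)[OF w rm rss tens(2,3)] ur_swap[OF w tens(1) r]
      move2[OF ur_closed[OF w rss] r(1) S1.K2.one_closed S3.K2.one_closed m tens(2,3)]
      S1.MB.smult_one[OF tens(2)] S3.MB.smult_one[OF tens(3)] ..
next
  case (add x y)
  have wp: "w \<otimes>\<^bsub>Wn\<^esub> pe4 (r, t) \<in> carrier Wn" using w r kk4 by (simp add: pe4)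
  have rs: "rho2 t \<in> carrier W2" by (rule S3.C.rho_closed[OF r(2)])
  have rm: "r \<odot>\<^bsub>M\<^esub> m \<in> carrier M" by (rule S1.MA.smult_closed[OF r(1) m])
  show ?case using add rs
    by (simp add: Hr(2)[OF wp m] Hr(2)[OF w rm] C3.smult_r_distr C3.smult_closed)
qed

text \<open>The projection of \<open>e3\<close> is the inner idempotent of L o N. Paired with the
  unit of \<open>Kb\<close> it is the idempotent of the triple, which \<open>ul w s\<close> absorbs
  already.\<close>

lemma ur_ul: "w \<in> carrier Wn \<Longrightarrow> s \<in> carrier S1.Wid \<Longrightarrow> ur (ul w s) e3 = ul w s"
proof -
  assume w: "w \<in> carrier Wn" and s: "s \<in> carrier S1.Wid"
  have p: "P1 s \<in> carrier Kba" by (rule P1_K[OF s])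
  have "P2 e3 = ka3 \<one>\<^bsub>Ka\<^esub> \<one>\<^bsub>Kc\<^esub>" unfolding S3.e by (simp add: S3.C.P_rho kk3)
  then have "ur (ul w s) e3 = w \<otimes>\<^bsub>Wn\<^esub> (rho (ka2 (P1 s) \<one>\<^bsub>Kc\<^esub>) \<otimes>\<^bsub>Wn\<^esub> rho (ka2 (ka1 \<one>\<^bsub>Kb\<^esub> \<one>\<^bsub>Ka\<^esub>) \<one>\<^bsub>Kc\<^esub>))"
    unfolding ur_def ul_def using w p by (simp add: Cn.W.m_assoc kk2 kk1 flip: assoc)
  also have "rho (ka2 (P1 s) \<one>\<^bsub>Kc\<^esub>) \<otimes>\<^bsub>Wn\<^esub> rho (ka2 (ka1 \<one>\<^bsub>Kb\<^esub> \<one>\<^bsub>Ka\<^esub>) \<one>\<^bsub>Kc\<^esub>) = rho (ka2 (P1 s) \<one>\<^bsub>Kc\<^esub>)"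
    using p by (simp add: P1_abs[OF s] kk1 p2.ka_closed flip: Cn.rho_mult p2.ka_mult)
  finally show ?thesis unfolding ul_def .
qed

lemma ul_ur: "w \<in> carrier Wn \<Longrightarrow> s \<in> carrier S3.Wid \<Longrightarrow> ul (ur w s) e1 = ur w s"
proof -
  assume w: "w \<in> carrier Wn" and s: "s \<in> carrier S3.Wid"
  have p: "P2 s \<in> carrier Kac" by (rule P2_K[OF s])
  have "P1 e1 = ka1 \<one>\<^bsub>Kb\<^esub> \<one>\<^bsub>Ka\<^esub>" unfolding S1.e by (simp add: S1.C.P_rho kk1)
  then have "ul (ur w s) e1 = w \<otimes>\<^bsub>Wn\<^esub> (rho (ka4 \<one>\<^bsub>Kb\<^esub> (P2 s)) \<otimes>\<^bsub>Wn\<^esub> rho (ka4 \<one>\<^bsub>Kb\<^esub> (ka3 \<one>\<^bsub>Ka\<^esub> \<one>\<^bsub>Kc\<^esub>)))"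
    unfolding ur_def ul_def using w p by (simp add: Cn.W.m_assoc kk4 kk3 assoc)
  also have "rho (ka4 \<one>\<^bsub>Kb\<^esub> (P2 s)) \<otimes>\<^bsub>Wn\<^esub> rho (ka4 \<one>\<^bsub>Kb\<^esub> (ka3 \<one>\<^bsub>Ka\<^esub> \<one>\<^bsub>Kc\<^esub>)) = rho (ka4 \<one>\<^bsub>Kb\<^esub> (P2 s))"
    using p by (simp add: P2_abs[OF s] kk3 p4.ka_closed flip: Cn.rho_mult p4.ka_mult)
  finally show ?thesis unfolding ur_def .
qed

text \<open>Here surjectivity onto the corner enters, through \<open>rho_P\<close>: projecting
  \<open>s\<close> and mapping back changes \<open>s\<close> only by the idempotent
  \<open>\<epsilon>1\<close> on the left, once \<open>e1\<close> is multiplied on the right.\<close>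

lemma tens_ul:
  assumes w: "w \<in> carrier S2.Wid" and s: "s \<in> carrier S1.Wid" and m: "m \<in> carrier M" and l: "l \<in> carrier L" and n: "n \<in> carrier N"
  shows "S2.tens (ul w s) (yt m l) n = S2.tens w (\<epsilon>1 \<odot>\<^bsub>S1.conv_mod\<^esub> S1.tens s m l) n"
proof -
  have p: "P1 s \<in> carrier Kba" by (rule P1_K[OF s])
  have s': "s \<in> carrier W1" "s \<otimes>\<^bsub>W1\<^esub> e1 = s" using s unfolding S1.Wid_iff by blast+
  have \<epsilon>: "\<epsilon>1 \<in> carrier W1" by (simp add: S1.C.rho_closed)
  have "\<epsilon>1 \<otimes>\<^bsub>W1\<^esub> e1 = e1" unfolding S1.e by (simp add: kk1 flip: S1.C.rho_mult)
  then have "rho1 (P1 s) \<otimes>\<^bsub>W1\<^esub> e1 = \<epsilon>1 \<otimes>\<^bsub>W1\<^esub> s"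
    using s' \<epsilon> e1_W(2) by (simp add: S1.C.rho_P S1.C.W.m_assoc)
  then have "P1 s \<odot>\<^bsub>R1\<^esub> yt m l = \<epsilon>1 \<odot>\<^bsub>S1.conv_mod\<^esub> S1.tens s m l"
    unfolding S1.smult_tens[OF \<epsilon> s m l] using S1.smult_tens[OF S1.C.rho_closed[OF p] e1_W(1) m l] by simp
  then show ?thesis
    using S2.tens_balanced[OF w yt_R1[OF m l] n p S3.K2.one_closed]
    unfolding ul_def S3.MB.smult_one[OF n] pe2[OF p S3.K2.one_closed] by simp
qed

lemma tens_ur:
  assumes w: "w \<in> carrier S4.Wid" and s: "s \<in> carrier S3.Wid" and m: "m \<in> carrier M" and l: "l \<in> carrier L" and n: "n \<in> carrier N"
  shows "S4.tens (ur w s) m (zt l n) = S4.tens w m (\<epsilon>3 \<odot>\<^bsub>S3.conv_mod\<^esub> S3.tens s l n)"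
proof -
  have p: "P2 s \<in> carrier Kac" by (rule P2_K[OF s])
  have s': "s \<in> carrier W2" "s \<otimes>\<^bsub>W2\<^esub> e3 = s" using s unfolding S3.Wid_iff by blast+
  have \<epsilon>: "\<epsilon>3 \<in> carrier W2" by (simp add: S3.C.rho_closed)
  have "\<epsilon>3 \<otimes>\<^bsub>W2\<^esub> e3 = e3" unfolding S3.e by (simp add: kk3 flip: S3.C.rho_mult)
  then have "rho2 (P2 s) \<otimes>\<^bsub>W2\<^esub> e3 = \<epsilon>3 \<otimes>\<^bsub>W2\<^esub> s"
    using s' \<epsilon> e3_W(2) by (simp add: S3.C.rho_P S3.C.W.m_assoc)
  then have "P2 s \<odot>\<^bsub>R3\<^esub> zt l n = \<epsilon>3 \<odot>\<^bsub>S3.conv_mod\<^esub> S3.tens s l n"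
    unfolding S3.smult_tens[OF \<epsilon> s l n] using S3.smult_tens[OF S3.C.rho_closed[OF p] e3_W(1) l n] by simp
  then show ?thesis
    using S4.tens_balanced[OF w m zt_R3[OF l n] S1.K1.one_closed p]
    unfolding ur_def S1.MA.smult_one[OF m] pe4[OF S1.K1.one_closed p] by simp
qed

theorem conv_assoc:
  obtains F where "module_isomorphism Wn S2.conv_mod S4.conv_mod F"
    "\<And>m l n. m \<in> carrier M \<Longrightarrow> l \<in> carrier L \<Longrightarrow> n \<in> carrier N \<Longrightarrow>
      F (S2.tens e2 (yt m l) n) = S4.tens e4 m (zt l n)"
proof -
  obtain F where F: "\<And>x. x \<in> carrier S2.conv_mod \<Longrightarrow> F x \<in> carrier S4.conv_mod"
    "\<And>x y. x \<in> carrier S2.conv_mod \<Longrightarrow> y \<in> carrier S2.conv_mod \<Longrightarrow> F (x \<oplus>\<^bsub>S2.conv_mod\<^esub> y) = F x \<oplus>\<^bsub>S4.conv_mod\<^esub> F y"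
    "\<And>w z n. w \<in> carrier S2.Wid \<Longrightarrow> z \<in> carrier R1 \<Longrightarrow> n \<in> carrier N \<Longrightarrow> F (S2.tens w z n) = Hl w n z"
  proof (rule S2.conv_universal[OF S4.abelian_group_conv, of "\<lambda>w z n. Hl w n z"])
    fix w z n assume w: "w \<in> carrier S2.Wid" and z: "z \<in> carrier R1" and n: "n \<in> carrier N"
    note w = Wid_W(3)[OF w] and z = R1_conv[OF z]
    show "Hl w n z \<in> carrier S4.conv_mod" by (rule Hl(1)[OF w n z])
    show "Hl (w \<oplus>\<^bsub>Wn\<^esub> w') n z = Hl w n z \<oplus>\<^bsub>S4.conv_mod\<^esub> Hl w' n z" if "w' \<in> carrier S2.Wid" for w'
      by (rule Hl_add1[OF w Wid_W(3)[OF that] n z])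
    show "Hl w n (z \<oplus>\<^bsub>R1\<^esub> z') = Hl w n z \<oplus>\<^bsub>S4.conv_mod\<^esub> Hl w n z'" if "z' \<in> carrier R1" for z'
      unfolding R1_add by (rule Hl(2)[OF w n z R1_conv[OF that]])
    show "Hl w (n \<oplus>\<^bsub>N\<^esub> n') z = Hl w n z \<oplus>\<^bsub>S4.conv_mod\<^esub> Hl w n' z" if "n' \<in> carrier N" for n'
      by (rule Hl_add2[OF w n that z])
    show "Hl (w \<otimes>\<^bsub>Wn\<^esub> pe2 (r, s)) n z = Hl w (s \<odot>\<^bsub>N\<^esub> n) (r \<odot>\<^bsub>R1\<^esub> z)" if "r \<in> carrier Kba" "s \<in> carrier Kc" for r s
      using Hl_balanced[OF w n z that] by simp
  qed blast
  obtain G where G: "\<And>x. x \<in> carrier S4.conv_mod \<Longrightarrow> G x \<in> carrier S2.conv_mod"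
    "\<And>x y. x \<in> carrier S4.conv_mod \<Longrightarrow> y \<in> carrier S4.conv_mod \<Longrightarrow> G (x \<oplus>\<^bsub>S4.conv_mod\<^esub> y) = G x \<oplus>\<^bsub>S2.conv_mod\<^esub> G y"
    "\<And>w m z. w \<in> carrier S4.Wid \<Longrightarrow> m \<in> carrier M \<Longrightarrow> z \<in> carrier R3 \<Longrightarrow> G (S4.tens w m z) = Hr w m z"
  proof (rule S4.conv_universal[OF S2.abelian_group_conv, of "\<lambda>w m z. Hr w m z"])
    fix w m z assume w: "w \<in> carrier S4.Wid" and z: "z \<in> carrier R3" and m: "m \<in> carrier M"
    note w = Wid_W(4)[OF w] and z = R3_conv[OF z]
    show "Hr w m z \<in> carrier S2.conv_mod" by (rule Hr(1)[OF w m z])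
    show "Hr (w \<oplus>\<^bsub>Wn\<^esub> w') m z = Hr w m z \<oplus>\<^bsub>S2.conv_mod\<^esub> Hr w' m z" if "w' \<in> carrier S4.Wid" for w'
      by (rule Hr_add1[OF w Wid_W(4)[OF that] m z])
    show "Hr w m (z \<oplus>\<^bsub>R3\<^esub> z') = Hr w m z \<oplus>\<^bsub>S2.conv_mod\<^esub> Hr w m z'" if "z' \<in> carrier R3" for z'
      unfolding R3_add by (rule Hr(2)[OF w m z R3_conv[OF that]])
    show "Hr w (m \<oplus>\<^bsub>M\<^esub> m') z = Hr w m z \<oplus>\<^bsub>S2.conv_mod\<^esub> Hr w m' z" if "m' \<in> carrier M" for m'
      by (rule Hr_add2[OF w m that z])
    show "Hr (w \<otimes>\<^bsub>Wn\<^esub> pe4 (r, s)) m z = Hr w (r \<odot>\<^bsub>M\<^esub> m) (s \<odot>\<^bsub>R3\<^esub> z)" if "r \<in> carrier Kb" "s \<in> carrier Kac" for r s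
      using Hr_balanced[OF w m z that] by simp
  qed blast
  have \<epsilon>: "\<epsilon>1 \<in> carrier W1" "\<epsilon>3 \<in> carrier W2" by (simp_all add: S1.C.rho_closed S3.C.rho_closed)
  \<comment> \<open>On the whole of M o L the composite returns \<open>z\<close> only up to
    \<open>\<epsilon>1\<close>, which acts as the identity on the restriction.\<close>
  have GHl: "G (Hl w n z) = S2.tens w (\<epsilon>1 \<odot>\<^bsub>S1.conv_mod\<^esub> z) n"
    if w: "w \<in> carrier S2.Wid" and n: "n \<in> carrier N" and z: "z \<in> carrier S1.conv_mod" for w n z
    using z
  proof (induction rule: S1.conv_induct)
    case (tens s m l)
    have u: "ul w s \<in> carrier S4.Wid" by (rule ul_closed[OF Wid_W(3)[OF w] tens(1)])
    show ?case unfolding Hl(3)[OF Wid_W(3)[OF w] n tens] G(3)[OF u tens(2) zt_R3[OF tens(3) n]]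
        Hr(3)[OF Wid_W(4)[OF u] tens(2) e3_W(1) tens(3) n] ur_ul[OF Wid_W(3)[OF w] tens(1)] tens_ul[OF w tens n] ..
  next
    case (add x y)
    show ?case
      unfolding Hl(2)[OF Wid_W(3)[OF w] n add(1,2)] G(2)[OF Hl(1)[OF Wid_W(3)[OF w] n add(1)] Hl(1)[OF Wid_W(3)[OF w] n add(2)]]
        add(3,4) C1.smult_r_distr[OF \<epsilon>(1) add(1,2)] unfolding R1_add[symmetric]
      by (rule S2.tens_add2[OF w S1.C.resm_mem[OF S1.left_module_conv add(1)] S1.C.resm_mem[OF S1.left_module_conv add(2)] n, symmetric])
  qed
  have FHr: "F (Hr w m z) = S4.tens w m (\<epsilon>3 \<odot>\<^bsub>S3.conv_mod\<^esub> z)"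
    if w: "w \<in> carrier S4.Wid" and m: "m \<in> carrier M" and z: "z \<in> carrier S3.conv_mod" for w m z
    using z
  proof (induction rule: S3.conv_induct)
    case (tens s l n)
    have u: "ur w s \<in> carrier S2.Wid" by (rule ur_closed[OF Wid_W(4)[OF w] tens(1)])
    show ?case unfolding Hr(3)[OF Wid_W(4)[OF w] m tens] F(3)[OF u yt_R1[OF m tens(2)] tens(3)]
        Hl(3)[OF Wid_W(3)[OF u] tens(3) e1_W(1) m tens(2)] ul_ur[OF Wid_W(4)[OF w] tens(1)] tens_ur[OF w tens(1) m tens(2,3)] ..
  next
    case (add x y)
    show ?case
      unfolding Hr(2)[OF Wid_W(4)[OF w] m add(1,2)] F(2)[OF Hr(1)[OF Wid_W(4)[OF w] m add(1)] Hr(1)[OF Wid_W(4)[OF w] m add(2)]]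
        add(3,4) C3.smult_r_distr[OF \<epsilon>(2) add(1,2)] unfolding R3_add[symmetric]
      by (rule S4.tens_add3[OF w m S3.C.resm_mem[OF S3.left_module_conv add(1)] S3.C.resm_mem[OF S3.left_module_conv add(2)], symmetric])
  qed
  have GF: "G (F x) = x" if "x \<in> carrier S2.conv_mod" for x
    using that
  proof (induction rule: S2.conv_induct)
    case (tens w z n)
    have "\<epsilon>1 \<odot>\<^bsub>S1.conv_mod\<^esub> z = z" using tens(2) unfolding R1_iff by blast
    then show ?case unfolding F(3)[OF tens] GHl[OF tens(1,3) R1_conv[OF tens(2)]] by simp
  next
    case (add x y)
    then show ?case by (simp add: F(1,2) G(2))
  qed
  have FG: "F (G x) = x" if "x \<in> carrier S4.conv_mod" for x
    using that
  proof (induction rule: S4.conv_induct)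
    case (tens w m z)
    have "\<epsilon>3 \<odot>\<^bsub>S3.conv_mod\<^esub> z = z" using tens(3) unfolding R3_iff by blast
    then show ?case unfolding G(3)[OF tens] FHr[OF tens(1,2) R3_conv[OF tens(3)]] by simp
  next
    case (add x y)
    then show ?case by (simp add: F(2) G(1,2))
  qed
  have bij: "bij_betw F (carrier S2.conv_mod) (carrier S4.conv_mod)"
    by (rule bij_betw_byWitness[where f' = G]) (use F(1) G(1) GF FG in blast)+
  have lin: "F (a \<odot>\<^bsub>S2.conv_mod\<^esub> x) = a \<odot>\<^bsub>S4.conv_mod\<^esub> F x" if a: "a \<in> carrier Wn" and x: "x \<in> carrier S2.conv_mod" for a x
    using x
  proof (induction rule: S2.conv_induct)
    case (tens w z n)
    show ?case
      unfolding S2.smult_tens[OF a tens] F(3)[OF Wid_mult2[OF a tens(1)] tens(2,3)] F(3)[OF tens]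
      by (rule Hl_left[OF a Wid_W(3)[OF tens(1)] tens(3) R1_conv[OF tens(2)]])
  next
    case (add x y)
    then show ?case using a by (simp add: F(1,2) C2.smult_r_distr C4.smult_r_distr C2.smult_closed)
  qed
  show thesis
  proof (rule that[of F])
    show "module_isomorphism Wn S2.conv_mod S4.conv_mod F"
      unfolding module_isomorphism_def
      using C2.left_module_axioms C4.left_module_axioms bij F(2) lin by blast
    fix m l n assume m: "m \<in> carrier M" and l: "l \<in> carrier L" and n: "n \<in> carrier N"
    have e2: "e2 \<in> carrier S2.Wid" unfolding S2.Wid_iff using S2.e_closed S2.e_idem by blast
    have e4': "e4 \<in> carrier S4.Wid" unfolding S4.Wid_iff using S4.e_closed S4.e_idem by blast
    \<comment> \<open>The idempotent of the triple of blocks. \<open>e4\<close> absorbs it from the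
      left of the tensor, and \<open>move4\<close> turns it into three units acting on
      \<open>m\<close>, \<open>l\<close> and \<open>n\<close>.\<close>
    let ?k = "ka2 (ka1 \<one>\<^bsub>Kb\<^esub> \<one>\<^bsub>Ka\<^esub>) \<one>\<^bsub>Kc\<^esub>"
    have "P1 e1 = ka1 \<one>\<^bsub>Kb\<^esub> \<one>\<^bsub>Ka\<^esub>" unfolding S1.e by (simp add: S1.C.P_rho kk1)
    then have "ul e2 e1 = rho ?k"
      unfolding ul_def S2.e by (simp add: kk1 p2.ka_closed p2.ka_one_left flip: Cn.rho_mult)
    also have "\<dots> = e4 \<otimes>\<^bsub>Wn\<^esub> rho ?k"
      unfolding S4.e by (simp add: kk3 assoc p4.ka_closed p4.ka_one_left flip: Cn.rho_mult)
    finally have "ul e2 e1 = e4 \<otimes>\<^bsub>Wn\<^esub> rho ?k" .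
    then show "F (S2.tens e2 (yt m l) n) = S4.tens e4 m (zt l n)"
      unfolding F(3)[OF e2 yt_R1[OF m l] n] Hl(3)[OF Wid_W(3)[OF e2] n e1_W(1) m l]
      using move4[OF e4' S1.K1.one_closed S1.K2.one_closed S3.K2.one_closed m l n]
      by (simp add: S1.MA.smult_one[OF m] S1.MB.smult_one[OF l] S3.MB.smult_one[OF n])
  qed
qed

end

section \<open>The corner and pairing maps on classes\<close>

lemma klr_alg_simps:
  "carrier (klr_alg p b) = klr_class p b ` carrier (free_alg (KG b))"
  "f \<in> carrier (free_alg (KG b)) \<Longrightarrow> g \<in> carrier (free_alg (KG b)) \<Longrightarrow>
    klr_class p b f \<otimes>\<^bsub>klr_alg p b\<^esub> klr_class p b g = klr_class p b (f * g)"
  "f \<in> carrier (free_alg (KG b)) \<Longrightarrow> g \<in> carrier (free_alg (KG b)) \<Longrightarrow>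
    klr_class p b f \<oplus>\<^bsub>klr_alg p b\<^esub> klr_class p b g = klr_class p b (f + g)"
  "\<one>\<^bsub>klr_alg p b\<^esub> = klr_class p b 1"
  "f \<in> carrier (free_alg (KG b)) \<Longrightarrow> g \<in> carrier (free_alg (KG b)) \<Longrightarrow>
    klr_class p b f = klr_class p b g \<longleftrightarrow> f \<doteq>\<^bsub>KJ p b\<^esub> g"
  unfolding klr_alg_def klr_class_def
  by (rule carrier_presented[OF KJ_closed] presented_mult[OF KJ_closed] presented_add[OF KJ_closed]
    presented_one[OF KJ_closed] pclass_eq_iff[OF KJ_closed]; assumption)+

lemma ring_klr_alg: "ring (klr_alg p b)"
  unfolding klr_alg_def by (rule ring_presented[OF KJ_closed])

lemma UN_klr_class:
  assumes "f \<in> carrier (free_alg (KG b))"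
    and "\<And>g. g \<in> carrier (free_alg (KG b)) \<Longrightarrow> g \<doteq>\<^bsub>KJ p b\<^esub> f \<Longrightarrow> h g = h f"
  shows "(\<Union>g\<in>klr_class p b f. h g) = h f"
  unfolding klr_class_def by (rule UN_pclass[OF KJ_closed]) (fact assms)+

definition pair_class :: "'k::field \<Rightarrow> 'k multiset \<Rightarrow> 'k multiset \<Rightarrow> 'k falg set \<Rightarrow> 'k falg set \<Rightarrow> 'k falg set" where
  "pair_class p b c r s = (\<Union>f\<in>r. \<Union>g\<in>s. klr_class p (b + c) (kap b c f g))"

lemma UN_UN_klr_class:
  assumes f: "f \<in> carrier (free_alg (KG b))" and g: "g \<in> carrier (free_alg (KG c))"
    and h: "\<And>f' g'. f' \<in> carrier (free_alg (KG b)) \<Longrightarrow> g' \<in> carrier (free_alg (KG c)) \<Longrightarrow>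
      f' \<doteq>\<^bsub>KJ p b\<^esub> f \<Longrightarrow> g' \<doteq>\<^bsub>KJ p c\<^esub> g \<Longrightarrow> h f' g' = h f g"
  shows "(\<Union>f\<in>klr_class p b f. \<Union>g\<in>klr_class p c g. h f g) = h f g"
proof -
  have "(\<Union>g\<in>klr_class p c g. h f' g) = h f g" if "f' \<in> carrier (free_alg (KG b))" "f' \<doteq>\<^bsub>KJ p b\<^esub> f" for f'
    using UN_klr_class[OF g, of p "h f'"] h[OF that(1) _ that(2)] g eqv_refl by metis
  then show ?thesis using UN_klr_class[OF f, of p "\<lambda>f. \<Union>g\<in>klr_class p c g. h f g"] f eqv_refl by metis
qed

lemma klr_cong_self: "klr_cong p (size b) (klr_words b) (KJ p b)"
  by (rule klr_cong_KJ) simp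

lemma pair_class_class:
  assumes "f \<in> carrier (free_alg (KG b))" "g \<in> carrier (free_alg (KG c))"
  shows "pair_class p b c (klr_class p b f) (klr_class p c g) = klr_class p (b + c) (kap b c f g)"
  unfolding pair_class_def
proof (rule UN_UN_klr_class[OF assms])
  fix f' g' assume *: "f' \<in> carrier (free_alg (KG b))" "g' \<in> carrier (free_alg (KG c))"
    "f' \<doteq>\<^bsub>KJ p b\<^esub> f" "g' \<doteq>\<^bsub>KJ p c\<^esub> g"
  show "klr_class p (b + c) (kap b c f' g') = klr_class p (b + c) (kap b c f g)"
    unfolding klr_alg_simps(5)[OF kap_closed[OF klr_cong_self *(1,2)] kap_closed[OF klr_cong_self assms]]
    by (rule kap_cong[OF klr_cong_self *(1) assms(1) *(3) *(2) assms(2) *(4)])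
qed

lemma pairing_klr:
  "pairing (klr_alg p b) (klr_alg p c) (klr_alg p (b + c)) (pair_class p b c)
    (\<lambda>k. klr_class p b (fscal k)) (\<lambda>k. klr_class p c (fscal k))"
proof -
  interpret K1: ring "klr_alg p b" by (rule ring_klr_alg)
  interpret K2: ring "klr_alg p c" by (rule ring_klr_alg)
  interpret K3: ring "klr_alg p (b + c)" by (rule ring_klr_alg)
  note kc = kap_closed[OF klr_cong_self]
  show ?thesis
  proof unfold_locales
    fix r s assume "r \<in> carrier (klr_alg p b)" "s \<in> carrier (klr_alg p c)"
    then obtain f g where r: "r = klr_class p b f" "f \<in> carrier (free_alg (KG b))"
      and s: "s = klr_class p c g" "g \<in> carrier (free_alg (KG c))"
      unfolding klr_alg_simps(1) by blast
    show "pair_class p b c r s \<in> carrier (klr_alg p (b + c))"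
      unfolding r s pair_class_class[OF r(2) s(2)] klr_alg_simps(1) using kc[OF r(2) s(2)] by blast
    show "pair_class p b c (klr_class p b (fscal k) \<otimes>\<^bsub>klr_alg p b\<^esub> r) s =
        pair_class p b c r (klr_class p c (fscal k) \<otimes>\<^bsub>klr_alg p c\<^esub> s)" for k
      using r(2) s(2) by (simp add: r s klr_alg_simps pair_class_class kap_scal)
    show "pair_class p b c (r \<oplus>\<^bsub>klr_alg p b\<^esub> r') s = pair_class p b c r s \<oplus>\<^bsub>klr_alg p (b + c)\<^esub> pair_class p b c r' s"
      if r': "r' \<in> carrier (klr_alg p b)" for r'
    proof -
      obtain f' where f': "r' = klr_class p b f'" "f' \<in> carrier (free_alg (KG b))"
        using r' unfolding klr_alg_simps(1) by blast
      show ?thesis using r(2) s(2) f'(2)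
        by (simp add: r(1) s(1) f'(1) klr_alg_simps(3)[OF kc[OF r(2) s(2)] kc[OF f'(2) s(2)]]
          klr_alg_simps(3) pair_class_class kap_add_left del: size_union)
    qed
    show "pair_class p b c r (s \<oplus>\<^bsub>klr_alg p c\<^esub> s') = pair_class p b c r s \<oplus>\<^bsub>klr_alg p (b + c)\<^esub> pair_class p b c r s'"
      if s': "s' \<in> carrier (klr_alg p c)" for s'
    proof -
      obtain g' where g': "s' = klr_class p c g'" "g' \<in> carrier (free_alg (KG c))"
        using s' unfolding klr_alg_simps(1) by blast
      show ?thesis using r(2) s(2) g'(2)
        by (simp add: r(1) s(1) g'(1) klr_alg_simps(3)[OF kc[OF r(2) s(2)] kc[OF r(2) g'(2)]]
          klr_alg_simps(3) pair_class_class kap_add_right del: size_union)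
    qed
    show "pair_class p b c (r \<otimes>\<^bsub>klr_alg p b\<^esub> r') (s \<otimes>\<^bsub>klr_alg p c\<^esub> s') =
        pair_class p b c r s \<otimes>\<^bsub>klr_alg p (b + c)\<^esub> pair_class p b c r' s'"
      if rs: "r' \<in> carrier (klr_alg p b)" "s' \<in> carrier (klr_alg p c)" for r' s'
    proof -
      obtain f' g' where f': "r' = klr_class p b f'" "f' \<in> carrier (free_alg (KG b))"
        and g': "s' = klr_class p c g'" "g' \<in> carrier (free_alg (KG c))"
        using rs unfolding klr_alg_simps(1) by blast
      note k = kc[OF r(2) s(2)] kc[OF f'(2) g'(2)]
      have ff: "f * f' \<in> carrier (free_alg (KG b))" "g * g' \<in> carrier (free_alg (KG c))"
        using r(2) s(2) f'(2) g'(2) by simp_all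
      show ?thesis
        unfolding r(1) s(1) f'(1) g'(1) klr_alg_simps(2)[OF r(2) f'(2)] klr_alg_simps(2)[OF s(2) g'(2)]
          pair_class_class[OF ff] pair_class_class[OF r(2) s(2)] pair_class_class[OF f'(2) g'(2)] klr_alg_simps(2)[OF k]
          klr_alg_simps(5)[OF kc[OF ff] free_alg_mult[OF k]]
        by (rule kap_mult[OF klr_cong_self r(2) f'(2) s(2) g'(2)])
    qed
  next
    show "klr_class p b (fscal k) \<otimes>\<^bsub>klr_alg p b\<^esub> r = r \<otimes>\<^bsub>klr_alg p b\<^esub> klr_class p b (fscal k)"
      if "r \<in> carrier (klr_alg p b)" for r k
      using that by (auto simp: klr_alg_simps(1,2) eqv_fscal_commute)
    show "klr_class p c (fscal k) \<otimes>\<^bsub>klr_alg p c\<^esub> s = s \<otimes>\<^bsub>klr_alg p c\<^esub> klr_class p c (fscal k)"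
      if "s \<in> carrier (klr_alg p c)" for s k
      using that by (auto simp: klr_alg_simps(1,2) eqv_fscal_commute)
  qed (simp_all add: klr_alg_simps(1))
qed

lemma pair_class_assoc:
  assumes "r \<in> carrier (klr_alg p b)" "s \<in> carrier (klr_alg p a)" "t \<in> carrier (klr_alg p c)"
  shows "pair_class p (b + a) c (pair_class p b a r s) t = pair_class p b (a + c) r (pair_class p a c s t)"
proof -
  obtain f g h where f: "r = klr_class p b f" "f \<in> carrier (free_alg (KG b))"
    and g: "s = klr_class p a g" "g \<in> carrier (free_alg (KG a))"
    and h: "t = klr_class p c h" "h \<in> carrier (free_alg (KG c))"
    using assms unfolding klr_alg_simps(1) by blast
  note 1 = kap_closed[OF klr_cong_self f(2) g(2)] and 2 = kap_closed[OF klr_cong_self g(2) h(2)]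
  have 3: "kap b (a + c) f (kap a c g h) \<in> carrier (free_alg (KG (b + a + c)))"
    using kap_closed[OF klr_cong_self f(2) 2] unfolding add.assoc[symmetric] .
  have "klr_class p (b + a + c) (kap (b + a) c (kap b a f g) h) = klr_class p (b + a + c) (kap b (a + c) f (kap a c g h))"
    unfolding klr_alg_simps(5)[OF kap_closed[OF klr_cong_self 1 h(2)] 3]
    by (rule kap_assoc[OF klr_cong_self f(2) g(2) h(2)])
  then show ?thesis unfolding f(1) g(1) h(1)
    by (simp add: pair_class_class f(2) g(2) h(2) 1 2 add.assoc del: size_union)
qed

section \<open>The corner of a VV algebra and its projection on classes\<close>

context vv_data
begin

abbreviation "wc \<equiv> pclass VG VR"

definition rho :: "'k falg set \<Rightarrow> 'k falg set" where
  "rho r = (\<Union>f\<in>r. wc (ep * f * ep))"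

definition Pc :: "'k falg set \<Rightarrow> 'k falg set" where
  "Pc w = (\<Union>f\<in>w. klr_class p b (Pj f))"

lemma ep_KG: "ep \<in> carrier (free_alg (KG b))"
  by (rule eset_closed) (auto simp: klr_gens_def)

lemma ep_f_ep: "f \<in> carrier (free_alg (KG b)) \<Longrightarrow> ep * f * ep \<doteq>\<^bsub>VR\<^esub> ep * f"
proof -
  assume f: "f \<in> carrier (free_alg (KG b))"
  have "ep * f * ep = ep * (f * ep)" by (simp add: mult.assoc)
  also have "\<dots> \<doteq>\<^bsub>VR\<^esub> ep * (ep * f)" by (intro eqv_mult_left eqv_sym[OF ep_comm[OF f]])
  also have "\<dots> = (ep * ep) * f" by (simp add: mult.assoc)
  also have "\<dots> \<doteq>\<^bsub>VR\<^esub> ep * f" by (intro eqv_mult_right ep_idem)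
  finally show ?thesis .
qed

lemma rho_class: "f \<in> carrier (free_alg (KG b)) \<Longrightarrow> rho (klr_class p b f) = wc (ep * f)"
proof -
  assume f: "f \<in> carrier (free_alg (KG b))"
  have c: "ep * g * ep \<in> carrier (free_alg VG)" "ep * g \<in> carrier (free_alg VG)" if "g \<in> carrier (free_alg (KG b))" for g
    using that ep_KG by (auto intro: KG_VG_carrier)
  have eq: "wc (ep * g * ep) = wc (ep * g)" if "g \<in> carrier (free_alg (KG b))" for g
    using that c ep_f_ep by (simp add: pclass_eq_iff[OF VR_closed])
  have "rho (klr_class p b f) = wc (ep * f * ep)"
    unfolding rho_def
  proof (rule UN_klr_class[OF f])
    fix g assume "g \<in> carrier (free_alg (KG b))" "g \<doteq>\<^bsub>J\<^esub> f"
    then show "wc (ep * g * ep) = wc (ep * f * ep)"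
      using f c ep_cong by (simp add: eq pclass_eq_iff[OF VR_closed])
  qed
  then show ?thesis using eq[OF f] by simp
qed

lemma Pc_class: "f \<in> carrier (free_alg VG) \<Longrightarrow> Pc (wc f) = klr_class p b (Pj f)"
  unfolding Pc_def
  by (rule UN_pclass[OF VR_closed]) (simp_all add: klr_alg_simps(5) Pj_closed Pj_cong)

text \<open>\<open>Pj\<close> gives the projection with its linearity on both sides, and
  \<open>ep_surj\<close> shows that the natural map reaches the whole corner.\<close>

lemma corner_vv: "corner (klr_alg p b) (presented VG VR) rho Pc"
proof -
  interpret K: ring "klr_alg p b" by (rule ring_klr_alg)
  interpret W: ring "presented VG VR" by (rule ring_presented[OF VR_closed])
  note [simp] = presented_mult[OF VR_closed] presented_add[OF VR_closed] presented_one[OF VR_closed]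
  have epV: "ep \<in> carrier (free_alg VG)" by (rule KG_VG_carrier[OF ep_KG])
  have rep: "\<exists>f. w = wc f \<and> f \<in> carrier (free_alg VG)" if "w \<in> carrier (presented VG VR)" for w
    using that unfolding carrier_presented[OF VR_closed] by blast
  have repK: "\<exists>f. r = klr_class p b f \<and> f \<in> carrier (free_alg (KG b)) \<and> f \<in> carrier (free_alg VG)"
    if "r \<in> carrier (klr_alg p b)" for r
    using that KG_VG_carrier unfolding klr_alg_simps(1) by blast
  \<comment> \<open>\<open>ep\<close> is 1 in the KLR algebra though not in the VV algebra, so left
    linearity makes the projection ignore it.\<close>
  have Pj_ep: "Pj (ep * f) \<doteq>\<^bsub>J\<^esub> Pj f" if f: "f \<in> carrier (free_alg VG)" for f
  proof -
    have "Pj (ep * f) \<doteq>\<^bsub>J\<^esub> ep * Pj f" by (rule Pj_left[OF ep_KG f])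
    also have "\<dots> \<doteq>\<^bsub>J\<^esub> 1 * Pj f" by (intro eqv_mult_right B.eset_A)
    finally show ?thesis by simp
  qed
  show ?thesis
  proof unfold_locales
    fix r assume "r \<in> carrier (klr_alg p b)"
    then obtain f where r: "r = klr_class p b f" "f \<in> carrier (free_alg (KG b))" "f \<in> carrier (free_alg VG)"
      using repK by blast
    show "rho r \<in> carrier (presented VG VR)"
      unfolding r rho_class[OF r(2)] carrier_presented[OF VR_closed] using epV r(3) by simp
    { fix s assume "s \<in> carrier (klr_alg p b)"
      then obtain g where s: "s = klr_class p b g" "g \<in> carrier (free_alg (KG b))" "g \<in> carrier (free_alg VG)"
        using repK by blast
      show "rho (r \<oplus>\<^bsub>klr_alg p b\<^esub> s) = rho r \<oplus>\<^bsub>presented VG VR\<^esub> rho s"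
        using r(2,3) s(2,3) epV by (simp add: r(1) s(1) klr_alg_simps(3) rho_class distrib_left)
      have "ep * (f * g) = (ep * f) * g" by (simp add: mult.assoc)
      also have "\<dots> \<doteq>\<^bsub>VR\<^esub> (ep * f * ep) * g" by (intro eqv_mult_right eqv_sym[OF ep_f_ep[OF r(2)]])
      also have "\<dots> = ep * f * (ep * g)" by (simp add: mult.assoc)
      finally show "rho (r \<otimes>\<^bsub>klr_alg p b\<^esub> s) = rho r \<otimes>\<^bsub>presented VG VR\<^esub> rho s"
        using r(2,3) s(2,3) epV by (simp add: r(1) s(1) klr_alg_simps(2) rho_class pclass_eq_iff[OF VR_closed]) }
    fix w assume "w \<in> carrier (presented VG VR)"
    then obtain g where w: "w = wc g" "g \<in> carrier (free_alg VG)" using rep by blast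
    have fg: "f * g \<in> carrier (free_alg VG)" "g * f \<in> carrier (free_alg VG)" "g * ep \<in> carrier (free_alg VG)"
      using r w epV by simp_all
    have "Pj (ep * f * g) \<doteq>\<^bsub>J\<^esub> f * Pj g"
      using eqv_trans[OF Pj_ep[OF fg(1)] Pj_left[OF r(2) w(2)]] by (simp add: mult.assoc)
    then show "Pc (rho r \<otimes>\<^bsub>presented VG VR\<^esub> w) = r \<otimes>\<^bsub>klr_alg p b\<^esub> Pc w"
      using r w epV Pj_closed by (simp add: rho_class Pc_class klr_alg_simps(2,5))
    have "Pj (g * (ep * f)) = Pj (g * ep * f)" by (simp add: mult.assoc)
    also have "\<dots> \<doteq>\<^bsub>J\<^esub> Pj (g * ep) * f" by (rule Pj_right[OF r(2) fg(3)])
    also have "\<dots> \<doteq>\<^bsub>J\<^esub> (Pj g * ep) * f" by (intro eqv_mult_right Pj_right[OF ep_KG w(2)])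
    also have "\<dots> \<doteq>\<^bsub>J\<^esub> (Pj g * 1) * f" by (intro eqv_mult_right eqv_mult_left B.eset_A)
    finally have "Pj (g * (ep * f)) \<doteq>\<^bsub>J\<^esub> Pj g * f" by simp
    then show "Pc (w \<otimes>\<^bsub>presented VG VR\<^esub> rho r) = Pc w \<otimes>\<^bsub>klr_alg p b\<^esub> r"
      using r w epV Pj_closed by (simp add: rho_class Pc_class klr_alg_simps(2,5))
  next
    fix w assume "w \<in> carrier (presented VG VR)"
    then obtain g where w: "w = wc g" "g \<in> carrier (free_alg VG)" using rep by blast
    show "Pc w \<in> carrier (klr_alg p b)"
      using w by (simp add: Pc_class klr_alg_simps(1) Pj_closed)
    have "ep * Pj g \<doteq>\<^bsub>VR\<^esub> ep * g * ep"
      using eqv_trans[OF eqv_sym[OF ep_f_ep[OF Pj_closed[OF w(2)]]] eqv_sym[OF ep_surj[OF w(2)]]] .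
    then show "rho (Pc w) = rho \<one>\<^bsub>klr_alg p b\<^esub> \<otimes>\<^bsub>presented VG VR\<^esub> w \<otimes>\<^bsub>presented VG VR\<^esub> rho \<one>\<^bsub>klr_alg p b\<^esub>"
      using w epV Pj_closed[OF w(2)] KG_VG_carrier[OF Pj_closed[OF w(2)]]
      by (simp add: Pc_class klr_alg_simps(4) rho_class pclass_eq_iff[OF VR_closed])
    fix v assume "v \<in> carrier (presented VG VR)"
    then obtain h where v: "v = wc h" "h \<in> carrier (free_alg VG)" using rep by blast
    show "Pc (w \<oplus>\<^bsub>presented VG VR\<^esub> v) = Pc w \<oplus>\<^bsub>klr_alg p b\<^esub> Pc v"
      using w v Pj_closed by (simp add: Pc_class klr_alg_simps(3) Pj_add)
  next
    show "Pc \<one>\<^bsub>presented VG VR\<^esub> = \<one>\<^bsub>klr_alg p b\<^esub>"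
      using Pj_closed[of 1] Pj_one by (simp add: Pc_class klr_alg_simps(4,5))
  qed
qed

end

section \<open>The convolution product of VV algebra modules\<close>

text \<open>Inverse to taking the positive part, by \<open>plus_part_dbl\<close> and
  \<open>theta_NI_dbl\<close>. Writing all dimension vectors as doubles makes positive parts compute
  by rewriting.\<close>

definition dbl :: "'k::field multiset \<Rightarrow> 'k multiset" where
  "dbl b = b + image_mset inverse b"

lemma dbl_add: "dbl b + dbl c = dbl (b + c)"
  by (simp add: dbl_def)

locale vv_setup =
  fixes p lam :: "'k::field"
  assumes p0: "p \<noteq> 0" and lam0: "lam \<noteq> 0"
    and not_VI: "1 \<notin> VI p lam" "-1 \<notin> VI p lam" "p \<notin> VI p lam" "-p \<notin> VI p lam"
begin

abbreviation Vp where "Vp \<equiv> VI_plus p lam"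

lemma VI_iff: "x \<in> VI p lam \<longleftrightarrow> x \<in> Vp \<or> inverse x \<in> Vp"
proof -
  have "x \<in> {p powi (2 * n) * inverse lam | n. True} \<longleftrightarrow> inverse x \<in> Vp"
  proof
    assume "x \<in> {p powi (2 * n) * inverse lam | n. True}"
    then obtain n where "x = p powi (2 * n) * inverse lam" by blast
    then have "inverse x = p powi (2 * (- n)) * lam"
      by (simp add: power_int_minus)
    then show "inverse x \<in> Vp" unfolding VI_plus_def by blast
  next
    assume "inverse x \<in> Vp"
    then obtain n where "inverse x = p powi (2 * n) * lam" unfolding VI_plus_def by blast
    then have "x = p powi (2 * (- n)) * inverse lam"
      by (metis inverse_inverse_eq inverse_mult_distrib mult_minus_right power_int_minus)
    then show "x \<in> {p powi (2 * n) * inverse lam | n. True}" by blast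
  qed
  then show ?thesis by (auto simp: VI_def VI_plus_def)
qed

text \<open>An arrow joins a letter and its multiple by the square of p, so this makes the sign
  constant along arrows.\<close>

lemma Vp_shift: "p\<^sup>2 * x \<in> Vp \<longleftrightarrow> x \<in> Vp"
proof -
  have s: "p powi (2 * (n + 1)) = p\<^sup>2 * p powi (2 * n)" for n
  proof -
    have "p powi (2 * (n + 1)) = p powi (2 * n + 2)" by (simp add: algebra_simps)
    also have "\<dots> = p powi (2 * n) * p powi 2" using p0 by (intro power_int_add) simp
    finally show ?thesis by (simp only: power_int_numeral mult.commute)
  qed
  show ?thesis
  proof
    assume "x \<in> Vp"
    then obtain n where "x = p powi (2 * n) * lam" unfolding VI_plus_def by blast
    then have "p\<^sup>2 * x = p powi (2 * (n + 1)) * lam" by (simp only: s mult.assoc)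
    then show "p\<^sup>2 * x \<in> Vp" unfolding VI_plus_def by blast
  next
    assume "p\<^sup>2 * x \<in> Vp"
    then obtain n where "p\<^sup>2 * x = p powi (2 * n) * lam" unfolding VI_plus_def by blast
    then have "p\<^sup>2 * x = p\<^sup>2 * (p powi (2 * (n - 1)) * lam)" using s[of "n - 1"] by (simp add: mult.assoc)
    then have "x = p powi (2 * (n - 1)) * lam" using p0 by simp
    then show "x \<in> Vp" unfolding VI_plus_def by blast
  qed
qed

text \<open>A common element yields $\lambda^2 = p^{2k}$, so $\lambda = \pm p^k$, and multiplying $\lambda$ by an
  even power of $p$ produces $\pm 1$ or $\pm p$ in $I$.\<close>

lemma Vp_disjoint: "x \<in> Vp \<Longrightarrow> inverse x \<notin> Vp"
proof
  assume "x \<in> Vp" "inverse x \<in> Vp"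
  then obtain n k where n: "x = p powi (2 * n) * lam" and k: "inverse x = p powi (2 * k) * lam"
    unfolding VI_plus_def by blast
  have "x \<noteq> 0" using n p0 lam0 by simp
  then have "(p powi (2 * n) * lam) * (p powi (2 * k) * lam) = 1" unfolding n[symmetric] k[symmetric] by simp
  then have "(p powi (n + k) * lam)\<^sup>2 = 1"
    using p0 power_int_add[of p n n] power_int_add[of p k k]
    unfolding mult_2[symmetric] by (simp add: power2_eq_square power_int_add mult_ac)
  then have *: "p powi (n + k) * lam = 1 \<or> p powi (n + k) * lam = -1"
    by (simp add: power2_eq_1_iff)
  have VI: "p powi (2 * j) * lam \<in> VI p lam" for j by (auto simp: VI_def)
  show False
  proof (cases "even (n + k)")
    case True
    then obtain j where "n + k = 2 * j" by blast
    then show False using * VI[of j] not_VI by auto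
  next
    case False
    then obtain j where j: "n + k + 1 = 2 * j" by (metis even_plus_one_iff dvdE)
    have "p powi (n + k + 1) * lam = p * (p powi (n + k) * lam)" using p0 by (simp add: power_int_add)
    moreover from * have "p * (p powi (n + k) * lam) \<in> {p, -p}" by (elim disjE) (simp_all only:, simp_all)
    ultimately have "p powi (n + k + 1) * lam \<in> {p, -p}" by (simp only:)
    then show False using VI[of j] not_VI unfolding j by auto
  qed
qed

lemma Vp_nonzero: "x \<in> Vp \<Longrightarrow> x \<noteq> 0"
  using p0 lam0 by (auto simp: VI_plus_def)

lemma vv_data_Vp: "set_mset b \<subseteq> Vp \<Longrightarrow> vv_data p (VI p lam) (\<lambda>x. x \<in> Vp) b"
proof unfold_locales
  show "x \<noteq> 0" "inverse x \<in> VI p lam" if "x \<in> VI p lam" for x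
    using that Vp_nonzero unfolding VI_iff by force+
  show "inverse x \<in> Vp \<longleftrightarrow> x \<notin> Vp" if "x \<in> VI p lam" for x
    using that Vp_disjoint[of x] Vp_disjoint[of "inverse x"] unfolding VI_iff by auto
  show "(x \<in> Vp) = (y \<in> Vp)" if "x \<in> VI p lam" "y \<in> VI p lam" "x = p\<^sup>2 * y" for x y
    using that Vp_shift[of y] by simp
  show "p \<noteq> 0" by (rule p0)
  show "x \<in> VI p lam \<and> x \<in> Vp" if "set_mset b \<subseteq> Vp" "x \<in># b" for x
    using that unfolding VI_iff by blast
qed

lemma plus_part_dbl: "set_mset b \<subseteq> Vp \<Longrightarrow> plus_part p lam (dbl b) = b"
proof -
  assume b: "set_mset b \<subseteq> Vp"
  have "filter_mset (\<lambda>i. i \<in> Vp) b = b" using b by (auto simp: filter_mset_eq_conv)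
  moreover have "filter_mset (\<lambda>i. i \<in> Vp) (image_mset inverse b) = {#}"
    using b Vp_disjoint by (auto simp flip: set_mset_eq_empty_iff)
  ultimately show ?thesis by (simp add: plus_part_def dbl_def)
qed

lemma theta_NI_dbl:
  assumes "\<alpha> \<in> theta_NI p lam"
  shows "dbl (plus_part p lam \<alpha>) = \<alpha>"
proof (rule multiset_eqI)
  fix x
  let ?b = "plus_part p lam \<alpha>"
  have img: "inverse -` {x} = {inverse x}" for x :: 'k by auto
  have c: "count (image_mset inverse ?b) x = count ?b (inverse x)"
    by (simp add: count_image_mset img Int_insert_left not_in_iff)
  have b: "count ?b y = (if y \<in> Vp then count \<alpha> y else 0)" for y by (simp add: plus_part_def)
  show "count (dbl ?b) x = count \<alpha> x"
  proof (cases "x \<in> VI p lam")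
    case True
    then have "count \<alpha> x = count \<alpha> (inverse x)" using assms by (auto simp: theta_NI_def)
    then show ?thesis using True Vp_disjoint[of x] unfolding VI_iff by (auto simp: dbl_def c b)
  next
    case False
    then have "count \<alpha> x = 0" using assms by (auto simp: theta_NI_def not_in_iff[symmetric])
    then show ?thesis using False unfolding VI_iff by (auto simp: dbl_def c b)
  qed
qed

lemma plus_part_Vp: "set_mset (plus_part p lam \<alpha>) \<subseteq> Vp"
  by (auto simp: plus_part_def)

end

lemma size_dbl: "size (dbl b) div 2 = size b"
  by (simp add: dbl_def)

section \<open>The concrete algebras as instances of the abstract setting\<close>

locale vv_block = vv_setup p lam + vv_data p "VI p lam" "\<lambda>x. x \<in> VI_plus p lam" b
  for p lam :: "'k::field" and b :: "'k multiset"
begin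

lemma b_Vp: "set_mset b \<subseteq> VI_plus p lam"
  using b by blast

lemma vv_alg_dbl: "vv_alg p (dbl b) = presented VG VR"
  and vv_class_dbl: "vv_class p (dbl b) = wc"
  by (simp_all only: vv_alg_def vv_class_def size_dbl Let_def) (simp_all only: dbl_def)

lemma idem_plus_dbl: "idem_plus p lam (dbl b) = ep"
  by (simp add: idem_plus_def plus_part_dbl[OF b_Vp] eset_def)

lemma klr_to_vv_dbl: "klr_to_vv p lam (dbl b) = rho"
  by (simp add: fun_eq_iff klr_to_vv_def rho_def vv_class_dbl idem_plus_dbl)

sublocale corner "klr_alg p b" "vv_alg p (dbl b)" "klr_to_vv p lam (dbl b)" Pc
  unfolding vv_alg_dbl klr_to_vv_dbl by (rule corner_vv)

lemma Res_eq: "Res p lam (dbl b) V = resm V"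
proof -
  have "rho \<one>\<^bsub>klr_alg p b\<^esub> = wc ep" using rho_class[of 1] by (simp add: klr_alg_simps(4))
  then show ?thesis unfolding Res_def resm_def unfolding klr_to_vv_dbl vv_class_dbl idem_plus_dbl by simp
qed

end

lemma (in vv_setup) vv_block: "set_mset b \<subseteq> VI_plus p lam \<Longrightarrow> vv_block p lam b"
  by (intro vv_block.intro vv_setup_axioms vv_data_Vp)

text \<open>\<open>pair_emb\<close> maps directly into the VV algebra, whereas the abstract setting
  wants it to factor through the KLR algebra of the sum. It does because the idempotent
  \<open>e2 b c\<close> of the pair lies below the idempotent of the corner.\<close>

lemma (in vv_setup) conv_setup_block:
  assumes b: "set_mset b \<subseteq> VI_plus p lam" and c: "set_mset c \<subseteq> VI_plus p lam"
    and M: "left_module (vv_alg p (dbl b)) M" and N: "left_module (vv_alg p (dbl c)) N"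
    and P: "P = vv_data.Pc p (\<lambda>x. x \<in> VI_plus p lam) (b + c)"
  shows "conv_setup (klr_alg p b) (klr_alg p c) (klr_alg p (b + c)) (vv_alg p (dbl b + dbl c))
      (klr_to_vv p lam (dbl (b + c))) P (pair_class p b c)
      (\<lambda>k. klr_class p b (fscal k)) (\<lambda>k. klr_class p c (fscal k))
      (Res p lam (dbl b) M) (Res p lam (dbl c) N)
      (pair_emb p lam (dbl b) (dbl c)) (vv_class p (dbl b + dbl c) (idem_pair p lam (dbl b) (dbl c)))"
proof -
  interpret B: vv_block p lam b by (rule vv_block[OF b])
  interpret C: vv_block p lam c by (rule vv_block[OF c])
  interpret D: vv_block p lam "b + c" by (rule vv_block) (use b c in simp)
  interpret pairing "klr_alg p b" "klr_alg p c" "klr_alg p (b + c)" "pair_class p b c"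
    "\<lambda>k. klr_class p b (fscal k)" "\<lambda>k. klr_class p c (fscal k)" by (rule pairing_klr)
  have ip: "idem_pair p lam (dbl b) (dbl c) = e2 b c"
    using eset_app_set[of "klr_words b" "size b" "klr_words c"] klr_words_length[of _ b]
    by (simp add: idem_pair_def plus_part_dbl[OF b] plus_part_dbl[OF c] e2_def)
  have e2V: "e2 b c \<in> carrier (free_alg D.VG)" by (rule D.KG_VG_carrier[OF e2_closed])
  have epe2: "D.ep * e2 b c \<doteq>\<^bsub>D.VR\<^esub> e2 b c"
    using D.W.eset_eset[OF D.klr_sub_A, of "app_set (klr_words b) (klr_words c)"]
      app_set_klr_words[of b c] D.klr_sub_A by (simp add: e2_def Int_absorb1 subset_trans)
  have rho_kap: "klr_to_vv p lam (dbl (b + c)) (klr_class p (b + c) (kap b c f g)) = D.wc (kap b c f g)"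
    if f: "f \<in> carrier (free_alg (KG b))" and g: "g \<in> carrier (free_alg (KG c))" for f g
  proof -
    note k = kap_closed[OF klr_cong_self f g]
    have "D.ep * kap b c f g = (D.ep * e2 b c) * (fsubst (mid {#} c) f * fsubst (mid b {#}) g * e2 b c)"
      by (simp add: kap_def mult.assoc)
    also have "\<dots> \<doteq>\<^bsub>D.VR\<^esub> e2 b c * (fsubst (mid {#} c) f * fsubst (mid b {#}) g * e2 b c)"
      by (intro eqv_mult_right epe2)
    also have "\<dots> = kap b c f g" by (simp add: kap_def mult.assoc)
    finally have "D.ep * kap b c f g \<doteq>\<^bsub>D.VR\<^esub> kap b c f g" .
    moreover have "D.ep * kap b c f g \<in> carrier (free_alg D.VG)"
      by (intro free_alg_mult D.KG_VG_carrier D.ep_KG k)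
    ultimately show ?thesis
      unfolding D.klr_to_vv_dbl D.rho_class[OF k]
      by (intro iffD2[OF pclass_eq_iff[OF D.VR_closed _ D.KG_VG_carrier[OF k]]])
  qed
  show ?thesis
    unfolding dbl_add P
  proof (intro conv_setup.intro conv_setup_axioms.intro D.corner_axioms pairing_axioms)
    show "left_module (klr_alg p b) (Res p lam (dbl b) M)" unfolding B.Res_eq by (rule B.left_module_resm[OF M])
    show "left_module (klr_alg p c) (Res p lam (dbl c) N)" unfolding C.Res_eq by (rule C.left_module_resm[OF N])
    show "pair_emb p lam (dbl b) (dbl c) (r, s) = klr_to_vv p lam (dbl (b + c)) (pair_class p b c r s)"
      if rs: "r \<in> carrier (klr_alg p b)" "s \<in> carrier (klr_alg p c)" for r s
    proof -
      obtain f g where f: "r = klr_class p b f" "f \<in> carrier (free_alg (KG b))"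
        and g: "s = klr_class p c g" "g \<in> carrier (free_alg (KG c))"
        using rs unfolding klr_alg_simps(1) by blast
      have "pair_emb p lam (dbl b) (dbl c) (r, s) =
          (\<Union>f\<in>r. \<Union>g\<in>s. D.wc (kap b c f g))"
        by (simp only: pair_emb_def prod.case dbl_add D.vv_class_dbl ip plus_part_dbl[OF b] plus_part_dbl[OF c]
            subst_left_mid subst_right_mid kap_def)
      also have "\<dots> = D.wc (kap b c f g)" unfolding f(1) g(1)
      proof (rule UN_UN_klr_class[OF f(2) g(2)])
        fix f' g' assume *: "f' \<in> carrier (free_alg (KG b))" "g' \<in> carrier (free_alg (KG c))"
          "f' \<doteq>\<^bsub>KJ p b\<^esub> f" "g' \<doteq>\<^bsub>KJ p c\<^esub> g"
        have "klr_class p (b + c) (kap b c f' g') = klr_class p (b + c) (kap b c f g)"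
          unfolding klr_alg_simps(5)[OF kap_closed[OF klr_cong_self *(1,2)] kap_closed[OF klr_cong_self f(2) g(2)]]
          by (rule kap_cong[OF klr_cong_self *(1) f(2) *(3) *(2) g(2) *(4)])
        then show "D.wc (kap b c f' g') = D.wc (kap b c f g)"
          unfolding rho_kap[OF *(1,2), symmetric] rho_kap[OF f(2) g(2), symmetric] by simp
      qed
      also have "\<dots> = klr_to_vv p lam (dbl (b + c)) (pair_class p b c r s)"
        unfolding f(1) g(1) pair_class_class[OF f(2) g(2)] rho_kap[OF f(2) g(2)] ..
      finally show ?thesis .
    qed
    have eq: "D.wc (kap b c 1 1) = D.wc (e2 b c)"
    proof -
      have "e2 b c * e2 b c \<doteq>\<^bsub>D.VR\<^esub> e2 b c"
        using D.W.eset_eset[of "app_set (klr_words b) (klr_words c)" "app_set (klr_words b) (klr_words c)"]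
          app_set_klr_words[of b c] D.klr_sub_A by (simp add: e2_def subset_trans)
      moreover have "kap b c 1 1 = e2 b c * e2 b c" by (simp add: kap_def)
      ultimately show ?thesis by (simp only: pclass_eq_iff[OF D.VR_closed free_alg_mult[OF e2V e2V] e2V])
    qed
    show "vv_class p (dbl (b + c)) (idem_pair p lam (dbl b) (dbl c)) =
        klr_to_vv p lam (dbl (b + c)) (pair_class p b c \<one>\<^bsub>klr_alg p b\<^esub> \<one>\<^bsub>klr_alg p c\<^esub>)"
      unfolding klr_alg_simps(4) pair_class_class[OF free_alg_1 free_alg_1] rho_kap[OF free_alg_1 free_alg_1]
        ip D.vv_class_dbl eq ..
  qed
qed

text \<open>Replaces the carrier of the inner tensor group by that of the outer tensor product of
  the regular modules, the form in which \<open>conv\<close> is defined.\<close>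

lemma (in convolution) conv_mod_eq:
  "conv_mod = module_of_group (tensor_group (carrier (outer_tensor sR sS (regular_module R) (regular_module S))) Wid rmul Omod act)
     (\<lambda>w z. \<Union>f\<in>z. tensor_class (carrier (outer_tensor sR sS (regular_module R) (regular_module S))) Wid rmul Omod act
       (frag_extend (\<lambda>(x, y). frag_of (w \<otimes>\<^bsub>W\<^esub> x, y)) f))"
  "tens w m n = tensor_class (carrier (outer_tensor sR sS (regular_module R) (regular_module S))) Wid rmul Omod act
     (frag_of (w, O.pure m n))"
proof -
  have "carrier (outer_tensor sR sS (regular_module R) (regular_module S)) = carrier K.T"
    by (simp add: outer_tensor_def Let_def)
  then show "conv_mod = module_of_group (tensor_group (carrier (outer_tensor sR sS (regular_module R) (regular_module S))) Wid rmul Omod act)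
     (\<lambda>w z. \<Union>f\<in>z. tensor_class (carrier (outer_tensor sR sS (regular_module R) (regular_module S))) Wid rmul Omod act
       (frag_extend (\<lambda>(x, y). frag_of (w \<otimes>\<^bsub>W\<^esub> x, y)) f))"
    "tens w m n = tensor_class (carrier (outer_tensor sR sS (regular_module R) (regular_module S))) Wid rmul Omod act
     (frag_of (w, O.pure m n))" unfolding conv_mod_def tens_def by (simp_all only:)
qed

text \<open>After this the concrete product is literally an instance of the abstract one. The third
  part makes it possible to form a further product with it.\<close>

lemma (in vv_setup) conv_eq:
  assumes b: "set_mset b \<subseteq> VI_plus p lam" and c: "set_mset c \<subseteq> VI_plus p lam"
    and M: "left_module (vv_alg p (dbl b)) M" and N: "left_module (vv_alg p (dbl c)) N"
  defines "KB \<equiv> klr_alg p b" and "KC \<equiv> klr_alg p c"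
    and "sb \<equiv> \<lambda>k. klr_class p b (fscal k)" and "sc \<equiv> \<lambda>k. klr_class p c (fscal k)"
    and "A \<equiv> Res p lam (dbl b) M" and "B \<equiv> Res p lam (dbl c) N"
    and "W \<equiv> vv_alg p (dbl b + dbl c)" and "pe \<equiv> pair_emb p lam (dbl b) (dbl c)"
    and "e \<equiv> vv_class p (dbl b + dbl c) (idem_pair p lam (dbl b) (dbl c))"
  shows "conv p lam (dbl b) (dbl c) M N = convolution.conv_mod KB KC A B sb sc W pe e"
    and "conv_unit p lam (dbl b) (dbl c) M N m n = convolution.tens KB KC A B sb sc W pe e e m n"
    and "left_module W (conv p lam (dbl b) (dbl c) M N)"
proof -
  interpret conv_setup KB KC "klr_alg p (b + c)" W "klr_to_vv p lam (dbl (b + c))"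
    "vv_data.Pc p (\<lambda>x. x \<in> VI_plus p lam) (b + c)" "pair_class p b c" sb sc A B pe e
    using conv_setup_block[OF b c M N refl] unfolding KB_def KC_def sb_def sc_def A_def B_def W_def pe_def e_def .
  show eq: "conv p lam (dbl b) (dbl c) M N = conv_mod"
    unfolding conv_mod_eq(1) unfolding KB_def KC_def sb_def sc_def A_def B_def W_def pe_def e_def conv_def conv_class_def ideal_module_def Let_def
      res_tensor_def klr_tensor_def tensor_emb_def plus_part_dbl[OF b] plus_part_dbl[OF c] ..
  show "conv_unit p lam (dbl b) (dbl c) M N m n = tens e m n"
    unfolding conv_mod_eq(2) unfolding KB_def KC_def sb_def sc_def A_def B_def W_def pe_def e_def conv_unit_def conv_class_def ideal_module_def Let_def
      res_tensor_def klr_tensor_def tensor_emb_def plus_part_dbl[OF b] plus_part_dbl[OF c] ..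
  show "left_module W (conv p lam (dbl b) (dbl c) M N)" unfolding eq by (rule left_module_conv)
qed

text \<open>The second conjunct expresses that the isomorphism is canonical: by
  \<open>tens_ul\<close> the elements named there generate the left product as a module, so their
  images determine the map on the carrier.\<close>

theorem lemma2p12:
  fixes p q lam :: "'k::field"
    and \<alpha> \<beta> \<gamma> :: "'k multiset"
    and L :: "('k falg set, 'l) module"
    and M :: "('k falg set, 'm) module"
    and N :: "('k falg set, 'n) module"
  assumes "CHAR('k) \<noteq> 2"
    and "p \<noteq> 0" and "q \<noteq> 0" and "lam \<noteq> 0"
    and "\<forall>n::int. p \<noteq> q powi n" and "\<forall>n::int. q \<noteq> p powi n"
    and "p \<noteq> 1" and "p \<noteq> -1"
    and "{1, -1, p, -p, q, -q} \<inter> VI p lam = {}"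
    and "\<alpha> \<in> theta_NI p lam" and "\<beta> \<in> theta_NI p lam" and "\<gamma> \<in> theta_NI p lam"
    and "left_module (vv_alg p \<alpha>) L"
    and "left_module (vv_alg p \<beta>) M"
    and "left_module (vv_alg p \<gamma>) N"
  shows "\<exists>\<phi>. module_isomorphism (vv_alg p (\<alpha> + \<beta> + \<gamma>))
        (conv p lam (\<beta> + \<alpha>) \<gamma> (conv p lam \<beta> \<alpha> M L) N)
        (conv p lam \<beta> (\<alpha> + \<gamma>) M (conv p lam \<alpha> \<gamma> L N)) \<phi> \<and>
      (\<forall>m\<in>carrier (Res p lam \<beta> M). \<forall>l\<in>carrier (Res p lam \<alpha> L). \<forall>n\<in>carrier (Res p lam \<gamma> N).
        \<phi> (conv_unit p lam (\<beta> + \<alpha>) \<gamma> (conv p lam \<beta> \<alpha> M L) N (conv_unit p lam \<beta> \<alpha> M L m l) n) =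
        conv_unit p lam \<beta> (\<alpha> + \<gamma>) M (conv p lam \<alpha> \<gamma> L N) m (conv_unit p lam \<alpha> \<gamma> L N l n))"
proof -
  interpret vv_setup p lam
    using assms(2,4,9) by unfold_locales auto
  define a b c where "a = plus_part p lam \<alpha>" and "b = plus_part p lam \<beta>" and "c = plus_part p lam \<gamma>"
  have dbl: "\<alpha> = dbl a" "\<beta> = dbl b" "\<gamma> = dbl c"
    unfolding a_def b_def c_def using theta_NI_dbl assms(10-12) by simp_all
  have Vp: "set_mset a \<subseteq> Vp" "set_mset b \<subseteq> Vp" "set_mset c \<subseteq> Vp"
    unfolding a_def b_def c_def by (rule plus_part_Vp)+
  then have Vp': "set_mset (b + a) \<subseteq> Vp" "set_mset (a + c) \<subseteq> Vp" by auto
  note L = assms(13)[unfolded dbl] and M = assms(14)[unfolded dbl] and N = assms(15)[unfolded dbl]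
  let ?P = "vv_data.Pc p (\<lambda>x. x \<in> Vp)"
  note C1 = conv_setup_block[OF Vp(2,1) M L refl, unfolded dbl_add]
    and C3 = conv_setup_block[OF Vp(1,3) L N refl, unfolded dbl_add]
  note conv1 = conv_eq[OF Vp(2,1) M L, unfolded dbl_add] and conv3 = conv_eq[OF Vp(1,3) L N, unfolded dbl_add]
  note lML = conv1(3) and lLN = conv3(3)
  \<comment> \<open>The second product lives over \<open>b + a + c\<close>, the fourth over
    \<open>b + (a + c)\<close>; folding \<open>add.assoc\<close> makes both modules over the same
    algebra.\<close>
  note C2 = conv_setup_block[OF Vp'(1) Vp(3) lML N refl, unfolded dbl_add]
    and C4 = conv_setup_block[OF Vp(2) Vp'(2) M lLN refl, unfolded dbl_add, folded add.assoc]
  note conv2 = conv_eq[OF Vp'(1) Vp(3) lML N, unfolded dbl_add]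
    and conv4 = conv_eq[OF Vp(2) Vp'(2) M lLN, unfolded dbl_add, folded add.assoc]
  interpret assoc_setup "klr_alg p b" "klr_alg p a" "klr_alg p c" "klr_alg p (b + a)" "klr_alg p (a + c)"
    "klr_alg p (b + a + c)" "vv_alg p (dbl (b + a))" "vv_alg p (dbl (a + c))" "vv_alg p (dbl (b + a + c))"
    "klr_to_vv p lam (dbl (b + a))" "?P (b + a)" "klr_to_vv p lam (dbl (a + c))" "?P (a + c)"
    "klr_to_vv p lam (dbl (b + a + c))" "?P (b + a + c)"
    "pair_class p b a" "pair_class p (b + a) c" "pair_class p a c" "pair_class p b (a + c)"
    "\<lambda>k. klr_class p b (fscal k)" "\<lambda>k. klr_class p a (fscal k)" "\<lambda>k. klr_class p c (fscal k)"
    "\<lambda>k. klr_class p (b + a) (fscal k)" "\<lambda>k. klr_class p (a + c) (fscal k)"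
    "Res p lam (dbl b) M" "Res p lam (dbl a) L" "Res p lam (dbl c) N"
    "pair_emb p lam (dbl b) (dbl a)" "vv_class p (dbl (b + a)) (idem_pair p lam (dbl b) (dbl a))"
    "pair_emb p lam (dbl a) (dbl c)" "vv_class p (dbl (a + c)) (idem_pair p lam (dbl a) (dbl c))"
    "pair_emb p lam (dbl (b + a)) (dbl c)" "vv_class p (dbl (b + a + c)) (idem_pair p lam (dbl (b + a)) (dbl c))"
    "pair_emb p lam (dbl b) (dbl (a + c))" "vv_class p (dbl (b + a + c)) (idem_pair p lam (dbl b) (dbl (a + c)))"
  proof (intro assoc_setup.intro assoc_setup_axioms.intro)
    show "corner (klr_alg p (b + a + c)) (vv_alg p (dbl (b + a + c))) (klr_to_vv p lam (dbl (b + a + c))) (?P (b + a + c))"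
      using C2 unfolding conv_setup_def by blast
    show "pairing (klr_alg p b) (klr_alg p (a + c)) (klr_alg p (b + a + c)) (pair_class p b (a + c))
        (\<lambda>k. klr_class p b (fscal k)) (\<lambda>k. klr_class p (a + c) (fscal k))"
      using C4 unfolding conv_setup_def by blast
  qed (rule C1 C3 pairing_klr conv_setup.pe[OF C2] conv_setup.e[OF C2] conv_setup.pe[OF C4] conv_setup.e[OF C4]
      pair_class_assoc; assumption)+
  interpret BA: vv_block p lam "b + a" by (rule vv_block[OF Vp'(1)])
  interpret AC: vv_block p lam "a + c" by (rule vv_block[OF Vp'(2)])
  obtain F where F: "module_isomorphism (vv_alg p (dbl (b + a + c))) S2.conv_mod S4.conv_mod F"
    "\<And>m l n. m \<in> carrier (Res p lam (dbl b) M) \<Longrightarrow> l \<in> carrier (Res p lam (dbl a) L) \<Longrightarrow> n \<in> carrier (Res p lam (dbl c) N) \<Longrightarrow>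
      F (S2.tens (vv_class p (dbl (b + a + c)) (idem_pair p lam (dbl (b + a)) (dbl c))) (yt m l) n) =
      S4.tens (vv_class p (dbl (b + a + c)) (idem_pair p lam (dbl b) (dbl (a + c)))) m (zt l n)"
    using conv_assoc by blast
  have sums: "\<alpha> + \<beta> + \<gamma> = dbl (b + a + c)" "\<beta> + \<alpha> = dbl (b + a)" "\<alpha> + \<gamma> = dbl (a + c)"
    unfolding dbl dbl_add by (simp_all add: add.commute)
  show ?thesis
    unfolding sums unfolding dbl conv2(1,2) conv4(1,2) BA.Res_eq AC.Res_eq unfolding conv1(1,2) conv3(1,2)
    using F by blast
qed

end
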